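(* Let $d\in\{2,3\}$, let $f \in L^2(\Omega)$, and for $\delta>0$ let $u_\delta \in H_0^1(\Omega)$ be the unique solution to $$\operatorname{div}(s_\delta A \nabla u_\delta) = f \mbox{ in } \Omega.$$ Assume that $s_0A$ is doubly complementary and that $\operatorname{supp} f \cap B_{r_3} = \emptyset$. Then the following hold. (1) $$\limsup_{\delta \to 0} \| u_\delta\|_{H^1(\Omega)} < + \infty.$$ (2) Assume in addition that $A = I$ in $B_{r_3} \setminus B_{r_2}$. If there exists $w \in H^1(B_{r_0} \setminus B_{r_2})$ for some $r_0 > \sqrt{r_2 r_3}$ with the properties $$\operatorname{div} (A \nabla w) = f \mbox{ in } B_{r_0} \setminus B_{r_2}, \quad w = 0 \mbox{ on } \partial B_{r_2}, \quad \mbox{and} \quad A \nabla w \cdot \eta = 0 \mbox{ on } \partial B_{r_2},$$ then $$\limsup_{\delta \to 0} \delta^{1/2} \|u_\delta \|_{H^{1}(\Omega)} < + \infty.$$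
   Context: $B_r$ is the open ball of radius $r$ centered at the origin in $\mathbb{R}^d$. $\Omega\subset\mathbb{R}^d$ is a smooth bounded open set, and $0<r_1<r_2$ with $B_{r_2}\subset\subset\Omega$. $A$ is a symmetric uniformly elliptic matrix-valued function on $\Omega$: $\Lambda^{-1}|\xi|^2\le\langle A(x)\xi,\xi\rangle\le\Lambda|\xi|^2$ for all $\xi\in\mathbb{R}^d$ and a.e. $x\in\Omega$, for some $1\le\Lambda<\infty$. For $\delta\ge0$, $s_\delta=-1+i\delta$ in $B_{r_2}\setminus B_{r_1}$ and $s_\delta=1$ otherwise. Solutions are complex valued. $\eta$ denotes the outward unit normal vector on the boundary of a domain. In (2), $r_0$ is such that $B_{r_0}\subset\Omega$, so that the equation for $w$ makes sense. For a diffeomorphism $T$ and a matrix-valued function $a$, $T_*a(y)=\dfrac{DT(x)\,a(x)\,DT(x)^T}{|\det DT(x)|}$ with $x=T^{-1}(y)$. Reflecting complementary media: for $r_1<r_2<r_3$, the media $A$ in $B_{r_3}\setminus B_{r_2}$ and $-A$ in $B_{r_2}\setminus B_{r_1}$ are reflecting complementary if there exists a diffeomorphism $F:B_{r_2}\setminus\bar B_{r_1}\to B_{r_3}\setminus\bar B_{r_2}$ such that $F_*A=A$ in $B_{r_3}\setminus\bar B_{r_2}$, $F(x)=x$ on $\partial B_{r_2}$, and: (a) $F$ has a diffeomorphism extension, still denoted $F$, from $B_{r_2}\setminus\{x_1\}$ onto $\mathbb{R}^d\setminus\bar B_{r_2}$ for some $x_1\in B_{r_1}$; (b) there exists a diffeomorphism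 $G:\mathbb{R}^d\setminus\bar B_{r_3}\to B_{r_3}\setminus\{x_2\}$ for some $x_2\in B_{r_3}$ such that $G(x)=x$ on $\partial B_{r_3}$, and $G\circ F:B_{r_1}\to B_{r_3}$ is a diffeomorphism if one sets $G\circ F(x_1)=x_2$. (In the boundary conditions, $F$ and $G$ denote diffeomorphism extensions of $F$ and $G$ to neighborhoods of $\partial B_{r_2}$ and $\partial B_{r_3}$.) Doubly complementary: $s_0A$ is doubly complementary if for some $r_3>0$ with $B_{r_3}\subset\subset\Omega$, $A$ in $B_{r_3}\setminus B_{r_2}$ and $-A$ in $B_{r_2}\setminus B_{r_1}$ are reflecting complementary and $F_*A=G_*F_*A=A$ in $B_{r_3}\setminus B_{r_2}$ for some $F,G$ as in that definition. This $r_3$ is fixed. Standing assumption: $A\in[C^3(\overline{B_{r_3}\setminus B_{r_2}})]^{d\times d}$. *)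

theory Defs
  imports "HOL-Analysis.Analysis"
begin

section \<open>Spaces of differentiable functions\<close>

text \<open>\<open>Ck_on k S f\<close> is meant for open \<open>S\<close>: all partial derivatives of order at most \<open>k\<close> exist
  and are continuous on \<open>S\<close>.\<close>

primrec Ck_on :: "nat \<Rightarrow> 'a set \<Rightarrow> ('a::euclidean_space \<Rightarrow> 'b::real_normed_vector) \<Rightarrow> bool" where
  "Ck_on 0 S f \<longleftrightarrow> continuous_on S f"
| "Ck_on (Suc k) S f \<longleftrightarrow>
     (\<forall>x\<in>S. f differentiable (at x)) \<and>
     (\<forall>b\<in>Basis. Ck_on k S (\<lambda>x. frechet_derivative f (at x) b))"

definition smooth_on :: "'a set \<Rightarrow> ('a::euclidean_space \<Rightarrow> 'b::real_normed_vector) \<Rightarrow> bool" where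
  "smooth_on S f \<longleftrightarrow> (\<forall>k. Ck_on k S f)"

text \<open>The space \<open>C\<^sup>k\<close> up to the boundary of an open set \<open>S\<close>: all partial derivatives of order at
  most \<open>k\<close> exist in \<open>S\<close> and extend continuously to \<open>closure S\<close>.\<close>

primrec Ck_closure :: "nat \<Rightarrow> 'a set \<Rightarrow> ('a::euclidean_space \<Rightarrow> 'b::real_normed_vector) \<Rightarrow> bool" where
  "Ck_closure 0 S f \<longleftrightarrow> (\<exists>g. continuous_on (closure S) g \<and> (\<forall>x\<in>S. g x = f x))"
| "Ck_closure (Suc k) S f \<longleftrightarrow>
     (\<exists>g. continuous_on (closure S) g \<and> (\<forall>x\<in>S. g x = f x)) \<and>
     (\<forall>x\<in>S. f differentiable (at x)) \<and>
     (\<forall>b\<in>Basis. Ck_closure k S (\<lambda>x. frechet_derivative f (at x) b))"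

definition C1_diffeo ::
    "'a set \<Rightarrow> 'b set \<Rightarrow> ('a::euclidean_space \<Rightarrow> 'b::euclidean_space) \<Rightarrow> bool" where
  "C1_diffeo S T f \<longleftrightarrow> open S \<and> open T \<and>
     (\<exists>g. homeomorphism S T f g \<and> Ck_on 1 S f \<and> Ck_on 1 T g)"

text \<open>Open sets with smooth boundary: near each boundary point a smooth change of coordinates
  straightens the set to a half space.\<close>

definition smooth_open_set :: "'a::euclidean_space set \<Rightarrow> bool" where
  "smooth_open_set \<Omega> \<longleftrightarrow> open \<Omega> \<and>
     (\<forall>x\<in>frontier \<Omega>. \<exists>U V \<Phi> \<Psi>. \<exists>b\<in>(Basis :: 'a set).
        open U \<and> open V \<and> x \<in> U \<and> homeomorphism U V \<Phi> \<Psi> \<and>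
        smooth_on U \<Phi> \<and> smooth_on V \<Psi> \<and>
        \<Phi> ` (U \<inter> \<Omega>) = {y \<in> V. y \<bullet> b > 0} \<and>
        \<Phi> ` (U \<inter> frontier \<Omega>) = {y \<in> V. y \<bullet> b = 0})"

section \<open>Sobolev spaces\<close>

definition L2 :: "'a::euclidean_space set \<Rightarrow> ('a \<Rightarrow> 'b::real_normed_vector) set" where
  "L2 U = {f. f \<in> borel_measurable (lebesgue_on U) \<and>
              integrable (lebesgue_on U) (\<lambda>x. (norm (f x))\<^sup>2)}"

definition gradient :: "(real^'n \<Rightarrow> complex) \<Rightarrow> real^'n \<Rightarrow> complex^'n::finite" where
  "gradient \<phi> x = (\<chi> i. frechet_derivative \<phi> (at x) (axis i 1))"

definition support_of :: "('a::topological_space \<Rightarrow> 'b::zero) \<Rightarrow> 'a set" where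
  "support_of \<phi> = closure {x. \<phi> x \<noteq> 0}"

definition test_function :: "'a set \<Rightarrow> ('a::euclidean_space \<Rightarrow> complex) \<Rightarrow> bool" where
  "test_function U \<phi> \<longleftrightarrow> smooth_on UNIV \<phi> \<and> compact (support_of \<phi>) \<and> support_of \<phi> \<subseteq> U"

definition has_weak_gradient ::
    "(real^'n) set \<Rightarrow> (real^'n \<Rightarrow> complex) \<Rightarrow> (real^'n \<Rightarrow> complex^'n::finite) \<Rightarrow> bool" where
  "has_weak_gradient U u g \<longleftrightarrow> g \<in> L2 U \<and>
     (\<forall>\<phi> i. test_function U \<phi> \<longrightarrow>
        (LINT x|lebesgue_on U. u x * gradient \<phi> x $ i) =
        - (LINT x|lebesgue_on U. g x $ i * \<phi> x))"

definition H1 :: "(real^'n::finite) set \<Rightarrow> (real^'n \<Rightarrow> complex) set" where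
  "H1 U = {u \<in> L2 U. \<exists>g. has_weak_gradient U u g}"

text \<open>The weak gradient is determined almost everywhere; the choice of a representative is
  immaterial below because it only occurs under integrals.\<close>

definition weak_gradient ::
    "(real^'n) set \<Rightarrow> (real^'n \<Rightarrow> complex) \<Rightarrow> real^'n \<Rightarrow> complex^'n::finite" where
  "weak_gradient U u = (SOME g. has_weak_gradient U u g)"

definition H1_norm :: "(real^'n::finite) set \<Rightarrow> (real^'n \<Rightarrow> complex) \<Rightarrow> real" where
  "H1_norm U u =
     sqrt ((LINT x|lebesgue_on U. (norm (u x))\<^sup>2) +
           (LINT x|lebesgue_on U. (norm (weak_gradient U u x))\<^sup>2))"

definition H10 :: "(real^'n::finite) set \<Rightarrow> (real^'n \<Rightarrow> complex) set" where
  "H10 U = {u \<in> H1 U. \<exists>\<phi>. (\<forall>k::nat. test_function U (\<phi> k)) \<and>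
                (\<lambda>k. H1_norm U (\<lambda>x. u x - \<phi> k x)) \<longlonglongrightarrow> 0}"

text \<open>Support of a function defined almost everywhere on \<open>U\<close>.\<close>

definition ess_support :: "'a::euclidean_space set \<Rightarrow> ('a \<Rightarrow> 'b::zero) \<Rightarrow> 'a set" where
  "ess_support U f =
     {x \<in> closure U. \<forall>N. open N \<and> x \<in> N \<longrightarrow> \<not> (AE y in lebesgue_on (N \<inter> U). f y = 0)}"

text \<open>Surface measure on \<open>sphere 0 r\<close>. By polar coordinates, the cone over a Borel set \<open>E\<close> of the
  sphere (the points of the ball whose radial projection lies in \<open>E\<close>) has Lebesgue measure
  \<open>r / d\<close> times the area of \<open>E\<close>.\<close>

definition sphere_measure :: "real \<Rightarrow> 'a::euclidean_space measure" where
  "sphere_measure r =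
     scale_measure (ennreal (real DIM('a) / r))
       (distr (restrict_space lborel (ball 0 r)) borel (\<lambda>x. (r / norm x) *\<^sub>R x))"

text \<open>For a bounded open set \<open>U\<close> with smooth boundary containing \<open>sphere 0 r\<close>, the trace operator
  is the continuous extension to \<open>H1 U\<close> of the restriction of smooth functions, which are dense.\<close>

definition has_trace_on_sphere ::
    "(real^'n::finite) set \<Rightarrow> real \<Rightarrow> (real^'n \<Rightarrow> complex) \<Rightarrow> (real^'n \<Rightarrow> complex) \<Rightarrow> bool" where
  "has_trace_on_sphere U r w g \<longleftrightarrow> g \<in> borel_measurable borel \<and>
     (\<exists>\<phi>. (\<forall>k::nat. smooth_on UNIV (\<phi> k)) \<and>
          (\<lambda>k. H1_norm U (\<lambda>x. w x - \<phi> k x)) \<longlonglongrightarrow> 0 \<and>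
          (\<lambda>k. \<integral>\<^sup>+x. ennreal ((norm (\<phi> k x - g x))\<^sup>2) \<partial>sphere_measure r) \<longlonglongrightarrow> 0)"

section \<open>The equation\<close>

definition uniformly_elliptic :: "(real^'n::finite) set \<Rightarrow> (real^'n \<Rightarrow> real^'n^'n) \<Rightarrow> bool" where
  "uniformly_elliptic \<Omega> A \<longleftrightarrow> A \<in> borel_measurable (lebesgue_on \<Omega>) \<and>
     (\<exists>\<Lambda>\<ge>1. AE x in lebesgue_on \<Omega>. \<forall>\<xi>.
        (norm \<xi>)\<^sup>2 / \<Lambda> \<le> (A x *v \<xi>) \<bullet> \<xi> \<and> (A x *v \<xi>) \<bullet> \<xi> \<le> \<Lambda> * (norm \<xi>)\<^sup>2)"

definition symmetric_ae :: "(real^'n::finite) set \<Rightarrow> (real^'n \<Rightarrow> real^'n^'n) \<Rightarrow> bool" where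
  "symmetric_ae \<Omega> A \<longleftrightarrow> (AE x in lebesgue_on \<Omega>. transpose (A x) = A x)"

definition s_coeff :: "real \<Rightarrow> real \<Rightarrow> real \<Rightarrow> 'a::real_normed_vector \<Rightarrow> complex" where
  "s_coeff r1 r2 \<delta> x = (if x \<in> ball 0 r2 - ball 0 r1 then - 1 + \<i> * complex_of_real \<delta> else 1)"

definition complex_coeff ::
    "('a \<Rightarrow> complex) \<Rightarrow> ('a \<Rightarrow> real^'n^'n) \<Rightarrow> 'a \<Rightarrow> complex^'n^'n::finite" where
  "complex_coeff s A x = (\<chi> i j. s x * complex_of_real (A x $ i $ j))"

text \<open>The pairing of \<open>a \<nabla>u\<close> with \<open>\<nabla>\<phi>\<close> over \<open>U\<close>, bilinear (no complex conjugation).\<close>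

definition energy_form ::
    "(real^'n::finite) set \<Rightarrow> (real^'n \<Rightarrow> complex^'n^'n) \<Rightarrow> (real^'n \<Rightarrow> complex) \<Rightarrow>
     (real^'n \<Rightarrow> complex) \<Rightarrow> complex" where
  "energy_form U a u \<phi> =
     (LINT x|lebesgue_on U. (\<Sum>i\<in>UNIV. (a x *v weak_gradient U u x) $ i * gradient \<phi> x $ i))"

text \<open>\<open>div (a \<nabla>u) = f\<close> in the open set \<open>U\<close>, in the sense of distributions.\<close>

definition weak_div_eq ::
    "(real^'n::finite) set \<Rightarrow> (real^'n \<Rightarrow> complex^'n^'n) \<Rightarrow> (real^'n \<Rightarrow> complex) \<Rightarrow>
     (real^'n \<Rightarrow> complex) \<Rightarrow> bool" where
  "weak_div_eq U a u f \<longleftrightarrow>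
     (\<forall>\<phi>. test_function U \<phi> \<longrightarrow>
        energy_form U a u \<phi> = - (LINT x|lebesgue_on U. f x * \<phi> x))"

text \<open>For \<open>u\<close> with \<open>div (a \<nabla>u) = f\<close> in \<open>U\<close>, the conormal derivative \<open>a \<nabla>u \<cdot> \<eta>\<close> on \<open>frontier U\<close> is the
  functional \<open>\<phi> \<mapsto> \<integral>\<^sub>U a \<nabla>u \<cdot> \<nabla>\<phi> + \<integral>\<^sub>U f \<phi>\<close>. It vanishes on a relatively open part \<open>\<Gamma>\<close> of \<open>frontier U\<close>
  if it vanishes for all \<open>\<phi>\<close> that are zero near the rest of \<open>frontier U\<close>.\<close>

definition zero_conormal_on ::
    "(real^'n) set \<Rightarrow> (real^'n::finite) set \<Rightarrow> (real^'n \<Rightarrow> complex^'n^'n) \<Rightarrow>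
     (real^'n \<Rightarrow> complex) \<Rightarrow> (real^'n \<Rightarrow> complex) \<Rightarrow> bool" where
  "zero_conormal_on \<Gamma> U a u f \<longleftrightarrow>
     (\<forall>\<phi>. test_function UNIV \<phi> \<and> support_of \<phi> \<inter> (frontier U - \<Gamma>) = {} \<longrightarrow>
        energy_form U a u \<phi> + (LINT x|lebesgue_on U. f x * \<phi> x) = 0)"

section \<open>Complementary media\<close>

text \<open>\<open>pushforward S T a\<close> is \<open>T\<^sub>*a\<close> for \<open>T\<close> a diffeomorphism with domain \<open>S\<close>; it is only meaningful on
  \<open>T ` S\<close>.\<close>

definition pushforward ::
    "(real^'n) set \<Rightarrow> (real^'n \<Rightarrow> real^'n) \<Rightarrow> (real^'n \<Rightarrow> real^'n^'n) \<Rightarrow>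
     real^'n \<Rightarrow> real^'n^'n::finite" where
  "pushforward S T a y =
     (let x = inv_into S T y; D = jacobian T (at x)
      in (1 / \<bar>det D\<bar>) *\<^sub>R (D ** a x ** transpose D))"

text \<open>The maps \<open>F\<close> and \<open>G\<close> of the definition of reflecting complementary media. \<open>F\<close> is a total
  function carrying at once the diffeomorphism of the shells, its extension to
  \<open>ball 0 r2 - {x1}\<close> and its extension across \<open>sphere 0 r2\<close>; similarly for \<open>G\<close>. Since coefficients
  are defined up to null sets, identities between them hold almost everywhere.\<close>

definition reflecting_maps ::
    "(real^'n \<Rightarrow> real^'n^'n) \<Rightarrow> real \<Rightarrow> real \<Rightarrow> real \<Rightarrow> (real^'n \<Rightarrow> real^'n) \<Rightarrow>
     (real^'n \<Rightarrow> real^'n) \<Rightarrow> real^'n \<Rightarrow> real^'n::finite \<Rightarrow> bool" where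
  "reflecting_maps A r1 r2 r3 F G x1 x2 \<longleftrightarrow>
     C1_diffeo (ball 0 r2 - cball 0 r1) (ball 0 r3 - cball 0 r2) F \<and>
     (AE y in lebesgue_on (ball 0 r3 - cball 0 r2).
        pushforward (ball 0 r2 - cball 0 r1) F A y = A y) \<and>
     (\<exists>N. open N \<and> sphere 0 r2 \<subseteq> N \<and> C1_diffeo N (F ` N) F) \<and>
     (\<forall>x\<in>sphere 0 r2. F x = x) \<and>
     x1 \<in> ball 0 r1 \<and> C1_diffeo (ball 0 r2 - {x1}) (- cball 0 r2) F \<and>
     x2 \<in> ball 0 r3 \<and> C1_diffeo (- cball 0 r3) (ball 0 r3 - {x2}) G \<and>
     (\<exists>N. open N \<and> sphere 0 r3 \<subseteq> N \<and> C1_diffeo N (G ` N) G) \<and>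
     (\<forall>x\<in>sphere 0 r3. G x = x) \<and>
     C1_diffeo (ball 0 r1) (ball 0 r3) ((G \<circ> F)(x1 := x2))"

definition reflecting_complementary ::
    "(real^'n::finite \<Rightarrow> real^'n^'n) \<Rightarrow> real \<Rightarrow> real \<Rightarrow> real \<Rightarrow> bool" where
  "reflecting_complementary A r1 r2 r3 \<longleftrightarrow>
     0 < r1 \<and> r1 < r2 \<and> r2 < r3 \<and> (\<exists>F G x1 x2. reflecting_maps A r1 r2 r3 F G x1 x2)"

definition doubly_complementary ::
    "(real^'n) set \<Rightarrow> (real^'n::finite \<Rightarrow> real^'n^'n) \<Rightarrow> real \<Rightarrow> real \<Rightarrow> real \<Rightarrow> bool" where
  "doubly_complementary \<Omega> A r1 r2 r3 \<longleftrightarrow>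
     cball 0 r3 \<subseteq> \<Omega> \<and> reflecting_complementary A r1 r2 r3 \<and>
     (\<exists>F G x1 x2. reflecting_maps A r1 r2 r3 F G x1 x2 \<and>
        (AE y in lebesgue_on (ball 0 r3 - ball 0 r2).
           pushforward (ball 0 r2 - {x1}) F A y = A y \<and>
           pushforward (- cball 0 r3) G (pushforward (ball 0 r2 - {x1}) F A) y = A y))"

end

theory Submission
  imports Defs
begin

text \<open>The reason for the bound is that the limit problem, with \<open>\<delta> = 0\<close>, has a solution of finite energy: the
  complementary media can be unfolded. Let \<open>K = G \<circ> F\<close> in \<open>B\<^bsub>r1\<^esub>\<close>, and let the folded medium be \<open>A\<close> outside
  \<open>B\<^bsub>r3\<^esub>\<close> and \<open>K\<^sub>*A\<close> inside. It is elliptic, and double complementarity says that it still equals \<open>A\<close> between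
  \<open>B\<^bsub>r2\<^esub>\<close> and \<open>B\<^bsub>r3\<^esub>\<close>. Solve the equation with right-hand side \<open>f\<close> in the folded medium by \<open>v\<close>, and let
  \<open>reflect v\<close> be \<open>v\<close> outside \<open>B\<^bsub>r2\<^esub>\<close>, \<open>v \<circ> F\<close> in the annulus and \<open>v \<circ> K\<close> in \<open>B\<^bsub>r1\<^esub>\<close>. Changing variables in each piece
  (\<open>transform_pairing\<close>) gives the duality \<open>reflect_fold_back_duality\<close>: the form of \<open>s\<^sub>0 A\<close> at \<open>(reflect v, \<phi>)\<close> is
  the form of the folded medium at \<open>(v, fold_back \<phi>)\<close>. The function \<open>fold_back \<phi>\<close> differs from \<open>\<phi>\<close> only in
  \<open>B\<^bsub>r3\<^esub>\<close>, where \<open>f\<close> vanishes. So \<open>reflect v\<close> solves the limit problem.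

  Let \<open>H\<close> be the gradient of \<open>u\<^sub>\<delta>\<close> minus that of \<open>reflect v\<close>. It satisfies the equation with coefficient \<open>s\<^sub>\<delta> A\<close>
  and the right-hand side \<open>\<delta>\<close> times a field which is supported in the annulus and does not depend on
  \<open>\<delta>\<close>. Test with the conjugate of \<open>H\<close>. The imaginary part is \<open>\<delta>\<close> times the energy of \<open>H\<close> in the annulus up to
  the forcing, so this energy is bounded; the real part then bounds the energy elsewhere
  (\<open>energy_algebra\<close>). With Poincare's inequality this is the bound \<open>uniform_bound\<close> on \<open>u\<^sub>\<delta>\<close> in \<open>H\<^sup>1\<close> for
  \<open>0 < \<delta> \<le> 1\<close>. The second claim follows from it because \<open>\<delta>\<^sup>1\<^sup>/\<^sup>2 \<le> 1\<close>.

  An exact solution \<open>v\<close> can be replaced by an approximate one: since the error equation has forcing of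
  order \<open>\<delta>\<close> anyway, a test function \<open>v\<close> with residual of order \<open>\<delta>\<close> and a gradient that is bounded
  independently of \<open>\<delta>\<close> suffices. Almost minimisers of the energy have this property
  (\<open>approximate_minimizer\<close>, \<open>approximate_solution\<close>). For smooth \<open>v\<close> the functions \<open>reflect v\<close> and
  \<open>fold_back \<phi>\<close> are continuous and \<open>C\<^sup>1\<close> off three spheres. Such functions are limits of test functions in
  \<open>H\<^sup>1\<close> (\<open>piecewise_C1_approximation\<close>), which is how they enter weak formulations.\<close>

section \<open>Smooth functions and bumps\<close>

lemma Ck_on_Suc_D: "Ck_on (Suc k) S f \<Longrightarrow> Ck_on k S f"
proof (induction k arbitrary: f)
  case 0
  then show ?case
    by (auto intro!: continuous_at_imp_continuous_on differentiable_imp_continuous_within)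
next
  case (Suc k)
  then show ?case by (metis Ck_on.simps(2))
qed

lemma frechet_derivative_eqI: "(f has_derivative f') (at x) \<Longrightarrow> frechet_derivative f (at x) = f'"
  using frechet_derivative_at by fastforce

lemma Ck_on_const: "Ck_on k UNIV (\<lambda>x. c)"
  by (induction k arbitrary: c) auto

lemma Ck_on_bounded_linear:
  assumes "bounded_linear l" "Ck_on k UNIV f"
  shows "Ck_on k UNIV (\<lambda>x. l (f x))"
  using assms(2)
proof (induction k arbitrary: f)
  case 0
  then show ?case
    using bounded_linear.continuous_on[OF assms(1)] by simp
next
  case (Suc k)
  have d: "((\<lambda>x. l (f x)) has_derivative (\<lambda>h. l (frechet_derivative f (at x) h))) (at x)" for x
    using Suc.prems
    by (intro bounded_linear.has_derivative[OF assms(1)]) (simp add: frechet_derivative_works[symmetric])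
  show ?case
    using Suc by (auto simp: frechet_derivative_eqI[OF d] intro!: differentiableI[OF d])
qed

lemma Ck_on_add:
  assumes "Ck_on k UNIV f" "Ck_on k UNIV g"
  shows "Ck_on k UNIV (\<lambda>x. f x + g x)"
  using assms
proof (induction k arbitrary: f g)
  case 0
  then show ?case by (auto intro!: continuous_intros)
next
  case (Suc k)
  have d: "((\<lambda>x. f x + g x) has_derivative
     (\<lambda>h. frechet_derivative f (at x) h + frechet_derivative g (at x) h)) (at x)" for x
    using Suc.prems by (auto intro!: has_derivative_add simp: frechet_derivative_works[symmetric])
  show ?case
    using Suc by (auto simp: frechet_derivative_eqI[OF d] intro!: differentiableI[OF d])
qed

lemma Ck_on_mult:
  fixes f g :: "'a::euclidean_space \<Rightarrow> 'b::real_normed_algebra"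
  assumes "Ck_on k UNIV f" "Ck_on k UNIV g"
  shows "Ck_on k UNIV (\<lambda>x. f x * g x)"
  using assms
proof (induction k arbitrary: f g)
  case 0
  then show ?case by (simp add: continuous_on_mult)
next
  case (Suc k)
  have d: "((\<lambda>x. f x * g x) has_derivative
     (\<lambda>h. f x * frechet_derivative g (at x) h + frechet_derivative f (at x) h * g x)) (at x)" for x
    using Suc.prems by (intro has_derivative_mult) (simp_all add: frechet_derivative_works[symmetric])
  have f: "Ck_on k UNIV f" and g: "Ck_on k UNIV g"
    using Suc.prems by (auto intro: Ck_on_Suc_D[of k] simp del: Ck_on.simps)
  have f': "Ck_on k UNIV (\<lambda>x. frechet_derivative f (at x) b)" if "b \<in> Basis" for b
    using Suc.prems(1) that by simp
  have g': "Ck_on k UNIV (\<lambda>x. frechet_derivative g (at x) b)" if "b \<in> Basis" for b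
    using Suc.prems(2) that by simp
  have "Ck_on k UNIV (\<lambda>x. f x * frechet_derivative g (at x) b + frechet_derivative f (at x) b * g x)"
    if "b \<in> Basis" for b
    by (rule Ck_on_add[OF Suc.IH[OF f g'[OF that]] Suc.IH[OF f'[OF that] g]])
  moreover have "(\<lambda>x. f x * g x) differentiable (at x)" for x
    by (rule differentiableI[OF d])
  ultimately show ?case
    unfolding Ck_on.simps frechet_derivative_eqI[OF d] by blast
qed

lemma smooth_on_const: "smooth_on UNIV (\<lambda>x. c)"
  by (simp add: smooth_on_def Ck_on_const)

lemma smooth_on_add:
  "smooth_on UNIV f \<Longrightarrow> smooth_on UNIV g \<Longrightarrow> smooth_on UNIV (\<lambda>x. f x + g x)"
  by (simp add: smooth_on_def Ck_on_add)

lemma smooth_on_mult: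
  fixes f g :: "'a::euclidean_space \<Rightarrow> 'b::real_normed_algebra"
  shows "smooth_on UNIV f \<Longrightarrow> smooth_on UNIV g \<Longrightarrow> smooth_on UNIV (\<lambda>x. f x * g x)"
  by (simp add: smooth_on_def Ck_on_mult)

lemma smooth_on_bounded_linear:
  "bounded_linear l \<Longrightarrow> smooth_on UNIV f \<Longrightarrow> smooth_on UNIV (\<lambda>x. l (f x))"
  by (simp add: smooth_on_def Ck_on_bounded_linear)

lemma smooth_on_prod:
  fixes f :: "'i \<Rightarrow> 'a::euclidean_space \<Rightarrow> 'b::{real_normed_algebra_1,comm_ring_1}"
  shows "(\<And>i. i \<in> I \<Longrightarrow> smooth_on UNIV (f i)) \<Longrightarrow> smooth_on UNIV (\<lambda>x. \<Prod>i\<in>I. f i x)"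
  by (induction I rule: infinite_finite_induct) (auto intro!: smooth_on_const smooth_on_mult)

lemma smooth_on_differentiable:
  assumes "smooth_on UNIV f" shows "f differentiable (at x)"
proof -
  have "Ck_on (Suc 0) UNIV f" using assms unfolding smooth_on_def by (rule spec)
  then show ?thesis by simp
qed

lemma smooth_on_continuous:
  assumes "smooth_on UNIV f" shows "continuous_on S f"
proof -
  have "Ck_on 0 UNIV f" using assms unfolding smooth_on_def by (rule spec)
  then show ?thesis by (auto intro: continuous_on_subset)
qed

lemma smooth_on_partial:
  assumes "smooth_on UNIV f" "b \<in> Basis"
  shows "smooth_on UNIV (\<lambda>x. frechet_derivative f (at x) b)"
  unfolding smooth_on_def
proof
  fix k
  have "Ck_on (Suc k) UNIV f" using assms(1) unfolding smooth_on_def by (rule spec)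
  then show "Ck_on k UNIV (\<lambda>x. frechet_derivative f (at x) b)" using assms(2) by simp
qed

text \<open>The linear span of these functions is closed under differentiation, which is why all the exponents
  \<open>m\<close> are treated together.\<close>

definition flat_exp :: "nat \<Rightarrow> real \<Rightarrow> real" where
  "flat_exp m t = (if t \<le> 0 then 0 else (1 / t) ^ m * exp (- (1 / t)))"

lemma flat_exp_tendsto_0: "(flat_exp m \<longlongrightarrow> 0) (at 0)"
proof -
  have "((\<lambda>x::real. x ^ m / exp x) \<longlongrightarrow> 0) at_top"
    by (rule tendsto_power_div_exp_0)
  then have "((\<lambda>t::real. (inverse t) ^ m / exp (inverse t)) \<longlongrightarrow> 0) (at_right 0)"
    by (rule filterlim_compose) (rule filterlim_inverse_at_top_right)
  moreover have "\<forall>\<^sub>F t in at_right 0. (inverse t) ^ m / exp (inverse t) = flat_exp m t"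
    unfolding eventually_at_filter
    by (auto simp: flat_exp_def exp_minus field_simps)
  ultimately have r: "(flat_exp m \<longlongrightarrow> 0) (at_right 0)"
    using tendsto_cong by fastforce
  have l: "(flat_exp m \<longlongrightarrow> 0) (at_left 0)"
    by (rule tendsto_eventually) (auto simp: eventually_at_filter flat_exp_def)
  show ?thesis
    using l r filterlim_at_split by blast
qed

lemma flat_exp_has_derivative:
  "(flat_exp m has_real_derivative (- real m * flat_exp (m + 1) t + flat_exp (m + 2) t)) (at t)"
proof (cases t "0::real" rule: linorder_cases)
  case less
  have "((\<lambda>_. 0) has_real_derivative 0) (at t)" by simp
  then have "(flat_exp m has_real_derivative 0) (at t)"
    by (rule has_field_derivative_transform_within_open[where S = "{..<0}"])
      (use less in \<open>auto simp: flat_exp_def\<close>)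
  then show ?thesis using less by (simp add: flat_exp_def)
next
  case equal
  have "((\<lambda>h. flat_exp m h / h) \<longlongrightarrow> 0) (at 0)"
  proof (rule tendsto_cong[THEN iffD1, OF _ flat_exp_tendsto_0[of "m + 1"]])
    show "\<forall>\<^sub>F x in at 0. flat_exp (m + 1) x = flat_exp m x / x"
      by (auto simp: eventually_at_filter flat_exp_def)
  qed
  then have "(flat_exp m has_real_derivative 0) (at 0)"
    by (simp add: DERIV_def flat_exp_def)
  then show ?thesis using equal by (simp add: flat_exp_def)
next
  case greater
  have 1: "((\<lambda>t. (1 / t) ^ m * exp (- (1 / t))) has_real_derivative
     (- real m * ((1 / t) ^ (m + 1) * exp (- (1 / t))) + (1 / t) ^ (m + 2) * exp (- (1 / t)))) (at t)"
  proof -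
    have i: "((\<lambda>t. 1 / t) has_real_derivative (- ((1 / t)^2))) (at t)"
      using greater by (auto intro!: derivative_eq_intros simp: power2_eq_square)
    have "((\<lambda>t. (1 / t) ^ m) has_real_derivative (- real m * (1 / t) ^ (m + 1))) (at t)"
      by (rule DERIV_cong[OF DERIV_power[OF i, of m]]) (cases m; simp add: power2_eq_square algebra_simps add_divide_distrib diff_divide_distrib)
    moreover have "((\<lambda>t. exp (- (1 / t))) has_real_derivative exp (- (1 / t)) * (1 / t)^2) (at t)"
      using DERIV_fun_exp[OF DERIV_minus[OF i]] by simp
    ultimately show ?thesis
      by (rule DERIV_cong[OF DERIV_mult]) (simp add: algebra_simps power2_eq_square)
  qed
  have "(flat_exp m has_real_derivative
     (- real m * ((1 / t) ^ (m + 1) * exp (- (1 / t))) + (1 / t) ^ (m + 2) * exp (- (1 / t)))) (at t)"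
    by (rule has_field_derivative_transform_within_open[OF 1, where S = "{0<..}"])
      (use greater in \<open>auto simp: flat_exp_def\<close>)
  then show ?thesis using greater by (simp add: flat_exp_def)
qed

lemma smooth_on_flat_exp_affine:
  "smooth_on UNIV (\<lambda>x::'a::euclidean_space. flat_exp m (x \<bullet> v + c))"
proof -
  have "Ck_on k UNIV (\<lambda>x::'a. flat_exp m (x \<bullet> v + c))" for k
  proof (induction k arbitrary: m)
    case 0
    have "continuous_on UNIV (flat_exp m)"
      using flat_exp_has_derivative by (meson DERIV_isCont continuous_at_imp_continuous_on)
    then have "continuous_on UNIV (flat_exp m \<circ> (\<lambda>x::'a. x \<bullet> v + c))"
      by (intro continuous_on_compose continuous_intros) (auto intro: continuous_on_subset)
    then show ?case by (simp add: o_def)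
  next
    case (Suc k)
    have d: "((\<lambda>x::'a. flat_exp m (x \<bullet> v + c)) has_derivative
       (\<lambda>h. (h \<bullet> v) * (- real m * flat_exp (m + 1) (x \<bullet> v + c)) +
            (h \<bullet> v) * flat_exp (m + 2) (x \<bullet> v + c))) (at x)" for x
    proof -
      have "((\<lambda>x::'a. x \<bullet> v + c) has_derivative (\<lambda>h. h \<bullet> v)) (at x)"
        by (auto intro!: derivative_eq_intros)
      from has_derivative_compose[OF this flat_exp_has_derivative[unfolded has_field_derivative_def]]
      show ?thesis by (simp add: algebra_simps)
    qed
    have "Ck_on k UNIV (\<lambda>x::'a. (h \<bullet> v) * (- real m * flat_exp (m + 1) (x \<bullet> v + c)) +
            (h \<bullet> v) * flat_exp (m + 2) (x \<bullet> v + c))" for h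
      by (intro Ck_on_add Ck_on_mult Ck_on_const Suc.IH)
    then show ?case
      unfolding Ck_on.simps frechet_derivative_eqI[OF d] using differentiableI[OF d] by simp
  qed
  then show ?thesis by (simp add: smooth_on_def)
qed

text \<open>The parameter \<open>k\<close> scales the argument of \<open>exp (-1/t)\<close>: for \<open>k \<rightarrow> \<infinity>\<close> every factor tends to \<open>1\<close> inside the
  box, and outside some factor is \<open>0\<close>.\<close>

definition box_bump :: "real \<Rightarrow> 'a::euclidean_space \<Rightarrow> 'a \<Rightarrow> 'a \<Rightarrow> real" where
  "box_bump k a b x =
     (\<Prod>i\<in>Basis. flat_exp 0 (k * (x \<bullet> i - a \<bullet> i)) * flat_exp 0 (k * (b \<bullet> i - x \<bullet> i)))"

lemma smooth_on_box_bump: "smooth_on UNIV (box_bump k a (b::'a::euclidean_space))"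
proof -
  have "smooth_on UNIV (\<lambda>x. flat_exp 0 (k * (x \<bullet> i - a \<bullet> i)) * flat_exp 0 (k * (b \<bullet> i - x \<bullet> i)))" for i
    using smooth_on_mult[OF smooth_on_flat_exp_affine[of 0 "k *\<^sub>R i" "- k * (a \<bullet> i)"]
        smooth_on_flat_exp_affine[of 0 "- k *\<^sub>R i" "k * (b \<bullet> i)"]]
    by (simp add: algebra_simps)
  then show ?thesis
    unfolding box_bump_def by (intro smooth_on_prod) auto
qed

lemma flat_exp_0_bounds: "0 \<le> flat_exp 0 t" "flat_exp 0 t \<le> 1" "flat_exp 0 t > 0 \<longleftrightarrow> t > 0"
  by (auto simp: flat_exp_def)

lemma box_bump_bounds: "0 \<le> box_bump k a b x" "box_bump k a b x \<le> 1"
  unfolding box_bump_def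
  by (auto intro!: prod_nonneg prod_le_1 mult_nonneg_nonneg mult_le_one flat_exp_0_bounds)

lemma box_bump_pos_iff:
  assumes "k > 0" shows "box_bump k a b x > 0 \<longleftrightarrow> x \<in> box a b"
proof -
  have "box_bump k a b x \<noteq> 0 \<longleftrightarrow> x \<in> box a b"
    using assms by (auto simp: box_bump_def mem_box flat_exp_def zero_less_mult_iff mult_le_0_iff not_le)
  then show ?thesis using box_bump_bounds(1)[of k a b x] by auto
qed

lemma box_bump_tendsto:
  "(\<lambda>k. box_bump (real k) a b x) \<longlonglongrightarrow> indicat_real (box a b) x"
proof (cases "x \<in> box a b")
  case False
  then have "box_bump (real k) a b x = 0" for k
    using box_bump_pos_iff[of "real k" a b x] box_bump_bounds(1)[of "real k" a b x]
    by (cases "k = 0") (auto simp: box_bump_def flat_exp_def)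
  then show ?thesis using False by simp
next
  case True
  have e: "(\<lambda>k. flat_exp 0 (real k * c)) \<longlonglongrightarrow> 1" if "c > 0" for c
  proof -
    have "(\<lambda>k. exp (- (inverse c * inverse (real (Suc k))))) \<longlonglongrightarrow> exp (- (inverse c * 0))"
      by (intro tendsto_intros LIMSEQ_inverse_real_of_nat)
    then have "(\<lambda>k. flat_exp 0 (real (Suc k) * c)) \<longlonglongrightarrow> 1"
      using that by (simp add: flat_exp_def mult_le_0_iff inverse_eq_divide mult.commute)
    then show ?thesis by (subst (asm) filterlim_sequentially_Suc)
  qed
  have "(\<lambda>k. box_bump (real k) a b x) \<longlonglongrightarrow> (\<Prod>i\<in>(Basis::'a set). 1 * 1)"
    unfolding box_bump_def
    by (intro tendsto_prod tendsto_mult e) (use True in \<open>auto simp: mem_box\<close>)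
  then show ?thesis using True by simp
qed

lemma support_box_bump: "support_of (box_bump k a b) \<subseteq> cbox a (b::'a::euclidean_space)" if "k > 0"
proof -
  have "{x. box_bump k a b x \<noteq> 0} \<subseteq> cbox a b"
    using box_bump_pos_iff[OF that, of a b] box_bump_bounds(1)[of k a b] box_subset_cbox[of a b]
    by (force simp: less_le)
  then show ?thesis unfolding support_of_def by (intro closure_minimal) auto
qed

section \<open>Functions which are \<open>C\<^sup>1\<close> off a thin set\<close>

text \<open>Fields glued along spheres are \<open>C\<^sup>1\<close> off the spheres only. Integration by parts still holds without jump
  terms because a line meets a sphere at most twice: a continuous function with bounded gradient off
  such a set is Lipschitz along every coordinate line.\<close>

definition thin :: "'a::euclidean_space set \<Rightarrow> bool" where
  "thin Z \<longleftrightarrow> closed Z \<and> negligible Z \<and> (\<forall>x e. e \<noteq> 0 \<longrightarrow> finite {t::real. x + t *\<^sub>R e \<in> Z})"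

definition piecewise_C1 :: "(real^'n) set \<Rightarrow> (real^'n::finite \<Rightarrow> complex) \<Rightarrow> bool" where
  "piecewise_C1 Z h \<longleftrightarrow> continuous_on UNIV h \<and> bounded {x. h x \<noteq> 0} \<and>
     (\<forall>x\<in>-Z. h differentiable (at x)) \<and> continuous_on (-Z) (gradient h) \<and>
     bounded (gradient h ` (-Z))"

lemma thin_empty: "thin {}"
  by (simp add: thin_def)

lemma thin_Un: "thin Y \<Longrightarrow> thin Z \<Longrightarrow> thin (Y \<union> Z)"
  by (auto simp: thin_def Collect_disj_eq)

lemma thin_sphere:
  fixes a :: "'a::euclidean_space"
  shows "thin (sphere a r)"
  unfolding thin_def
proof (intro conjI allI impI)
  fix x e :: 'a assume "e \<noteq> 0"
  let ?p = "[:(x - a) \<bullet> (x - a) - r\<^sup>2, 2 * ((x - a) \<bullet> e), e \<bullet> e:]"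
  have "{t. x + t *\<^sub>R e \<in> sphere a r} \<subseteq> {t. poly ?p t = 0}"
  proof (rule subsetI)
    fix t assume "t \<in> {t. x + t *\<^sub>R e \<in> sphere a r}"
    then have "r\<^sup>2 = ((x - a) + t *\<^sub>R e) \<bullet> ((x - a) + t *\<^sub>R e)"
      by (auto simp: dist_norm norm_minus_commute power2_norm_eq_inner algebra_simps)
    then show "t \<in> {t. poly ?p t = 0}"
      by (simp add: inner_add_left inner_add_right algebra_simps inner_commute)
  qed
  moreover have "?p \<noteq> 0" using \<open>e \<noteq> 0\<close> by simp
  ultimately show "finite {t. x + t *\<^sub>R e \<in> sphere a r}"
    using poly_roots_finite finite_subset by blast
qed (auto intro: negligible_sphere)

lemma gradient_nth: "gradient h x $ i = frechet_derivative h (at x) (axis i 1)"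
  by (simp add: gradient_def)

lemma has_derivative_gradient:
  fixes h :: "real^'n::finite \<Rightarrow> complex"
  assumes "(h has_derivative D) (at x)"
  shows "gradient h x $ i = D (axis i 1)"
  using frechet_derivative_eqI[OF assms] by (simp add: gradient_nth)

lemma frechet_derivative_gradient:
  fixes h :: "real^'n::finite \<Rightarrow> complex"
  assumes "h differentiable (at x)"
  shows "frechet_derivative h (at x) v = (\<Sum>i\<in>UNIV. v $ i *\<^sub>R gradient h x $ i)"
proof -
  have l: "linear (frechet_derivative h (at x))"
    using assms by (rule linear_frechet_derivative)
  have "v = (\<Sum>i\<in>UNIV. v $ i *\<^sub>R axis i 1)"
    by (simp add: vec_eq_iff axis_def if_distrib sum.delta cong: if_cong)
  then have "frechet_derivative h (at x) v = frechet_derivative h (at x) (\<Sum>i\<in>UNIV. v $ i *\<^sub>R axis i 1)"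
    by simp
  also have "\<dots> = (\<Sum>i\<in>UNIV. v $ i *\<^sub>R gradient h x $ i)"
    by (simp add: linear_sum[OF l] linear_cmul[OF l] gradient_nth)
  finally show ?thesis .
qed

lemma norm_vec_le_sum: "norm (v::complex^'n::finite) \<le> (\<Sum>i\<in>UNIV. norm (v $ i))"
  unfolding norm_vec_def by (rule L2_set_le_sum) simp

lemma continuous_on_gradientI:
  "(\<And>i. continuous_on S (\<lambda>x. gradient h x $ i)) \<Longrightarrow> continuous_on S (gradient h)"
  using continuous_on_vec_lambda[of S "\<lambda>i x. gradient h x $ i"] by simp

text \<open>The fundamental theorem of calculus tolerates finitely many exceptional points on a line.\<close>

lemma piecewise_C1_lipschitz:
  fixes h :: "real^'n::finite \<Rightarrow> complex"
  assumes "thin Z" "piecewise_C1 Z h"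
  obtains M where "M \<ge> 0" "\<And>x. x \<notin> Z \<Longrightarrow> norm (gradient h x) \<le> M"
    "\<And>x t i. norm (h (x + t *\<^sub>R axis i 1) - h x) \<le> M * \<bar>t\<bar>"
proof -
  obtain M where M: "M > 0" "\<And>x. x \<notin> Z \<Longrightarrow> norm (gradient h x) \<le> M"
    using assms(2) unfolding piecewise_C1_def bounded_pos by auto
  have pos: "norm (h (x + t *\<^sub>R axis i 1) - h x) \<le> M * t" if "t \<ge> 0" for x t i
  proof -
    let ?e = "axis i 1 :: real^'n" and ?S = "{s. x + s *\<^sub>R axis i 1 \<in> Z}"
    have e: "?e \<noteq> 0" by (simp add: axis_eq_0_iff)
    have fin: "finite ?S" using assms(1) e by (auto simp: thin_def)
    have der: "((\<lambda>s. h (x + s *\<^sub>R ?e)) has_vector_derivative gradient h (x + s *\<^sub>R ?e) $ i) (at s)"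
      if "s \<notin> ?S" for s
    proof -
      have "h differentiable (at (x + s *\<^sub>R ?e))"
        using that assms(2) by (auto simp: piecewise_C1_def)
      then have d: "(h has_derivative frechet_derivative h (at (x + s *\<^sub>R ?e))) (at (x + s *\<^sub>R ?e))"
        by (simp add: frechet_derivative_works)
      have "((\<lambda>s. x + s *\<^sub>R ?e) has_vector_derivative ?e) (at s)"
        by (auto intro!: derivative_eq_intros)
      from has_derivative_compose[OF this[unfolded has_vector_derivative_def] d]
      show ?thesis
        unfolding has_vector_derivative_def gradient_nth
        by (simp add: linear_cmul[OF has_derivative_linear[OF d]])
    qed
    have "((\<lambda>s. gradient h (x + s *\<^sub>R ?e) $ i) has_integral (h (x + t *\<^sub>R ?e) - h (x + 0 *\<^sub>R ?e))) {0..t}"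
    proof (rule fundamental_theorem_of_calculus_interior_strong[OF fin that])
      show "continuous_on {0..t} (\<lambda>s. h (x + s *\<^sub>R ?e))"
        by (rule continuous_on_compose2[of UNIV h]) (use assms(2) in \<open>auto simp: piecewise_C1_def intro!: continuous_intros\<close>)
    qed (use der in auto)
    then have i: "((\<lambda>s. if s \<in> ?S then 0 else gradient h (x + s *\<^sub>R ?e) $ i) has_integral (h (x + t *\<^sub>R ?e) - h x)) {0..t}"
      using has_integral_spike_finite[OF fin, of "{0..t}" "\<lambda>s. if s \<in> ?S then 0 else gradient h (x + s *\<^sub>R ?e) $ i"
          "\<lambda>s. gradient h (x + s *\<^sub>R ?e) $ i"] by simp
    have "norm (if s \<in> ?S then 0 else gradient h (x + s *\<^sub>R ?e) $ i) \<le> M" for s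
      using M(1) M(2)[of "x + s *\<^sub>R ?e"] Finite_Cartesian_Product.norm_nth_le[of "gradient h (x + s *\<^sub>R ?e)" i]
      by (auto intro: order_trans)
    with has_integral_bound[OF _ i[unfolded box_real(2)[symmetric]], of M] M(1) that
    show ?thesis by auto
  qed
  have "norm (h (x + t *\<^sub>R axis i 1) - h x) \<le> M * \<bar>t\<bar>" for x t i
  proof (cases "t \<ge> 0")
    case False
    then show ?thesis
      using pos[of "-t" "x + t *\<^sub>R axis i 1" i] by (simp add: norm_minus_commute)
  qed (use pos in auto)
  with M show ?thesis by (intro that[of M]) auto
qed

lemma borel_measurable_lebesgue_off_null:
  fixes g :: "'a::euclidean_space \<Rightarrow> 'b::euclidean_space"
  assumes "closed Z" "negligible Z" "continuous_on (-Z) g"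
  shows "g \<in> borel_measurable lebesgue"
proof -
  have "g \<in> borel_measurable (lebesgue_on (-Z))"
    by (rule continuous_imp_measurable_on_sets_lebesgue[OF assms(3)])
      (use assms(1) in \<open>auto intro: borel_open[THEN sets_completionI_sets[of _ lborel, simplified]]\<close>)
  then show ?thesis
    using lebesgue_measurable_diff_null[of Z g] assms(2) by (simp add: negligible_iff_null_sets)
qed

lemma piecewise_C1_gradient_measurable:
  assumes "thin Z" "piecewise_C1 Z h"
  shows "gradient h \<in> borel_measurable lebesgue"
  using assms by (intro borel_measurable_lebesgue_off_null[of Z]) (auto simp: thin_def piecewise_C1_def)

lemma has_vector_derivative_quotient:
  assumes "(f has_vector_derivative D) (at 0)"
  shows "((\<lambda>t. (f t - f 0) /\<^sub>R t) \<longlongrightarrow> D) (at 0)"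
proof -
  have "((\<lambda>t. norm (f (0 + t) - f 0 - t *\<^sub>R D) / norm t) \<longlongrightarrow> 0) (at 0)"
    using assms unfolding has_vector_derivative_def has_derivative_at by simp
  then have "((\<lambda>t. norm ((f t - f 0) /\<^sub>R t - D)) \<longlongrightarrow> 0) (at 0)"
  proof (rule tendsto_cong[THEN iffD1, rotated])
    have "norm (f t - f 0 - t *\<^sub>R D) / norm t = norm ((f t - f 0) /\<^sub>R t - D)" if "t \<noteq> 0" for t
    proof -
      have "(f t - f 0) /\<^sub>R t - D = (f t - f 0 - t *\<^sub>R D) /\<^sub>R t"
        using that by (simp add: scaleR_diff_right)
      then show ?thesis by (simp add: divide_inverse mult.commute)
    qed
    then show "\<forall>\<^sub>F t in at 0. norm (f (0 + t) - f 0 - t *\<^sub>R D) / norm t = norm ((f t - f 0) /\<^sub>R t - D)"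
      by (simp add: eventually_at_filter)
  qed
  then show ?thesis by (rule LIM_zero_cancel[OF tendsto_norm_zero_cancel])
qed

lemma AE_off_thin: "thin Z \<Longrightarrow> AE x in lebesgue. x \<notin> Z"
  by (simp add: thin_def negligible_iff_null_sets AE_not_in)

lemma integral_lebesgue_translate:
  fixes F :: "'a::euclidean_space \<Rightarrow> 'b::{banach,second_countable_topology}"
  assumes "F \<in> borel_measurable borel"
  shows "(LINT x|lebesgue. F (c + x)) = (LINT x|lebesgue. F x)"
proof -
  have "(LINT x|lebesgue. F (c + x)) = (LINT x|lborel. F (c + x))"
    by (intro integral_completion) (simp add: measurable_compose[OF _ assms])
  also have "\<dots> = (LINT x|distr lborel borel ((+) c). F x)"
    using integral_distr[of "(+) c" lborel borel F] assms by simp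
  also have "\<dots> = (LINT x|lebesgue. F x)"
    using integral_completion[of F lborel] assms by (simp add: lborel_distr_plus)
  finally show ?thesis .
qed

lemma integrable_lebesgue_bounded_support:
  fixes F :: "'a::euclidean_space \<Rightarrow> 'b::{banach,second_countable_topology}"
  assumes "F \<in> borel_measurable lebesgue" "AE x in lebesgue. norm (F x) \<le> B"
    "\<And>x. x \<notin> cball 0 R \<Longrightarrow> F x = 0"
  shows "integrable lebesgue F"
proof (rule Bochner_Integration.integrable_bound)
  show "integrable lebesgue (\<lambda>x. B * indicat_real (cball 0 R) x)"
    by (intro integrable_mult_right integrable_real_indicator)
      (auto simp: emeasure_bounded_finite[unfolded infinity_ennreal_def])
  show "AE x in lebesgue. norm (F x) \<le> norm (B * indicat_real (cball 0 R) x)"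
    using assms(2)
  proof eventually_elim
    case (elim x)
    then show ?case using assms(3)[of x] by (cases "x \<in> cball 0 R") auto
  qed
qed fact

text \<open>Difference quotients have integral zero by translation invariance; the bound along lines lets
  one pass to the limit.\<close>

lemma piecewise_C1_integral_gradient:
  fixes h :: "real^'n::finite \<Rightarrow> complex"
  assumes "thin Z" "piecewise_C1 Z h"
  shows "integrable lebesgue (\<lambda>x. gradient h x $ i)" "(LINT x|lebesgue. gradient h x $ i) = 0"
proof -
  obtain M where M: "M \<ge> 0" "\<And>x. x \<notin> Z \<Longrightarrow> norm (gradient h x) \<le> M"
    "\<And>x t i. norm (h (x + t *\<^sub>R axis i 1) - h x) \<le> M * \<bar>t\<bar>"
    by (rule piecewise_C1_lipschitz[OF assms]) blast
  obtain R where R: "R > 0" "\<And>x. h x \<noteq> 0 \<Longrightarrow> norm x \<le> R"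
    using assms(2) unfolding piecewise_C1_def bounded_pos by auto
  have ch: "continuous_on UNIV h" using assms(2) by (simp add: piecewise_C1_def)
  have bh: "h \<in> borel_measurable borel" by (rule borel_measurable_continuous_onI[OF ch])
  let ?e = "axis i 1 :: real^'n"
  define s where "s k x = real (Suc k) *\<^sub>R (h (inverse (real (Suc k)) *\<^sub>R ?e + x) - h x)" for k x
  define w where "w x = M * indicat_real (cball 0 (R + 1)) (x::real^'n)" for x
  have bs: "s k \<in> borel_measurable borel" for k
    unfolding s_def using bh by measurable
  have 1: "(\<lambda>x. gradient h x $ i) \<in> borel_measurable lebesgue"
    using piecewise_C1_gradient_measurable[OF assms]
    by (rule measurable_compose) (intro borel_measurable_continuous_onI continuous_intros)
  have 2: "s k \<in> borel_measurable lebesgue" for k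
    using bs by (simp add: measurable_completion)
  have 3: "integrable lebesgue w"
    unfolding w_def by (intro integrable_mult_right integrable_real_indicator)
      (auto simp: emeasure_bounded_finite[unfolded infinity_ennreal_def])
  have b: "norm (s k x) \<le> w x" for k x
  proof (cases "x \<in> cball 0 (R + 1)")
    case True
    have "norm (h (x + inverse (real (Suc k)) *\<^sub>R ?e) - h x) \<le> M * inverse (real (Suc k))"
      using M(3)[of x "inverse (real (Suc k))" i] by simp
    then have "real (Suc k) * norm (h (x + inverse (real (Suc k)) *\<^sub>R ?e) - h x) \<le> M"
      by (simp add: field_simps del: of_nat_Suc)
    then show ?thesis using True
      by (simp add: s_def w_def add.commute del: of_nat_Suc)
  next
    case False
    have "norm (inverse (real (Suc k)) *\<^sub>R ?e) \<le> 1"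
      by (simp add: norm_axis_1 inverse_le_1_iff del: of_nat_Suc)
    then have "h (inverse (real (Suc k)) *\<^sub>R ?e + x) = 0" "h x = 0"
      using R(2)[of x] R(2)[of "inverse (real (Suc k)) *\<^sub>R ?e + x"] False
        norm_triangle_ineq2[of x "- (inverse (real (Suc k)) *\<^sub>R ?e)"]
      by (auto simp: add.commute)
    then show ?thesis using False by (simp add: s_def w_def)
  qed
  have 4: "AE x in lebesgue. (\<lambda>k. s k x) \<longlonglongrightarrow> gradient h x $ i"
    using AE_off_thin[OF assms(1)]
  proof eventually_elim
    case (elim x)
    have "h differentiable (at (x + 0 *\<^sub>R ?e))"
      using elim assms(2) by (auto simp: piecewise_C1_def)
    then have d: "(h has_derivative frechet_derivative h (at x)) (at (x + 0 *\<^sub>R ?e))"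
      by (simp add: frechet_derivative_works)
    have "((\<lambda>t. x + t *\<^sub>R ?e) has_derivative (\<lambda>t. t *\<^sub>R ?e)) (at 0)"
      by (auto intro!: derivative_eq_intros)
    from has_derivative_compose[OF this d]
    have "((\<lambda>t. h (x + t *\<^sub>R ?e)) has_vector_derivative gradient h x $ i) (at 0)"
      unfolding has_vector_derivative_def gradient_nth
      by (simp add: linear_cmul[OF has_derivative_linear[OF d]])
    then have "((\<lambda>t. (h (x + t *\<^sub>R ?e) - h x) /\<^sub>R t) \<longlongrightarrow> gradient h x $ i) (at 0)"
      using has_vector_derivative_quotient by fastforce
    then have "(\<lambda>k. (h (x + inverse (real (Suc k)) *\<^sub>R ?e) - h x) /\<^sub>R inverse (real (Suc k))) \<longlonglongrightarrow> gradient h x $ i"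
      by (rule filterlim_compose)
        (auto simp: filterlim_at LIMSEQ_inverse_real_of_nat simp del: of_nat_Suc)
    then show ?case by (simp add: s_def add.commute)
  qed
  show "integrable lebesgue (\<lambda>x. gradient h x $ i)"
    by (rule integrable_dominated_convergence[OF 1 2 3 4]) (use b in auto)
  have "(\<lambda>k. LINT x|lebesgue. s k x) \<longlonglongrightarrow> (LINT x|lebesgue. gradient h x $ i)"
    by (rule integral_dominated_convergence[OF 1 2 3 4]) (use b in auto)
  moreover have "(LINT x|lebesgue. s k x) = 0" for k
  proof -
    obtain B where B: "\<And>x. norm (h x) \<le> B"
    proof -
      have "compact (h ` cball 0 R)"
        by (intro compact_continuous_image continuous_on_subset[OF ch]) auto
      from compact_imp_bounded[OF this]
      obtain B where "\<forall>x\<in>cball 0 R. norm (h x) \<le> B"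
        unfolding bounded_iff by auto
      then have B: "norm (h x) \<le> B" if "x \<in> cball 0 R" for x
        using that by blast
      have "norm (h x) \<le> max B 0" for x
        using B[of x] R(2)[of x] by (cases "h x = 0") (auto simp: max.coboundedI1)
      then show ?thesis by (rule that)
    qed
    have ih: "integrable lebesgue h"
      by (rule integrable_lebesgue_bounded_support[of _ B R])
        (use B R(2) bh in \<open>auto intro: measurable_completion\<close>)
    have ih': "integrable lebesgue (\<lambda>x. h (c + x))" if "norm c \<le> 1" for c
    proof (rule integrable_lebesgue_bounded_support[of _ B "R + 1"])
      show "h (c + x) = 0" if "x \<notin> cball 0 (R + 1)" for x
        using R(2)[of "c + x"] that \<open>norm c \<le> 1\<close> norm_triangle_ineq2[of x "- c"] by (auto simp: add.commute)
    qed (use B bh in \<open>auto intro: measurable_completion\<close>)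
    have "norm (inverse (real (Suc k)) *\<^sub>R ?e) \<le> 1"
      by (simp add: norm_axis_1 inverse_le_1_iff del: of_nat_Suc)
    from ih'[OF this] ih integral_lebesgue_translate[OF bh]
    show ?thesis by (simp add: s_def del: of_nat_Suc)
  qed
  ultimately show "(LINT x|lebesgue. gradient h x $ i) = 0"
    by (simp add: LIMSEQ_const_iff)
qed

section \<open>Square integrable functions\<close>

lemma quadratic_nonneg_discriminant:
  fixes a b c :: real
  assumes "\<And>t. 0 \<le> a * t\<^sup>2 + 2 * b * t + c"
  shows "b\<^sup>2 \<le> a * c"
proof (cases "a = 0")
  case True
  have "b = 0"
  proof (rule ccontr)
    assume "b \<noteq> 0"
    then show False using assms[of "- (c + 1) / (2 * b)"] True by simp
  qed
  then show ?thesis using True by simp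
next
  case False
  have "0 \<le> a * (a * (- b / a)\<^sup>2 + 2 * b * (- b / a) + c)" if "a > 0"
    using mult_nonneg_nonneg[OF _ assms[of "- b / a"], of a] that by simp
  moreover have "a > 0"
  proof (rule ccontr)
    assume "\<not> a > 0"
    with False have "a < 0" by simp
    define t where "t = (\<bar>b\<bar> * 2 + \<bar>c\<bar> + 1) / (- a) + 1"
    have at: "a * t = a - \<bar>b\<bar> * 2 - \<bar>c\<bar> - 1"
      using \<open>a < 0\<close> by (simp add: t_def field_simps)
    have t: "t \<ge> 1" using \<open>a < 0\<close> by (simp add: t_def divide_nonneg_neg)
    have "a * t\<^sup>2 + 2 * b * t + c \<le> a * t\<^sup>2 + 2 * \<bar>b\<bar> * t + \<bar>c\<bar> * t"
    proof -
      have "2 * b * t \<le> 2 * \<bar>b\<bar> * t" using t by (intro mult_right_mono) auto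
      moreover have "c \<le> \<bar>c\<bar> * t" using t mult_left_mono[OF t, of "\<bar>c\<bar>"] by auto
      ultimately show ?thesis by linarith
    qed
    also have "\<dots> = t * (a * t + 2 * \<bar>b\<bar> + \<bar>c\<bar>)"
      by (simp add: algebra_simps power2_eq_square)
    also have "a * t + 2 * \<bar>b\<bar> + \<bar>c\<bar> = a - 1"
      using at by simp
    finally show False
      using assms[of t] t \<open>a < 0\<close> mult_pos_neg[of t "a - 1"] by linarith
  qed
  ultimately show ?thesis
    using False by (simp add: field_simps power2_eq_square)
qed

definition L2_norm :: "'a::euclidean_space set \<Rightarrow> ('a \<Rightarrow> 'b::real_normed_vector) \<Rightarrow> real" where
  "L2_norm U p = sqrt (LINT x|lebesgue_on U. (norm (p x))\<^sup>2)"

lemma L2_norm_nonneg [simp]: "0 \<le> L2_norm U p"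
  by (simp add: L2_norm_def)

lemma L2_norm_square: "(L2_norm U p)\<^sup>2 = (LINT x|lebesgue_on U. (norm (p x))\<^sup>2)"
  by (simp add: L2_norm_def)

lemma L2_measurable: "p \<in> L2 U \<Longrightarrow> p \<in> borel_measurable (lebesgue_on U)"
  and L2_integrable: "p \<in> L2 U \<Longrightarrow> integrable (lebesgue_on U) (\<lambda>x. (norm (p x))\<^sup>2)"
  by (auto simp: L2_def)

lemma L2_dominated:
  fixes p :: "'a::euclidean_space \<Rightarrow> 'b::euclidean_space" and q :: "'a \<Rightarrow> 'c::euclidean_space"
  assumes "p \<in> L2 U" "q \<in> borel_measurable (lebesgue_on U)"
    "AE x in lebesgue_on U. norm (q x) \<le> C * norm (p x)" "C \<ge> 0"
  shows "q \<in> L2 U" "L2_norm U q \<le> C * L2_norm U p"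
proof -
  have i: "integrable (lebesgue_on U) (\<lambda>x. C\<^sup>2 * (norm (p x))\<^sup>2)"
    using L2_integrable[OF assms(1)] by simp
  have b: "AE x in lebesgue_on U. (norm (q x))\<^sup>2 \<le> C\<^sup>2 * (norm (p x))\<^sup>2"
    using assms(3) by eventually_elim (metis power_mono norm_ge_zero power_mult_distrib)
  have m: "(\<lambda>x. (norm (q x))\<^sup>2) \<in> borel_measurable (lebesgue_on U)"
    using assms(2) by measurable
  have iq: "integrable (lebesgue_on U) (\<lambda>x. (norm (q x))\<^sup>2)"
    by (rule Bochner_Integration.integrable_bound[OF i m]) (use b in auto)
  then show "q \<in> L2 U" using assms(2) by (simp add: L2_def)
  have "(L2_norm U q)\<^sup>2 \<le> (C * L2_norm U p)\<^sup>2"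
    unfolding power_mult_distrib L2_norm_square
    using integral_mono_AE[OF iq i b] by simp
  then show "L2_norm U q \<le> C * L2_norm U p"
    using assms(4) by (meson L2_norm_nonneg mult_nonneg_nonneg power2_le_imp_le)
qed

lemma L2_add:
  fixes p q :: "'a::euclidean_space \<Rightarrow> 'b::euclidean_space"
  assumes "p \<in> L2 U" "q \<in> L2 U"
  shows "(\<lambda>x. p x + q x) \<in> L2 U"
proof -
  have m: "(\<lambda>x. p x + q x) \<in> borel_measurable (lebesgue_on U)"
    using L2_measurable[OF assms(1)] L2_measurable[OF assms(2)] by measurable
  have i: "integrable (lebesgue_on U) (\<lambda>x. 2 * (norm (p x))\<^sup>2 + 2 * (norm (q x))\<^sup>2)"
    using L2_integrable[OF assms(1)] L2_integrable[OF assms(2)] by simp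
  have "(norm (p x + q x))\<^sup>2 \<le> 2 * (norm (p x))\<^sup>2 + 2 * (norm (q x))\<^sup>2" for x
  proof -
    have "(norm (p x + q x))\<^sup>2 \<le> (norm (p x) + norm (q x))\<^sup>2"
      by (intro power_mono norm_triangle_ineq) auto
    also have "\<dots> \<le> 2 * (norm (p x))\<^sup>2 + 2 * (norm (q x))\<^sup>2"
      using sum_squares_bound[of "norm (p x)" "norm (q x)"] by (simp add: power2_sum)
    finally show ?thesis .
  qed
  then have "integrable (lebesgue_on U) (\<lambda>x. (norm (p x + q x))\<^sup>2)"
    using m by (intro Bochner_Integration.integrable_bound[OF i]) auto
  then show ?thesis using m by (simp add: L2_def)
qed

lemma L2_scaleR: "p \<in> L2 U \<Longrightarrow> (\<lambda>x. c *\<^sub>R p x) \<in> L2 U"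
  and L2_norm_scaleR: "p \<in> L2 U \<Longrightarrow> L2_norm U (\<lambda>x. c *\<^sub>R p x) = \<bar>c\<bar> * L2_norm U p"
  for p :: "'a::euclidean_space \<Rightarrow> 'b::euclidean_space"
  by (auto simp: L2_def L2_norm_def power_mult_distrib real_sqrt_mult)

lemma L2_diff:
  fixes p q :: "'a::euclidean_space \<Rightarrow> 'b::euclidean_space"
  assumes "p \<in> L2 U" "q \<in> L2 U"
  shows "(\<lambda>x. p x - q x) \<in> L2 U"
  using L2_add[OF assms(1) L2_scaleR[OF assms(2), of "-1"]] by simp

lemma L2_norm_product:
  fixes p :: "'a::euclidean_space \<Rightarrow> 'b::euclidean_space" and q :: "'a \<Rightarrow> 'c::euclidean_space"
  assumes "p \<in> L2 U" "q \<in> L2 U"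
  shows "integrable (lebesgue_on U) (\<lambda>x. norm (p x) * norm (q x))"
    "(LINT x|lebesgue_on U. norm (p x) * norm (q x)) \<le> L2_norm U p * L2_norm U q"
proof -
  note [measurable] = L2_measurable[OF assms(1)] L2_measurable[OF assms(2)]
  have i: "integrable (lebesgue_on U) (\<lambda>x. (norm (p x))\<^sup>2 + (norm (q x))\<^sup>2)"
    using L2_integrable[OF assms(1)] L2_integrable[OF assms(2)] by simp
  show pq: "integrable (lebesgue_on U) (\<lambda>x. norm (p x) * norm (q x))"
  proof (rule Bochner_Integration.integrable_bound[OF i])
    show "AE x in lebesgue_on U. norm (norm (p x) * norm (q x)) \<le> norm ((norm (p x))\<^sup>2 + (norm (q x))\<^sup>2)"
    proof (rule AE_I2)
      fix x
      have "0 \<le> norm (p x) * norm (q x)" by simp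
      moreover have "2 * (norm (p x) * norm (q x)) \<le> (norm (p x))\<^sup>2 + (norm (q x))\<^sup>2"
        using sum_squares_bound[of "norm (p x)" "norm (q x)"] by (simp add: mult.assoc)
      ultimately have "norm (p x) * norm (q x) \<le> (norm (p x))\<^sup>2 + (norm (q x))\<^sup>2"
        by linarith
      then show "norm (norm (p x) * norm (q x)) \<le> norm ((norm (p x))\<^sup>2 + (norm (q x))\<^sup>2)"
        by simp
    qed
  qed measurable
  have "(LINT x|lebesgue_on U. norm (p x) * norm (q x))\<^sup>2 \<le> (L2_norm U p)\<^sup>2 * (L2_norm U q)\<^sup>2"
  proof (rule quadratic_nonneg_discriminant)
    fix t :: real
    have "0 \<le> (LINT x|lebesgue_on U. (norm (p x) * t + norm (q x))\<^sup>2)"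
      by simp
    also have "\<dots> = (LINT x|lebesgue_on U. (norm (p x))\<^sup>2 * t\<^sup>2 + 2 * (norm (p x) * norm (q x)) * t + (norm (q x))\<^sup>2)"
      by (rule Bochner_Integration.integral_cong) (simp_all add: power2_eq_square algebra_simps)
    also have "\<dots> = (L2_norm U p)\<^sup>2 * t\<^sup>2 + 2 * (LINT x|lebesgue_on U. norm (p x) * norm (q x)) * t + (L2_norm U q)\<^sup>2"
      using pq L2_integrable[OF assms(1)] L2_integrable[OF assms(2)] by (simp add: L2_norm_square)
    finally show "0 \<le> (L2_norm U p)\<^sup>2 * t\<^sup>2 + 2 * (LINT x|lebesgue_on U. norm (p x) * norm (q x)) * t + (L2_norm U q)\<^sup>2" .
  qed
  then show "(LINT x|lebesgue_on U. norm (p x) * norm (q x)) \<le> L2_norm U p * L2_norm U q"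
    by (metis L2_norm_nonneg mult_nonneg_nonneg power2_le_imp_le power_mult_distrib)
qed

lemma L2_product_bound:
  fixes p :: "'a::euclidean_space \<Rightarrow> 'b::euclidean_space" and q :: "'a \<Rightarrow> 'c::euclidean_space"
    and h :: "'a \<Rightarrow> 'd::{banach,second_countable_topology}"
  assumes "p \<in> L2 U" "q \<in> L2 U" "h \<in> borel_measurable (lebesgue_on U)"
    "AE x in lebesgue_on U. norm (h x) \<le> C * (norm (p x) * norm (q x))" "C \<ge> 0"
  shows "integrable (lebesgue_on U) h" "norm (LINT x|lebesgue_on U. h x) \<le> C * (L2_norm U p * L2_norm U q)"
proof -
  have i: "integrable (lebesgue_on U) (\<lambda>x. C * (norm (p x) * norm (q x)))"
    using L2_norm_product(1)[OF assms(1,2)] by simp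
  show ih: "integrable (lebesgue_on U) h"
    by (rule Bochner_Integration.integrable_bound[OF i assms(3)])
      (use assms(4,5) in auto)
  have "norm (LINT x|lebesgue_on U. h x) \<le> (LINT x|lebesgue_on U. norm (h x))"
    by (rule integral_norm_bound)
  also have "\<dots> \<le> (LINT x|lebesgue_on U. C * (norm (p x) * norm (q x)))"
    using ih i assms(4) by (intro integral_mono_AE) auto
  also have "\<dots> \<le> C * (L2_norm U p * L2_norm U q)"
    using L2_norm_product(2)[OF assms(1,2)] assms(5) by (simp add: mult_left_mono)
  finally show "norm (LINT x|lebesgue_on U. h x) \<le> C * (L2_norm U p * L2_norm U q)" .
qed

lemma L2_norm_triangle:
  fixes p q :: "'a::euclidean_space \<Rightarrow> 'b::euclidean_space"
  assumes "p \<in> L2 U" "q \<in> L2 U"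
  shows "L2_norm U (\<lambda>x. p x + q x) \<le> L2_norm U p + L2_norm U q"
proof -
  have "(L2_norm U (\<lambda>x. p x + q x))\<^sup>2 \<le>
      (LINT x|lebesgue_on U. (norm (p x))\<^sup>2 + 2 * (norm (p x) * norm (q x)) + (norm (q x))\<^sup>2)"
    unfolding L2_norm_square
  proof (rule integral_mono)
    show "(norm (p x + q x))\<^sup>2 \<le> (norm (p x))\<^sup>2 + 2 * (norm (p x) * norm (q x)) + (norm (q x))\<^sup>2" for x
      using power_mono[OF norm_triangle_ineq[of "p x" "q x"], of 2] by (simp add: power2_sum)
  qed (use L2_integrable[OF L2_add[OF assms]] L2_norm_product(1)[OF assms]
      L2_integrable[OF assms(1)] L2_integrable[OF assms(2)] in auto)
  also have "\<dots> = (L2_norm U p)\<^sup>2 + 2 * (LINT x|lebesgue_on U. norm (p x) * norm (q x)) + (L2_norm U q)\<^sup>2"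
    using L2_norm_product(1)[OF assms] L2_integrable[OF assms(1)] L2_integrable[OF assms(2)]
    by (simp add: L2_norm_square)
  also have "\<dots> \<le> (L2_norm U p + L2_norm U q)\<^sup>2"
    using L2_norm_product(2)[OF assms] by (simp add: power2_sum)
  finally show ?thesis
    by (meson L2_norm_nonneg add_nonneg_nonneg power2_le_imp_le)
qed

lemma L2_norm_minus_commute: "L2_norm U (\<lambda>x. p x - q x) = L2_norm U (\<lambda>x. q x - p x)"
  by (simp add: L2_norm_def norm_minus_commute)

lemma L2_norm_triangle_diff:
  fixes p q :: "'a::euclidean_space \<Rightarrow> 'b::euclidean_space"
  assumes "p \<in> L2 U" "q \<in> L2 U"
  shows "L2_norm U p \<le> L2_norm U q + L2_norm U (\<lambda>x. p x - q x)"
  using L2_norm_triangle[OF assms(2) L2_diff[OF assms]] by simp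

lemma L2_norm_cong_AE:
  fixes p q :: "'a::euclidean_space \<Rightarrow> 'b::euclidean_space"
  assumes "p \<in> borel_measurable (lebesgue_on U)" "q \<in> borel_measurable (lebesgue_on U)"
    "AE x in lebesgue_on U. p x = q x"
  shows "L2_norm U p = L2_norm U q"
proof -
  have "AE x in lebesgue_on U. (norm (p x))\<^sup>2 = (norm (q x))\<^sup>2"
    using assms(3) by eventually_elim simp
  then show ?thesis
    using integral_cong_AE[of "\<lambda>x. (norm (p x))\<^sup>2" "lebesgue_on U" "\<lambda>x. (norm (q x))\<^sup>2"] assms(1,2)
    by (simp add: L2_norm_def borel_measurable_power borel_measurable_norm)
qed

section \<open>Weak gradients\<close>

lemma open_lebesgue [simp]: "open U \<Longrightarrow> U \<in> sets lebesgue"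
  by (simp add: borel_open)

lemma integral_lebesgue_on_eq:
  fixes h :: "'a::euclidean_space \<Rightarrow> 'b::{banach,second_countable_topology}"
  assumes "open U" "\<And>x. x \<notin> U \<Longrightarrow> h x = 0"
  shows "(LINT x|lebesgue_on U. h x) = (LINT x|lebesgue. h x)"
proof -
  have "(LINT x|lebesgue_on U. h x) = (LINT x|lebesgue. indicat_real U x *\<^sub>R h x)"
    using assms(1) by (intro integral_restrict_space) simp
  also have "\<dots> = (LINT x|lebesgue. h x)"
    by (rule Bochner_Integration.integral_cong) (use assms(2) in \<open>auto simp: indicator_def\<close>)
  finally show ?thesis .
qed

lemma bounded_if_bounded_support:
  fixes h :: "'a::euclidean_space \<Rightarrow> 'b::real_normed_vector"
  assumes "continuous_on UNIV h" "bounded {x. h x \<noteq> 0}"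
  obtains B where "B \<ge> 0" "\<And>x. norm (h x) \<le> B"
proof -
  obtain R where R: "\<And>x. h x \<noteq> 0 \<Longrightarrow> norm x \<le> R"
    using assms(2) unfolding bounded_iff by auto
  have "compact (h ` cball 0 R)"
    by (intro compact_continuous_image continuous_on_subset[OF assms(1)]) auto
  from compact_imp_bounded[OF this]
  obtain B where "\<forall>x\<in>cball 0 R. norm (h x) \<le> B" unfolding bounded_iff by auto
  then have B: "norm (h x) \<le> B" if "x \<in> cball 0 R" for x using that by blast
  have "norm (h x) \<le> max B 0" for x
    using B[of x] R[of x] by (cases "h x = 0") (auto simp: max.coboundedI1)
  then show ?thesis using that[of "max B 0"] by simp
qed

lemma gradient_eq_0:
  fixes h :: "real^'n::finite \<Rightarrow> complex"
  assumes "open N" "x \<in> N" "\<And>y. y \<in> N \<Longrightarrow> h y = 0"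
  shows "gradient h x = 0"
proof -
  have "(h has_derivative (\<lambda>_. 0)) (at x)"
    by (rule has_derivative_transform_within_open[OF has_derivative_const[of 0] assms(1,2)]) (simp add: assms(3))
  then show ?thesis by (simp add: vec_eq_iff has_derivative_gradient)
qed

lemma gradient_eq_0_outside:
  fixes h :: "real^'n::finite \<Rightarrow> complex"
  assumes "x \<notin> closure {y. h y \<noteq> 0}"
  shows "gradient h x = 0"
  by (rule gradient_eq_0[of "- closure {y. h y \<noteq> 0}"])
    (use assms closure_subset[of "{y. h y \<noteq> 0}"] in auto)

lemma gradient_mult:
  fixes h k :: "real^'n::finite \<Rightarrow> complex"
  assumes "h differentiable (at x)" "k differentiable (at x)"
  shows "gradient (\<lambda>x. h x * k x) x $ i = h x * gradient k x $ i + gradient h x $ i * k x"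
    "(\<lambda>x. h x * k x) differentiable (at x)"
  using has_derivative_gradient[OF has_derivative_mult[OF assms[unfolded frechet_derivative_works]]]
    has_derivative_mult[OF assms[unfolded frechet_derivative_works]]
  by (auto simp: gradient_nth intro: differentiableI)

lemma gradient_add:
  fixes h k :: "real^'n::finite \<Rightarrow> complex"
  assumes "h differentiable (at x)" "k differentiable (at x)"
  shows "gradient (\<lambda>x. h x + k x) x = gradient h x + gradient k x"
  using has_derivative_gradient[OF has_derivative_add[OF assms[unfolded frechet_derivative_works]]]
  by (auto simp: gradient_nth vec_eq_iff)

lemma gradient_bounded_linear:
  fixes h :: "real^'n::finite \<Rightarrow> complex"
  assumes "h differentiable (at x)" "bounded_linear l"
  shows "gradient (\<lambda>x. l (h x)) x $ i = l (gradient h x $ i)"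
    "(\<lambda>x. l (h x)) differentiable (at x)"
  using has_derivative_gradient[OF bounded_linear.has_derivative[OF assms(2) assms(1)[unfolded frechet_derivative_works]]]
    bounded_linear.has_derivative[OF assms(2) assms(1)[unfolded frechet_derivative_works]]
  by (auto simp: gradient_nth intro: differentiableI)

lemma piecewise_C1_mult:
  fixes h k :: "real^'n::finite \<Rightarrow> complex"
  assumes h: "piecewise_C1 Z h"
    and k: "\<And>x. k differentiable (at x)" "continuous_on UNIV (gradient k)"
  shows "piecewise_C1 Z (\<lambda>x. h x * k x)"
  unfolding piecewise_C1_def
proof (intro conjI ballI)
  have ck: "continuous_on UNIV k"
    using k(1) by (simp add: continuous_at_imp_continuous_on differentiable_imp_continuous_within)
  have ch: "continuous_on UNIV h" using h by (simp add: piecewise_C1_def)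
  then show "continuous_on UNIV (\<lambda>x. h x * k x)"
    using ck by (rule continuous_on_mult)
  have bh: "bounded {x. h x \<noteq> 0}" using h by (simp add: piecewise_C1_def)
  then show "bounded {x. h x * k x \<noteq> 0}" by (rule bounded_subset) auto
  show "(\<lambda>x. h x * k x) differentiable at x" if "x \<in> - Z" for x
    using h k(1) that by (intro gradient_mult(2)) (auto simp: piecewise_C1_def)
  have g: "gradient (\<lambda>x. h x * k x) x $ i = h x * gradient k x $ i + gradient h x $ i * k x"
    if "x \<in> - Z" for x i
    using h k(1) that by (intro gradient_mult(1)) (auto simp: piecewise_C1_def)
  have cg: "continuous_on (- Z) (gradient h)" using h by (simp add: piecewise_C1_def)
  show "continuous_on (- Z) (gradient (\<lambda>x. h x * k x))"
  proof (rule continuous_on_gradientI)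
    fix i
    have "continuous_on (- Z) (\<lambda>x. h x * gradient k x $ i + gradient h x $ i * k x)"
      by (intro continuous_on_add continuous_on_mult continuous_on_component cg
          continuous_on_subset[OF ck] continuous_on_subset[OF ch] continuous_on_subset[OF k(2)]) auto
    then show "continuous_on (- Z) (\<lambda>x. gradient (\<lambda>x. h x * k x) x $ i)"
      by (rule continuous_on_eq) (simp add: g)
  qed
  define S where "S = closure {y. h y \<noteq> 0}"
  have S: "compact S" using bh by (simp add: S_def compact_closure)
  obtain Bh where Bh: "Bh \<ge> 0" "\<And>x. norm (h x) \<le> Bh"
    using bounded_if_bounded_support[OF ch bh] by blast
  have "compact (k ` S)" "compact (gradient k ` S)"
    by (intro compact_continuous_image S continuous_on_subset[OF ck] continuous_on_subset[OF k(2)]; simp)+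
  from this[THEN compact_imp_bounded] obtain Bk Bg where
    B: "\<And>x. x \<in> S \<Longrightarrow> norm (k x) \<le> Bk" "\<And>x. x \<in> S \<Longrightarrow> norm (gradient k x) \<le> Bg"
    unfolding bounded_iff by blast
  obtain M where M: "\<And>x. x \<in> - Z \<Longrightarrow> norm (gradient h x) \<le> M"
    using h unfolding piecewise_C1_def bounded_iff by blast
  have "norm (gradient (\<lambda>x. h x * k x) x) \<le> (\<Sum>i\<in>(UNIV::'n set). Bh * \<bar>Bg\<bar> + \<bar>M\<bar> * \<bar>Bk\<bar>)" if "x \<in> - Z" for x
  proof (cases "x \<in> S")
    case False
    then have "gradient (\<lambda>x. h x * k x) x = 0"
      by (intro gradient_eq_0[of "- S"]) (use closure_subset[of "{y. h y \<noteq> 0}"] in \<open>auto simp: S_def\<close>)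
    then show ?thesis using Bh(1) by (simp add: mult_nonneg_nonneg)
  next
    case True
    have "norm (gradient (\<lambda>x. h x * k x) x $ i) \<le> Bh * \<bar>Bg\<bar> + \<bar>M\<bar> * \<bar>Bk\<bar>" for i
    proof -
      have "norm (gradient k x $ i) \<le> \<bar>Bg\<bar>" "norm (gradient h x $ i) \<le> \<bar>M\<bar>" "norm (k x) \<le> \<bar>Bk\<bar>"
        using Finite_Cartesian_Product.norm_nth_le[of "gradient k x" i]
          Finite_Cartesian_Product.norm_nth_le[of "gradient h x" i] B[OF True] M[OF that] by linarith+
      then have "norm (h x * gradient k x $ i) \<le> Bh * \<bar>Bg\<bar>" "norm (gradient h x $ i * k x) \<le> \<bar>M\<bar> * \<bar>Bk\<bar>"
        using Bh by (auto simp: norm_mult intro!: mult_mono)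
      then show ?thesis unfolding g[OF that] by (rule norm_triangle_mono)
    qed
    then show ?thesis by (intro order_trans[OF norm_vec_le_sum] sum_mono)
  qed
  then show "bounded (gradient (\<lambda>x. h x * k x) ` (- Z))"
    unfolding bounded_iff by blast
qed

lemma smooth_gradient_continuous:
  fixes k :: "real^'n::finite \<Rightarrow> complex"
  assumes "smooth_on UNIV k" shows "continuous_on S (gradient k)"
proof (rule continuous_on_gradientI)
  fix i
  have "axis i 1 \<in> (Basis :: (real^'n) set)" by (simp add: axis_in_Basis_iff)
  from smooth_on_continuous[OF smooth_on_partial[OF assms this]]
  show "continuous_on S (\<lambda>x. gradient k x $ i)" by (simp add: gradient_nth)
qed

lemma test_function_piecewise_C1:
  assumes "test_function U \<phi>" shows "piecewise_C1 {} \<phi>"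
  unfolding piecewise_C1_def
proof (intro conjI ballI)
  have s: "smooth_on UNIV \<phi>" and c: "compact (support_of \<phi>)"
    using assms by (auto simp: test_function_def)
  show "continuous_on UNIV \<phi>" by (rule smooth_on_continuous[OF s])
  show "bounded {x. \<phi> x \<noteq> 0}"
    using bounded_subset[OF compact_imp_bounded[OF c]] closure_subset[of "{x. \<phi> x \<noteq> 0}"] by (simp add: support_of_def)
  show "\<phi> differentiable (at x)" for x by (rule smooth_on_differentiable[OF s])
  show cg: "continuous_on (- {}) (gradient \<phi>)" by (rule smooth_gradient_continuous[OF s])
  have "{x. gradient \<phi> x \<noteq> 0} \<subseteq> support_of \<phi>"
    using gradient_eq_0_outside by (auto simp: support_of_def)
  from bounded_if_bounded_support[OF cg[simplified] bounded_subset[OF compact_imp_bounded[OF c] this]]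
  show "bounded (gradient \<phi> ` (- {}))" unfolding bounded_iff by auto
qed

text \<open>The product \<open>h k\<close> is again glued along \<open>Z\<close>, so its partial derivatives have integral zero.\<close>

lemma integral_by_parts:
  fixes h k :: "real^'n::finite \<Rightarrow> complex"
  assumes Z: "thin Z" and h: "piecewise_C1 Z h"
    and k: "\<And>x. k differentiable (at x)" "continuous_on UNIV (gradient k)"
  shows "integrable lebesgue (\<lambda>x. h x * gradient k x $ i)"
    "integrable lebesgue (\<lambda>x. gradient h x $ i * k x)"
    "(LINT x|lebesgue. h x * gradient k x $ i) = - (LINT x|lebesgue. gradient h x $ i * k x)"
proof -
  have p: "piecewise_C1 Z (\<lambda>x. h x * k x)" by (rule piecewise_C1_mult[OF h k])
  have ck: "continuous_on UNIV k"
    using k(1) by (simp add: continuous_at_imp_continuous_on differentiable_imp_continuous_within)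
  have ch: "continuous_on UNIV h" using h by (simp add: piecewise_C1_def)
  have c: "continuous_on UNIV (\<lambda>x. h x * gradient k x $ i)"
    by (intro continuous_on_mult ch continuous_on_component k(2))
  obtain R where R: "\<And>x. h x \<noteq> 0 \<Longrightarrow> norm x \<le> R"
    using h unfolding piecewise_C1_def bounded_iff by auto
  have b: "bounded {x. h x * gradient k x $ i \<noteq> 0}"
    using R by (auto simp: bounded_iff)
  obtain B where B: "\<And>x. norm (h x * gradient k x $ i) \<le> B"
    using bounded_if_bounded_support[OF c b] by blast
  show 1: "integrable lebesgue (\<lambda>x. h x * gradient k x $ i)"
  proof (rule integrable_lebesgue_bounded_support[of _ B R])
    show "(\<lambda>x. h x * gradient k x $ i) \<in> borel_measurable lebesgue"
      using borel_measurable_continuous_onI[OF c] by (simp add: measurable_completion)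
  qed (use B R in force)+
  have e: "AE x in lebesgue. gradient (\<lambda>x. h x * k x) x $ i = h x * gradient k x $ i + gradient h x $ i * k x"
    using AE_off_thin[OF Z]
  proof eventually_elim
    case (elim x)
    then show ?case using h k(1) by (intro gradient_mult(1)) (auto simp: piecewise_C1_def)
  qed
  have mh: "(\<lambda>x. gradient h x $ i) \<in> borel_measurable lebesgue"
    using piecewise_C1_integral_gradient(1)[OF Z h] by (rule borel_measurable_integrable)
  have mk: "k \<in> borel_measurable lebesgue"
    using borel_measurable_continuous_onI[OF ck] by (simp add: measurable_completion)
  have m: "(\<lambda>x. gradient h x $ i * k x) \<in> borel_measurable lebesgue"
    by (intro borel_measurable_times mh mk)
  have i: "integrable lebesgue (\<lambda>x. gradient (\<lambda>x. h x * k x) x $ i - h x * gradient k x $ i)"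
    using piecewise_C1_integral_gradient(1)[OF Z p, of i] 1 by simp
  have e': "AE x in lebesgue. gradient (\<lambda>x. h x * k x) x $ i - h x * gradient k x $ i = gradient h x $ i * k x"
    using e by eventually_elim simp
  show 2: "integrable lebesgue (\<lambda>x. gradient h x $ i * k x)"
    using integrable_cong_AE[OF borel_measurable_integrable[OF i] m e'] i by simp
  have "0 = (LINT x|lebesgue. gradient (\<lambda>x. h x * k x) x $ i)"
    using piecewise_C1_integral_gradient(2)[OF Z p] by simp
  also have "\<dots> = (LINT x|lebesgue. h x * gradient k x $ i + gradient h x $ i * k x)"
    by (rule integral_cong_AE)
      (use e 1 2 piecewise_C1_integral_gradient(1)[OF Z p, of i] in \<open>auto intro: borel_measurable_integrable\<close>)
  finally show "(LINT x|lebesgue. h x * gradient k x $ i) = - (LINT x|lebesgue. gradient h x $ i * k x)"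
    using 1 2 by (simp add: eq_neg_iff_add_eq_0)
qed

lemma integrable_lebesgue_on:
  fixes f :: "'a::euclidean_space \<Rightarrow> 'b::{banach,second_countable_topology}"
  assumes "U \<in> sets lebesgue" "integrable lebesgue f"
  shows "integrable (lebesgue_on U) f"
  using integrable_mult_indicator[OF assms] assms(1) by (simp add: integrable_restrict_space)

lemma L2_bounded_support:
  fixes g :: "'a::euclidean_space \<Rightarrow> 'b::euclidean_space"
  assumes "U \<in> sets lebesgue" "g \<in> borel_measurable lebesgue"
    "AE x in lebesgue. norm (g x) \<le> B" "\<And>x. x \<notin> cball 0 R \<Longrightarrow> g x = 0"
  shows "g \<in> L2 U"
proof -
  have "integrable lebesgue (\<lambda>x. (norm (g x))\<^sup>2)"
  proof (rule integrable_lebesgue_bounded_support[of _ "B\<^sup>2" R])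
    show "(\<lambda>x. (norm (g x))\<^sup>2) \<in> borel_measurable lebesgue" using assms(2) by measurable
    show "AE x in lebesgue. norm ((norm (g x))\<^sup>2) \<le> B\<^sup>2"
      using assms(3) by eventually_elim (simp add: power_mono)
  qed (use assms(4) in auto)
  from integrable_lebesgue_on[OF assms(1) this] assms(2) show ?thesis
    by (auto simp: L2_def intro: measurable_restrict_space1)
qed

lemma piecewise_C1_L2:
  assumes "thin Z" "piecewise_C1 Z h" "U \<in> sets lebesgue"
  shows "h \<in> L2 U" "gradient h \<in> L2 U"
proof -
  have ch: "continuous_on UNIV h" and bh: "bounded {x. h x \<noteq> 0}"
    using assms(2) by (auto simp: piecewise_C1_def)
  obtain B where B: "\<And>x. norm (h x) \<le> B" using bounded_if_bounded_support[OF ch bh] by blast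
  have "bounded (closure {x. h x \<noteq> 0})" using bh by (rule bounded_closure)
  then obtain R where R: "\<And>x. x \<in> closure {x. h x \<noteq> 0} \<Longrightarrow> norm x \<le> R"
    unfolding bounded_iff by blast
  show "h \<in> L2 U"
  proof (rule L2_bounded_support[OF assms(3), of _ B R])
    show "h \<in> borel_measurable lebesgue"
      using borel_measurable_continuous_onI[OF ch] by (simp add: measurable_completion)
    show "h x = 0" if "x \<notin> cball 0 R" for x
      using R[of x] that closure_subset[of "{x. h x \<noteq> 0}"] by auto
  qed (use B in auto)
  obtain M where M: "\<And>x. x \<in> - Z \<Longrightarrow> norm (gradient h x) \<le> M"
    using assms(2) unfolding piecewise_C1_def bounded_iff by blast
  show "gradient h \<in> L2 U"
  proof (rule L2_bounded_support[OF assms(3) piecewise_C1_gradient_measurable[OF assms(1,2)], of M R])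
    show "AE x in lebesgue. norm (gradient h x) \<le> M"
      using AE_off_thin[OF assms(1)] by eventually_elim (use M in auto)
    show "gradient h x = 0" if "x \<notin> cball 0 R" for x
      using R[of x] that by (intro gradient_eq_0_outside) auto
  qed
qed

lemma test_function_L2:
  assumes "test_function V \<phi>" "U \<in> sets lebesgue"
  shows "\<phi> \<in> L2 U" "gradient \<phi> \<in> L2 U"
  using piecewise_C1_L2[OF thin_empty test_function_piecewise_C1[OF assms(1)] assms(2)] by auto

lemma test_function_smooth: "test_function U \<phi> \<Longrightarrow> smooth_on UNIV \<phi>"
  by (simp add: test_function_def)

lemma test_function_eq_0: "test_function U \<phi> \<Longrightarrow> x \<notin> U \<Longrightarrow> \<phi> x = 0"
  using closure_subset[of "{x. \<phi> x \<noteq> 0}"] by (auto simp: test_function_def support_of_def)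

lemma test_function_gradient_eq_0: "test_function U \<phi> \<Longrightarrow> x \<notin> U \<Longrightarrow> gradient \<phi> x = 0"
  by (rule gradient_eq_0_outside) (auto simp: test_function_def support_of_def)

lemma piecewise_C1_has_weak_gradient:
  assumes "open U" "thin Z" "piecewise_C1 Z h"
  shows "has_weak_gradient U h (gradient h)"
  unfolding has_weak_gradient_def
proof (intro conjI allI impI)
  show "gradient h \<in> L2 U" using assms by (intro piecewise_C1_L2) auto
  fix \<psi> :: "real^'a \<Rightarrow> complex" and i assume \<psi>: "test_function U \<psi>"
  note s = test_function_smooth[OF \<psi>]
  have "(LINT x|lebesgue_on U. h x * gradient \<psi> x $ i) = (LINT x|lebesgue. h x * gradient \<psi> x $ i)"
    by (rule integral_lebesgue_on_eq[OF assms(1)]) (simp add: test_function_gradient_eq_0[OF \<psi>])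
  also have "\<dots> = - (LINT x|lebesgue. gradient h x $ i * \<psi> x)"
    by (rule integral_by_parts[OF assms(2,3) smooth_on_differentiable[OF s] smooth_gradient_continuous[OF s]])
  also have "(LINT x|lebesgue. gradient h x $ i * \<psi> x) = (LINT x|lebesgue_on U. gradient h x $ i * \<psi> x)"
    by (rule integral_lebesgue_on_eq[OF assms(1), symmetric]) (simp add: test_function_eq_0[OF \<psi>])
  finally show "(LINT x|lebesgue_on U. h x * gradient \<psi> x $ i) = - (LINT x|lebesgue_on U. gradient h x $ i * \<psi> x)" .
qed

lemma test_function_has_weak_gradient:
  "open U \<Longrightarrow> test_function V \<phi> \<Longrightarrow> has_weak_gradient U \<phi> (gradient \<phi>)"
  by (rule piecewise_C1_has_weak_gradient[OF _ thin_empty test_function_piecewise_C1])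

lemma test_function_box_bump:
  assumes "cbox a b \<subseteq> U" "k > 0"
  shows "test_function U (\<lambda>x. complex_of_real (box_bump k a b x))"
proof -
  have "support_of (\<lambda>x. complex_of_real (box_bump k a b x)) = support_of (box_bump k a b)"
    by (simp add: support_of_def)
  moreover have "compact (support_of (box_bump k a b))"
    using bounded_subset[OF bounded_cbox support_box_bump[OF assms(2), of a b]]
    by (simp add: compact_eq_bounded_closed support_of_def)
  ultimately show ?thesis
    using smooth_on_bounded_linear[OF bounded_linear_of_real smooth_on_box_bump[of k a b]]
      support_box_bump[OF assms(2), of a b] assms(1)
    by (auto simp: test_function_def)
qed

text \<open>Testing with bumps that converge to the indicator of a box shows that the integral over every
  small box vanishes; Lebesgue's differentiation theorem then applies.\<close>

lemma AE_zero_if_orthogonal_to_test_functions: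
  fixes h :: "'a::euclidean_space \<Rightarrow> complex"
  assumes U: "open U" and h: "h \<in> L2 U"
    and zero: "\<And>\<phi>. test_function U \<phi> \<Longrightarrow> (LINT x|lebesgue_on U. h x * \<phi> x) = 0"
  shows "AE x in lebesgue_on U. h x = 0"
proof -
  define H where "H x = (if x \<in> U then h x else 0)" for x
  have mH: "H \<in> borel_measurable lebesgue"
    unfolding H_def using L2_measurable[OF h] U
    by (subst borel_measurable_if) auto
  have i2: "integrable lebesgue (\<lambda>x. (norm (H x))\<^sup>2)"
  proof -
    have "integrable lebesgue (\<lambda>x. indicat_real U x *\<^sub>R (norm (h x))\<^sup>2)"
      using L2_integrable[OF h] U by (simp add: integrable_restrict_space)
    moreover have "(\<lambda>x. indicat_real U x *\<^sub>R (norm (h x))\<^sup>2) = (\<lambda>x. (norm (H x))\<^sup>2)"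
      by (auto simp: H_def indicator_def)
    ultimately show ?thesis by simp
  qed
  have iC: "integrable lebesgue (\<lambda>x. indicat_real (cbox a b) x *\<^sub>R H x)" for a b
  proof (rule Bochner_Integration.integrable_bound)
    show "integrable lebesgue (\<lambda>x. indicat_real (cbox a b) x + (norm (H x))\<^sup>2)"
      using i2 by (intro Bochner_Integration.integrable_add integrable_real_indicator) (auto simp: emeasure_bounded_finite[unfolded infinity_ennreal_def])
    show "(\<lambda>x. indicat_real (cbox a b) x *\<^sub>R H x) \<in> borel_measurable lebesgue"
      by (intro borel_measurable_scaleR mH borel_measurable_indicator) auto
    have "norm (H x) \<le> 1 + (norm (H x))\<^sup>2" for x
      using sum_squares_bound[of 1 "norm (H x)"] norm_ge_zero[of "H x"] by (simp del: norm_ge_zero)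
    then show "AE x in lebesgue. norm (indicat_real (cbox a b) x *\<^sub>R H x) \<le> norm (indicat_real (cbox a b) x + (norm (H x))\<^sup>2)"
      by (intro AE_I2) (auto simp: indicator_def)
  qed
  have ab: "H absolutely_integrable_on cbox a b" for a b
    using iC by (simp add: set_integrable_def)
  have z: "integral (cbox a b) H = 0" if ab_U: "cbox a b \<subseteq> U" for a b
  proof -
    have "(LINT x|lebesgue. box_bump (real (Suc k)) a b x *\<^sub>R H x) = 0" for k
    proof -
      let ?\<phi> = "\<lambda>x. complex_of_real (box_bump (real (Suc k)) a b x)"
      have t: "test_function U ?\<phi>" by (rule test_function_box_bump[OF ab_U]) simp
      have "(LINT x|lebesgue. H x * ?\<phi> x) = (LINT x|lebesgue_on U. H x * ?\<phi> x)"
        by (rule integral_lebesgue_on_eq[OF U, symmetric]) (simp add: H_def)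
      also have "\<dots> = (LINT x|lebesgue_on U. h x * ?\<phi> x)"
        by (rule Bochner_Integration.integral_cong) (auto simp: H_def)
      also have "\<dots> = 0" by (rule zero[OF t])
      finally show ?thesis by (simp add: scaleR_conv_of_real mult.commute)
    qed
    moreover have "(\<lambda>k. LINT x|lebesgue. box_bump (real (Suc k)) a b x *\<^sub>R H x) \<longlonglongrightarrow>
       (LINT x|lebesgue. indicat_real (box a b) x *\<^sub>R H x)"
    proof (rule integral_dominated_convergence[where w = "\<lambda>x. norm (indicat_real (cbox a b) x *\<^sub>R H x)"])
      show "(\<lambda>x. indicat_real (box a b) x *\<^sub>R H x) \<in> borel_measurable lebesgue"
        by (intro borel_measurable_scaleR mH borel_measurable_indicator) auto
      show "(\<lambda>x. box_bump (real (Suc k)) a b x *\<^sub>R H x) \<in> borel_measurable lebesgue" for k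
        using borel_measurable_continuous_onI[OF smooth_on_continuous[OF smooth_on_box_bump], of "real (Suc k)" a b]
        by (intro borel_measurable_scaleR mH) (simp add: measurable_completion)
      show "integrable lebesgue (\<lambda>x. norm (indicat_real (cbox a b) x *\<^sub>R H x))"
        using iC by (rule integrable_norm)
      show "AE x in lebesgue. (\<lambda>k. box_bump (real (Suc k)) a b x *\<^sub>R H x) \<longlonglongrightarrow> indicat_real (box a b) x *\<^sub>R H x"
        by (intro AE_I2 tendsto_scaleR tendsto_const LIMSEQ_Suc box_bump_tendsto)
      show "AE x in lebesgue. norm (box_bump (real (Suc k)) a b x *\<^sub>R H x) \<le> norm (indicat_real (cbox a b) x *\<^sub>R H x)" for k
      proof (rule AE_I2)
        fix x
        show "norm (box_bump (real (Suc k)) a b x *\<^sub>R H x) \<le> norm (indicat_real (cbox a b) x *\<^sub>R H x)"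
        proof (cases "x \<in> cbox a b")
          case True
          then show ?thesis
            using box_bump_bounds[of "real (Suc k)" a b x] by (simp add: mult_left_le_one_le)
        next
          case False
          then have "\<not> box_bump (real (Suc k)) a b x > 0"
            using box_bump_pos_iff[of "real (Suc k)" a b x] box_subset_cbox[of a b] by auto
          then have "box_bump (real (Suc k)) a b x = 0"
            using box_bump_bounds(1)[of "real (Suc k)" a b x] by linarith
          then show ?thesis by simp
        qed
      qed
    qed
    ultimately have "(LINT x|lebesgue. indicat_real (box a b) x *\<^sub>R H x) = 0"
      by (simp add: LIMSEQ_const_iff)
    moreover have "H absolutely_integrable_on box a b"
      using ab[of a b] by (rule set_integrable_subset) (auto simp: box_subset_cbox)
    ultimately have "integral (box a b) H = 0"
      using set_lebesgue_integral_eq_integral(2)[of "box a b" H] by (simp add: set_lebesgue_integral_def)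
    then show ?thesis by (simp add: integral_open_interval)
  qed
  have int: "H integrable_on cbox a b" for a b
    using set_lebesgue_integral_eq_integral(1)[OF ab] .
  obtain N where N: "negligible N" "\<And>x e. x \<notin> N \<Longrightarrow> 0 < e \<Longrightarrow> \<exists>d>0. \<forall>h. 0 < h \<and> h < d \<longrightarrow>
      norm (integral (cbox x (x + h *\<^sub>R One)) H /\<^sub>R h ^ DIM('a) - H x) < e"
    by (rule integrable_ccontinuous_explicit[of H, OF int]) (rule that, assumption, blast)
  have "H x = 0" if xU: "x \<in> U" and xN: "x \<notin> N" for x
  proof (rule ccontr)
    assume "H x \<noteq> 0"
    then obtain d where d: "d > 0" "\<And>t. 0 < t \<Longrightarrow> t < d \<Longrightarrow>
        norm (integral (cbox x (x + t *\<^sub>R One)) H /\<^sub>R t ^ DIM('a) - H x) < norm (H x)"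
      using N(2)[OF xN, of "norm (H x)"] by auto
    obtain r where r: "r > 0" "ball x r \<subseteq> U" using U \<open>x \<in> U\<close> open_contains_ball by blast
    \<comment> \<open>\<open>n\<close> exceeds the diagonal of a unit cube, so the cube of side \<open>t\<close> at \<open>x\<close> stays in the ball\<close>
    define n where "n = norm (One::'a) + 1"
    define t where "t = min (d / 2) (r / (2 * n))"
    have n: "n > 0" using norm_ge_zero[of "One::'a"] unfolding n_def by linarith
    then have t: "0 < t" "t < d" using d(1) r(1) by (auto simp: t_def)
    have "cbox x (x + t *\<^sub>R One) \<subseteq> U"
    proof
      fix y assume y: "y \<in> cbox x (x + t *\<^sub>R One)"
      have "norm (y - x) \<le> norm (t *\<^sub>R (One::'a))"
        by (rule norm_le_componentwise) (use y t in \<open>auto simp: mem_box inner_diff_left algebra_simps\<close>)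
      also have "\<dots> \<le> t * n" using t(1) by (simp add: n_def algebra_simps)
      also have "\<dots> \<le> r / (2 * n) * n"
        using n by (intro mult_right_mono) (auto simp: t_def)
      also have "\<dots> < r" using n r(1) by simp
      finally show "y \<in> U" using r(2) by (auto simp: dist_norm norm_minus_commute)
    qed
    from z[OF this] d(2)[OF t] show False by simp
  qed
  moreover have "AE x in lebesgue. x \<notin> N"
    using N(1) by (simp add: negligible_iff_null_sets AE_not_in)
  ultimately have "AE x in lebesgue. x \<in> U \<longrightarrow> h x = 0"
    by (auto elim!: eventually_mono simp: H_def)
  then show ?thesis using U by (simp add: AE_restrict_space_iff)
qed

lemma weak_gradient_unique:
  fixes g1 g2 :: "real^'n::finite \<Rightarrow> complex^'n"
  assumes U: "open U" and w: "has_weak_gradient U u g1" "has_weak_gradient U u g2"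
  shows "AE x in lebesgue_on U. g1 x = g2 x"
proof -
  have l2: "g1 \<in> L2 U" "g2 \<in> L2 U" using w by (auto simp: has_weak_gradient_def)
  have comp: "(\<lambda>x. g x $ i) \<in> L2 U" if "g \<in> L2 U" for g :: "real^'n \<Rightarrow> complex^'n" and i
  proof (rule L2_dominated(1)[OF that, of _ 1])
    have "(\<lambda>v::complex^'n. v $ i) \<in> borel_measurable borel"
      by (intro borel_measurable_continuous_onI continuous_on_component continuous_on_id)
    from measurable_compose[OF L2_measurable[OF that] this]
    show "(\<lambda>x. g x $ i) \<in> borel_measurable (lebesgue_on U)" .
  qed (use Finite_Cartesian_Product.norm_nth_le in auto)
  have "AE x in lebesgue_on U. g1 x $ i - g2 x $ i = 0" for i
  proof (rule AE_zero_if_orthogonal_to_test_functions[OF U L2_diff[OF comp comp]])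
    fix \<phi> :: "real^'n \<Rightarrow> complex" assume \<phi>: "test_function U \<phi>"
    have l: "\<phi> \<in> L2 U" using test_function_L2[OF \<phi>] U by simp
    have int: "integrable (lebesgue_on U) (\<lambda>x. g x $ i * \<phi> x)" if "g \<in> L2 U" for g
      by (rule L2_product_bound(1)[OF comp[OF that] l, where C = 1 and h = "\<lambda>x. g x $ i * \<phi> x" for i])
        (use L2_measurable[OF comp[OF that]] L2_measurable[OF l] in \<open>auto simp: norm_mult\<close>)
    have "(LINT x|lebesgue_on U. g1 x $ i * \<phi> x) = (LINT x|lebesgue_on U. g2 x $ i * \<phi> x)"
    proof -
      have "- (LINT x|lebesgue_on U. g1 x $ i * \<phi> x) = - (LINT x|lebesgue_on U. g2 x $ i * \<phi> x)"
        using w(1)[unfolded has_weak_gradient_def, THEN conjunct2, rule_format, OF \<phi>, of i]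
          w(2)[unfolded has_weak_gradient_def, THEN conjunct2, rule_format, OF \<phi>, of i] by (rule trans[OF sym])
      then show ?thesis by simp
    qed
    then show "(LINT x|lebesgue_on U. (g1 x $ i - g2 x $ i) * \<phi> x) = 0"
      using int[OF l2(1)] int[OF l2(2)] by (simp add: left_diff_distrib)
  qed (use l2 in auto)
  then have "AE x in lebesgue_on U. \<forall>i\<in>UNIV. g1 x $ i - g2 x $ i = 0"
    by (intro AE_finite_allI) auto
  then show ?thesis by eventually_elim (simp add: vec_eq_iff)
qed

section \<open>The Poincare inequality\<close>

text \<open>Integrate \<open>\<partial>\<^sub>i (x\<^sub>i |\<phi>|\<^sup>2) = |\<phi>|\<^sup>2 + 2 x\<^sub>i Re (\<phi> \<partial>\<^sub>i \<phi>\<^sup>*)\<close>, where \<open>*\<close> is complex conjugation, for one coordinate \<open>i\<close>: the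
  total is zero, and \<open>|x\<^sub>i| \<le> R\<close> on \<open>U\<close>.\<close>

lemma test_function_poincare:
  fixes \<phi> :: "real^'n::finite \<Rightarrow> complex"
  assumes U: "open U" "U \<subseteq> cball 0 R" "R \<ge> 0" and \<phi>: "test_function U \<phi>"
  shows "L2_norm U \<phi> \<le> 2 * R * L2_norm U (gradient \<phi>)"
proof -
  fix i :: 'n
  have U': "U \<in> sets lebesgue" using U(1) by simp
  note s = test_function_smooth[OF \<phi>]
  have d: "\<phi> differentiable (at x)" for x by (rule smooth_on_differentiable[OF s])
  define k where "k x = cnj (\<phi> x) * complex_of_real (x $ i)" for x
  have dc: "(\<lambda>x. cnj (\<phi> x)) differentiable (at x)"
    and gc: "gradient (\<lambda>x. cnj (\<phi> x)) x $ j = cnj (gradient \<phi> x $ j)" for x j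
    using gradient_bounded_linear[OF d bounded_linear_cnj] by auto
  have hx: "((\<lambda>x::real^'n. complex_of_real (x $ i)) has_derivative (\<lambda>v. complex_of_real (v $ i))) (at x)" for x
    by (rule bounded_linear_imp_has_derivative)
      (rule bounded_linear_compose[OF bounded_linear_of_real bounded_linear_vec_nth])
  have dx: "(\<lambda>x::real^'n. complex_of_real (x $ i)) differentiable (at x)" for x
    using hx by (rule differentiableI)
  have gx: "gradient (\<lambda>x::real^'n. complex_of_real (x $ i)) x $ j = (if j = i then 1 else 0)" for x j
    using has_derivative_gradient[OF hx] by (simp add: axis_def)
  have dk: "k differentiable (at x)"
    and gk: "gradient k x $ j = cnj (\<phi> x) * (if j = i then 1 else 0) + cnj (gradient \<phi> x $ j) * complex_of_real (x $ i)" for x j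
    unfolding k_def using gradient_mult[OF dc dx] by (simp_all only: gc gx)
  have cg: "continuous_on UNIV (gradient \<phi>)" by (rule smooth_gradient_continuous[OF s])
  have c\<phi>: "continuous_on UNIV \<phi>" by (rule smooth_on_continuous[OF s])
  have ck: "continuous_on UNIV (gradient k)"
    by (rule continuous_on_gradientI, subst gk) (intro continuous_intros continuous_on_component cg c\<phi>)
  note bp = integral_by_parts[OF thin_empty test_function_piecewise_C1[OF \<phi>] dk ck, of i]
  define h where "h x = (\<phi> x * cnj (gradient \<phi> x $ i) + gradient \<phi> x $ i * cnj (\<phi> x)) * complex_of_real (x $ i)" for x
  have i\<phi>: "integrable (lebesgue_on U) (\<lambda>x. (norm (\<phi> x))\<^sup>2)"
    using test_function_L2(1)[OF \<phi> U'] by (rule L2_integrable)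
  have mh: "h \<in> borel_measurable (lebesgue_on U)"
  proof -
    have "continuous_on UNIV h"
      unfolding h_def by (intro continuous_intros continuous_on_component cg c\<phi>)
    then show ?thesis
      by (rule continuous_imp_measurable_on_sets_lebesgue[OF continuous_on_subset U']) simp
  qed
  have bh: "norm (h x) \<le> (2 * R) * (norm (\<phi> x) * norm (gradient \<phi> x))" if "x \<in> U" for x
  proof -
    have x: "\<bar>x $ i\<bar> \<le> R"
      using component_le_norm_cart[of x i] that U(2) by (force)
    have "norm (\<phi> x * cnj (gradient \<phi> x $ i) + gradient \<phi> x $ i * cnj (\<phi> x)) \<le>
        norm (\<phi> x) * norm (gradient \<phi> x) + norm (\<phi> x) * norm (gradient \<phi> x)"
      using Finite_Cartesian_Product.norm_nth_le[of "gradient \<phi> x" i]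
      by (intro norm_triangle_mono) (auto simp: norm_mult mult.commute intro!: mult_left_mono)
    then have "norm (h x) \<le> (2 * (norm (\<phi> x) * norm (gradient \<phi> x))) * R"
      unfolding h_def norm_mult using x by (intro mult_mono) auto
    then show ?thesis by (simp add: mult_ac)
  qed
  have ae: "AE x in lebesgue_on U. norm (h x) \<le> (2 * R) * (norm (\<phi> x) * norm (gradient \<phi> x))"
    using bh by (intro AE_I2) simp
  note hb = L2_product_bound[OF test_function_L2[OF \<phi> U'] mh ae]
  have "(LINT x|lebesgue. \<phi> x * gradient k x $ i + gradient \<phi> x $ i * k x) = 0"
    using bp by simp
  also have "(LINT x|lebesgue. \<phi> x * gradient k x $ i + gradient \<phi> x $ i * k x) =
      (LINT x|lebesgue_on U. \<phi> x * gradient k x $ i + gradient \<phi> x $ i * k x)"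
    by (rule integral_lebesgue_on_eq[OF U(1), symmetric])
      (simp add: test_function_eq_0[OF \<phi>] test_function_gradient_eq_0[OF \<phi>])
  also have "\<dots> = (LINT x|lebesgue_on U. complex_of_real ((norm (\<phi> x))\<^sup>2) + h x)"
    by (rule Bochner_Integration.integral_cong[OF refl])
      (simp only: complex_norm_square gk h_def k_def, simp add: algebra_simps)
  also have "\<dots> = complex_of_real ((L2_norm U \<phi>)\<^sup>2) + (LINT x|lebesgue_on U. h x)"
  proof -
    have "integrable (lebesgue_on U) (\<lambda>x. complex_of_real ((norm (\<phi> x))\<^sup>2))"
      using i\<phi> by (rule integrable_of_real)
    with hb(1) U(3) show ?thesis by (simp add: L2_norm_square del: of_real_power)
  qed
  finally have "norm (complex_of_real ((L2_norm U \<phi>)\<^sup>2)) = norm (LINT x|lebesgue_on U. h x)"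
    by (metis add_eq_0_iff2 norm_minus_cancel)
  then have "(L2_norm U \<phi>)\<^sup>2 \<le> (2 * R) * (L2_norm U \<phi> * L2_norm U (gradient \<phi>))"
    using hb(2) U(3) by (simp del: of_real_power)
  then have "L2_norm U \<phi> * L2_norm U \<phi> \<le> L2_norm U \<phi> * (2 * R * L2_norm U (gradient \<phi>))"
    by (simp add: power2_eq_square algebra_simps)
  then show ?thesis
    using L2_norm_nonneg[of U \<phi>] L2_norm_nonneg[of U "gradient \<phi>"] U(3)
    by (cases "L2_norm U \<phi> = 0") (auto simp: mult_le_cancel_left)
qed

section \<open>Mollification\<close>

definition mollifier :: "real \<Rightarrow> ('a::euclidean_space \<Rightarrow> real) \<Rightarrow> bool" where
  "mollifier e \<rho> \<longleftrightarrow> smooth_on UNIV \<rho> \<and> (\<forall>x. 0 \<le> \<rho> x) \<and> (\<forall>x. e \<le> norm x \<longrightarrow> \<rho> x = 0) \<and>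
     (\<forall>x. \<rho> (- x) = \<rho> x) \<and> integrable lebesgue \<rho> \<and> (LINT x|lebesgue. \<rho> x) = 1"

lemma mollifier_exists:
  assumes "e > 0"
  shows "\<exists>\<rho>::'a::euclidean_space \<Rightarrow> real. mollifier e \<rho>"
proof -
  \<comment> \<open>\<open>n\<close> exceeds the diagonal of a unit cube\<close>
  define n where "n = norm (One::'a) + 1"
  define r where "r = e / (2 * n)"
  have n: "n > 0" using norm_ge_zero[of "One::'a"] unfolding n_def by linarith
  have r: "r > 0" using n assms by (simp add: r_def)
  define b where "b = box_bump 1 (- r *\<^sub>R One) (r *\<^sub>R (One::'a))"
  have cb: "continuous_on UNIV b" unfolding b_def by (rule smooth_on_continuous[OF smooth_on_box_bump])
  have pos: "b x > 0 \<longleftrightarrow> x \<in> box (- r *\<^sub>R One) (r *\<^sub>R One)" for x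
    unfolding b_def by (rule box_bump_pos_iff) simp
  have nn: "0 \<le> b x" and le1: "b x \<le> 1" for x by (auto simp: b_def box_bump_bounds)
  have off: "b x = 0" if "e \<le> norm x" for x
  proof (rule ccontr)
    assume "b x \<noteq> 0"
    then have "x \<in> box (- r *\<^sub>R One) (r *\<^sub>R One)" using nn[of x] pos[of x] by linarith
    then have "norm x \<le> norm (r *\<^sub>R (One::'a))"
      by (intro norm_le_componentwise) (force simp: mem_box)
    also have "\<dots> \<le> r * n" using r by (simp add: n_def algebra_simps)
    also have "\<dots> < e" using n assms by (simp add: r_def)
    finally show False using that by simp
  qed
  have mb: "b \<in> borel_measurable lebesgue"
    using borel_measurable_continuous_onI[OF cb] by (simp add: measurable_completion)
  have ib: "integrable lebesgue b"
    by (rule integrable_lebesgue_bounded_support[OF mb, of 1 e]) (use nn le1 off in auto)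
  define c where "c = (LINT x|lebesgue. b x)"
  have "c \<noteq> 0"
  proof
    assume "c = 0"
    then have "AE x in lebesgue. b x = 0"
      unfolding c_def using integral_nonneg_eq_0_iff_AE[OF ib] nn by simp
    then have "negligible {x. b x \<noteq> 0}"
      by (simp add: negligible_iff_null_sets AE_iff_null_sets completion.AE_iff_null_sets)
    moreover have "open (box (- r *\<^sub>R One) (r *\<^sub>R (One::'a)))" "box (- r *\<^sub>R One) (r *\<^sub>R (One::'a)) \<noteq> {}"
      using r by (auto simp: box_ne_empty inner_diff_left)
    moreover have "box (- r *\<^sub>R One) (r *\<^sub>R (One::'a)) \<subseteq> {x. b x \<noteq> 0}" using pos by force
    ultimately show False using open_not_negligible negligible_subset by blast
  qed
  moreover have "c \<ge> 0" unfolding c_def using nn by simp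
  ultimately have c: "c > 0" by simp
  have sym: "b (- x) = b x" for x
    unfolding b_def box_bump_def
    by (intro prod.cong refl) (simp add: mult.commute add.commute)
  have "smooth_on UNIV (\<lambda>x. inverse c * b x)"
    unfolding b_def by (intro smooth_on_mult smooth_on_const smooth_on_box_bump)
  then have "mollifier e (\<lambda>x. inverse c * b x)"
    using c nn off sym ib by (auto simp: mollifier_def c_def[symmetric])
  then show ?thesis by blast
qed

definition mollify :: "('a::euclidean_space \<Rightarrow> real) \<Rightarrow> ('a \<Rightarrow> 'b::euclidean_space) \<Rightarrow> 'a \<Rightarrow> 'b" where
  "mollify \<rho> p x = (LINT z|lebesgue. \<rho> (x - z) *\<^sub>R p z)"

lemma mollifier_translate:
  assumes "mollifier e \<rho>"
  shows "integrable lebesgue (\<lambda>z. \<rho> (x - z))" "(LINT z|lebesgue. \<rho> (x - z)) = 1"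
proof -
  have eq: "\<rho> (x - z) = \<rho> (- x + z)" for z
    using assms unfolding mollifier_def by (metis minus_diff_eq uminus_add_conv_diff)
  have c: "continuous_on UNIV \<rho>" using assms by (auto simp: mollifier_def intro: smooth_on_continuous)
  then have m: "\<rho> \<in> borel_measurable borel" by (rule borel_measurable_continuous_onI)
  show i: "(LINT z|lebesgue. \<rho> (x - z)) = 1"
    unfolding eq integral_lebesgue_translate[OF m] using assms by (simp add: mollifier_def)
  show "integrable lebesgue (\<lambda>z. \<rho> (x - z))"
    by (rule ccontr) (use i not_integrable_integral_eq in force)
qed

text \<open>The kernel has mass one and is supported near \<open>0\<close>, so mollification averages nearby values.\<close>

lemma mollify_close:
  fixes p :: "'a::euclidean_space \<Rightarrow> 'b::euclidean_space"
  assumes \<rho>: "mollifier e \<rho>" and p: "p \<in> borel_measurable lebesgue"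
    "AE z in lebesgue. norm (z - x) < e \<longrightarrow> norm (p z - c) \<le> \<eta>"
  shows "integrable lebesgue (\<lambda>z. \<rho> (x - z) *\<^sub>R p z)" "norm (mollify \<rho> p x - c) \<le> \<eta>"
proof -
  have m: "(\<lambda>z. \<rho> (x - z)) \<in> borel_measurable lebesgue"
    using mollifier_translate(1)[OF \<rho>] by (rule borel_measurable_integrable)
  have mp: "(\<lambda>z. p z - c) \<in> borel_measurable lebesgue"
    using p(1) by (intro borel_measurable_diff) auto
  have b: "AE z in lebesgue. norm (\<rho> (x - z) *\<^sub>R (p z - c)) \<le> \<eta> * \<rho> (x - z)"
    using p(2)
  proof eventually_elim
    case (elim z)
    show ?case
    proof (cases "norm (z - x) < e")
      case True
      then show ?thesis
        using mult_left_mono[of "norm (p z - c)" \<eta> "\<rho> (x - z)"] elim \<rho>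
        by (auto simp: mollifier_def mult.commute)
    next
      case False
      then have "\<rho> (x - z) = 0"
        using \<rho> by (auto simp: mollifier_def norm_minus_commute)
      then show ?thesis by simp
    qed
  qed
  have i1: "integrable lebesgue (\<lambda>z. \<eta> * \<rho> (x - z))"
    using mollifier_translate(1)[OF \<rho>] by simp
  have i2: "integrable lebesgue (\<lambda>z. \<rho> (x - z) *\<^sub>R (p z - c))"
    by (rule Bochner_Integration.integrable_bound[OF i1])
      (use b m mp in \<open>auto intro: borel_measurable_scaleR order_trans[OF _ abs_ge_self]\<close>)
  have i3: "integrable lebesgue (\<lambda>z. \<rho> (x - z) *\<^sub>R c)"
    using mollifier_translate(1)[OF \<rho>] by simp
  from Bochner_Integration.integrable_add[OF i2 i3]
  show i4: "integrable lebesgue (\<lambda>z. \<rho> (x - z) *\<^sub>R p z)"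
    by (simp add: scaleR_diff_right)
  have "(LINT z|lebesgue. \<rho> (x - z) *\<^sub>R (p z - c)) = mollify \<rho> p x - (LINT z|lebesgue. \<rho> (x - z) *\<^sub>R c)"
    unfolding mollify_def using i4 i3 by (simp add: scaleR_diff_right)
  also have "(LINT z|lebesgue. \<rho> (x - z) *\<^sub>R c) = c"
    using mollifier_translate[OF \<rho>] by simp
  finally have "norm (mollify \<rho> p x - c) = norm (LINT z|lebesgue. \<rho> (x - z) *\<^sub>R (p z - c))"
    by simp
  also have "\<dots> \<le> (LINT z|lebesgue. norm (\<rho> (x - z) *\<^sub>R (p z - c)))"
    by (rule integral_norm_bound)
  also have "\<dots> \<le> (LINT z|lebesgue. \<eta> * \<rho> (x - z))"
    by (rule integral_mono_AE[OF integrable_norm[OF i2] i1 b])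
  also have "\<dots> = \<eta>" using mollifier_translate(2)[OF \<rho>] by simp
  finally show "norm (mollify \<rho> p x - c) \<le> \<eta>" .
qed

text \<open>Every derivative can be put on the kernel by Leibniz' rule.\<close>

lemma convolution_smooth:
  fixes h :: "'a::euclidean_space \<Rightarrow> 'b::euclidean_space"
  assumes h: "continuous_on UNIV h" and \<rho>: "smooth_on UNIV \<rho>"
  shows "((\<lambda>x. integral (cbox a b) (\<lambda>z. \<rho> (x - z) *\<^sub>R h z)) has_derivative
          (\<lambda>v. integral (cbox a b) (\<lambda>z. frechet_derivative \<rho> (at (x - z)) v *\<^sub>R h z))) (at x)"
    "smooth_on UNIV (\<lambda>x. integral (cbox a b) (\<lambda>z. \<rho> (x - z) *\<^sub>R h z))"
proof -
  have D: "((\<lambda>x. integral (cbox a b) (\<lambda>z. \<rho> (x - z) *\<^sub>R h z)) has_derivative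
          (\<lambda>v. integral (cbox a b) (\<lambda>z. frechet_derivative \<rho> (at (x - z)) v *\<^sub>R h z))) (at x)"
    if \<rho>: "smooth_on UNIV \<rho>" for \<rho> :: "'a \<Rightarrow> real" and x :: 'a
  proof -
    define fx where "fx x z = Blinfun (\<lambda>v. frechet_derivative \<rho> (at (x - z)) v *\<^sub>R h z)" for x z
    have d\<rho>: "(\<rho> has_derivative frechet_derivative \<rho> (at y)) (at y)" for y
      using smooth_on_differentiable[OF \<rho>] by (simp add: frechet_derivative_works)
    have "bounded_linear (\<lambda>v. frechet_derivative \<rho> (at y) v *\<^sub>R c)" for y and c :: 'b
      using has_derivative_bounded_linear[OF d\<rho>] by (rule bounded_linear_scaleR_const)
    then have fx: "blinfun_apply (fx x z) = (\<lambda>v. frechet_derivative \<rho> (at (x - z)) v *\<^sub>R h z)" for x z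
      unfolding fx_def by (rule bounded_linear_Blinfun_apply)
    have c\<rho>: "continuous_on UNIV \<rho>" by (rule smooth_on_continuous[OF \<rho>])
    have cfx: "continuous_on (UNIV \<times> cbox a b) (\<lambda>(x, z). fx x z)"
    proof (rule continuous_on_blinfun_componentwise)
      fix i :: 'a assume i: "i \<in> Basis"
      have c1: "continuous_on UNIV (\<lambda>y. frechet_derivative \<rho> (at y) i)"
        by (rule smooth_on_continuous[OF smooth_on_partial[OF \<rho> i]])
      have "continuous_on (UNIV \<times> cbox a b) (\<lambda>w. frechet_derivative \<rho> (at (fst w - snd w)) i *\<^sub>R h (snd w))"
        by (rule continuous_on_scaleR;
            rule continuous_on_compose2[OF c1] continuous_on_compose2[OF h])
          (auto intro!: continuous_intros)
      then show "continuous_on (UNIV \<times> cbox a b) (\<lambda>w. blinfun_apply (case w of (x, z) \<Rightarrow> fx x z) i)"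
        by (simp add: fx split_beta)
    qed
    have "((\<lambda>x. integral (cbox a b) (\<lambda>z. \<rho> (x - z) *\<^sub>R h z)) has_derivative
        blinfun_apply (integral (cbox a b) (fx x))) (at x within UNIV)"
    proof (rule leibniz_rule[where f = "\<lambda>x z. \<rho> (x - z) *\<^sub>R h z", OF _ _ cfx])
      fix x z :: 'a
      have "((\<lambda>x. x - z) has_derivative (\<lambda>v. v)) (at x)" by (auto intro!: derivative_eq_intros)
      from has_derivative_scaleR_left[OF has_derivative_compose[OF this d\<rho>]]
      show "((\<lambda>x. \<rho> (x - z) *\<^sub>R h z) has_derivative blinfun_apply (fx x z)) (at x within UNIV)"
        by (simp add: fx)
      show "(\<lambda>z. \<rho> (x - z) *\<^sub>R h z) integrable_on cbox a b"
        by (rule integrable_continuous, rule continuous_on_scaleR;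
            rule continuous_on_compose2[OF c\<rho>] continuous_on_subset[OF h])
          (auto intro!: continuous_intros)
    qed auto
    moreover have int: "fx x integrable_on cbox a b"
    proof (rule integrable_continuous)
      have "continuous_on (cbox a b) ((\<lambda>(x, z). fx x z) \<circ> (\<lambda>z. (x, z)))"
        by (rule continuous_on_compose) (auto intro!: continuous_intros intro: continuous_on_subset[OF cfx])
      then show "continuous_on (cbox a b) (fx x)" by (simp add: o_def)
    qed
    moreover have "blinfun_apply (integral (cbox a b) (fx x)) =
        (\<lambda>v. integral (cbox a b) (\<lambda>z. frechet_derivative \<rho> (at (x - z)) v *\<^sub>R h z))"
      by (rule ext) (simp add: blinfun_apply_integral[OF int] fx)
    ultimately show ?thesis by simp
  qed
  from D[OF \<rho>] show "((\<lambda>x. integral (cbox a b) (\<lambda>z. \<rho> (x - z) *\<^sub>R h z)) has_derivative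
          (\<lambda>v. integral (cbox a b) (\<lambda>z. frechet_derivative \<rho> (at (x - z)) v *\<^sub>R h z))) (at x)" .
  have "Ck_on k UNIV (\<lambda>x. integral (cbox a b) (\<lambda>z. \<rho> (x - z) *\<^sub>R h z))"
    if "smooth_on UNIV \<rho>" for k and \<rho> :: "'a \<Rightarrow> real"
    using that
  proof (induction k arbitrary: \<rho>)
    case 0
    show ?case
      using has_derivative_continuous[OF D[OF 0]] by (simp add: continuous_at_imp_continuous_on)
  next
    case (Suc k)
    have "Ck_on k UNIV (\<lambda>x. integral (cbox a b) (\<lambda>z. frechet_derivative \<rho> (at (x - z)) i *\<^sub>R h z))"
      if "i \<in> Basis" for i
      by (rule Suc.IH[OF smooth_on_partial[OF Suc.prems that]])
    then show ?case
      using differentiableI[OF D[OF Suc.prems]] by (simp add: frechet_derivative_eqI[OF D[OF Suc.prems]])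
  qed
  then show "smooth_on UNIV (\<lambda>x. integral (cbox a b) (\<lambda>z. \<rho> (x - z) *\<^sub>R h z))"
    using \<rho> by (simp add: smooth_on_def)
qed

lemma L2_norm_tendsto_0:
  fixes q :: "nat \<Rightarrow> 'a::euclidean_space \<Rightarrow> 'b::euclidean_space"
  assumes U: "U \<in> sets lebesgue" and m: "\<And>k. q k \<in> borel_measurable lebesgue"
    and lim: "AE x in lebesgue. (\<lambda>k. q k x) \<longlonglongrightarrow> 0"
    and b: "\<And>k. AE x in lebesgue. norm (q k x) \<le> B" and off: "\<And>k x. x \<notin> cball 0 R \<Longrightarrow> q k x = 0"
  shows "(\<lambda>k. L2_norm U (q k)) \<longlonglongrightarrow> 0"
proof -
  have ae: "AE x in lebesgue_on U. P x" if "AE x in lebesgue. P x" for P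
    using that U by (auto simp: AE_restrict_space_iff)
  have "(\<lambda>k. LINT x|lebesgue_on U. (norm (q k x))\<^sup>2) \<longlonglongrightarrow> (LINT x|lebesgue_on U. 0)"
  proof (rule integral_dominated_convergence[where w = "\<lambda>x. B\<^sup>2 * indicat_real (cball 0 R) x"])
    show "(\<lambda>x. (norm (q k x))\<^sup>2) \<in> borel_measurable (lebesgue_on U)" for k
    proof -
      have [measurable]: "q k \<in> borel_measurable (lebesgue_on U)"
        using m by (rule measurable_restrict_space1)
      show ?thesis by measurable
    qed
    show "integrable (lebesgue_on U) (\<lambda>x. B\<^sup>2 * indicat_real (cball 0 R) x)"
      by (intro integrable_lebesgue_on[OF U] integrable_mult_right integrable_real_indicator)
        (auto simp: emeasure_bounded_finite[unfolded infinity_ennreal_def])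
    show "AE x in lebesgue_on U. (\<lambda>k. (norm (q k x))\<^sup>2) \<longlonglongrightarrow> 0"
      using ae[OF lim]
    proof eventually_elim
      case (elim x)
      from tendsto_power[OF tendsto_norm[OF elim], of 2] show ?case by simp
    qed
    show "AE x in lebesgue_on U. norm ((norm (q k x))\<^sup>2) \<le> B\<^sup>2 * indicat_real (cball 0 R) x" for k
      using ae[OF b[of k]]
    proof eventually_elim
      case (elim x)
      then show ?case
        using off[of x k] by (cases "x \<in> cball 0 R") (auto intro: power_mono)
    qed
  qed simp
  from tendsto_real_sqrt[OF this] show ?thesis by (simp add: L2_norm_def)
qed

lemma lebesgue_integral_eq_cbox:
  fixes F :: "'a::euclidean_space \<Rightarrow> 'b::euclidean_space"
  assumes "integrable lebesgue F" "\<And>x. x \<notin> cbox a b \<Longrightarrow> F x = 0"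
  shows "(LINT x|lebesgue. F x) = integral (cbox a b) F"
proof -
  have "(F has_integral (LINT x|lebesgue. F x)) UNIV"
    using assms(1) by (rule has_integral_integral_lebesgue)
  moreover have "F = (\<lambda>x. if x \<in> cbox a b then F x else 0)" using assms(2) by auto
  ultimately have "(F has_integral (LINT x|lebesgue. F x)) (cbox a b)"
    by (metis has_integral_restrict_UNIV)
  then show ?thesis by (simp add: integral_unique)
qed

text \<open>A derivative of the kernel can be moved to \<open>h\<close> by parts, since gluing along a thin set produces no jump
  terms.\<close>

lemma mollify_piecewise_C1:
  fixes h :: "real^'n::finite \<Rightarrow> complex"
  assumes Z: "thin Z" and h: "piecewise_C1 Z h" and \<rho>: "mollifier e \<rho>"
  shows "smooth_on UNIV (mollify \<rho> h)"
    "gradient (mollify \<rho> h) x $ i = mollify \<rho> (\<lambda>z. gradient h z $ i) x"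
proof -
  obtain R where R: "R > 0" "\<And>x. h x \<noteq> 0 \<Longrightarrow> norm x \<le> R"
    using h unfolding piecewise_C1_def bounded_pos by auto
  have ch: "continuous_on UNIV h" and bh: "bounded {x. h x \<noteq> 0}" using h by (auto simp: piecewise_C1_def)
  have sm: "smooth_on UNIV \<rho>" using \<rho> by (simp add: mollifier_def)
  define C where "C = cbox (- R *\<^sub>R One) (R *\<^sub>R (One :: real^'n))"
  have C: "h x = 0" if "x \<notin> C" for x
  proof (rule ccontr)
    assume "h x \<noteq> 0"
    then have "\<bar>x \<bullet> b\<bar> \<le> R" if "b \<in> Basis" for b
      using R(2)[of x] Basis_le_norm[OF that, of x] by linarith
    then have "x \<in> C" by (auto simp: C_def mem_box abs_le_iff minus_le_iff)
    with that show False by simp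
  qed
  have conv: "(LINT z|lebesgue. \<sigma> (x - z) *\<^sub>R h z) = integral C (\<lambda>z. \<sigma> (x - z) *\<^sub>R h z)"
    if c: "continuous_on UNIV \<sigma>" for \<sigma> :: "real^'n \<Rightarrow> real" and x
  proof -
    have c': "continuous_on UNIV (\<lambda>z. \<sigma> (x - z) *\<^sub>R h z)"
      by (rule continuous_on_scaleR[OF continuous_on_compose2[OF c] ch]) (auto intro!: continuous_intros)
    have "bounded {z. \<sigma> (x - z) *\<^sub>R h z \<noteq> 0}"
      by (rule bounded_subset[OF bh]) auto
    from bounded_if_bounded_support[OF c' this]
    obtain B where B: "\<And>z. norm (\<sigma> (x - z) *\<^sub>R h z) \<le> B" by blast
    have "integrable lebesgue (\<lambda>z. \<sigma> (x - z) *\<^sub>R h z)"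
    proof (rule integrable_lebesgue_bounded_support[of _ B R])
      show "(\<lambda>z. \<sigma> (x - z) *\<^sub>R h z) \<in> borel_measurable lebesgue"
        using borel_measurable_continuous_onI[OF c'] by (simp add: measurable_completion)
      show "\<sigma> (x - z) *\<^sub>R h z = 0" if "z \<notin> cball 0 R" for z
        using R(2)[of z] that by auto
    qed (use B in auto)
    then show ?thesis unfolding C_def by (rule lebesgue_integral_eq_cbox) (use C in \<open>auto simp: C_def\<close>)
  qed
  have c\<rho>: "continuous_on UNIV \<rho>" by (rule smooth_on_continuous[OF sm])
  have eq: "mollify \<rho> h = (\<lambda>x. integral C (\<lambda>z. \<rho> (x - z) *\<^sub>R h z))"
    unfolding mollify_def using conv[OF c\<rho>] by blast
  show "smooth_on UNIV (mollify \<rho> h)"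
    unfolding eq C_def by (rule convolution_smooth(2)[OF ch sm])
  have ax: "axis i 1 \<in> (Basis :: (real^'n) set)" by (simp add: axis_in_Basis_iff)
  let ?d = "\<lambda>y. frechet_derivative \<rho> (at y) (axis i 1)"
  have cd: "continuous_on UNIV ?d" by (rule smooth_on_continuous[OF smooth_on_partial[OF sm ax]])
  have "gradient (mollify \<rho> h) x $ i = integral C (\<lambda>z. ?d (x - z) *\<^sub>R h z)"
    unfolding eq C_def by (rule has_derivative_gradient[OF convolution_smooth(1)[OF ch sm]])
  also have "\<dots> = (LINT z|lebesgue. ?d (x - z) *\<^sub>R h z)"
    by (rule conv[OF cd, symmetric])
  also have "\<dots> = mollify \<rho> (\<lambda>z. gradient h z $ i) x"
  proof -
    define k where "k z = complex_of_real (\<rho> (x - z))" for z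
    have dk: "(k has_derivative (\<lambda>v. complex_of_real (frechet_derivative \<rho> (at (x - z)) (- v)))) (at z)" for z
    proof -
      have "((\<lambda>z. x - z) has_derivative (\<lambda>v. - v)) (at z)" by (auto intro!: derivative_eq_intros)
      moreover have "(\<rho> has_derivative frechet_derivative \<rho> (at (x - z))) (at (x - z))"
        using smooth_on_differentiable[OF sm] by (simp add: frechet_derivative_works)
      ultimately show ?thesis unfolding k_def
        by (rule bounded_linear.has_derivative[OF bounded_linear_of_real has_derivative_compose])
    qed
    have lin: "linear (frechet_derivative \<rho> (at y))" for y
      using smooth_on_differentiable[OF sm] by (rule linear_frechet_derivative)
    have gk: "gradient k z $ j = - complex_of_real (frechet_derivative \<rho> (at (x - z)) (axis j 1))" for z j
      using has_derivative_gradient[OF dk] by (simp add: linear_neg[OF lin])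
    have "continuous_on UNIV (gradient k)"
    proof (rule continuous_on_gradientI, subst gk)
      fix j
      have "axis j 1 \<in> (Basis :: (real^'n) set)" by (simp add: axis_in_Basis_iff)
      from smooth_on_continuous[OF smooth_on_partial[OF sm this]]
      have "continuous_on UNIV (\<lambda>z. frechet_derivative \<rho> (at (x - z)) (axis j 1))"
        by (rule continuous_on_compose2) (auto intro!: continuous_intros)
      then show "continuous_on UNIV (\<lambda>z. - complex_of_real (frechet_derivative \<rho> (at (x - z)) (axis j 1)))"
        by (intro continuous_intros)
    qed
    from integral_by_parts(3)[OF Z h differentiableI[OF dk] this, of i]
    show ?thesis
      by (simp add: gk k_def mollify_def scaleR_conv_of_real mult.commute)
  qed
  finally show "gradient (mollify \<rho> h) x $ i = mollify \<rho> (\<lambda>z. gradient h z $ i) x" .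
qed

lemma mollify_tendsto:
  fixes p :: "'a::euclidean_space \<Rightarrow> 'b::euclidean_space"
  assumes Z: "thin Z" and c: "continuous_on (- Z) p" and x: "x \<notin> Z" and p: "p \<in> borel_measurable lebesgue"
    and \<rho>: "\<And>k. mollifier (\<epsilon> / real (Suc k)) (\<rho> k)" and \<epsilon>: "\<epsilon> > 0"
  shows "(\<lambda>k. mollify (\<rho> k) p x) \<longlonglongrightarrow> p x"
proof (rule LIMSEQ_I)
  fix \<eta> :: real assume "0 < \<eta>"
  then obtain d where d: "d > 0" "\<And>z. z \<in> - Z \<Longrightarrow> dist z x < d \<Longrightarrow> dist (p z) (p x) < \<eta> / 2"
    using c x unfolding continuous_on_iff by (metis ComplI half_gt_zero)
  obtain k0 where k0: "\<epsilon> / d < real k0" using reals_Archimedean2 by blast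
  show "\<exists>k0. \<forall>k\<ge>k0. norm (mollify (\<rho> k) p x - p x) < \<eta>"
  proof (intro exI allI impI)
    fix k assume "k0 \<le> k"
    then have "\<epsilon> / d < real (Suc k)" using k0 by linarith
    then have ek: "\<epsilon> / real (Suc k) < d" using d(1) by (simp add: field_simps)
    have "AE z in lebesgue. norm (z - x) < \<epsilon> / real (Suc k) \<longrightarrow> norm (p z - p x) \<le> \<eta> / 2"
      using AE_off_thin[OF Z]
    proof eventually_elim
      case (elim z)
      then show ?case using d(2)[of z] ek by (auto simp: dist_norm)
    qed
    from mollify_close(2)[OF \<rho> p this] \<open>0 < \<eta>\<close>
    show "norm (mollify (\<rho> k) p x - p x) < \<eta>" by linarith
  qed
qed

text \<open>The gradient of a glued function is bounded and continuous off a null set, so the mollified gradients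
  converge boundedly almost everywhere. Hence a glued function with compact support in \<open>U\<close> belongs to
  \<open>H\<^sup>1\<^sub>0(U)\<close>.\<close>

lemma piecewise_C1_approximation:
  fixes h :: "real^'n::finite \<Rightarrow> complex"
  assumes Z: "thin Z" and h: "piecewise_C1 Z h" and U: "open U" "closure {x. h x \<noteq> 0} \<subseteq> U"
  obtains \<phi> where "\<And>k::nat. test_function U (\<phi> k)"
    "(\<lambda>k. L2_norm U (\<lambda>x. \<phi> k x - h x)) \<longlonglongrightarrow> 0"
    "(\<lambda>k. L2_norm U (\<lambda>x. gradient (\<phi> k) x - gradient h x)) \<longlonglongrightarrow> 0"
proof -
  define K where "K = closure {x. h x \<noteq> 0}"
  have bh: "bounded {x. h x \<noteq> 0}" and ch: "continuous_on UNIV h"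
    and cg: "continuous_on (- Z) (gradient h)" using h by (auto simp: piecewise_C1_def)
  have K: "compact K" unfolding K_def using bh by (simp add: compact_closure)
  obtain \<epsilon> where \<epsilon>: "\<epsilon> > 0" "(\<Union>x\<in>K. cball x \<epsilon>) \<subseteq> U"
    using compact_subset_open_imp_cball_epsilon_subset[OF K U(1)] U(2) unfolding K_def by blast
  have U': "U \<in> sets lebesgue" using U(1) by simp
  obtain R where R: "\<And>x. x \<in> K \<Longrightarrow> norm x \<le> R"
    using compact_imp_bounded[OF K] unfolding bounded_iff by blast
  have "\<exists>\<rho>::real^'n \<Rightarrow> real. mollifier (\<epsilon> / real (Suc k)) \<rho>" for k
    using \<epsilon>(1) by (intro mollifier_exists) simp
  then obtain \<rho> :: "nat \<Rightarrow> real^'n \<Rightarrow> real" where \<rho>: "mollifier (\<epsilon> / real (Suc k)) (\<rho> k)" for k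
    by metis
  define \<phi> where "\<phi> k = mollify (\<rho> k) h" for k
  have sm: "smooth_on UNIV (\<phi> k)" for k
    unfolding \<phi>_def by (rule mollify_piecewise_C1(1)[OF Z h \<rho>])
  have g\<phi>: "gradient (\<phi> k) x $ i = mollify (\<rho> k) (\<lambda>z. gradient h z $ i) x" for k x i
    unfolding \<phi>_def by (rule mollify_piecewise_C1(2)[OF Z h \<rho>])
  define S where "S = {x + y |x y. x \<in> K \<and> y \<in> cball 0 \<epsilon>}"
  have S: "compact S" unfolding S_def by (intro compact_sums K) simp
  have SU: "S \<subseteq> U"
  proof
    fix s assume "s \<in> S"
    then obtain x y where "s = x + y" "x \<in> K" "norm y \<le> \<epsilon>" by (auto simp: S_def)
    then have "s \<in> cball x \<epsilon>" by (simp add: dist_norm)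
    with \<open>x \<in> K\<close> \<epsilon>(2) show "s \<in> U" by blast
  qed
  have KS: "K \<subseteq> S" unfolding S_def using \<epsilon>(1) by force
  have \<phi>S: "\<phi> k x = 0" if "x \<notin> S" for k x
  proof -
    have "\<rho> k (x - z) *\<^sub>R h z = 0" for z
    proof (rule ccontr)
      assume nz: "\<rho> k (x - z) *\<^sub>R h z \<noteq> 0"
      then have "z \<in> K" using closure_subset[of "{x. h x \<noteq> 0}"] by (auto simp: K_def)
      moreover have "norm (x - z) < \<epsilon> / real (Suc k)"
        using nz \<rho>[of k] unfolding mollifier_def by (metis not_less scale_zero_left)
      moreover have "\<epsilon> / real (Suc k) \<le> \<epsilon>"
        using \<epsilon>(1) by (simp add: field_simps)
      ultimately have "z \<in> K" "norm (x - z) \<le> \<epsilon>" by linarith+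
      then have "x \<in> S" unfolding S_def by (intro CollectI exI[of _ z] exI[of _ "x - z"]) simp
      with that show False by simp
    qed
    then show ?thesis unfolding \<phi>_def mollify_def by (simp del: scaleR_eq_0_iff)
  qed
  have sup: "support_of (\<phi> k) \<subseteq> S" for k
    unfolding support_of_def using \<phi>S compact_imp_closed[OF S] by (intro closure_minimal) auto
  have t: "test_function U (\<phi> k)" for k
    unfolding test_function_def
  proof (intro conjI sm)
    have "closed (support_of (\<phi> k))" by (simp add: support_of_def)
    from compact_Int_closed[OF S this] sup[of k] show "compact (support_of (\<phi> k))"
      by (simp add: Int_absorb1)
    show "support_of (\<phi> k) \<subseteq> U" using sup SU by blast
  qed
  obtain R' where R': "\<And>x. x \<in> S \<Longrightarrow> norm x \<le> R'"
    using compact_imp_bounded[OF S] unfolding bounded_iff by blast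
  have off: "\<phi> k x = 0" "gradient (\<phi> k) x = 0" "h x = 0" "gradient h x = 0" if "x \<notin> cball 0 R'" for k x
  proof -
    have "x \<notin> S" using R'[of x] that by auto
    then have "x \<notin> K" using KS by blast
    show "\<phi> k x = 0" by (rule \<phi>S) fact
    show "gradient (\<phi> k) x = 0"
      using sup[of k] \<open>x \<notin> S\<close> by (intro gradient_eq_0_outside) (auto simp: support_of_def)
    show "h x = 0" using \<open>x \<notin> K\<close> closure_subset[of "{x. h x \<noteq> 0}"] by (auto simp: K_def)
    show "gradient h x = 0" using \<open>x \<notin> K\<close> by (intro gradient_eq_0_outside) (simp add: K_def)
  qed
  have mh: "h \<in> borel_measurable lebesgue"
    using borel_measurable_continuous_onI[OF ch] by (simp add: measurable_completion)
  have mg: "gradient h \<in> borel_measurable lebesgue" by (rule piecewise_C1_gradient_measurable[OF Z h])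
  have mgi: "(\<lambda>x. gradient h x $ i) \<in> borel_measurable lebesgue" for i
    using piecewise_C1_integral_gradient(1)[OF Z h] by (rule borel_measurable_integrable)
  have m\<phi>: "\<phi> k \<in> borel_measurable lebesgue" for k
    using borel_measurable_continuous_onI[OF smooth_on_continuous[OF sm]] by (simp add: measurable_completion)
  have mg\<phi>: "gradient (\<phi> k) \<in> borel_measurable lebesgue" for k
    by (rule piecewise_C1_gradient_measurable[OF thin_empty test_function_piecewise_C1[OF t]])
  obtain B where B: "\<And>x. norm (h x) \<le> B"
    using bounded_if_bounded_support[OF ch bh] by blast
  obtain M where M: "\<And>x. x \<in> - Z \<Longrightarrow> norm (gradient h x) \<le> M"
    using h unfolding piecewise_C1_def bounded_iff by blast
  have Mi: "norm (gradient h x $ i) \<le> M" if "x \<notin> Z" for x i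
    using M[of x] Finite_Cartesian_Product.norm_nth_le[of "gradient h x" i] that by auto
  have 1: "(\<lambda>k. L2_norm U (\<lambda>x. \<phi> k x - h x)) \<longlonglongrightarrow> 0"
  proof (rule L2_norm_tendsto_0[OF U', of _ "B + B" R'])
    show "AE x in lebesgue. (\<lambda>k. \<phi> k x - h x) \<longlonglongrightarrow> 0"
    proof (rule AE_I2)
      fix x
      have "(\<lambda>k. \<phi> k x) \<longlonglongrightarrow> h x"
        unfolding \<phi>_def by (rule mollify_tendsto[OF thin_empty _ _ mh \<rho> \<epsilon>(1)]) (use ch in auto)
      then show "(\<lambda>k. \<phi> k x - h x) \<longlonglongrightarrow> 0" by (rule LIM_zero)
    qed
    have "norm (\<phi> k x) \<le> B" for k x
      using mollify_close(2)[OF \<rho>[of k] mh, of x 0 B] B by (simp add: \<phi>_def)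
    then have "norm (\<phi> k x - h x) \<le> B + B" for k x
      using B by (intro order_trans[OF norm_triangle_ineq4] add_mono)
    then show "AE x in lebesgue. norm (\<phi> k x - h x) \<le> B + B" for k by simp
  qed (use m\<phi> mh off in auto)
  have 2: "(\<lambda>k. L2_norm U (\<lambda>x. gradient (\<phi> k) x - gradient h x)) \<longlonglongrightarrow> 0"
  proof (rule L2_norm_tendsto_0[OF U', of _ "(\<Sum>i\<in>(UNIV::'n set). M + M)" R'])
    show "AE x in lebesgue. (\<lambda>k. gradient (\<phi> k) x - gradient h x) \<longlonglongrightarrow> 0"
      using AE_off_thin[OF Z]
    proof eventually_elim
      case (elim x)
      have "(\<lambda>k. gradient (\<phi> k) x $ i) \<longlonglongrightarrow> gradient h x $ i" for i
        unfolding g\<phi> by (rule mollify_tendsto[OF Z continuous_on_component[OF cg] elim mgi \<rho> \<epsilon>(1)])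
      then have "(\<lambda>k. gradient (\<phi> k) x) \<longlonglongrightarrow> gradient h x" by (rule vec_tendstoI)
      then show ?case by (rule LIM_zero)
    qed
    show "AE x in lebesgue. norm (gradient (\<phi> k) x - gradient h x) \<le> (\<Sum>i\<in>(UNIV::'n set). M + M)" for k
      using AE_off_thin[OF Z]
    proof eventually_elim
      case (elim x)
      have "AE z in lebesgue. norm (z - x) < \<epsilon> / real (Suc k) \<longrightarrow> norm (gradient h z $ i - 0) \<le> M" for i
        using AE_off_thin[OF Z] by eventually_elim (use Mi in auto)
      from mollify_close(2)[OF \<rho> mgi this]
      have "norm (gradient (\<phi> k) x $ i) \<le> M" for i by (simp add: g\<phi>)
      then have "norm ((gradient (\<phi> k) x - gradient h x) $ i) \<le> M + M" for i
        using Mi[OF elim, of i] norm_triangle_ineq4[of "gradient (\<phi> k) x $ i" "gradient h x $ i"]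
        by (smt (verit) vector_minus_component)
      then show ?case by (intro order_trans[OF norm_vec_le_sum] sum_mono)
    qed
  qed (use mg\<phi> mg off in auto)
  show ?thesis by (rule that[OF t 1 2])
qed

section \<open>Sobolev functions with zero boundary values\<close>

lemma weak_gradient_works:
  "u \<in> H1 U \<Longrightarrow> has_weak_gradient U u (weak_gradient U u)"
  unfolding H1_def weak_gradient_def by (auto intro: someI[of "has_weak_gradient U u"])

lemma has_weak_gradient_L2: "has_weak_gradient U u g \<Longrightarrow> g \<in> L2 U"
  by (simp add: has_weak_gradient_def)

lemma L2_component:
  fixes p :: "'a::euclidean_space \<Rightarrow> complex^'n::finite"
  assumes "p \<in> L2 U" shows "(\<lambda>x. p x $ i) \<in> L2 U"
proof (rule L2_dominated(1)[OF assms, of _ 1])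
  have "(\<lambda>v::complex^'n. v $ i) \<in> borel_measurable borel"
    by (intro borel_measurable_continuous_onI continuous_on_component continuous_on_id)
  from measurable_compose[OF L2_measurable[OF assms] this]
  show "(\<lambda>x. p x $ i) \<in> borel_measurable (lebesgue_on U)" .
qed (use Finite_Cartesian_Product.norm_nth_le in auto)

lemma L2_mult_integrable:
  fixes p q :: "'a::euclidean_space \<Rightarrow> complex"
  assumes "p \<in> L2 U" "q \<in> L2 U"
  shows "integrable (lebesgue_on U) (\<lambda>x. p x * q x)"
    "norm (LINT x|lebesgue_on U. p x * q x) \<le> L2_norm U p * L2_norm U q"
  using L2_product_bound[OF assms, of "\<lambda>x. p x * q x" 1] L2_measurable[OF assms(1)] L2_measurable[OF assms(2)]
  by (auto simp: norm_mult)

lemma has_weak_gradient_diff: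
  fixes u v :: "real^'n::finite \<Rightarrow> complex"
  assumes U: "open U" and u: "u \<in> L2 U" "has_weak_gradient U u g" and v: "v \<in> L2 U" "has_weak_gradient U v k"
  shows "has_weak_gradient U (\<lambda>x. u x - v x) (\<lambda>x. g x - k x)"
  unfolding has_weak_gradient_def
proof (intro conjI allI impI)
  note gk = has_weak_gradient_L2[OF u(2)] has_weak_gradient_L2[OF v(2)]
  show "(\<lambda>x. g x - k x) \<in> L2 U" by (rule L2_diff[OF gk])
  fix \<psi> i assume \<psi>: "test_function U \<psi>"
  have U': "U \<in> sets lebesgue" using U by simp
  note t = test_function_L2[OF \<psi> U']
  have e: "(LINT x|lebesgue_on U. u x * gradient \<psi> x $ i) = - (LINT x|lebesgue_on U. g x $ i * \<psi> x)"
    "(LINT x|lebesgue_on U. v x * gradient \<psi> x $ i) = - (LINT x|lebesgue_on U. k x $ i * \<psi> x)"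
    using u(2) v(2) \<psi> unfolding has_weak_gradient_def by blast+
  show "(LINT x|lebesgue_on U. (u x - v x) * gradient \<psi> x $ i) =
      - (LINT x|lebesgue_on U. (g x - k x) $ i * \<psi> x)"
    using e L2_mult_integrable(1)[OF u(1) L2_component[OF t(2)]] L2_mult_integrable(1)[OF v(1) L2_component[OF t(2)]]
      L2_mult_integrable(1)[OF L2_component[OF gk(1)] t(1)] L2_mult_integrable(1)[OF L2_component[OF gk(2)] t(1)]
    by (simp add: left_diff_distrib)
qed

lemma H1_norm_eq: "H1_norm U u = sqrt ((L2_norm U u)\<^sup>2 + (L2_norm U (weak_gradient U u))\<^sup>2)"
  by (simp add: H1_norm_def L2_norm_square)

text \<open>The approximants in the definition of \<open>H10\<close> are compared in terms of chosen weak gradients; uniqueness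
  turns these into classical gradients of the test functions.\<close>

lemma H10_approximation:
  fixes u :: "real^'n::finite \<Rightarrow> complex"
  assumes U: "open U" and u: "u \<in> H10 U"
  obtains \<phi> where "\<And>k::nat. test_function U (\<phi> k)"
    "(\<lambda>k. L2_norm U (\<lambda>x. u x - \<phi> k x)) \<longlonglongrightarrow> 0"
    "(\<lambda>k. L2_norm U (\<lambda>x. weak_gradient U u x - gradient (\<phi> k) x)) \<longlonglongrightarrow> 0"
proof -
  obtain \<phi> where \<phi>: "\<And>k::nat. test_function U (\<phi> k)" "(\<lambda>k. H1_norm U (\<lambda>x. u x - \<phi> k x)) \<longlonglongrightarrow> 0"
    using u unfolding H10_def by blast
  have uH: "u \<in> H1 U" using u by (simp add: H10_def)
  then have uL: "u \<in> L2 U" by (simp add: H1_def)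
  have U': "U \<in> sets lebesgue" using U by simp
  have w: "has_weak_gradient U (\<lambda>x. u x - \<phi> k x) (\<lambda>x. weak_gradient U u x - gradient (\<phi> k) x)" for k
    by (rule has_weak_gradient_diff[OF U uL weak_gradient_works[OF uH] test_function_L2(1)[OF \<phi>(1) U']
          test_function_has_weak_gradient[OF U \<phi>(1)]])
  have w': "has_weak_gradient U (\<lambda>x. u x - \<phi> k x) (weak_gradient U (\<lambda>x. u x - \<phi> k x))" for k
    unfolding weak_gradient_def[of U "\<lambda>x. u x - \<phi> k x"]
    by (rule someI[of "has_weak_gradient U (\<lambda>x. u x - \<phi> k x)", OF w])
  have eq: "L2_norm U (weak_gradient U (\<lambda>x. u x - \<phi> k x)) = L2_norm U (\<lambda>x. weak_gradient U u x - gradient (\<phi> k) x)" for k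
    by (rule L2_norm_cong_AE[OF _ _ weak_gradient_unique[OF U w' w]])
      (use has_weak_gradient_L2[OF w] has_weak_gradient_L2[OF w'] in \<open>auto simp: L2_measurable\<close>)
  have "(\<lambda>k. L2_norm U (\<lambda>x. u x - \<phi> k x)) \<longlonglongrightarrow> 0"
    by (rule tendsto_sandwich[OF _ _ tendsto_const \<phi>(2)]) (auto simp: H1_norm_eq)
  moreover have "(\<lambda>k. L2_norm U (\<lambda>x. weak_gradient U u x - gradient (\<phi> k) x)) \<longlonglongrightarrow> 0"
    by (rule tendsto_sandwich[OF _ _ tendsto_const \<phi>(2)]) (auto simp: H1_norm_eq eq[symmetric])
  ultimately show ?thesis by (rule that[OF \<phi>(1)])
qed

lemma H10_poincare:
  fixes u :: "real^'n::finite \<Rightarrow> complex"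
  assumes U: "open U" "U \<subseteq> cball 0 R" "R \<ge> 0" and u: "u \<in> H10 U"
  shows "L2_norm U u \<le> 2 * R * L2_norm U (weak_gradient U u)"
proof -
  let ?g = "weak_gradient U u"
  obtain \<phi> where \<phi>: "\<And>k::nat. test_function U (\<phi> k)"
    "(\<lambda>k. L2_norm U (\<lambda>x. u x - \<phi> k x)) \<longlonglongrightarrow> 0" "(\<lambda>k. L2_norm U (\<lambda>x. ?g x - gradient (\<phi> k) x)) \<longlonglongrightarrow> 0"
    by (rule H10_approximation[OF U(1) u]) blast
  have uH: "u \<in> H1 U" using u by (simp add: H10_def)
  then have uL: "u \<in> L2 U" by (simp add: H1_def)
  have gL: "?g \<in> L2 U" using weak_gradient_works[OF uH] by (rule has_weak_gradient_L2)
  have U': "U \<in> sets lebesgue" using U by simp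
  have "L2_norm U u \<le> 2 * R * (L2_norm U ?g + L2_norm U (\<lambda>x. ?g x - gradient (\<phi> k) x)) + L2_norm U (\<lambda>x. u x - \<phi> k x)" for k
  proof -
    note t = test_function_L2[OF \<phi>(1)[of k] U']
    have "L2_norm U u \<le> L2_norm U (\<phi> k) + L2_norm U (\<lambda>x. u x - \<phi> k x)"
      by (rule L2_norm_triangle_diff[OF uL t(1)])
    moreover have "L2_norm U (\<phi> k) \<le> 2 * R * L2_norm U (gradient (\<phi> k))"
      by (rule test_function_poincare[OF U \<phi>(1)])
    moreover have "L2_norm U (gradient (\<phi> k)) \<le> L2_norm U ?g + L2_norm U (\<lambda>x. ?g x - gradient (\<phi> k) x)"
      using L2_norm_triangle_diff[OF t(2) gL] unfolding L2_norm_minus_commute[of U ?g] .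
    then have "2 * R * L2_norm U (gradient (\<phi> k)) \<le> 2 * R * (L2_norm U ?g + L2_norm U (\<lambda>x. ?g x - gradient (\<phi> k) x))"
      using U(3) by (intro mult_left_mono) auto
    ultimately show ?thesis by linarith
  qed
  moreover have "(\<lambda>k. 2 * R * (L2_norm U ?g + L2_norm U (\<lambda>x. ?g x - gradient (\<phi> k) x)) + L2_norm U (\<lambda>x. u x - \<phi> k x))
      \<longlonglongrightarrow> 2 * R * (L2_norm U ?g + 0) + 0"
    by (intro tendsto_intros \<phi>)
  ultimately show ?thesis
    using LIMSEQ_le_const by (metis (no_types, lifting) add.right_neutral)
qed

section \<open>Change of variables\<close>

text \<open>Renaming coordinates by a bijection of the index types preserves boxes, volumes and determinants. It
  carries the change of variables formula, which refers to a well-order of the coordinates, over to any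
  index type of the same size.\<close>

definition reindex :: "('m \<Rightarrow> 'n) \<Rightarrow> real^'n \<Rightarrow> real^'m::finite" where
  "reindex \<pi> x = (\<chi> j. x $ \<pi> j)"

lemma reindex_nth: "reindex \<pi> x $ j = x $ \<pi> j"
  by (simp add: reindex_def)

lemma reindex_inverse:
  assumes "bij \<pi>"
  shows "reindex (inv \<pi>) (reindex \<pi> x) = x" "reindex \<pi> (reindex (inv \<pi>) y) = y"
  using assms by (simp_all add: reindex_def bij_is_surj surj_f_inv_f bij_is_inj)

lemma linear_reindex: "linear (reindex \<pi>)"
  by (auto simp: reindex_def vec_eq_iff intro!: linearI)

lemma bounded_linear_reindex: "bounded_linear (reindex (\<pi> :: 'm::finite \<Rightarrow> 'n::finite))"
  by (rule linear_conv_bounded_linear[THEN iffD1, OF linear_reindex])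

lemma reindex_cbox:
  assumes "bij \<pi>" shows "reindex \<pi> ` cbox u v = cbox (reindex \<pi> u) (reindex \<pi> (v :: real^'n::finite) :: real^'m::finite)"
proof (rule set_eqI)
  fix y :: "real^'m"
  have "y \<in> reindex \<pi> ` cbox u v \<longleftrightarrow> reindex (inv \<pi>) y \<in> cbox u v"
    using reindex_inverse[OF assms] by (metis image_iff)
  also have "\<dots> \<longleftrightarrow> (\<forall>i. u $ i \<le> y $ inv \<pi> i \<and> y $ inv \<pi> i \<le> v $ i)"
    by (simp add: mem_box_cart reindex_def)
  also have "\<dots> \<longleftrightarrow> (\<forall>j. u $ \<pi> j \<le> y $ j \<and> y $ j \<le> v $ \<pi> j)"
    using assms by (metis bij_inv_eq_iff)
  finally show "y \<in> reindex \<pi> ` cbox u v \<longleftrightarrow> y \<in> cbox (reindex \<pi> u) (reindex \<pi> v)"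
    by (simp add: mem_box_cart reindex_def)
qed

lemma content_reindex:
  assumes "bij \<pi>"
  shows "measure lborel (reindex \<pi> ` cbox u v :: (real^'m::finite) set) = measure lborel (cbox u (v :: real^'n::finite))"
proof (cases "cbox u v = {}")
  case False
  then have ne: "cbox (reindex \<pi> u) (reindex \<pi> v :: real^'m) \<noteq> {}"
    using reindex_cbox[OF assms, of u v] by auto
  have "measure lborel (cbox (reindex \<pi> u) (reindex \<pi> v :: real^'m)) = (\<Prod>j\<in>UNIV. v $ \<pi> j - u $ \<pi> j)"
    using content_cbox_cart[OF ne] by (simp add: reindex_def)
  also have "\<dots> = (\<Prod>i\<in>UNIV. v $ i - u $ i)"
    using assms by (rule prod.reindex_bij_betw)
  finally show ?thesis using content_cbox_cart[OF False] by (simp add: reindex_cbox[OF assms])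
qed simp

lemma has_integral_reindex:
  fixes f :: "real^'n::finite \<Rightarrow> 'b::euclidean_space" and \<pi> :: "'m::finite \<Rightarrow> 'n"
  assumes \<pi>: "bij \<pi>" and S: "bounded S" and f: "(f has_integral i) S"
  shows "((\<lambda>y. f (reindex (inv \<pi>) y)) has_integral i) (reindex \<pi> ` S)"
proof -
  have \<pi>': "bij (inv \<pi>)" using \<pi> by (rule bij_imp_bij_inv)
  have ii: "inv (inv \<pi>) = \<pi>" using \<pi> by (rule inv_inv_eq)
  obtain a where a: "S \<subseteq> cbox (- a) a" using bounded_subset_cbox_symmetric[OF S] by blast
  have "((\<lambda>x. if x \<in> S then f x else 0) has_integral i) (cbox (- a) a)"
    using f a has_integral_restrict[of S "cbox (- a) a" f i] by blast
  then have "((\<lambda>y. if reindex (inv \<pi>) y \<in> S then f (reindex (inv \<pi>) y) else 0) has_integral (1 / 1) *\<^sub>R i)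
      (reindex \<pi> ` cbox (- a) a)"
  proof (rule has_integral_twiddle[rotated -1])
    show "\<exists>w z. reindex (inv \<pi>) ` cbox u v = cbox w z" for u v :: "real^'m"
      using reindex_cbox[OF \<pi>'] by blast
    show "\<exists>w z. reindex \<pi> ` cbox u v = cbox w z" for u v :: "real^'n"
      using reindex_cbox[OF \<pi>] by blast
    show "measure lborel (reindex (inv \<pi>) ` cbox u v) = 1 * measure lborel (cbox u v)" for u v :: "real^'m"
      using content_reindex[OF \<pi>'] by simp
    show "continuous (at x) (reindex (inv \<pi>))" for x :: "real^'m"
      by (rule linear_continuous_at[OF bounded_linear_reindex])
  qed (use reindex_inverse[OF \<pi>] in auto)
  moreover have "reindex (inv \<pi>) y \<in> S \<longleftrightarrow> y \<in> reindex \<pi> ` S" for y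
    using reindex_inverse[OF \<pi>] by (metis image_iff)
  ultimately have "((\<lambda>y. if y \<in> reindex \<pi> ` S then f (reindex (inv \<pi>) y) else 0) has_integral i)
      (reindex \<pi> ` cbox (- a) a)" by simp
  then show ?thesis
    using has_integral_restrict[OF image_mono[OF a, of "reindex \<pi>"]] by blast
qed

lemma absolutely_integrable_reindex:
  fixes f :: "real^'n::finite \<Rightarrow> 'b::euclidean_space" and \<pi> :: "'m::finite \<Rightarrow> 'n"
  assumes \<pi>: "bij \<pi>" and S: "bounded S" and f: "f absolutely_integrable_on S"
  shows "(\<lambda>y. f (reindex (inv \<pi>) y)) absolutely_integrable_on (reindex \<pi> ` S)"
    "integral (reindex \<pi> ` S) (\<lambda>y. f (reindex (inv \<pi>) y)) = integral S f"
proof -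
  have "f integrable_on S" "(\<lambda>x. norm (f x)) integrable_on S"
    using f by (auto simp: absolutely_integrable_on_def)
  note i = this[THEN integrable_integral, THEN has_integral_reindex[OF \<pi> S]]
  show "(\<lambda>y. f (reindex (inv \<pi>) y)) absolutely_integrable_on (reindex \<pi> ` S)"
    using i by (auto simp: absolutely_integrable_on_def integrable_on_def)
  show "integral (reindex \<pi> ` S) (\<lambda>y. f (reindex (inv \<pi>) y)) = integral S f"
    using i(1) by (rule integral_unique)
qed

lemma sign_conjugate:
  fixes \<pi> :: "'m::finite \<Rightarrow> 'n::finite"
  assumes \<pi>: "bij \<pi>" and p: "p permutes (UNIV :: 'n set)"
  shows "(inv \<pi> \<circ> p \<circ> \<pi>) permutes UNIV" "sign (inv \<pi> \<circ> p \<circ> \<pi>) = sign p"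
proof -
  have perm: "(inv \<pi> \<circ> q \<circ> \<pi>) permutes UNIV" if "q permutes (UNIV :: 'n set)" for q
  proof -
    have "bij (inv \<pi> \<circ> q \<circ> \<pi>)"
      using \<pi> that by (intro bij_comp bij_imp_bij_inv permutes_bij)
    then show ?thesis by (rule bij_imp_permutes) simp
  qed
  show "(inv \<pi> \<circ> p \<circ> \<pi>) permutes UNIV" by (rule perm[OF p])
  have inv: "\<pi> (inv \<pi> x) = x" "inv \<pi> (\<pi> y) = y" for x y
    using \<pi> by (simp_all add: bij_is_surj surj_f_inv_f bij_is_inj)
  show "sign (inv \<pi> \<circ> p \<circ> \<pi>) = sign p"
    using p finite[of "UNIV :: 'n set"]
  proof (induction rule: permutes_induct)
    case id
    have "inv \<pi> \<circ> id \<circ> \<pi> = id" using inv by auto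
    then show ?case by simp
  next
    case (swap a b p)
    have e: "inv \<pi> \<circ> (Transposition.transpose a b \<circ> p) \<circ> \<pi> =
        Transposition.transpose (inv \<pi> a) (inv \<pi> b) \<circ> (inv \<pi> \<circ> p \<circ> \<pi>)"
      using inv by (auto simp: fun_eq_iff Transposition.transpose_def) (metis inv(1))+
    have ne: "inv \<pi> a \<noteq> inv \<pi> b" using \<open>a \<noteq> b\<close> inv by metis
    have pp: "permutation (inv \<pi> \<circ> p \<circ> \<pi>)" "permutation p"
      using perm[OF \<open>p permutes UNIV\<close>] \<open>p permutes UNIV\<close> by (auto simp: permutation_permutes)
    show ?case
      unfolding e sign_compose[OF permutation_swap_id pp(1)] sign_compose[OF permutation_swap_id pp(2)] swap.IH
      using \<open>a \<noteq> b\<close> ne by (simp add: sign_swap_id)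
  qed
qed

lemma det_reindex:
  fixes A :: "real^'n::finite^'n" and \<pi> :: "'m::finite \<Rightarrow> 'n"
  assumes \<pi>: "bij \<pi>"
  shows "det (\<chi> i j. A $ \<pi> i $ \<pi> j) = det A"
proof -
  have inv: "\<pi> (inv \<pi> x) = x" "inv \<pi> (\<pi> y) = y" for x y
    using \<pi> by (simp_all add: bij_is_surj surj_f_inv_f bij_is_inj)
  have inv': "inv (inv \<pi>) = \<pi>" using \<pi> by (rule inv_inv_eq)
  have b: "bij_betw (\<lambda>p. inv \<pi> \<circ> p \<circ> \<pi>) {p. p permutes (UNIV :: 'n set)} {p. p permutes (UNIV :: 'm set)}"
  proof (rule bij_betw_byWitness[where f' = "\<lambda>q. \<pi> \<circ> q \<circ> inv \<pi>"])
    show "(\<lambda>q. \<pi> \<circ> q \<circ> inv \<pi>) ` {p. p permutes (UNIV :: 'm set)} \<subseteq> {p. p permutes (UNIV :: 'n set)}"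
      using sign_conjugate(1)[OF bij_imp_bij_inv[OF \<pi>]] by (auto simp: inv')
  qed (use sign_conjugate(1)[OF \<pi>] inv in \<open>auto simp: fun_eq_iff\<close>)
  have "det (\<chi> i j. A $ \<pi> i $ \<pi> j) =
      (\<Sum>q | q permutes (UNIV :: 'm set). of_int (sign q) * (\<Prod>i\<in>UNIV. A $ \<pi> i $ \<pi> (q i)))"
    by (simp add: det_def)
  also have "\<dots> = (\<Sum>p | p permutes (UNIV :: 'n set). of_int (sign (inv \<pi> \<circ> p \<circ> \<pi>)) *
      (\<Prod>i\<in>UNIV. A $ \<pi> i $ \<pi> ((inv \<pi> \<circ> p \<circ> \<pi>) i)))"
    by (rule sum.reindex_bij_betw[OF b, symmetric])
  also have "\<dots> = (\<Sum>p | p permutes (UNIV :: 'n set). of_int (sign p) * (\<Prod>i\<in>UNIV. A $ i $ p i))"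
  proof (rule sum.cong[OF refl])
    fix p assume "p \<in> {p. p permutes (UNIV :: 'n set)}"
    moreover have "(\<Prod>i\<in>UNIV. A $ \<pi> i $ p (\<pi> i)) = (\<Prod>i\<in>UNIV. A $ i $ p i)"
      using \<pi> by (rule prod.reindex_bij_betw)
    ultimately show "of_int (sign (inv \<pi> \<circ> p \<circ> \<pi>)) * (\<Prod>i\<in>UNIV. A $ \<pi> i $ \<pi> ((inv \<pi> \<circ> p \<circ> \<pi>) i)) =
        of_int (sign p) * (\<Prod>i\<in>UNIV. A $ i $ p i)"
      using sign_conjugate(2)[OF \<pi>] inv by simp
  qed
  finally show ?thesis by (simp add: det_def)
qed

lemma change_of_variables_finite:
  fixes f :: "real^'n::finite \<Rightarrow> real^'k::finite" and g :: "real^'n \<Rightarrow> real^'n"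
    and \<pi> :: "'m::{finite,wellorder} \<Rightarrow> 'n"
  assumes \<pi>: "bij \<pi>" and S: "open S" "bounded S" and gS: "bounded (g ` S)"
    and der: "\<And>x. x \<in> S \<Longrightarrow> (g has_derivative g' x) (at x)" and inj: "inj_on g S"
    and f: "f absolutely_integrable_on (g ` S)"
  shows "(\<lambda>x. \<bar>det (matrix (g' x))\<bar> *\<^sub>R f (g x)) absolutely_integrable_on S"
    "integral S (\<lambda>x. \<bar>det (matrix (g' x))\<bar> *\<^sub>R f (g x)) = integral (g ` S) f"
proof -
  let ?R = "reindex \<pi> :: real^'n \<Rightarrow> real^'m::_" and ?R' = "reindex (inv \<pi>) :: real^'m::_ \<Rightarrow> real^'n"
  have \<pi>': "bij (inv \<pi>)" using \<pi> by (rule bij_imp_bij_inv)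
  have ii: "inv (inv \<pi>) = \<pi>" using \<pi> by (rule inv_inv_eq)
  note inv = reindex_inverse[OF \<pi>]
  define h where "h y = ?R (g (?R' y))" for y
  define h' where "h' y v = ?R (g' (?R' y) (?R' v))" for y v
  have memR: "y \<in> ?R ` S \<longleftrightarrow> ?R' y \<in> S" for y
    using inv by (metis image_iff)
  then have RS: "?R ` S = ?R' -` S" by blast
  have oRS: "open (?R ` S)"
    unfolding RS by (rule continuous_open_vimage[OF S(1)])
      (simp add: linear_continuous_at[OF bounded_linear_reindex])
  have bR: "bounded (?R ` A)" if "bounded A" for A
    using that bounded_linear_reindex by (rule bounded_linear_image)
  have bR': "bounded (?R' ` A)" if "bounded A" for A
    using that bounded_linear_reindex by (rule bounded_linear_image)
  have hS: "h ` (?R ` S) = ?R ` (g ` S)" by (simp add: h_def image_image inv)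
  have dh: "(h has_derivative h' y) (at y)" if "y \<in> ?R ` S" for y
  proof -
    have "?R' y \<in> S" using that by (simp only: memR)
    from has_derivative_compose[OF bounded_linear_imp_has_derivative[OF bounded_linear_reindex] der[OF this]]
    have "((\<lambda>y. g (?R' y)) has_derivative (\<lambda>v. g' (?R' y) (?R' v))) (at y)" .
    from bounded_linear.has_derivative[OF bounded_linear_reindex this]
    show ?thesis unfolding h_def h'_def .
  qed
  have inj_h: "inj_on h (?R ` S)"
  proof (rule inj_onI)
    fix y z assume y: "y \<in> ?R ` S" and z: "z \<in> ?R ` S" and hyz: "h y = h z"
    from hyz have "?R' (?R (g (?R' y))) = ?R' (?R (g (?R' z)))" unfolding h_def by (rule arg_cong)
    then have "g (?R' y) = g (?R' z)" unfolding inv(1) .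
    moreover have "?R' y \<in> S" "?R' z \<in> S" using y z by (simp_all only: memR)
    ultimately have "?R' y = ?R' z" by (rule inj_onD[OF inj])
    then have "?R (?R' y) = ?R (?R' z)" by (rule arg_cong)
    then show "y = z" unfolding inv(2) .
  qed
  have det: "det (matrix (h' y)) = det (matrix (g' (?R' y)))" for y
  proof -
    have "inv \<pi> i = j \<longleftrightarrow> i = \<pi> j" for i j by (metis bij_inv_eq_iff[OF \<pi>])
    then have ax: "?R' (axis j 1) = axis (\<pi> j) 1" for j
      by (simp add: reindex_nth axis_def vec_eq_iff)
    have "matrix (h' y) $ i $ j = matrix (g' (?R' y)) $ \<pi> i $ \<pi> j" for i j
      by (simp add: matrix_def h'_def reindex_nth ax)
    then have "matrix (h' y) = (\<chi> i j. matrix (g' (?R' y)) $ \<pi> i $ \<pi> j)"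
      by (simp add: vec_eq_iff)
    then show ?thesis by (simp only: det_reindex[OF \<pi>])
  qed
  have f': "(\<lambda>y. f (?R' y)) absolutely_integrable_on (h ` (?R ` S))"
    "integral (h ` (?R ` S)) (\<lambda>y. f (?R' y)) = integral (g ` S) f"
    unfolding hS by (rule absolutely_integrable_reindex[OF \<pi> gS f])+
  have "(\<lambda>y. \<bar>det (matrix (h' y))\<bar> *\<^sub>R f (?R' (h y))) absolutely_integrable_on (?R ` S) \<and>
      integral (?R ` S) (\<lambda>y. \<bar>det (matrix (h' y))\<bar> *\<^sub>R f (?R' (h y))) = integral (g ` S) f"
    by (rule has_absolute_integral_change_of_variables[THEN iffD2])
      (use oRS dh inj_h f' in \<open>auto intro: has_derivative_at_withinI\<close>)
  then have *: "(\<lambda>y. \<bar>det (matrix (g' (?R' y)))\<bar> *\<^sub>R f (g (?R' y))) absolutely_integrable_on (?R ` S)"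
    "integral (?R ` S) (\<lambda>y. \<bar>det (matrix (g' (?R' y)))\<bar> *\<^sub>R f (g (?R' y))) = integral (g ` S) f"
    by (simp_all add: det h_def inv)
  have RR: "?R' ` (?R ` S) = S" by (simp add: image_image inv)
  from absolutely_integrable_reindex[OF \<pi>' bR[OF S(2)] *(1)] *(2)
  show "(\<lambda>x. \<bar>det (matrix (g' x))\<bar> *\<^sub>R f (g x)) absolutely_integrable_on S"
    "integral S (\<lambda>x. \<bar>det (matrix (g' x))\<bar> *\<^sub>R f (g x)) = integral (g ` S) f"
    unfolding RR ii by (simp_all add: inv)
qed

lemma change_of_variables_complex:
  fixes f :: "real^'n::finite \<Rightarrow> complex" and g :: "real^'n \<Rightarrow> real^'n"
  assumes dim: "CARD('n) = 2 \<or> CARD('n) = 3" and S: "open S" "bounded S" and gS: "open (g ` S)" "bounded (g ` S)"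
    and der: "\<And>x. x \<in> S \<Longrightarrow> (g has_derivative g' x) (at x)" and inj: "inj_on g S"
    and f: "integrable (lebesgue_on (g ` S)) f"
  shows "integrable (lebesgue_on S) (\<lambda>x. \<bar>det (matrix (g' x))\<bar> *\<^sub>R f (g x))"
    "(LINT x|lebesgue_on S. \<bar>det (matrix (g' x))\<bar> *\<^sub>R f (g x)) = (LINT y|lebesgue_on (g ` S). f y)"
proof -
  define L where "L z = (vector [Re z, Im z] :: real^2)" for z
  define L' where "L' v = Complex (v $ 1) (v $ 2)" for v :: "real^2"
  have L'L: "L' (L z) = z" for z by (simp add: L_def L'_def)
  have lin: "linear L" "linear L'"
    by (auto intro!: linearI simp: L_def L'_def vec_eq_iff forall_2 complex_eq_iff)
  then have bl: "bounded_linear L" "bounded_linear L'" by (simp_all add: linear_conv_bounded_linear)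
  have fi: "f absolutely_integrable_on (g ` S)"
    using f gS(1) by (simp add: set_integrable_def integrable_restrict_space)
  have Lf: "(\<lambda>y. L (f y)) absolutely_integrable_on (g ` S)"
    using absolutely_integrable_linear[OF fi bl(1)] by (simp add: o_def)
  have cv: "(\<lambda>x. \<bar>det (matrix (g' x))\<bar> *\<^sub>R L (f (g x))) absolutely_integrable_on S \<and>
    integral S (\<lambda>x. \<bar>det (matrix (g' x))\<bar> *\<^sub>R L (f (g x))) = integral (g ` S) (\<lambda>y. L (f y))"
    using dim
  proof
    assume "CARD('n) = 2"
    then have "card (UNIV :: 2 set) = card (UNIV :: 'n set)" by simp
    from finite_same_card_bij[OF finite finite this] obtain \<pi> :: "2 \<Rightarrow> 'n" where "bij \<pi>"
      by blast
    from change_of_variables_finite[OF this S gS(2) der inj Lf] show ?thesis by blast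
  next
    assume "CARD('n) = 3"
    then have "card (UNIV :: 3 set) = card (UNIV :: 'n set)" by simp
    from finite_same_card_bij[OF finite finite this] obtain \<pi> :: "3 \<Rightarrow> 'n" where "bij \<pi>"
      by blast
    from change_of_variables_finite[OF this S gS(2) der inj Lf] show ?thesis by blast
  qed
  have "(\<lambda>x. L' (\<bar>det (matrix (g' x))\<bar> *\<^sub>R L (f (g x)))) absolutely_integrable_on S"
    using absolutely_integrable_linear[OF conjunct1[OF cv] bl(2)] by (simp add: o_def)
  then have i: "(\<lambda>x. \<bar>det (matrix (g' x))\<bar> *\<^sub>R f (g x)) absolutely_integrable_on S"
    by (simp add: linear_cmul[OF lin(2)] L'L)
  then show i': "integrable (lebesgue_on S) (\<lambda>x. \<bar>det (matrix (g' x))\<bar> *\<^sub>R f (g x))"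
    using S(1) by (simp add: set_integrable_def integrable_restrict_space)
  have "(LINT x|lebesgue_on S. \<bar>det (matrix (g' x))\<bar> *\<^sub>R f (g x)) = integral S (\<lambda>x. \<bar>det (matrix (g' x))\<bar> *\<^sub>R f (g x))"
    by (rule lebesgue_integral_eq_integral[OF i']) (simp add: S(1))
  also have "\<dots> = integral S (\<lambda>x. L' (\<bar>det (matrix (g' x))\<bar> *\<^sub>R L (f (g x))))"
    by (simp add: linear_cmul[OF lin(2)] L'L)
  also have "\<dots> = L' (integral S (\<lambda>x. \<bar>det (matrix (g' x))\<bar> *\<^sub>R L (f (g x))))"
    using integral_linear[OF set_lebesgue_integral_eq_integral(1)[OF conjunct1[OF cv]] bl(2)] by (simp add: o_def)
  also have "\<dots> = L' (integral (g ` S) (\<lambda>y. L (f y)))" using cv by simp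
  also have "\<dots> = integral (g ` S) (\<lambda>y. L' (L (f y)))"
    using integral_linear[OF set_lebesgue_integral_eq_integral(1)[OF Lf] bl(2)] by (simp add: o_def)
  also have "\<dots> = (LINT y|lebesgue_on (g ` S). f y)"
    using lebesgue_integral_eq_integral[OF f] gS(1) by (simp add: L'L)
  finally show "(LINT x|lebesgue_on S. \<bar>det (matrix (g' x))\<bar> *\<^sub>R f (g x)) = (LINT y|lebesgue_on (g ` S). f y)" .
qed

section \<open>Elliptic matrices and the bilinear form\<close>

text \<open>The form is bilinear, as in the weak equation; conjugation is applied explicitly when an energy is
  meant.\<close>

definition pairing :: "real^'n^'n \<Rightarrow> complex^'n \<Rightarrow> complex^'n::finite \<Rightarrow> complex" where
  "pairing M p q = (\<Sum>i\<in>UNIV. \<Sum>j\<in>UNIV. complex_of_real (M $ i $ j) * p $ j * q $ i)"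

definition cnj_vec :: "complex^'n \<Rightarrow> complex^'n::finite" where
  "cnj_vec p = (\<chi> i. cnj (p $ i))"

definition elliptic :: "real \<Rightarrow> real^'n^'n::finite \<Rightarrow> bool" where
  "elliptic \<Lambda> M \<longleftrightarrow> transpose M = M \<and>
     (\<forall>\<xi>. (norm \<xi>)\<^sup>2 / \<Lambda> \<le> (M *v \<xi>) \<bullet> \<xi> \<and> (M *v \<xi>) \<bullet> \<xi> \<le> \<Lambda> * (norm \<xi>)\<^sup>2)"

lemma complex_coeff_pairing:
  "(\<Sum>i\<in>UNIV. (complex_coeff s A x *v p) $ i * q $ i) = s x * pairing (A x) p q"
  by (simp add: complex_coeff_def matrix_vector_mult_def pairing_def sum_distrib_left sum_distrib_right mult_ac)

lemma norm_cnj_vec [simp]: "norm (cnj_vec p) = norm p"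
  by (simp add: norm_vec_def cnj_vec_def)

lemma pairing_add_left: "pairing M (p + p') q = pairing M p q + pairing M p' q"
  and pairing_diff_left: "pairing M (p - p') q = pairing M p q - pairing M p' q"
  and pairing_add_right: "pairing M p (q + q') = pairing M p q + pairing M p q'"
  and pairing_diff_right: "pairing M p (q - q') = pairing M p q - pairing M p q'"
  by (simp_all add: pairing_def algebra_simps sum.distrib sum_subtractf)

lemma pairing_smult:
  "pairing M (\<chi> i. c * p $ i) q = c * pairing M p q" "pairing M p (\<chi> i. c * q $ i) = c * pairing M p q"
  by (simp_all add: pairing_def sum_distrib_left mult_ac)

lemma symmetric_entry: "transpose M = M \<Longrightarrow> M $ i $ j = M $ j $ i"
  by (drule arg_cong[of _ _ "\<lambda>B. B $ i $ j"]) (simp add: transpose_def)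

lemma pairing_commute:
  assumes "transpose M = M" shows "pairing M p q = pairing M q p"
proof -
  have M: "M $ i $ j = M $ j $ i" for i j
    using assms by (rule symmetric_entry)
  have "pairing M p q = (\<Sum>j\<in>UNIV. \<Sum>i\<in>UNIV. complex_of_real (M $ i $ j) * p $ j * q $ i)"
    unfolding pairing_def by (rule sum.swap)
  also have "\<dots> = pairing M q p"
    unfolding pairing_def by (intro sum.cong refl) (simp add: M mult_ac)
  finally show ?thesis .
qed

lemma matrix_quadratic_form: "(M *v \<xi>) \<bullet> \<xi> = (\<Sum>i\<in>UNIV. \<Sum>j\<in>UNIV. M $ i $ j * \<xi> $ j * \<xi> $ i)"
  for M :: "real^'n::finite^'n"
  by (simp add: inner_vec_def matrix_vector_mult_def sum_distrib_right)

text \<open>An entry off the diagonal is obtained by polarisation with \<open>e\<^sub>i + e\<^sub>j\<close> and \<open>e\<^sub>i - e\<^sub>j\<close>.\<close>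

lemma elliptic_entries:
  fixes M :: "real^'n::finite^'n"
  assumes M: "elliptic \<Lambda> M" and \<Lambda>: "\<Lambda> > 0"
  shows "\<bar>M $ i $ j\<bar> \<le> \<Lambda>"
proof -
  have sym: "M $ j $ i = M $ i $ j"
    using M unfolding elliptic_def by (intro symmetric_entry) blast
  have b: "0 \<le> (M *v \<xi>) \<bullet> \<xi>" "(M *v \<xi>) \<bullet> \<xi> \<le> \<Lambda> * (norm \<xi>)\<^sup>2" for \<xi>
  proof -
    have "0 \<le> (norm \<xi>)\<^sup>2 / \<Lambda>" using \<Lambda> by simp
    then show "0 \<le> (M *v \<xi>) \<bullet> \<xi>" "(M *v \<xi>) \<bullet> \<xi> \<le> \<Lambda> * (norm \<xi>)\<^sup>2"
      using M unfolding elliptic_def by (auto intro: order_trans)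
  qed
  have e: "(M *v axis a 1) \<bullet> axis c 1 = M $ c $ a" for a c
    by (simp add: inner_axis matrix_vector_mult_basis column_def)
  show ?thesis
  proof (cases "i = j")
    case True
    then show ?thesis using b[of "axis i 1"] e[of i i] by (simp add: norm_axis_1)
  next
    case False
    let ?p = "axis i 1 + axis j 1 :: real^'n" and ?m = "axis i 1 - axis j 1 :: real^'n"
    have o: "axis i 1 \<bullet> (axis j 1 :: real^'n) = 0" "axis j 1 \<bullet> (axis i 1 :: real^'n) = 0"
      "axis i 1 \<bullet> (axis i 1 :: real^'n) = 1" "axis j 1 \<bullet> (axis j 1 :: real^'n) = 1"
      using False by (auto simp: inner_axis_axis)
    have n: "(norm ?p)\<^sup>2 = 2" "(norm ?m)\<^sup>2 = 2"
      unfolding power2_norm_eq_inner by (simp_all add: inner_add_left inner_add_right inner_diff_left inner_diff_right o)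
    have "(M *v ?p) \<bullet> ?p = M $ i $ i + M $ j $ j + 2 * M $ i $ j"
      "(M *v ?m) \<bullet> ?m = M $ i $ i + M $ j $ j - 2 * M $ i $ j"
      by (simp_all add: matrix_vector_right_distrib matrix_vector_mult_diff_distrib inner_add_left inner_add_right
          inner_diff_left inner_diff_right e sym)
    then show ?thesis using b[of ?p] b[of ?m] n by auto
  qed
qed

lemma norm_pairing_le:
  fixes M :: "real^'n::finite^'n"
  assumes "elliptic \<Lambda> M" "\<Lambda> > 0"
  shows "norm (pairing M p q) \<le> (\<Lambda> * (real CARD('n))\<^sup>2) * (norm p * norm q)"
proof -
  have "norm (complex_of_real (M $ i $ j) * p $ j * q $ i) \<le> \<Lambda> * norm p * norm q" for i j
    unfolding norm_mult norm_of_real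
    using elliptic_entries[OF assms, of i j] Finite_Cartesian_Product.norm_nth_le[of p j]
      Finite_Cartesian_Product.norm_nth_le[of q i] assms(2) by (intro mult_mono) auto
  then have "norm (pairing M p q) \<le> (\<Sum>i\<in>(UNIV::'n set). \<Sum>j\<in>(UNIV::'n set). \<Lambda> * norm p * norm q)"
    unfolding pairing_def by (intro sum_norm_le order_refl)
  then show ?thesis by (simp add: power2_eq_square mult_ac)
qed

lemma norm_Re_Im_vec: "(norm (p::complex^'n::finite))\<^sup>2 = (norm (\<chi> i. Re (p $ i)))\<^sup>2 + (norm (\<chi> i. Im (p $ i)))\<^sup>2"
  by (simp add: norm_vec_def L2_set_def sum_nonneg cmod_power2 sum.distrib)

lemma pairing_cnj_real:
  fixes M :: "real^'n::finite^'n"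
  assumes "transpose M = M"
  shows "pairing M p (cnj_vec p) = complex_of_real
     ((M *v (\<chi> i. Re (p $ i))) \<bullet> (\<chi> i. Re (p $ i)) + (M *v (\<chi> i. Im (p $ i))) \<bullet> (\<chi> i. Im (p $ i)))"
proof (rule complex_eqI)
  show "Re (pairing M p (cnj_vec p)) = Re (complex_of_real
     ((M *v (\<chi> i. Re (p $ i))) \<bullet> (\<chi> i. Re (p $ i)) + (M *v (\<chi> i. Im (p $ i))) \<bullet> (\<chi> i. Im (p $ i))))"
    unfolding matrix_quadratic_form
    by (simp add: pairing_def cnj_vec_def sum.distrib[symmetric] algebra_simps)
  have "cnj (pairing M p (cnj_vec p)) = pairing M (cnj_vec p) p"
    by (simp add: pairing_def cnj_vec_def)
  also have "\<dots> = pairing M p (cnj_vec p)" by (rule pairing_commute[OF assms])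
  finally show "Im (pairing M p (cnj_vec p)) = Im (complex_of_real
     ((M *v (\<chi> i. Re (p $ i))) \<bullet> (\<chi> i. Re (p $ i)) + (M *v (\<chi> i. Im (p $ i))) \<bullet> (\<chi> i. Im (p $ i))))"
    by (metis Im_complex_of_real cnj.simps(2) equal_neg_zero)
qed

lemma pairing_coercive:
  fixes M :: "real^'n::finite^'n"
  assumes M: "elliptic \<Lambda> M"
  shows "pairing M p (cnj_vec p) = complex_of_real (Re (pairing M p (cnj_vec p)))"
    "(norm p)\<^sup>2 / \<Lambda> \<le> Re (pairing M p (cnj_vec p))" "Re (pairing M p (cnj_vec p)) \<le> \<Lambda> * (norm p)\<^sup>2"
proof -
  have e: "\<And>\<xi>. (norm \<xi>)\<^sup>2 / \<Lambda> \<le> (M *v \<xi>) \<bullet> \<xi>" "\<And>\<xi>. (M *v \<xi>) \<bullet> \<xi> \<le> \<Lambda> * (norm \<xi>)\<^sup>2"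
    and s: "transpose M = M" using M by (auto simp: elliptic_def)
  note r = pairing_cnj_real[OF s, of p]
  show "pairing M p (cnj_vec p) = complex_of_real (Re (pairing M p (cnj_vec p)))" unfolding r by simp
  show "(norm p)\<^sup>2 / \<Lambda> \<le> Re (pairing M p (cnj_vec p))"
    unfolding r norm_Re_Im_vec add_divide_distrib Re_complex_of_real by (intro add_mono e)
  show "Re (pairing M p (cnj_vec p)) \<le> \<Lambda> * (norm p)\<^sup>2"
    unfolding r norm_Re_Im_vec distrib_left Re_complex_of_real by (intro add_mono e)
qed

text \<open>Multiplication by \<open>J\<^sup>T\<close>, extended to complex vectors: this is how gradients transform.\<close>

definition pullback :: "real^'n^'n \<Rightarrow> complex^'n \<Rightarrow> complex^'n::finite" where
  "pullback J p = (\<chi> k. \<Sum>l\<in>UNIV. complex_of_real (J $ l $ k) * p $ l)"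

text \<open>The transformation law of media is made for this identity: together with the chain rule it leaves
  only the Jacobian, which the change of variables absorbs.\<close>

lemma pairing_pushforward:
  "pairing (c *\<^sub>R (J ** M ** transpose J)) p q = complex_of_real c * pairing M (pullback J p) (pullback J q)"
proof -
  have entry: "(c *\<^sub>R (J ** M ** transpose J)) $ i $ j = c * (\<Sum>k\<in>UNIV. \<Sum>l\<in>UNIV. J $ i $ l * M $ l $ k * J $ j $ k)" for i j
    by (simp add: matrix_matrix_mult_def transpose_def sum_distrib_right)
  have "pairing M (pullback J p) (pullback J q) =
     (\<Sum>l\<in>UNIV. \<Sum>k\<in>UNIV. \<Sum>j\<in>UNIV. \<Sum>i\<in>UNIV. complex_of_real (M $ l $ k) * (complex_of_real (J $ j $ k) * p $ j) * (complex_of_real (J $ i $ l) * q $ i))"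
    unfolding pairing_def pullback_def
    by (simp add: sum_distrib_left sum_distrib_right mult_ac)
  also have "\<dots> = (\<Sum>i\<in>UNIV. \<Sum>j\<in>UNIV. \<Sum>k\<in>UNIV. \<Sum>l\<in>UNIV. complex_of_real (M $ l $ k) * (complex_of_real (J $ j $ k) * p $ j) * (complex_of_real (J $ i $ l) * q $ i))"
  proof -
    have swap4: "(\<Sum>l\<in>UNIV. \<Sum>k\<in>UNIV. \<Sum>j\<in>UNIV. \<Sum>i\<in>UNIV. h l k j i) = (\<Sum>i\<in>UNIV. \<Sum>j\<in>UNIV. \<Sum>k\<in>UNIV. \<Sum>l\<in>UNIV. h l k j i)"
      for h :: "'a \<Rightarrow> 'a \<Rightarrow> 'a \<Rightarrow> 'a \<Rightarrow> complex"
      unfolding sum.cartesian_product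
      by (rule sum.reindex_bij_witness[of _ "\<lambda>(i, j, k, l). (l, k, j, i)" "\<lambda>(l, k, j, i). (i, j, k, l)"]) auto
    show ?thesis by (rule swap4)
  qed
  finally show ?thesis
    unfolding pairing_def[of "c *\<^sub>R _"] entry
    by (simp add: sum_distrib_left sum_distrib_right mult_ac)
qed

lemma pullback_Re_Im:
  "(\<chi> i. Re (pullback J p $ i)) = transpose J *v (\<chi> i. Re (p $ i))"
  "(\<chi> i. Im (pullback J p $ i)) = transpose J *v (\<chi> i. Im (p $ i))"
  by (simp_all add: pullback_def matrix_vector_mult_def transpose_def vec_eq_iff)

lemma elliptic_pushforward:
  fixes M J :: "real^'n::finite^'n"
  assumes M: "elliptic \<Lambda> M" and \<Lambda>: "\<Lambda> > 0" and c: "\<alpha> > 0"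
    "\<And>\<xi>. \<alpha> * (norm \<xi>)\<^sup>2 \<le> c * (norm (transpose J *v \<xi>))\<^sup>2" "\<And>\<xi>. c * (norm (transpose J *v \<xi>))\<^sup>2 \<le> \<beta> * (norm \<xi>)\<^sup>2"
    and c0: "c \<ge> 0" and \<Lambda>': "\<Lambda> / \<alpha> \<le> \<Lambda>'" "\<Lambda> * \<beta> \<le> \<Lambda>'"
  shows "elliptic \<Lambda>' (c *\<^sub>R (J ** M ** transpose J))"
  unfolding elliptic_def
proof (intro conjI allI)
  have s: "transpose M = M" using M by (simp add: elliptic_def)
  have tr: "transpose (c *\<^sub>R B) = c *\<^sub>R transpose B" for B :: "real^'n^'n"
    by (simp add: transpose_def vec_eq_iff)
  show "transpose (c *\<^sub>R (J ** M ** transpose J)) = c *\<^sub>R (J ** M ** transpose J)"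
    by (simp add: tr matrix_transpose_mul s matrix_mul_assoc)
  fix \<xi> :: "real^'n"
  let ?z = "transpose J *v \<xi>"
  have "((J ** M ** transpose J) *v \<xi>) \<bullet> \<xi> = (J *v (M *v ?z)) \<bullet> \<xi>"
    by (simp only: matrix_vector_mul_assoc matrix_mul_assoc)
  also have "\<dots> = (\<xi> v* J) \<bullet> (M *v ?z)"
    by (simp only: dot_lmul_matrix inner_commute)
  also have "\<dots> = (M *v ?z) \<bullet> ?z"
    by (simp only: transpose_matrix_vector inner_commute)
  finally have q: "((c *\<^sub>R (J ** M ** transpose J)) *v \<xi>) \<bullet> \<xi> = c * ((M *v ?z) \<bullet> ?z)"
    by (simp add: scaleR_matrix_vector_assoc[symmetric])
  have e: "(norm ?z)\<^sup>2 / \<Lambda> \<le> (M *v ?z) \<bullet> ?z" "(M *v ?z) \<bullet> ?z \<le> \<Lambda> * (norm ?z)\<^sup>2"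
    using M by (auto simp: elliptic_def)
  have pos: "\<Lambda>' > 0" using \<Lambda>'(1) \<Lambda> c(1) by (meson divide_pos_pos less_le_trans)
  have "(norm \<xi>)\<^sup>2 / \<Lambda>' \<le> \<alpha> * (norm \<xi>)\<^sup>2 / \<Lambda>"
  proof -
    have "1 / \<Lambda>' \<le> \<alpha> / \<Lambda>" using \<Lambda>'(1) \<Lambda> c(1) pos by (simp add: field_simps)
    from mult_right_mono[OF this, of "(norm \<xi>)\<^sup>2"] show ?thesis by (simp add: field_simps)
  qed
  also have "\<dots> \<le> c * (norm ?z)\<^sup>2 / \<Lambda>" using c(2) \<Lambda> by (intro divide_right_mono) auto
  also have "\<dots> \<le> c * ((M *v ?z) \<bullet> ?z)" using mult_left_mono[OF e(1) c0] by simp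
  finally show "(norm \<xi>)\<^sup>2 / \<Lambda>' \<le> ((c *\<^sub>R (J ** M ** transpose J)) *v \<xi>) \<bullet> \<xi>" unfolding q .
  have "c * ((M *v ?z) \<bullet> ?z) \<le> c * (\<Lambda> * (norm ?z)\<^sup>2)" by (rule mult_left_mono[OF e(2) c0])
  also have "\<dots> \<le> \<Lambda> * (\<beta> * (norm \<xi>)\<^sup>2)" using mult_left_mono[OF c(3), of \<Lambda>] \<Lambda> by (simp add: mult_ac)
  also have "\<dots> \<le> \<Lambda>' * (norm \<xi>)\<^sup>2" using mult_right_mono[OF \<Lambda>'(2), of "(norm \<xi>)\<^sup>2"] by (simp add: mult_ac)
  finally show "((c *\<^sub>R (J ** M ** transpose J)) *v \<xi>) \<bullet> \<xi> \<le> \<Lambda>' * (norm \<xi>)\<^sup>2" unfolding q .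
qed

lemma gradient_compose:
  fixes u :: "real^'n::finite \<Rightarrow> complex" and \<Phi> :: "real^'n \<Rightarrow> real^'n"
  assumes "\<Phi> differentiable (at x)" "u differentiable (at (\<Phi> x))"
  shows "gradient (\<lambda>x. u (\<Phi> x)) x = pullback (jacobian \<Phi> (at x)) (gradient u (\<Phi> x))"
    "(\<lambda>x. u (\<Phi> x)) differentiable (at x)"
proof -
  note d = has_derivative_compose[OF assms(1)[unfolded frechet_derivative_works] assms(2)[unfolded frechet_derivative_works]]
  show "(\<lambda>x. u (\<Phi> x)) differentiable (at x)" using d by (rule differentiableI)
  show "gradient (\<lambda>x. u (\<Phi> x)) x = pullback (jacobian \<Phi> (at x)) (gradient u (\<Phi> x))"
    by (simp add: vec_eq_iff has_derivative_gradient[OF d] frechet_derivative_gradient[OF assms(2)]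
        pullback_def jacobian_def matrix_def scaleR_conv_of_real)
qed

section \<open>Diffeomorphisms that are regular up to the boundary\<close>

definition C1_bounded :: "(real^'n) set \<Rightarrow> (real^'n::finite \<Rightarrow> complex) \<Rightarrow> bool" where
  "C1_bounded U u \<longleftrightarrow> (\<forall>x\<in>U. u differentiable (at x)) \<and> continuous_on U (gradient u) \<and>
     bounded (gradient u ` U)"

lemma C1_bounded_subset: "C1_bounded U u \<Longrightarrow> V \<subseteq> U \<Longrightarrow> C1_bounded V u"
  unfolding C1_bounded_def by (meson bounded_subset continuous_on_subset image_mono subsetD)

lemma gradient_cong:
  fixes u :: "real^'n::finite \<Rightarrow> complex"
  assumes "open U" "x \<in> U" "\<And>y. y \<in> U \<Longrightarrow> u y = v y" "v differentiable (at x)"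
  shows "gradient u x = gradient v x" "u differentiable (at x)"
proof -
  have d: "(u has_derivative frechet_derivative v (at x)) (at x)"
    by (rule has_derivative_transform_within_open[OF assms(4)[unfolded frechet_derivative_works] assms(1,2)])
      (simp add: assms(3))
  show "u differentiable (at x)" using d by (rule differentiableI)
  show "gradient u x = gradient v x" by (simp add: gradient_def frechet_derivative_eqI[OF d])
qed

lemma C1_bounded_cong:
  assumes U: "open U" and uv: "\<And>y. y \<in> U \<Longrightarrow> u y = v y" and v: "C1_bounded U v"
  shows "C1_bounded U u"
proof -
  have g: "gradient u x = gradient v x" "u differentiable (at x)" if "x \<in> U" for x
    using gradient_cong[OF U that uv] v that by (auto simp: C1_bounded_def)
  have "continuous_on U (gradient u)"
    using v by (auto simp: C1_bounded_def g(1) cong: continuous_on_cong)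
  moreover have "gradient u ` U = gradient v ` U" using g(1) by (rule image_cong[OF refl])
  ultimately show ?thesis using v g(2) by (auto simp: C1_bounded_def)
qed

lemma C1_bounded_add:
  assumes "C1_bounded U u" "C1_bounded U v"
  shows "C1_bounded U (\<lambda>x. u x + v x)" "C1_bounded U (\<lambda>x. u x - v x)"
    "x \<in> U \<Longrightarrow> gradient (\<lambda>x. u x + v x) x = gradient u x + gradient v x"
    "x \<in> U \<Longrightarrow> gradient (\<lambda>x. u x - v x) x = gradient u x - gradient v x"
proof -
  have d: "u differentiable (at x)" "v differentiable (at x)" if "x \<in> U" for x
    using assms that by (auto simp: C1_bounded_def)
  have g1: "gradient (\<lambda>x. u x + v x) x = gradient u x + gradient v x" if "x \<in> U" for x
    by (rule gradient_add[OF d[OF that]])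
  have g2: "gradient (\<lambda>x. u x - v x) x = gradient u x - gradient v x" if "x \<in> U" for x
    using has_derivative_gradient[OF has_derivative_diff[OF d[OF that, unfolded frechet_derivative_works]]]
    by (simp add: gradient_nth vec_eq_iff)
  obtain B1 where "\<forall>p\<in>gradient u ` U. norm p \<le> B1"
    using assms(1) unfolding C1_bounded_def bounded_iff by blast
  moreover obtain B2 where "\<forall>p\<in>gradient v ` U. norm p \<le> B2"
    using assms(2) unfolding C1_bounded_def bounded_iff by blast
  ultimately have B: "norm (gradient u x) \<le> B1" "norm (gradient v x) \<le> B2" if "x \<in> U" for x
    using that by simp_all
  have c: "continuous_on U (gradient u)" "continuous_on U (gradient v)" using assms by (auto simp: C1_bounded_def)
  have c1: "continuous_on U (gradient (\<lambda>x. u x + v x))"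
    by (rule continuous_on_eq[OF continuous_on_add[OF c]]) (simp add: g1)
  have c2: "continuous_on U (gradient (\<lambda>x. u x - v x))"
    by (rule continuous_on_eq[OF continuous_on_diff[OF c]]) (simp add: g2)
  have b1: "bounded (gradient (\<lambda>x. u x + v x) ` U)"
    unfolding bounded_iff using B by (auto simp: g1 intro!: exI[of _ "B1 + B2"] norm_triangle_mono)
  have "norm (gradient u x - gradient v x) \<le> B1 + B2" if "x \<in> U" for x
    using norm_triangle_ineq4[of "gradient u x" "gradient v x"] B[OF that] by linarith
  then have b2: "bounded (gradient (\<lambda>x. u x - v x) ` U)"
    unfolding bounded_iff by (auto simp: g2)
  show "C1_bounded U (\<lambda>x. u x + v x)" unfolding C1_bounded_def using d c1 b1 by (auto intro: differentiable_add)
  show "C1_bounded U (\<lambda>x. u x - v x)" unfolding C1_bounded_def using d c2 b2 by (auto intro: differentiable_diff)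
  show "x \<in> U \<Longrightarrow> gradient (\<lambda>x. u x + v x) x = gradient u x + gradient v x"
    "x \<in> U \<Longrightarrow> gradient (\<lambda>x. u x - v x) x = gradient u x - gradient v x"
    using g1 g2 by auto
qed

lemma C1_bounded_test_function:
  assumes "test_function V \<phi>" shows "C1_bounded U \<phi>"
  by (rule C1_bounded_subset[of UNIV])
    (use test_function_piecewise_C1[OF assms] in \<open>auto simp: piecewise_C1_def C1_bounded_def\<close>)

lemma C1_bounded_L2:
  assumes "C1_bounded U u" "open U" "bounded U"
  shows "gradient u \<in> L2 U"
proof -
  obtain B where B: "\<And>x. x \<in> U \<Longrightarrow> norm (gradient u x) \<le> B"
    using assms unfolding C1_bounded_def bounded_iff by blast
  have m: "gradient u \<in> borel_measurable (lebesgue_on U)"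
    using assms by (intro continuous_imp_measurable_on_sets_lebesgue) (auto simp: C1_bounded_def)
  have "emeasure lebesgue U < \<infinity>"
    using emeasure_bounded_finite[OF assms(3)] assms(2) by (simp add: emeasure_completion borel_open)
  then have c: "integrable (lebesgue_on U) (\<lambda>x. 1 :: real)"
    using assms(2) by (subst integrable_restrict_space) (auto simp: integrable_real_indicator)
  have "(\<lambda>x. 1 :: real) \<in> L2 U" using c by (simp add: L2_def)
  from L2_dominated(1)[OF this m, of "\<bar>B\<bar>"] B show ?thesis
    by (force intro!: AE_I2)
qed

lemma continuous_on_jacobian:
  fixes f :: "real^'n::finite \<Rightarrow> real^'n"
  assumes "Ck_on 1 S f"
  shows "\<And>x. x \<in> S \<Longrightarrow> f differentiable (at x)" "continuous_on S (\<lambda>x. jacobian f (at x))"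
proof -
  have *: "Ck_on (Suc 0) S f" using assms by simp
  show "\<And>x. x \<in> S \<Longrightarrow> f differentiable (at x)" using * by simp
  have "continuous_on S (\<lambda>x. frechet_derivative f (at x) (axis j 1) $ i)" for i j
    using * by (intro continuous_on_component) (auto simp: axis_in_Basis_iff)
  then show "continuous_on S (\<lambda>x. jacobian f (at x))"
    unfolding jacobian_def matrix_def by (intro continuous_on_vec_lambda)
qed

lemma compact_positive_bounds:
  fixes f :: "'a::topological_space \<Rightarrow> real"
  assumes "compact K" "continuous_on K f" "\<And>x. x \<in> K \<Longrightarrow> f x > 0"
  obtains m M where "m > 0" "M > 0" "\<And>x. x \<in> K \<Longrightarrow> m \<le> f x" "\<And>x. x \<in> K \<Longrightarrow> f x \<le> M"
proof (cases "K = {}")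
  case True
  then show ?thesis using that[of 1 1] by simp
next
  case False
  obtain a where a: "a \<in> K" "\<forall>x\<in>K. f a \<le> f x"
    using continuous_attains_inf[OF assms(1) False assms(2)] by blast
  obtain b where b: "b \<in> K" "\<forall>x\<in>K. f x \<le> f b"
    using continuous_attains_sup[OF assms(1) False assms(2)] by blast
  show ?thesis using that[of "f a" "f b"] a b assms(3) by blast
qed

lemma norm_pullback: "(norm (pullback J p))\<^sup>2 =
    (norm (transpose J *v (\<chi> i. Re (p $ i))))\<^sup>2 + (norm (transpose J *v (\<chi> i. Im (p $ i))))\<^sup>2"
  unfolding norm_Re_Im_vec[of "pullback J p"] pullback_Re_Im ..

lemma continuous_on_pullback:
  "continuous_on S J \<Longrightarrow> continuous_on S p \<Longrightarrow> continuous_on S (\<lambda>x. pullback (J x) (p x))"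
  unfolding pullback_def
  by (intro continuous_on_vec_lambda continuous_on_sum continuous_on_mult continuous_on_of_real continuous_on_component)

text \<open>Regularity and injectivity are required on the compact closure of \<open>S\<close>. Then the Jacobian is bounded from above and
  from below, and composition with \<open>\<Phi>\<close> and with its inverse is bounded on gradients in \<open>L\<^sup>2\<close>.\<close>

locale diffeo_piece =
  fixes S T :: "(real^'n::finite) set" and \<Phi> :: "real^'n \<Rightarrow> real^'n"
  assumes dim: "CARD('n) = 2 \<or> CARD('n) = 3"
    and diffeo: "C1_diffeo S T \<Phi>"
    and bounded_S: "bounded S"
    and inj: "inj_on \<Phi> (closure S)"
    and diff: "\<And>x. x \<in> closure S \<Longrightarrow> \<Phi> differentiable (at x)"
    and cont_jac: "continuous_on (closure S) (\<lambda>x. jacobian \<Phi> (at x))"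
    and det: "\<And>x. x \<in> closure S \<Longrightarrow> det (jacobian \<Phi> (at x)) \<noteq> 0"
begin

text \<open>The inverse is formed on the closure, so that it is continuous up to the boundary of \<open>T\<close>.\<close>

definition \<Psi> where "\<Psi> = inv_into (closure S) \<Phi>"

lemma open_S: "open S" and open_T: "open T" and image_S: "\<Phi> ` S = T"
  using diffeo by (auto simp: C1_diffeo_def homeomorphism_def)

lemma compact_closure_S: "compact (closure S)"
  using bounded_S by (simp add: compact_closure)

lemma cont: "continuous_on (closure S) \<Phi>"
  using diff by (meson continuous_at_imp_continuous_on differentiable_imp_continuous_within)

lemma \<Psi>_\<Phi>: "x \<in> closure S \<Longrightarrow> \<Psi> (\<Phi> x) = x"
  unfolding \<Psi>_def by (rule inv_into_f_f[OF inj])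

lemma \<Psi>_T: "y \<in> T \<Longrightarrow> \<Psi> y \<in> S" and \<Phi>_\<Psi>: "y \<in> T \<Longrightarrow> \<Phi> (\<Psi> y) = y"
proof -
  assume "y \<in> T"
  then obtain x where x: "x \<in> S" "y = \<Phi> x" using image_S by blast
  then have "\<Psi> y = x" using \<Psi>_\<Phi> closure_subset by blast
  with x show "\<Psi> y \<in> S" "\<Phi> (\<Psi> y) = y" by auto
qed

lemma cont_\<Psi>: "continuous_on (\<Phi> ` closure S) \<Psi>"
  by (rule continuous_on_inv[OF cont compact_closure_S]) (simp add: \<Psi>_\<Phi>)

lemma bounded_T: "bounded T"
  using compact_imp_bounded[OF compact_continuous_image[OF cont compact_closure_S]] image_S closure_subset
  by (metis bounded_subset image_mono)

lemma \<Psi>_regular: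
  shows "\<And>y. y \<in> T \<Longrightarrow> \<Psi> differentiable (at y)" "continuous_on T (\<lambda>y. jacobian \<Psi> (at y))"
proof -
  obtain g where g: "homeomorphism S T \<Phi> g" "Ck_on 1 T g" using diffeo by (auto simp: C1_diffeo_def)
  have eq: "\<Psi> y = g y" if "y \<in> T" for y
  proof -
    have "g y \<in> S" "\<Phi> (g y) = y" using g(1) that by (auto simp: homeomorphism_def)
    then show ?thesis using \<Psi>_\<Phi>[of "g y"] closure_subset by auto
  qed
  have d: "(\<Psi> has_derivative frechet_derivative g (at y)) (at y)" if "y \<in> T" for y
    by (rule has_derivative_transform_within_open[OF _ open_T that])
      (use continuous_on_jacobian(1)[OF g(2) that] eq in \<open>auto simp: frechet_derivative_works\<close>)
  show "\<Psi> differentiable (at y)" if "y \<in> T" for y using d[OF that] by (rule differentiableI)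
  have "jacobian \<Psi> (at y) = jacobian g (at y)" if "y \<in> T" for y
    using frechet_derivative_eqI[OF d[OF that]] by (simp add: jacobian_def)
  then show "continuous_on T (\<lambda>y. jacobian \<Psi> (at y))"
    by (intro continuous_on_eq[OF continuous_on_jacobian(2)[OF g(2)]]) simp
qed

text \<open>Compactness of the closure makes the Jacobian uniformly invertible.\<close>

lemma jacobian_bounds:
  obtains m M where "m > 0" "M > 0"
    "\<And>x. x \<in> closure S \<Longrightarrow> m \<le> \<bar>det (jacobian \<Phi> (at x))\<bar>"
    "\<And>x. x \<in> closure S \<Longrightarrow> \<bar>det (jacobian \<Phi> (at x))\<bar> \<le> M"
    "\<And>x \<xi>. x \<in> closure S \<Longrightarrow> m * (norm \<xi>)\<^sup>2 \<le> (norm (transpose (jacobian \<Phi> (at x)) *v \<xi>))\<^sup>2"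
    "\<And>x \<xi>. x \<in> closure S \<Longrightarrow> (norm (transpose (jacobian \<Phi> (at x)) *v \<xi>))\<^sup>2 \<le> M * (norm \<xi>)\<^sup>2"
proof -
  let ?J = "\<lambda>x. jacobian \<Phi> (at x)"
  have c: "continuous_on (closure S) (\<lambda>x. ?J x $ i $ j)" for i j
    by (intro continuous_on_component cont_jac)
  have "continuous_on (closure S) (\<lambda>x. \<bar>det (?J x)\<bar>)"
    unfolding det_def by (intro continuous_intros c)
  then obtain m1 M1 where 1: "m1 > 0" "M1 > 0" "\<And>x. x \<in> closure S \<Longrightarrow> m1 \<le> \<bar>det (?J x)\<bar>"
      "\<And>x. x \<in> closure S \<Longrightarrow> \<bar>det (?J x)\<bar> \<le> M1"
    by (rule compact_positive_bounds[OF compact_closure_S]) (use det in auto)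
  let ?f = "\<lambda>w. (norm (transpose (?J (fst w)) *v snd w))\<^sup>2"
  have "continuous_on (closure S \<times> sphere 0 1) (\<lambda>w. transpose (?J (fst w)) *v snd w)"
    unfolding matrix_vector_mult_def transpose_def
    by (simp, intro continuous_on_vec_lambda continuous_on_sum continuous_on_mult
        continuous_on_component[OF continuous_on_snd[OF continuous_on_id]]
        continuous_on_compose2[OF c continuous_on_fst[OF continuous_on_id]]) auto
  then have cf: "continuous_on (closure S \<times> sphere 0 1) ?f" by (intro continuous_intros)
  have pf: "?f w > 0" if "w \<in> closure S \<times> sphere 0 1" for w
  proof -
    have w: "fst w \<in> closure S" "norm (snd w) = 1" using that by (auto simp: mem_Times_iff)
    have "invertible (transpose (?J (fst w)))" using det[OF w(1)] by (simp add: invertible_det_nz)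
    then have "inj ((*v) (transpose (?J (fst w))))" by (rule inj_matrix_vector_mult)
    from injD[OF this, of "snd w" 0] w(2)
    have "transpose (?J (fst w)) *v snd w \<noteq> 0" by auto
    then show ?thesis by simp
  qed
  obtain m2 M2 where 2: "m2 > 0" "M2 > 0" "\<And>w. w \<in> closure S \<times> sphere 0 1 \<Longrightarrow> m2 \<le> ?f w"
      "\<And>w. w \<in> closure S \<times> sphere 0 1 \<Longrightarrow> ?f w \<le> M2"
    by (rule compact_positive_bounds[OF compact_Times[OF compact_closure_S compact_sphere] cf pf]) auto
  have 3: "m2 * (norm \<xi>)\<^sup>2 \<le> (norm (transpose (?J x) *v \<xi>))\<^sup>2" "(norm (transpose (?J x) *v \<xi>))\<^sup>2 \<le> M2 * (norm \<xi>)\<^sup>2"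
    if "x \<in> closure S" for x \<xi>
  proof -
    define \<zeta> where "\<zeta> = (if \<xi> = 0 then axis undefined 1 else (1 / norm \<xi>) *\<^sub>R \<xi>)"
    have \<zeta>: "\<zeta> \<in> sphere 0 1" by (auto simp: \<zeta>_def norm_axis_1)
    have "\<xi> = norm \<xi> *\<^sub>R \<zeta>" by (simp add: \<zeta>_def)
    then have "transpose (?J x) *v \<xi> = norm \<xi> *\<^sub>R (transpose (?J x) *v \<zeta>)"
      by (metis matrix_vector_mult_scaleR)
    then have n: "(norm (transpose (?J x) *v \<xi>))\<^sup>2 = (norm \<xi>)\<^sup>2 * ?f (x, \<zeta>)"
      by (simp add: power_mult_distrib)
    show "m2 * (norm \<xi>)\<^sup>2 \<le> (norm (transpose (?J x) *v \<xi>))\<^sup>2" "(norm (transpose (?J x) *v \<xi>))\<^sup>2 \<le> M2 * (norm \<xi>)\<^sup>2"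
      unfolding n using 2(3,4)[of "(x, \<zeta>)"] \<zeta> that
        mult_left_mono[of m2 "?f (x, \<zeta>)" "(norm \<xi>)\<^sup>2"] mult_left_mono[of "?f (x, \<zeta>)" M2 "(norm \<xi>)\<^sup>2"]
      by (auto simp: mult.commute)
  qed
  show ?thesis
  proof (rule that[of "min m1 m2" "max M1 M2"])
    fix x assume x: "x \<in> closure S"
    show "min m1 m2 \<le> \<bar>det (?J x)\<bar>" "\<bar>det (?J x)\<bar> \<le> max M1 M2"
      using 1(3,4)[OF x] by auto
    fix \<xi> :: "real^'n"
    have "min m1 m2 * (norm \<xi>)\<^sup>2 \<le> m2 * (norm \<xi>)\<^sup>2" "M2 * (norm \<xi>)\<^sup>2 \<le> max M1 M2 * (norm \<xi>)\<^sup>2"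
      by (intro mult_right_mono; simp)+
    with 3[OF x, of \<xi>]
    show "min m1 m2 * (norm \<xi>)\<^sup>2 \<le> (norm (transpose (?J x) *v \<xi>))\<^sup>2"
      "(norm (transpose (?J x) *v \<xi>))\<^sup>2 \<le> max M1 M2 * (norm \<xi>)\<^sup>2" by linarith+
  qed (use 1 2 in auto)
qed

lemma pullback_bounds:
  obtains m M where "m > 0" "M > 0"
    "\<And>x. x \<in> closure S \<Longrightarrow> m \<le> \<bar>det (jacobian \<Phi> (at x))\<bar>"
    "\<And>x. x \<in> closure S \<Longrightarrow> \<bar>det (jacobian \<Phi> (at x))\<bar> \<le> M"
    "\<And>x p. x \<in> closure S \<Longrightarrow> m * (norm p)\<^sup>2 \<le> (norm (pullback (jacobian \<Phi> (at x)) p))\<^sup>2"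
    "\<And>x p. x \<in> closure S \<Longrightarrow> (norm (pullback (jacobian \<Phi> (at x)) p))\<^sup>2 \<le> M * (norm p)\<^sup>2"
proof -
  obtain m M where mM: "m > 0" "M > 0"
    "\<And>x. x \<in> closure S \<Longrightarrow> m \<le> \<bar>det (jacobian \<Phi> (at x))\<bar>"
    "\<And>x. x \<in> closure S \<Longrightarrow> \<bar>det (jacobian \<Phi> (at x))\<bar> \<le> M"
    "\<And>x \<xi>. x \<in> closure S \<Longrightarrow> m * (norm \<xi>)\<^sup>2 \<le> (norm (transpose (jacobian \<Phi> (at x)) *v \<xi>))\<^sup>2"
    "\<And>x \<xi>. x \<in> closure S \<Longrightarrow> (norm (transpose (jacobian \<Phi> (at x)) *v \<xi>))\<^sup>2 \<le> M * (norm \<xi>)\<^sup>2"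
    by (rule jacobian_bounds) blast
  show ?thesis
  proof (rule that[OF mM(1-4)])
    fix x and p :: "complex^'n" assume x: "x \<in> closure S"
    show "m * (norm p)\<^sup>2 \<le> (norm (pullback (jacobian \<Phi> (at x)) p))\<^sup>2"
      "(norm (pullback (jacobian \<Phi> (at x)) p))\<^sup>2 \<le> M * (norm p)\<^sup>2"
      unfolding norm_pullback norm_Re_Im_vec[of p] distrib_left by (intro add_mono mM(5,6)[OF x])+
  qed auto
qed

lemma C1_bounded_compose:
  assumes u: "C1_bounded T u"
  shows "C1_bounded S (\<lambda>x. u (\<Phi> x))"
    "\<And>x. x \<in> S \<Longrightarrow> gradient (\<lambda>x. u (\<Phi> x)) x = pullback (jacobian \<Phi> (at x)) (gradient u (\<Phi> x))"
proof -
  have xT: "\<Phi> x \<in> T" if "x \<in> S" for x using image_S that by blast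
  have dS: "\<Phi> differentiable (at x)" if "x \<in> S" for x using diff closure_subset that by blast
  have du: "u differentiable (at (\<Phi> x))" if "x \<in> S" for x using u xT[OF that] by (auto simp: C1_bounded_def)
  show g: "gradient (\<lambda>x. u (\<Phi> x)) x = pullback (jacobian \<Phi> (at x)) (gradient u (\<Phi> x))" if "x \<in> S" for x
    by (rule gradient_compose(1)[OF dS du]) (use that in auto)
  obtain m M where M: "M > 0" "\<And>x p. x \<in> closure S \<Longrightarrow> (norm (pullback (jacobian \<Phi> (at x)) p))\<^sup>2 \<le> M * (norm p)\<^sup>2"
    by (rule pullback_bounds) blast
  obtain B where B: "\<And>y. y \<in> T \<Longrightarrow> norm (gradient u y) \<le> B"
    using u unfolding C1_bounded_def bounded_iff by blast
  have "norm (gradient (\<lambda>x. u (\<Phi> x)) x) \<le> sqrt (M * B\<^sup>2)" if x: "x \<in> S" for x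
  proof -
    have "x \<in> closure S" using x closure_subset by blast
    from M(2)[OF this, of "gradient u (\<Phi> x)"]
    have "(norm (gradient (\<lambda>x. u (\<Phi> x)) x))\<^sup>2 \<le> M * (norm (gradient u (\<Phi> x)))\<^sup>2" unfolding g[OF x] .
    also have "\<dots> \<le> M * B\<^sup>2" using B[OF xT[OF x]] M(1) by (intro mult_left_mono power_mono) auto
    finally show ?thesis by (rule real_le_rsqrt)
  qed
  then have b: "bounded (gradient (\<lambda>x. u (\<Phi> x)) ` S)" unfolding bounded_iff by blast
  have "continuous_on S (\<lambda>x. gradient u (\<Phi> x))"
    by (rule continuous_on_compose2[of T "gradient u"])
      (use u xT continuous_on_subset[OF cont closure_subset] in \<open>auto simp: C1_bounded_def\<close>)
  then have "continuous_on S (\<lambda>x. pullback (jacobian \<Phi> (at x)) (gradient u (\<Phi> x)))"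
    by (rule continuous_on_pullback[OF continuous_on_subset[OF cont_jac closure_subset]])
  then have "continuous_on S (gradient (\<lambda>x. u (\<Phi> x)))" by (rule continuous_on_eq) (simp add: g)
  with b gradient_compose(2)[OF dS du] show "C1_bounded S (\<lambda>x. u (\<Phi> x))" by (auto simp: C1_bounded_def)
qed

lemma C1_bounded_compose_inverse:
  assumes v: "C1_bounded S v"
  shows "C1_bounded T (\<lambda>y. v (\<Psi> y))"
    "\<And>x. x \<in> S \<Longrightarrow> gradient v x = pullback (jacobian \<Phi> (at x)) (gradient (\<lambda>y. v (\<Psi> y)) (\<Phi> x))"
proof -
  have dT: "\<Psi> differentiable (at y)" if "y \<in> T" for y by (rule \<Psi>_regular(1)[OF that])
  have dv: "v differentiable (at (\<Psi> y))" if "y \<in> T" for y using v \<Psi>_T[OF that] by (auto simp: C1_bounded_def)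
  have d: "(\<lambda>y. v (\<Psi> y)) differentiable (at y)" if "y \<in> T" for y
    by (rule gradient_compose(2)[OF dT dv]) (use that in auto)
  have g: "gradient (\<lambda>y. v (\<Psi> y)) y = pullback (jacobian \<Psi> (at y)) (gradient v (\<Psi> y))" if "y \<in> T" for y
    by (rule gradient_compose(1)[OF dT dv]) (use that in auto)
  have "continuous_on T \<Psi>" using dT by (meson continuous_at_imp_continuous_on differentiable_imp_continuous_within)
  then have "continuous_on T (\<lambda>y. gradient v (\<Psi> y))"
    by (rule continuous_on_compose2[of S "gradient v", rotated]) (use v \<Psi>_T in \<open>auto simp: C1_bounded_def\<close>)
  then have "continuous_on T (\<lambda>y. pullback (jacobian \<Psi> (at y)) (gradient v (\<Psi> y)))"
    by (rule continuous_on_pullback[OF \<Psi>_regular(2)])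
  then have c: "continuous_on T (gradient (\<lambda>y. v (\<Psi> y)))" by (rule continuous_on_eq) (simp add: g)
  show pb: "gradient v x = pullback (jacobian \<Phi> (at x)) (gradient (\<lambda>y. v (\<Psi> y)) (\<Phi> x))" if x: "x \<in> S" for x
  proof -
    have xT: "\<Phi> x \<in> T" using image_S x by blast
    have dx: "\<Phi> differentiable (at x)" using diff closure_subset x by blast
    have e: "v y = v (\<Psi> (\<Phi> y))" if "y \<in> S" for y using \<Psi>_\<Phi> that closure_subset by (metis subsetD)
    have "gradient v x = gradient (\<lambda>x. v (\<Psi> (\<Phi> x))) x"
      by (rule gradient_cong(1)[OF open_S x e gradient_compose(2)[OF dx d[OF xT]]])
    also have "\<dots> = pullback (jacobian \<Phi> (at x)) (gradient (\<lambda>y. v (\<Psi> y)) (\<Phi> x))"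
      by (rule gradient_compose(1)[OF dx d[OF xT]])
    finally show ?thesis .
  qed
  obtain m M where m: "m > 0" "\<And>x p. x \<in> closure S \<Longrightarrow> m * (norm p)\<^sup>2 \<le> (norm (pullback (jacobian \<Phi> (at x)) p))\<^sup>2"
    by (rule pullback_bounds) blast
  obtain B where B: "\<And>x. x \<in> S \<Longrightarrow> norm (gradient v x) \<le> B"
    using v unfolding C1_bounded_def bounded_iff by blast
  have "norm (gradient (\<lambda>y. v (\<Psi> y)) y) \<le> sqrt (B\<^sup>2 / m)" if y: "y \<in> T" for y
  proof -
    let ?x = "\<Psi> y"
    have x: "?x \<in> S" "\<Phi> ?x = y" using \<Psi>_T \<Phi>_\<Psi> y by auto
    then have "?x \<in> closure S" using closure_subset by blast
    moreover have "pullback (jacobian \<Phi> (at ?x)) (gradient (\<lambda>y. v (\<Psi> y)) y) = gradient v ?x"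
      using pb[OF x(1)] unfolding x(2) by (rule sym)
    ultimately have "m * (norm (gradient (\<lambda>y. v (\<Psi> y)) y))\<^sup>2 \<le> (norm (gradient v ?x))\<^sup>2"
      using m(2)[of ?x "gradient (\<lambda>y. v (\<Psi> y)) y"] by simp
    also have "\<dots> \<le> B\<^sup>2" using B[OF x(1)] by (intro power_mono) auto
    finally have "(norm (gradient (\<lambda>y. v (\<Psi> y)) y))\<^sup>2 \<le> B\<^sup>2 / m" using m(1) by (simp add: field_simps)
    then show ?thesis by (rule real_le_rsqrt)
  qed
  then have "bounded (gradient (\<lambda>y. v (\<Psi> y)) ` T)" unfolding bounded_iff by blast
  with c d show "C1_bounded T (\<lambda>y. v (\<Psi> y))" by (auto simp: C1_bounded_def)
qed

end

section \<open>Invariance of energies under diffeomorphisms\<close>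

lemma negligible_AE:
  fixes U :: "'a::euclidean_space set"
  assumes "U \<in> sets lebesgue"
  shows "(AE x in lebesgue_on U. P x) \<longleftrightarrow> negligible {x \<in> U. \<not> P x}"
proof -
  have "(AE x in lebesgue_on U. P x) \<longleftrightarrow> (AE x in lebesgue. x \<in> U \<longrightarrow> P x)"
    using assms by (simp add: AE_restrict_space_iff)
  also have "\<dots> \<longleftrightarrow> {x. \<not> (x \<in> U \<longrightarrow> P x)} \<in> null_sets lebesgue"
    by (simp add: completion.AE_iff_null_sets)
  also have "{x. \<not> (x \<in> U \<longrightarrow> P x)} = {x \<in> U. \<not> P x}" by auto
  finally show ?thesis by (simp add: negligible_iff_null_sets)
qed

lemma integrable_lebesgue_on_iff:
  fixes f :: "'a::euclidean_space \<Rightarrow> 'b::euclidean_space"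
  assumes "U \<in> sets lebesgue"
  shows "integrable (lebesgue_on U) f \<longleftrightarrow> f absolutely_integrable_on U"
  using assms by (simp add: set_integrable_def integrable_restrict_space)

lemma integrable_cong_AE_lebesgue_on:
  fixes f g :: "'a::euclidean_space \<Rightarrow> 'b::euclidean_space"
  assumes U: "U \<in> sets lebesgue" and f: "integrable (lebesgue_on U) f" and ae: "AE x in lebesgue_on U. f x = g x"
  shows "integrable (lebesgue_on U) g" "(LINT x|lebesgue_on U. g x) = (LINT x|lebesgue_on U. f x)"
proof -
  have n: "negligible {x \<in> U. f x \<noteq> g x}" using ae negligible_AE[OF U, of "\<lambda>x. f x = g x"] by simp
  have "g absolutely_integrable_on U"
    by (rule absolutely_integrable_spike[OF f[unfolded integrable_lebesgue_on_iff[OF U]] n]) auto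
  then show g: "integrable (lebesgue_on U) g" using integrable_lebesgue_on_iff[OF U] by blast
  show "(LINT x|lebesgue_on U. g x) = (LINT x|lebesgue_on U. f x)"
    by (rule integral_cong_AE) (use f g ae in \<open>auto intro: borel_measurable_integrable\<close>)
qed

context diffeo_piece
begin

lemma pushforward_eq:
  assumes "x \<in> S"
  shows "pushforward S \<Phi> A (\<Phi> x) =
    (1 / \<bar>det (jacobian \<Phi> (at x))\<bar>) *\<^sub>R (jacobian \<Phi> (at x) ** A x ** transpose (jacobian \<Phi> (at x)))"
proof -
  have "inv_into S \<Phi> (\<Phi> x) = x"
    by (rule inv_into_f_f[OF inj_on_subset[OF inj closure_subset] assms])
  then show ?thesis by (simp add: pushforward_def Let_def)
qed

lemma change_of_variables:
  fixes f :: "real^'n \<Rightarrow> complex"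
  assumes "integrable (lebesgue_on T) f"
  shows "integrable (lebesgue_on S) (\<lambda>x. \<bar>det (jacobian \<Phi> (at x))\<bar> *\<^sub>R f (\<Phi> x))"
    "(LINT x|lebesgue_on S. \<bar>det (jacobian \<Phi> (at x))\<bar> *\<^sub>R f (\<Phi> x)) = (LINT y|lebesgue_on T. f y)"
proof -
  have d: "(\<Phi> has_derivative frechet_derivative \<Phi> (at x)) (at x)" if "x \<in> S" for x
    using diff closure_subset that frechet_derivative_works by blast
  have "inj_on \<Phi> S" by (rule inj_on_subset[OF inj closure_subset])
  from change_of_variables_complex[OF dim open_S bounded_S _ _ d this] image_S open_T bounded_T assms
  show "integrable (lebesgue_on S) (\<lambda>x. \<bar>det (jacobian \<Phi> (at x))\<bar> *\<^sub>R f (\<Phi> x))"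
    "(LINT x|lebesgue_on S. \<bar>det (jacobian \<Phi> (at x))\<bar> *\<^sub>R f (\<Phi> x)) = (LINT y|lebesgue_on T. f y)"
    unfolding jacobian_def by simp_all
qed

text \<open>Invariance of the energy: chain rule, transformation law of the medium, and change of variables.\<close>

lemma transform_pairing:
  assumes u: "C1_bounded T u" and w: "C1_bounded T w"
    and B: "AE y in lebesgue_on T. pushforward S \<Phi> A y = B y"
    and i: "integrable (lebesgue_on T) (\<lambda>y. pairing (B y) (gradient u y) (gradient w y))"
  shows "(LINT x|lebesgue_on S. pairing (A x) (gradient (\<lambda>x. u (\<Phi> x)) x) (gradient (\<lambda>x. w (\<Phi> x)) x)) =
    (LINT y|lebesgue_on T. pairing (B y) (gradient u y) (gradient w y))"
proof -
  have T: "T \<in> sets lebesgue" using open_T by simp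
  define f where "f y = pairing (pushforward S \<Phi> A y) (gradient u y) (gradient w y)" for y
  have "AE y in lebesgue_on T. pairing (B y) (gradient u y) (gradient w y) = f y"
    using B by eventually_elim (simp add: f_def)
  note f = integrable_cong_AE_lebesgue_on[OF T i this]
  have "(LINT x|lebesgue_on S. pairing (A x) (gradient (\<lambda>x. u (\<Phi> x)) x) (gradient (\<lambda>x. w (\<Phi> x)) x)) =
      (LINT x|lebesgue_on S. \<bar>det (jacobian \<Phi> (at x))\<bar> *\<^sub>R f (\<Phi> x))"
  proof (rule Bochner_Integration.integral_cong[OF refl])
    fix x assume "x \<in> space (lebesgue_on S)"
    then have x: "x \<in> S" using open_S by simp
    then have "det (jacobian \<Phi> (at x)) \<noteq> 0" using det closure_subset by blast
    then show "pairing (A x) (gradient (\<lambda>x. u (\<Phi> x)) x) (gradient (\<lambda>x. w (\<Phi> x)) x) =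
        \<bar>det (jacobian \<Phi> (at x))\<bar> *\<^sub>R f (\<Phi> x)"
      unfolding f_def pushforward_eq[OF x] pairing_pushforward C1_bounded_compose(2)[OF u x]
        C1_bounded_compose(2)[OF w x] by (simp add: scaleR_conv_of_real)
  qed
  also have "\<dots> = (LINT y|lebesgue_on T. f y)" by (rule change_of_variables(2)[OF f(1)])
  finally show ?thesis using f(2) by simp
qed

lemma gradient_norm_bounds:
  obtains C where "C \<ge> 0"
    "\<And>u. C1_bounded T u \<Longrightarrow> L2_norm S (gradient (\<lambda>x. u (\<Phi> x))) \<le> C * L2_norm T (gradient u)"
    "\<And>v. C1_bounded S v \<Longrightarrow> L2_norm T (gradient (\<lambda>y. v (\<Psi> y))) \<le> C * L2_norm S (gradient v)"
proof -
  obtain m M where m: "m > 0" "M > 0"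
    "\<And>x. x \<in> closure S \<Longrightarrow> m \<le> \<bar>det (jacobian \<Phi> (at x))\<bar>"
    "\<And>x. x \<in> closure S \<Longrightarrow> \<bar>det (jacobian \<Phi> (at x))\<bar> \<le> M"
    "\<And>x p. x \<in> closure S \<Longrightarrow> m * (norm p)\<^sup>2 \<le> (norm (pullback (jacobian \<Phi> (at x)) p))\<^sup>2"
    "\<And>x p. x \<in> closure S \<Longrightarrow> (norm (pullback (jacobian \<Phi> (at x)) p))\<^sup>2 \<le> M * (norm p)\<^sup>2"
    by (rule pullback_bounds) blast
  have det_int: "integrable (lebesgue_on S) (\<lambda>x. \<bar>det (jacobian \<Phi> (at x))\<bar> * (norm (p (\<Phi> x)))\<^sup>2)"
    "(LINT x|lebesgue_on S. \<bar>det (jacobian \<Phi> (at x))\<bar> * (norm (p (\<Phi> x)))\<^sup>2) = (L2_norm T p)\<^sup>2"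
    if "p \<in> L2 T" for p :: "real^'n \<Rightarrow> complex^'n"
  proof -
    have "integrable (lebesgue_on T) (\<lambda>y. complex_of_real ((norm (p y))\<^sup>2))"
      using L2_integrable[OF that] by (rule integrable_of_real)
    note cv = change_of_variables[OF this]
    have e: "\<bar>det (jacobian \<Phi> (at x))\<bar> *\<^sub>R complex_of_real ((norm (p (\<Phi> x)))\<^sup>2) =
        complex_of_real (\<bar>det (jacobian \<Phi> (at x))\<bar> * (norm (p (\<Phi> x)))\<^sup>2)" for x
      by (simp add: scaleR_conv_of_real)
    have "integrable (lebesgue_on S) (\<lambda>x. complex_of_real (\<bar>det (jacobian \<Phi> (at x))\<bar> * (norm (p (\<Phi> x)))\<^sup>2))"
      using cv(1) unfolding e .
    then show "integrable (lebesgue_on S) (\<lambda>x. \<bar>det (jacobian \<Phi> (at x))\<bar> * (norm (p (\<Phi> x)))\<^sup>2)"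
      by (subst (asm) complex_of_real_integrable_eq)
    show "(LINT x|lebesgue_on S. \<bar>det (jacobian \<Phi> (at x))\<bar> * (norm (p (\<Phi> x)))\<^sup>2) = (L2_norm T p)\<^sup>2"
      using cv(2) unfolding e integral_complex_of_real L2_norm_square of_real_eq_iff .
  qed
  have S': "x \<in> closure S" if "x \<in> space (lebesgue_on S)" for x
    using that closure_subset[of S] by auto
  have "L2_norm S (gradient (\<lambda>x. u (\<Phi> x))) \<le> sqrt (M / m) * L2_norm T (gradient u)" if u: "C1_bounded T u" for u
  proof -
    note uT = C1_bounded_L2[OF u open_T bounded_T]
    note uS = C1_bounded_L2[OF C1_bounded_compose(1)[OF u] open_S bounded_S]
    have "(L2_norm S (gradient (\<lambda>x. u (\<Phi> x))))\<^sup>2 \<le> (LINT x|lebesgue_on S. (M / m) * (\<bar>det (jacobian \<Phi> (at x))\<bar> * (norm (gradient u (\<Phi> x)))\<^sup>2))"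
      unfolding L2_norm_square
    proof (rule integral_mono[OF L2_integrable[OF uS] integrable_mult_right[OF det_int(1)[OF uT]]])
      fix x assume x: "x \<in> space (lebesgue_on S)"
      then have xS: "x \<in> S" by simp
      note xc = S'[OF x]
      have "(norm (gradient (\<lambda>x. u (\<Phi> x)) x))\<^sup>2 \<le> M * (norm (gradient u (\<Phi> x)))\<^sup>2"
        unfolding C1_bounded_compose(2)[OF u xS] by (rule m(6)[OF xc])
      also have "\<dots> = (M / m) * (m * (norm (gradient u (\<Phi> x)))\<^sup>2)" using m(1) by simp
      also have "\<dots> \<le> (M / m) * (\<bar>det (jacobian \<Phi> (at x))\<bar> * (norm (gradient u (\<Phi> x)))\<^sup>2)"
        using m(1,2) m(3)[OF xc] by (intro mult_left_mono mult_right_mono) auto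
      finally show "(norm (gradient (\<lambda>x. u (\<Phi> x)) x))\<^sup>2 \<le> (M / m) * (\<bar>det (jacobian \<Phi> (at x))\<bar> * (norm (gradient u (\<Phi> x)))\<^sup>2)" .
    qed
    also have "\<dots> = (M / m) * (L2_norm T (gradient u))\<^sup>2"
      unfolding integral_mult_right_zero det_int(2)[OF uT] ..
    finally have "(L2_norm S (gradient (\<lambda>x. u (\<Phi> x))))\<^sup>2 \<le> (sqrt (M / m) * L2_norm T (gradient u))\<^sup>2"
      using m(1,2) by (simp add: power_mult_distrib)
    then show ?thesis by (rule power2_le_imp_le) (use m(1,2) in simp)
  qed
  moreover have "L2_norm T (gradient (\<lambda>y. v (\<Psi> y))) \<le> sqrt (M / m) * L2_norm S (gradient v)" if v: "C1_bounded S v" for v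
  proof -
    note vS = C1_bounded_L2[OF v open_S bounded_S]
    note vT = C1_bounded_L2[OF C1_bounded_compose_inverse(1)[OF v] open_T bounded_T]
    have "(L2_norm T (gradient (\<lambda>y. v (\<Psi> y))))\<^sup>2 = (LINT x|lebesgue_on S. \<bar>det (jacobian \<Phi> (at x))\<bar> * (norm (gradient (\<lambda>y. v (\<Psi> y)) (\<Phi> x)))\<^sup>2)"
      by (rule det_int(2)[OF vT, symmetric])
    also have "\<dots> \<le> (LINT x|lebesgue_on S. (M / m) * (norm (gradient v x))\<^sup>2)"
    proof (rule integral_mono[OF det_int(1)[OF vT] integrable_mult_right[OF L2_integrable[OF vS]]])
      fix x assume x: "x \<in> space (lebesgue_on S)"
      then have xS: "x \<in> S" by simp
      note xc = S'[OF x]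
      have "m * (norm (gradient (\<lambda>y. v (\<Psi> y)) (\<Phi> x)))\<^sup>2 \<le> (norm (gradient v x))\<^sup>2"
        unfolding C1_bounded_compose_inverse(2)[OF v xS] by (rule m(5)[OF xc])
      then have "(norm (gradient (\<lambda>y. v (\<Psi> y)) (\<Phi> x)))\<^sup>2 \<le> (norm (gradient v x))\<^sup>2 / m"
        using m(1) by (simp add: field_simps)
      then have "\<bar>det (jacobian \<Phi> (at x))\<bar> * (norm (gradient (\<lambda>y. v (\<Psi> y)) (\<Phi> x)))\<^sup>2 \<le> M * ((norm (gradient v x))\<^sup>2 / m)"
        using m(4)[OF xc] m(2) by (intro mult_mono) auto
      then show "\<bar>det (jacobian \<Phi> (at x))\<bar> * (norm (gradient (\<lambda>y. v (\<Psi> y)) (\<Phi> x)))\<^sup>2 \<le> (M / m) * (norm (gradient v x))\<^sup>2"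
        by simp
    qed
    also have "\<dots> = (M / m) * (L2_norm S (gradient v))\<^sup>2"
      unfolding integral_mult_right_zero L2_norm_square ..
    finally have "(L2_norm T (gradient (\<lambda>y. v (\<Psi> y))))\<^sup>2 \<le> (sqrt (M / m) * L2_norm S (gradient v))\<^sup>2"
      using m(1,2) by (simp add: power_mult_distrib)
    then show ?thesis by (rule power2_le_imp_le) (use m(1,2) in simp)
  qed
  ultimately show ?thesis by (intro that[of "sqrt (M / m)"]) (use m(1,2) in simp_all)
qed

lemma AE_transfer:
  assumes "AE x in lebesgue_on S. P x"
  shows "AE y in lebesgue_on T. P (\<Psi> y)"
proof -
  have S: "S \<in> sets lebesgue" and T: "T \<in> sets lebesgue" using open_S open_T by auto
  have n: "negligible {x \<in> S. \<not> P x}" using assms negligible_AE[OF S] by blast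
  have "\<Phi> differentiable_on {x \<in> S. \<not> P x}"
    unfolding differentiable_on_def using diff closure_subset by (blast intro: differentiable_at_withinI)
  from negligible_differentiable_image_negligible[OF order_refl n this]
  have "negligible (\<Phi> ` {x \<in> S. \<not> P x})" .
  moreover have "{y \<in> T. \<not> P (\<Psi> y)} \<subseteq> \<Phi> ` {x \<in> S. \<not> P x}"
  proof
    fix y assume "y \<in> {y \<in> T. \<not> P (\<Psi> y)}"
    then have "y = \<Phi> (\<Psi> y)" "\<Psi> y \<in> {x \<in> S. \<not> P x}" using \<Phi>_\<Psi> \<Psi>_T by auto
    then show "y \<in> \<Phi> ` {x \<in> S. \<not> P x}" by (rule image_eqI)
  qed
  ultimately have "negligible {y \<in> T. \<not> P (\<Psi> y)}" by (rule negligible_subset)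
  then show ?thesis using negligible_AE[OF T] by blast
qed

lemma measurable_compose_inverse:
  fixes A :: "real^'n \<Rightarrow> 'b::euclidean_space"
  assumes "A \<in> borel_measurable (lebesgue_on S)"
  shows "(\<lambda>y. A (\<Psi> y)) \<in> borel_measurable (lebesgue_on T)"
proof (rule measurableI)
  have S: "S \<in> sets lebesgue" and T: "T \<in> sets lebesgue" using open_S open_T by auto
  fix E :: "'b set" assume E: "E \<in> sets borel"
  have "A -` E \<inter> S \<in> sets (lebesgue_on S)"
    using measurable_sets[OF assms E] by simp
  then have l: "A -` E \<inter> S \<in> sets lebesgue"
    using S by (simp add: sets_restrict_space_iff)
  have "\<Phi> differentiable_on (A -` E \<inter> S)"
    unfolding differentiable_on_def using diff closure_subset by (blast intro: differentiable_at_withinI)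
  from differentiable_image_in_sets_lebesgue[OF l order_refl this]
  have "\<Phi> ` (A -` E \<inter> S) \<in> sets lebesgue" .
  moreover have "(\<lambda>y. A (\<Psi> y)) -` E \<inter> T = \<Phi> ` (A -` E \<inter> S)"
  proof (intro subset_antisym subsetI)
    fix y assume "y \<in> (\<lambda>y. A (\<Psi> y)) -` E \<inter> T"
    then have "y = \<Phi> (\<Psi> y)" "\<Psi> y \<in> A -` E \<inter> S" using \<Phi>_\<Psi> \<Psi>_T by auto
    then show "y \<in> \<Phi> ` (A -` E \<inter> S)" by (rule image_eqI)
  next
    fix y assume "y \<in> \<Phi> ` (A -` E \<inter> S)"
    then obtain x where x: "x \<in> S" "A x \<in> E" "y = \<Phi> x" by auto
    then have "\<Psi> y = x" using \<Psi>_\<Phi> closure_subset by blast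
    with x image_S show "y \<in> (\<lambda>y. A (\<Psi> y)) -` E \<inter> T" by auto
  qed
  ultimately show "(\<lambda>y. A (\<Psi> y)) -` E \<inter> space (lebesgue_on T) \<in> sets (lebesgue_on T)"
    using T by (auto simp: sets_restrict_space_iff)
qed simp

lemma pushforward_\<Psi>:
  assumes "y \<in> T"
  shows "pushforward S \<Phi> A y = (1 / \<bar>det (jacobian \<Phi> (at (\<Psi> y)))\<bar>) *\<^sub>R
    (jacobian \<Phi> (at (\<Psi> y)) ** A (\<Psi> y) ** transpose (jacobian \<Phi> (at (\<Psi> y))))"
  using pushforward_eq[OF \<Psi>_T[OF assms], of A] \<Phi>_\<Psi>[OF assms] by simp

lemma borel_measurable_matrixI:
  fixes B :: "'z \<Rightarrow> real^'n^'n"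
  assumes "\<And>i j. (\<lambda>y. B y $ i $ j) \<in> borel_measurable M"
  shows "B \<in> borel_measurable M"
proof (subst borel_measurable_euclidean_space, rule ballI)
  fix b :: "real^'n^'n" assume "b \<in> Basis"
  then obtain i j where "b = axis i (axis j 1)" by (auto simp: Basis_vec_def)
  then show "(\<lambda>y. B y \<bullet> b) \<in> borel_measurable M" using assms by (simp add: inner_axis)
qed

lemma measurable_matrix_entry:
  fixes B :: "'z \<Rightarrow> real^'n^'n"
  assumes "B \<in> borel_measurable M" shows "(\<lambda>y. B y $ i $ j) \<in> borel_measurable M"
proof -
  have "(\<lambda>m::real^'n^'n. m $ i $ j) \<in> borel_measurable borel"
    by (intro borel_measurable_continuous_onI continuous_on_component continuous_on_id)
  from measurable_compose[OF assms this] show ?thesis .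
qed

lemma measurable_pushforward:
  assumes A: "A \<in> borel_measurable (lebesgue_on S)"
  shows "pushforward S \<Phi> A \<in> borel_measurable (lebesgue_on T)"
proof (rule borel_measurable_matrixI)
  fix i j
  have T: "T \<in> sets lebesgue" using open_T by simp
  have T': "T \<subseteq> \<Phi> ` closure S" using image_S closure_subset by blast
  have "continuous_on T (\<lambda>y. jacobian \<Phi> (at (\<Psi> y)))"
    by (rule continuous_on_compose2[OF cont_jac continuous_on_subset[OF cont_\<Psi> T']])
      (use \<Psi>_T closure_subset in blast)
  from continuous_imp_measurable_on_sets_lebesgue[OF this T]
  have J [measurable]: "(\<lambda>y. jacobian \<Phi> (at (\<Psi> y)) $ k $ l) \<in> borel_measurable (lebesgue_on T)" for k l
    by (rule measurable_matrix_entry)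
  have a [measurable]: "(\<lambda>y. A (\<Psi> y) $ k $ l) \<in> borel_measurable (lebesgue_on T)" for k l
    by (rule measurable_matrix_entry[OF measurable_compose_inverse[OF A]])
  have [measurable]: "(\<lambda>y. det (jacobian \<Phi> (at (\<Psi> y)))) \<in> borel_measurable (lebesgue_on T)"
    unfolding det_def by measurable
  have "(\<lambda>y. (1 / \<bar>det (jacobian \<Phi> (at (\<Psi> y)))\<bar>) *
      (\<Sum>k\<in>UNIV. (\<Sum>l\<in>UNIV. jacobian \<Phi> (at (\<Psi> y)) $ i $ l * A (\<Psi> y) $ l $ k) * jacobian \<Phi> (at (\<Psi> y)) $ j $ k))
      \<in> borel_measurable (lebesgue_on T)"
    by measurable
  then show "(\<lambda>y. pushforward S \<Phi> A y $ i $ j) \<in> borel_measurable (lebesgue_on T)"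
    by (rule measurable_cong[THEN iffD1, rotated])
      (simp add: pushforward_\<Psi> matrix_matrix_mult_def transpose_def)
qed

lemma elliptic_pushforward_AE:
  assumes A: "AE x in lebesgue_on S. elliptic \<Lambda> (A x)" and \<Lambda>: "\<Lambda> > 0"
  obtains \<Lambda>' where "\<Lambda>' > 0" "AE y in lebesgue_on T. elliptic \<Lambda>' (pushforward S \<Phi> A y)"
proof -
  obtain m M where m: "m > 0" "M > 0"
    "\<And>x. x \<in> closure S \<Longrightarrow> m \<le> \<bar>det (jacobian \<Phi> (at x))\<bar>"
    "\<And>x. x \<in> closure S \<Longrightarrow> \<bar>det (jacobian \<Phi> (at x))\<bar> \<le> M"
    "\<And>x \<xi>. x \<in> closure S \<Longrightarrow> m * (norm \<xi>)\<^sup>2 \<le> (norm (transpose (jacobian \<Phi> (at x)) *v \<xi>))\<^sup>2"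
    "\<And>x \<xi>. x \<in> closure S \<Longrightarrow> (norm (transpose (jacobian \<Phi> (at x)) *v \<xi>))\<^sup>2 \<le> M * (norm \<xi>)\<^sup>2"
    by (rule jacobian_bounds) blast
  define \<Lambda>' where "\<Lambda>' = max (\<Lambda> / (m / M)) (\<Lambda> * (M / m))"
  have "\<Lambda>' > 0" unfolding \<Lambda>'_def using \<Lambda> m(1,2) by (simp add: less_max_iff_disj)
  moreover have "AE y in lebesgue_on T. elliptic \<Lambda>' (pushforward S \<Phi> A y)"
    using AE_transfer[OF A] AE_space[of "lebesgue_on T"]
  proof eventually_elim
    case (elim y)
    then have y: "y \<in> T" by simp
    let ?x = "\<Psi> y" let ?d = "\<bar>det (jacobian \<Phi> (at (\<Psi> y)))\<bar>"
    have x: "?x \<in> closure S" using \<Psi>_T[OF y] closure_subset by blast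
    have d: "?d > 0" using m(1) m(3)[OF x] by linarith
    show ?case
      unfolding pushforward_\<Psi>[OF y]
    proof (rule elliptic_pushforward[OF elim(1) \<Lambda>, where \<alpha> = "m / M" and \<beta> = "M / m"])
      show "m / M > 0" using m by simp
      fix \<xi> :: "real^'n"
      let ?n = "(norm (transpose (jacobian \<Phi> (at (\<Psi> y))) *v \<xi>))\<^sup>2"
      have "m / M * (norm \<xi>)\<^sup>2 = (m * (norm \<xi>)\<^sup>2) / M" by simp
      also have "\<dots> \<le> ?n / ?d" using m(5)[OF x, of \<xi>] m(4)[OF x] d m(2) by (intro frac_le) auto
      finally show "m / M * (norm \<xi>)\<^sup>2 \<le> 1 / ?d * ?n" by simp
      have "?n / ?d \<le> (M * (norm \<xi>)\<^sup>2) / m" using m(6)[OF x, of \<xi>] m(3)[OF x] d m(1,2) by (intro frac_le) auto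
      then show "1 / ?d * ?n \<le> M / m * (norm \<xi>)\<^sup>2" by simp
    qed (use d in \<open>auto simp: \<Lambda>'_def\<close>)
  qed
  ultimately show ?thesis by (rule that)
qed

end

section \<open>The reflections\<close>

text \<open>The Jacobian is invertible because the inverse map is differentiable as well.\<close>

lemma C1_diffeo_regular:
  fixes f :: "real^'n::finite \<Rightarrow> real^'n"
  assumes "C1_diffeo S T f"
  shows "open S" "open T" "f ` S = T" "inj_on f S" "\<And>x. x \<in> S \<Longrightarrow> f differentiable (at x)"
    "continuous_on S (\<lambda>x. jacobian f (at x))" "\<And>x. x \<in> S \<Longrightarrow> det (jacobian f (at x)) \<noteq> 0"
    "continuous_on S f"
proof -
  obtain g where o: "open S" "open T" and h: "homeomorphism S T f g" and f: "Ck_on 1 S f" and g: "Ck_on 1 T g"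
    using assms by (auto simp: C1_diffeo_def)
  show "open S" "open T" by fact+
  have fS: "f ` S = T" and gf: "\<And>x. x \<in> S \<Longrightarrow> g (f x) = x" and cf: "continuous_on S f"
    using h by (auto simp: homeomorphism_def)
  show "f ` S = T" "continuous_on S f" by fact+
  show "inj_on f S" by (rule inj_on_inverseI[of S g f]) (rule gf)
  show df: "f differentiable (at x)" if "x \<in> S" for x by (rule continuous_on_jacobian(1)[OF f that])
  show "continuous_on S (\<lambda>x. jacobian f (at x))" by (rule continuous_on_jacobian(2)[OF f])
  show "det (jacobian f (at x)) \<noteq> 0" if x: "x \<in> S" for x
  proof -
    have "f x \<in> T" using fS x by blast
    have "(f has_derivative (\<lambda>h. jacobian f (at x) *v h)) (at x)"
      using df[OF x] by (simp add: jacobian_works)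
    moreover have "(g has_derivative (\<lambda>h. jacobian g (at (f x)) *v h)) (at (f x))"
      using continuous_on_jacobian(1)[OF g \<open>f x \<in> T\<close>] by (simp add: jacobian_works)
    ultimately have "((\<lambda>x. g (f x)) has_derivative (\<lambda>h. jacobian g (at (f x)) *v (jacobian f (at x) *v h))) (at x)"
      by (rule has_derivative_compose)
    then have "((\<lambda>x. x) has_derivative (\<lambda>h. jacobian g (at (f x)) *v (jacobian f (at x) *v h))) (at x)"
      by (rule has_derivative_transform_within_open[OF _ o(1) x]) (simp add: gf)
    then have "(\<lambda>h. jacobian g (at (f x)) *v (jacobian f (at x) *v h)) = (\<lambda>h. h)"
      using has_derivative_unique has_derivative_ident by blast
    then have "(jacobian g (at (f x)) ** jacobian f (at x)) *v h = mat 1 *v h" for h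
      by (simp add: matrix_vector_mul_assoc[symmetric] fun_eq_iff)
    then have "jacobian g (at (f x)) ** jacobian f (at x) = mat 1" by (simp add: matrix_eq)
    then have "det (jacobian g (at (f x))) * det (jacobian f (at x)) = 1"
      by (metis det_I det_mul)
    then show ?thesis by auto
  qed
qed

lemma jacobian_compose:
  fixes f g :: "real^'n::finite \<Rightarrow> real^'n"
  assumes U: "open U" "x \<in> U" "\<And>y. y \<in> U \<Longrightarrow> k y = g (f y)"
    and "f differentiable (at x)" "g differentiable (at (f x))"
  shows "k differentiable (at x)" "jacobian k (at x) = jacobian g (at (f x)) ** jacobian f (at x)"
proof -
  have "((\<lambda>x. g (f x)) has_derivative (\<lambda>h. jacobian g (at (f x)) *v (jacobian f (at x) *v h))) (at x)"
    by (rule has_derivative_compose) (use assms(4,5) in \<open>simp_all add: jacobian_works\<close>)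
  then have d: "(k has_derivative (\<lambda>h. jacobian g (at (f x)) *v (jacobian f (at x) *v h))) (at x)"
    by (rule has_derivative_transform_within_open[OF _ U(1,2)]) (simp add: U(3))
  then show "k differentiable (at x)" by (rule differentiableI)
  show "jacobian k (at x) = jacobian g (at (f x)) ** jacobian f (at x)"
    unfolding jacobian_def[of k] frechet_derivative_eqI[OF d]
    by (simp add: matrix_vector_mul_assoc)
qed

lemma continuous_on_matrix_mult:
  fixes A B :: "'a::topological_space \<Rightarrow> real^'n::finite^'n"
  assumes "continuous_on S A" "continuous_on S B"
  shows "continuous_on S (\<lambda>x. A x ** B x)"
  unfolding matrix_matrix_mult_def
  by (intro continuous_on_vec_lambda continuous_on_sum continuous_on_mult continuous_on_component assms)

lemma pushforward_matrix_compose: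
  fixes A M N :: "real^'n::finite^'n"
  shows "(1 / \<bar>det M\<bar>) *\<^sub>R (M ** ((1 / \<bar>det N\<bar>) *\<^sub>R (N ** A ** transpose N)) ** transpose M) =
    (1 / \<bar>det (M ** N)\<bar>) *\<^sub>R ((M ** N) ** A ** transpose (M ** N))"
  by (simp add: det_mul abs_mult matrix_transpose_mul matrix_mul_assoc
      matrix_scalar_ac scalar_matrix_assoc[symmetric])

lemma cball_diff_ball_subset_closure:
  fixes x :: "'a::real_normed_vector"
  assumes "0 < a" "a < b" "a \<le> norm x" "norm x \<le> b"
  shows "x \<in> closure (ball 0 b - cball 0 a)"
proof (unfold closure_approachable, intro allI impI)
  fix e :: real assume e: "0 < e"
  define n where "n = norm x"
  define s where "s = min (1 / 2) (e / (2 * (b - a)))"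
  have s: "0 < s" "s < 1" "s * (b - a) \<le> e / 2"
  proof -
    show "0 < s" "s < 1" using assms e by (auto simp: s_def)
    have "s \<le> (e / 2) / (b - a)" by (simp add: s_def)
    then show "s * (b - a) \<le> e / 2" using assms by (simp add: pos_le_divide_eq algebra_simps)
  qed
  have n: "a \<le> n" "n \<le> b" "n > 0" using assms by (auto simp: n_def)
  define m where "m = (1 - s) * n + s * ((a + b) / 2)"
  have "(1 - s) * a + s * ((a + b) / 2) \<le> m" "m \<le> (1 - s) * b + s * ((a + b) / 2)"
    unfolding m_def using n s by (auto intro!: mult_left_mono)
  moreover have "s * a < s * ((a + b) / 2)" "s * ((a + b) / 2) < s * b"
    using s assms by simp_all
  moreover have "(1 - s) * a = a - s * a" "(1 - s) * b = b - s * b" by (simp_all add: algebra_simps)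
  ultimately have m: "a < m" "m < b" by linarith+
  define y where "y = (m / n) *\<^sub>R x"
  have "norm y = m" using n m assms by (simp add: y_def n_def)
  then have "y \<in> ball 0 b - cball 0 a" using m by simp
  moreover have "dist y x < e"
  proof -
    have "y - x = ((m - n) / n) *\<^sub>R x"
      using n by (simp add: y_def diff_divide_distrib scaleR_left_diff_distrib)
    then have "dist y x = \<bar>m - n\<bar>" using n by (simp add: dist_norm n_def)
    also have "m - n = s * ((a + b) / 2 - n)" by (simp add: m_def algebra_simps)
    also have "\<bar>s * ((a + b) / 2 - n)\<bar> \<le> s * (b - a)"
      unfolding abs_mult using n s assms by (intro mult_mono) (auto simp: abs_le_iff field_simps)
    also have "\<dots> < e" using s(3) e by linarith
    finally show ?thesis .
  qed
  ultimately show "\<exists>y\<in>ball 0 b - cball 0 a. dist y x < e" by blast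
qed

locale reflection =
  fixes A :: "real^'n::finite \<Rightarrow> real^'n^'n" and r1 r2 r3 :: real and F G :: "real^'n \<Rightarrow> real^'n"
    and x1 x2 :: "real^'n"
  assumes dim: "CARD('n) = 2 \<or> CARD('n) = 3"
    and radii: "0 < r1" "r1 < r2" "r2 < r3"
    and maps: "reflecting_maps A r1 r2 r3 F G x1 x2"
begin

text \<open>The composed reflection of the core, with the singularity \<open>x1\<close> of \<open>F\<close> removed.\<close>

definition K where "K = (G \<circ> F)(x1 := x2)"

abbreviation "D \<equiv> ball 0 r2 - {x1}"
abbreviation "core \<equiv> ball (0::real^'n) r1"
abbreviation "annulus \<equiv> ball (0::real^'n) r2 - cball 0 r1"
abbreviation "shell \<equiv> ball (0::real^'n) r3 - cball 0 r2"

lemma F_annulus: "C1_diffeo annulus shell F"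
  and F_AE: "AE y in lebesgue_on shell. pushforward annulus F A y = A y"
  and F_N: "\<exists>N. open N \<and> sphere 0 r2 \<subseteq> N \<and> C1_diffeo N (F ` N) F"
  and F_sphere: "\<And>x. norm x = r2 \<Longrightarrow> F x = x"
  and x1: "norm x1 < r1"
  and F_D: "C1_diffeo D (- cball 0 r2) F"
  and x2: "norm x2 < r3"
  and G_out: "C1_diffeo (- cball 0 r3) (ball 0 r3 - {x2}) G"
  and G_N: "\<exists>N. open N \<and> sphere 0 r3 \<subseteq> N \<and> C1_diffeo N (G ` N) G"
  and G_sphere: "\<And>x. norm x = r3 \<Longrightarrow> G x = x"
  and K_core: "C1_diffeo core (ball 0 r3) K"
  using maps unfolding reflecting_maps_def K_def by (auto simp: dist_norm)

lemma sphere_r1_closure: "norm x = r1 \<Longrightarrow> x \<in> closure annulus"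
  using cball_diff_ball_subset_closure[OF radii(1,2), of x] radii by simp

lemma F_D_out: "x \<in> D \<Longrightarrow> norm (F x) > r2"
  using imageI[of x D F] unfolding C1_diffeo_regular(3)[OF F_D] by simp

text \<open>The value of \<open>F\<close> on this sphere is a limit of values in the shell. It does not lie in the shell itself,
  since those values are taken in the annulus and \<open>F\<close> is injective on \<open>D\<close>.\<close>

lemma F_r1: "norm x = r1 \<Longrightarrow> norm (F x) = r3"
proof -
  assume x: "norm x = r1"
  note D = C1_diffeo_regular[OF F_D] and S = C1_diffeo_regular[OF F_annulus]
  have xD: "x \<in> D" using x radii x1 by auto
  have out: "norm (F x) > r2" by (rule F_D_out[OF xD])
  have "\<not> norm (F x) < r3"
  proof
    assume "norm (F x) < r3"
    then have "F x \<in> F ` annulus" using out S(3) by auto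
    then obtain s where s: "s \<in> annulus" "F x = F s" by blast
    then have "s \<in> D" using x1 by auto
    then have "x = s" using inj_onD[OF D(4) s(2) xD] by blast
    with s x show False by auto
  qed
  moreover have "norm (F x) \<le> r3"
  proof -
    let ?W = "closure annulus \<inter> D"
    have "isCont F x" using D(5)[OF xD] by (rule differentiable_imp_continuous_within)
    moreover obtain s where s: "\<And>n. s n \<in> annulus" "s \<longlonglongrightarrow> x"
      using sphere_r1_closure[OF x] unfolding closure_sequential by blast
    ultimately have "(\<lambda>n. F (s n)) \<longlonglongrightarrow> F x" using isCont_tendsto_compose by blast
    moreover have "norm (F (s n)) \<le> r3" for n
      using imageI[OF s(1)[of n], of F] unfolding S(3) by simp
    ultimately show ?thesis
      using Lim_bounded[OF tendsto_norm[of "\<lambda>n. F (s n)" "F x" sequentially], of 0 r3] by blast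
  qed
  ultimately show ?thesis by linarith
qed

lemma F_inside: "x \<in> D \<Longrightarrow> norm (F x) > r3 \<Longrightarrow> norm x < r1"
proof (rule ccontr)
  assume x: "x \<in> D" "norm (F x) > r3" "\<not> norm x < r1"
  show False
  proof (cases "norm x = r1")
    case True
    then show False using F_r1 x(2) by auto
  next
    case False
    then have "x \<in> annulus" using x by auto
    then have "F x \<in> shell" using C1_diffeo_regular(3)[OF F_annulus] by blast
    then show False using x(2) by auto
  qed
qed

text \<open>Norms below \<open>r3\<close> are excluded by injectivity. If the norm were \<open>r3\<close>, then \<open>G\<close> would fix \<open>F x\<close> and \<open>K x\<close>
  would lie on the sphere, although \<open>K\<close> maps the core into the open ball.\<close>

lemma F_r1_inside: "x \<in> D \<Longrightarrow> norm x < r1 \<Longrightarrow> norm (F x) > r3"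
proof -
  assume x: "x \<in> D" "norm x < r1"
  note D = C1_diffeo_regular[OF F_D] and S = C1_diffeo_regular[OF F_annulus]
  have out: "norm (F x) > r2" by (rule F_D_out[OF x(1)])
  show "norm (F x) > r3"
  proof (rule ccontr)
    assume "\<not> norm (F x) > r3"
    then consider "norm (F x) < r3" | "norm (F x) = r3" by linarith
    then show False
    proof cases
      case 1
      then have "F x \<in> F ` annulus" using out S(3) by auto
      then obtain s where s: "s \<in> annulus" "F x = F s" by blast
      then have "s \<in> D" using x1 by auto
      then have "x = s" using inj_onD[OF D(4) s(2) x(1)] by blast
      with s x show False by auto
    next
      case 2
      have "x \<noteq> x1" using x by auto
      then have "K x = F x" using 2 G_sphere by (simp add: K_def)
      moreover have "K x \<in> ball 0 r3" using C1_diffeo_regular(3)[OF K_core] x(2) by auto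
      ultimately show False using 2 by simp
    qed
  qed
qed

lemma K_r1: "norm x = r1 \<Longrightarrow> K x = F x"
  using F_r1[of x] G_sphere[of "F x"] x1 by (auto simp: K_def)

lemma closure_annulus: "closure annulus \<subseteq> cball 0 r2 - ball 0 r1"
  by (rule closure_minimal) (auto intro!: closed_Diff)

lemma piece_F: "diffeo_piece annulus shell F"
proof
  note D = C1_diffeo_regular[OF F_D]
  obtain N where N: "open N" "sphere 0 r2 \<subseteq> N" "C1_diffeo N (F ` N) F" using F_N by blast
  note N' = C1_diffeo_regular[OF N(3)]
  have cover: "cball 0 r2 - ball 0 r1 \<subseteq> D \<union> N" using N(2) x1 by (auto simp: subset_iff order_le_less)
  then have cl: "closure annulus \<subseteq> D \<union> N" using closure_annulus by blast
  show "F differentiable (at x)" if "x \<in> closure annulus" for x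
    using cl that D(5) N'(5) by blast
  show "det (jacobian F (at x)) \<noteq> 0" if "x \<in> closure annulus" for x
    using cl that D(7) N'(7) by blast
  show "continuous_on (closure annulus) (\<lambda>x. jacobian F (at x))"
    by (rule continuous_on_subset[OF continuous_on_open_Un[OF D(1) N(1) D(6) N'(6)] cl])
  show "inj_on F (closure annulus)"
  proof (rule inj_onI)
    fix x y assume xy: "x \<in> closure annulus" "y \<in> closure annulus" "F x = F y"
    have c: "x \<in> D \<or> norm x = r2" "y \<in> D \<or> norm y = r2"
      using xy closure_annulus x1 by (auto simp: subset_iff)
    have i: "norm (F z) > r2" if "z \<in> D" for z by (rule F_D_out[OF that])
    show "x = y"
      using c inj_onD[OF D(4) xy(3)] i[of x] i[of y] F_sphere[of x] F_sphere[of y] xy(3) by auto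
  qed
qed (use dim F_annulus in \<open>auto intro: bounded_subset[OF bounded_ball]\<close>)

lemma K_jacobian:
  assumes "x \<in> D" "G differentiable (at (F x))"
  shows "K differentiable (at x)" "jacobian K (at x) = jacobian G (at (F x)) ** jacobian F (at x)"
proof -
  note D = C1_diffeo_regular[OF F_D]
  have "K y = G (F y)" if "y \<in> D" for y using that by (auto simp: K_def)
  from jacobian_compose[OF D(1) assms(1) this D(5)[OF assms(1)] assms(2)]
  show "K differentiable (at x)" "jacobian K (at x) = jacobian G (at (F x)) ** jacobian F (at x)" by auto
qed

text \<open>Inside the core this is part of the hypotheses on \<open>K\<close>. Near its boundary sphere \<open>K\<close> is \<open>G \<circ> F\<close>, and both
  \<open>F\<close> and \<open>G\<close> are regular across the spheres that are involved.\<close>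

lemma piece_K: "diffeo_piece core (ball 0 r3) K"
proof
  note D = C1_diffeo_regular[OF F_D] and C = C1_diffeo_regular[OF K_core]
  obtain N where N: "open N" "sphere 0 r3 \<subseteq> N" "C1_diffeo N (G ` N) G" using G_N by blast
  note N' = C1_diffeo_regular[OF N(3)]
  define V where "V = D \<inter> F -` N"
  have V: "open V" unfolding V_def using continuous_open_preimage[OF D(8) D(1) N(1)] by simp
  have KV: "K differentiable (at x)" "jacobian K (at x) = jacobian G (at (F x)) ** jacobian F (at x)" if "x \<in> V" for x
    using K_jacobian[of x] N'(5)[of "F x"] that by (auto simp: V_def)
  have clb: "closure core = cball 0 r1" using radii by (simp add: closure_ball)
  have "x \<in> V" if "norm x = r1" for x
    using that F_r1[OF that] N(2) radii x1 by (auto simp: V_def)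
  then have cl: "closure core \<subseteq> core \<union> V" unfolding clb by (auto simp: order_le_less)
  show "K differentiable (at x)" if "x \<in> closure core" for x
    using cl that C(5) KV(1) by blast
  have "continuous_on V (\<lambda>x. jacobian G (at (F x)))"
    by (rule continuous_on_compose2[OF N'(6) continuous_on_subset[OF D(8)]]) (auto simp: V_def)
  moreover have "continuous_on V (\<lambda>x. jacobian F (at x))"
    by (rule continuous_on_subset[OF D(6)]) (auto simp: V_def)
  ultimately have "continuous_on V (\<lambda>x. jacobian G (at (F x)) ** jacobian F (at x))"
    by (rule continuous_on_matrix_mult)
  then have cV: "continuous_on V (\<lambda>x. jacobian K (at x))"
    by (rule continuous_on_eq) (simp add: KV)
  show "continuous_on (closure core) (\<lambda>x. jacobian K (at x))"
    by (rule continuous_on_subset[OF continuous_on_open_Un[OF C(1) V C(6) cV] cl])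
  have "det (jacobian K (at x)) \<noteq> 0" if "x \<in> V" for x
    using that N'(7)[of "F x"] D(7)[of x] by (simp add: KV(2) det_mul V_def)
  then show "det (jacobian K (at x)) \<noteq> 0" if "x \<in> closure core" for x
    using cl that C(7) by blast
  show "inj_on K (closure core)"
  proof (rule inj_onI)
    fix x y assume xy: "x \<in> closure core" "y \<in> closure core" "K x = K y"
    have c: "x \<in> core \<or> norm x = r1" "y \<in> core \<or> norm y = r1"
      using xy unfolding clb by auto
    have i: "norm (K z) < r3" if "z \<in> core" for z using C(3) that by auto
    have s: "norm (K z) = r3" if "norm z = r1" for z using F_r1[OF that] K_r1[OF that] by simp
    have D1: "z \<in> D" if "norm z = r1" for z using that radii x1 by auto
    show "x = y"
    proof (cases "x \<in> core")
      case True
      then have "y \<in> core" using c(2) i[of x] s[of y] xy(3) by auto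
      with True show ?thesis using inj_onD[OF C(4) xy(3)] by blast
    next
      case False
      then have "norm x = r1" using c(1) by blast
      moreover have "norm y = r1" using c(2) i[of y] s[OF \<open>norm x = r1\<close>] xy(3) by auto
      ultimately show ?thesis using inj_onD[OF D(4), of x y] xy(3) K_r1 D1 by simp
    qed
  qed
qed (use dim K_core in auto)

lemma pushforward_K:
  assumes y: "norm y < r3" "y \<noteq> x2"
  shows "pushforward core K A y = pushforward (- cball 0 r3) G (pushforward D F A) y"
proof -
  note D = C1_diffeo_regular[OF F_D] and G = C1_diffeo_regular[OF G_out] and C = C1_diffeo_regular[OF K_core]
  have "y \<in> G ` (- cball 0 r3)" using G(3) y by auto
  then obtain z where z: "z \<in> - cball 0 r3" "y = G z" by blast
  then have "z \<in> - cball 0 r2" using radii by auto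
  then have "z \<in> F ` D" using D(3) by blast
  then obtain x where x: "x \<in> D" "z = F x" by blast
  have nx: "norm x < r1" using F_inside[OF x(1)] x z by auto
  have Kx: "K x = y" using x z by (simp add: K_def)
  have iz: "inv_into (- cball 0 r3) G y = z" using inv_into_f_f[OF G(4) z(1)] z(2) by simp
  have ix: "inv_into D F z = x" using inv_into_f_f[OF D(4) x(1)] x(2) by simp
  have iK: "inv_into core K y = x" using inv_into_f_f[OF C(4), of x] nx Kx by simp
  have J: "jacobian K (at x) = jacobian G (at z) ** jacobian F (at x)"
    unfolding x(2) by (rule K_jacobian(2)[OF x(1)]) (use G(5) z(1) x(2) in blast)
  show ?thesis
    unfolding pushforward_def[of core] pushforward_def[of "- cball 0 r3"] pushforward_def[of D] Let_def iz ix iK J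
    by (rule pushforward_matrix_compose[symmetric])
qed

end

section \<open>Reflecting and folding back\<close>

lemma continuous_on_annuli:
  fixes h :: "'a::real_normed_vector \<Rightarrow> 'b::topological_space"
  assumes "continuous_on (cball 0 a) h" "continuous_on (cball 0 b - ball 0 a) h"
    "continuous_on (cball 0 c - ball 0 b) h" "continuous_on (- ball 0 c) h"
  shows "continuous_on UNIV h"
proof -
  have "continuous_on (cball 0 a \<union> (cball 0 b - ball 0 a)) h"
    by (rule continuous_on_closed_Un[OF _ _ assms(1,2)]) (auto intro: closed_Diff)
  then have "continuous_on (cball 0 a \<union> (cball 0 b - ball 0 a) \<union> (cball 0 c - ball 0 b)) h"
    by (rule continuous_on_closed_Un[rotated 2, OF _ assms(3)]) (auto intro: closed_Diff closed_Un)
  then have "continuous_on (cball 0 a \<union> (cball 0 b - ball 0 a) \<union> (cball 0 c - ball 0 b) \<union> (- ball 0 c)) h"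
    by (rule continuous_on_closed_Un[rotated 2, OF _ assms(4)]) (auto intro: closed_Diff closed_Un)
  then show ?thesis by (rule continuous_on_subset) (auto simp: not_le not_less)
qed

lemma piecewise_C1_annuli:
  fixes h :: "real^'n::finite \<Rightarrow> complex"
  assumes c: "continuous_on UNIV h" and b: "bounded {x. h x \<noteq> 0}"
    and h: "C1_bounded (ball 0 r1) h" "C1_bounded (ball 0 r2 - cball 0 r1) h"
      "C1_bounded (ball 0 r3 - cball 0 r2) h" "C1_bounded (- cball 0 r3) h"
  shows "piecewise_C1 (sphere 0 r1 \<union> sphere 0 r2 \<union> sphere 0 r3) h"
proof -
  let ?Z = "sphere 0 r1 \<union> sphere 0 r2 \<union> sphere (0::real^'n) r3"
  let ?U = "ball 0 r1 \<union> (ball 0 r2 - cball 0 r1) \<union> (ball 0 r3 - cball 0 r2) \<union> - cball (0::real^'n) r3"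
  have Z: "- ?Z \<subseteq> ?U" by (auto simp: not_less)
  have "continuous_on (ball 0 r1 \<union> (ball 0 r2 - cball 0 r1)) (gradient h)"
    by (rule continuous_on_open_Un) (use h in \<open>auto simp: C1_bounded_def intro: open_Diff\<close>)
  then have "continuous_on (ball 0 r1 \<union> (ball 0 r2 - cball 0 r1) \<union> (ball 0 r3 - cball 0 r2)) (gradient h)"
    by (rule continuous_on_open_Un[rotated 2]) (use h in \<open>auto simp: C1_bounded_def intro: open_Diff\<close>)
  then have "continuous_on ?U (gradient h)"
    by (rule continuous_on_open_Un[rotated 2]) (use h in \<open>auto simp: C1_bounded_def intro: open_Diff\<close>)
  then have "continuous_on (- ?Z) (gradient h)" using Z by (rule continuous_on_subset)
  moreover have "h differentiable (at x)" if "x \<in> - ?Z" for x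
    using Z that h unfolding C1_bounded_def by blast
  moreover have "bounded (gradient h ` ?U)"
    unfolding image_Un bounded_Un using h by (simp add: C1_bounded_def)
  then have "bounded (gradient h ` (- ?Z))" by (rule bounded_subset) (use Z in blast)
  ultimately show ?thesis using c b by (simp add: piecewise_C1_def)
qed

lemma thin_spheres: "thin (sphere 0 r1 \<union> sphere 0 r2 \<union> sphere (0::'a::euclidean_space) r3)"
  by (intro thin_Un thin_sphere)

lemma integral_lebesgue_on_split:
  fixes h :: "'a::euclidean_space \<Rightarrow> complex"
  assumes s: "U \<in> sets lebesgue" "V \<in> sets lebesgue" "W \<in> sets lebesgue"
    and d: "V \<inter> W = {}" "V \<union> W \<subseteq> U" "negligible (U - (V \<union> W))" and h: "integrable (lebesgue_on U) h"
  shows "integrable (lebesgue_on V) h" "integrable (lebesgue_on W) h"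
    "(LINT x|lebesgue_on U. h x) = (LINT x|lebesgue_on V. h x) + (LINT x|lebesgue_on W. h x)"
proof -
  have iU: "integrable lebesgue (\<lambda>x. indicat_real U x *\<^sub>R h x)"
    using h s(1) by (simp add: integrable_restrict_space)
  have e: "(\<lambda>x. indicat_real V x *\<^sub>R (indicat_real U x *\<^sub>R h x)) = (\<lambda>x. indicat_real V x *\<^sub>R h x)"
    "(\<lambda>x. indicat_real W x *\<^sub>R (indicat_real U x *\<^sub>R h x)) = (\<lambda>x. indicat_real W x *\<^sub>R h x)"
    using d(2) by (auto simp: indicator_def fun_eq_iff)
  have i: "integrable lebesgue (\<lambda>x. indicat_real V x *\<^sub>R h x)" "integrable lebesgue (\<lambda>x. indicat_real W x *\<^sub>R h x)"
    using integrable_mult_indicator[OF s(2) iU] integrable_mult_indicator[OF s(3) iU] unfolding e by blast+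
  then show "integrable (lebesgue_on V) h" "integrable (lebesgue_on W) h"
    using s by (simp_all add: integrable_restrict_space)
  have "(LINT x|lebesgue. indicat_real U x *\<^sub>R h x) = (LINT x|lebesgue. indicat_real V x *\<^sub>R h x + indicat_real W x *\<^sub>R h x)"
  proof (rule integral_cong_AE)
    have "AE x in lebesgue. x \<notin> U - (V \<union> W)"
      using d(3) by (simp only: negligible_iff_null_sets AE_not_in)
    then show "AE x in lebesgue. indicat_real U x *\<^sub>R h x = indicat_real V x *\<^sub>R h x + indicat_real W x *\<^sub>R h x"
    proof eventually_elim
      case (elim x)
      then show ?case using d(1,2) by (auto simp: indicator_def)
    qed
  qed (use iU i in \<open>auto intro!: borel_measurable_integrable\<close>)
  also have "\<dots> = (LINT x|lebesgue. indicat_real V x *\<^sub>R h x) + (LINT x|lebesgue. indicat_real W x *\<^sub>R h x)"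
    by (rule Bochner_Integration.integral_add[OF i])
  finally show "(LINT x|lebesgue_on U. h x) = (LINT x|lebesgue_on V. h x) + (LINT x|lebesgue_on W. h x)"
    using s by (simp add: integral_restrict_space)
qed

lemma measurable_pairing:
  assumes B: "B \<in> borel_measurable M" and p: "p \<in> borel_measurable M" and q: "q \<in> borel_measurable M"
  shows "(\<lambda>x. pairing (B x) (p x) (q x)) \<in> borel_measurable (M :: 'z measure)"
proof -
  have [measurable]: "(\<lambda>x. B x $ i $ j) \<in> borel_measurable M" for i j
  proof -
    have "(\<lambda>m::real^'a^'a. m $ i $ j) \<in> borel_measurable borel"
      by (intro borel_measurable_continuous_onI continuous_on_component continuous_on_id)
    from measurable_compose[OF B this] show ?thesis .
  qed
  have c: "(\<lambda>v::complex^'a. v $ i) \<in> borel_measurable borel" for i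
    by (intro borel_measurable_continuous_onI continuous_on_component continuous_on_id)
  have [measurable]: "(\<lambda>x. p x $ i) \<in> borel_measurable M" "(\<lambda>x. q x $ i) \<in> borel_measurable M" for i
    using measurable_compose[OF p c] measurable_compose[OF q c] by auto
  show ?thesis unfolding pairing_def by measurable
qed

lemma pairing_L2:
  fixes p q :: "real^'n::finite \<Rightarrow> complex^'n"
  assumes B: "B \<in> borel_measurable (lebesgue_on U)" "AE x in lebesgue_on U. elliptic \<Lambda> (B x)" "\<Lambda> > 0"
    and pq: "p \<in> L2 U" "q \<in> L2 U"
    and s: "s \<in> borel_measurable (lebesgue_on U)" "\<And>x. norm (s x) \<le> c" "c \<ge> 0"
  shows "integrable (lebesgue_on U) (\<lambda>x. s x * pairing (B x) (p x) (q x))"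
    "norm (LINT x|lebesgue_on U. s x * pairing (B x) (p x) (q x)) \<le> (c * (\<Lambda> * (real CARD('n))\<^sup>2)) * (L2_norm U p * L2_norm U q)"
proof -
  have m: "(\<lambda>x. s x * pairing (B x) (p x) (q x)) \<in> borel_measurable (lebesgue_on U)"
    by (intro borel_measurable_times s(1) measurable_pairing B(1) L2_measurable pq)
  have ae: "AE x in lebesgue_on U. norm (s x * pairing (B x) (p x) (q x)) \<le> (c * (\<Lambda> * (real CARD('n))\<^sup>2)) * (norm (p x) * norm (q x))"
    using B(2)
  proof eventually_elim
    case (elim x)
    have "norm (s x * pairing (B x) (p x) (q x)) \<le> c * ((\<Lambda> * (real CARD('n))\<^sup>2) * (norm (p x) * norm (q x)))"
      unfolding norm_mult[of "s x"] using norm_pairing_le[OF elim B(3)] s(2,3) by (intro mult_mono) auto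
    then show ?case by (simp add: mult_ac)
  qed
  have "c * (\<Lambda> * (real CARD('n))\<^sup>2) \<ge> 0" using s(3) B(3) by simp
  from L2_product_bound[OF pq m ae this]
  show "integrable (lebesgue_on U) (\<lambda>x. s x * pairing (B x) (p x) (q x))"
    "norm (LINT x|lebesgue_on U. s x * pairing (B x) (p x) (q x)) \<le> (c * (\<Lambda> * (real CARD('n))\<^sup>2)) * (L2_norm U p * L2_norm U q)"
    by auto
qed

lemma pairing_L2_1:
  fixes p q :: "real^'n::finite \<Rightarrow> complex^'n"
  assumes "B \<in> borel_measurable (lebesgue_on U)" "AE x in lebesgue_on U. elliptic \<Lambda> (B x)" "\<Lambda> > 0"
    "p \<in> L2 U" "q \<in> L2 U"
  shows "integrable (lebesgue_on U) (\<lambda>x. pairing (B x) (p x) (q x))"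
    "norm (LINT x|lebesgue_on U. pairing (B x) (p x) (q x)) \<le> (\<Lambda> * (real CARD('n))\<^sup>2) * (L2_norm U p * L2_norm U q)"
  using pairing_L2[OF assms, of "\<lambda>_. 1" 1] by simp_all

locale doubly_reflected = reflection A r1 r2 r3 F G x1 x2
  for A :: "real^'n::finite \<Rightarrow> real^'n^'n" and r1 r2 r3 F G x1 x2 +
  fixes \<Omega> :: "(real^'n) set" and \<Lambda> :: real
  assumes open_\<Omega>: "open \<Omega>" and bounded_\<Omega>: "bounded \<Omega>" and cball_\<Omega>: "cball 0 r3 \<subseteq> \<Omega>"
    and A_measurable: "A \<in> borel_measurable (lebesgue_on \<Omega>)" and \<Lambda>: "\<Lambda> > 0"
    and A_elliptic: "AE x in lebesgue_on \<Omega>. elliptic \<Lambda> (A x)"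
    and double: "AE y in lebesgue_on (ball 0 r3 - ball 0 r2).
       pushforward (- cball 0 r3) G (pushforward (ball 0 r2 - {x1}) F A) y = A y"
begin

sublocale f: diffeo_piece annulus shell F by (rule piece_F)
sublocale k: diffeo_piece core "ball 0 r3" K by (rule piece_K)

abbreviation "Z \<equiv> sphere 0 r1 \<union> sphere 0 r2 \<union> sphere (0::real^'n) r3"

lemma lebesgue_\<Omega> [simp]: "\<Omega> \<in> sets lebesgue" using open_\<Omega> by simp

text \<open>\<open>reflect u\<close> continues \<open>u\<close> into \<open>B\<^bsub>r2\<^esub>\<close> by the two reflections, so that solutions in the folded
  medium become solutions of the limit problem. \<open>fold_back\<close> is the transpose of \<open>reflect\<close> with respect to the forms of the original and of the
  folded medium; the minus sign comes from the sign of the coefficient in the annulus.\<close>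

definition reflect :: "(real^'n \<Rightarrow> complex) \<Rightarrow> real^'n \<Rightarrow> complex" where
  "reflect u x = (if r2 \<le> norm x then u x else if r1 \<le> norm x then u (F x) else u (K x))"

definition fold_back :: "(real^'n \<Rightarrow> complex) \<Rightarrow> real^'n \<Rightarrow> complex" where
  "fold_back \<phi> y = (if r3 \<le> norm y then \<phi> y
     else if r2 \<le> norm y then \<phi> y - \<phi> (f.\<Psi> y) + \<phi> (k.\<Psi> y) else \<phi> (k.\<Psi> y))"

lemma closure_annulus_eq: "closure annulus = cball 0 r2 - ball 0 r1"
  using closure_annulus cball_diff_ball_subset_closure[OF radii(1,2)] by force

lemma closure_core_eq: "closure core = cball 0 r1"
  using radii by (simp add: closure_ball)

lemma f\<Psi>_r2: "norm y = r2 \<Longrightarrow> f.\<Psi> y = y"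
  using f.\<Psi>_\<Phi>[of y] F_sphere[of y] radii unfolding closure_annulus_eq by auto

lemma F_r3:
  assumes "norm y = r3" obtains x where "norm x = r1" "F x = y"
proof -
  have "y \<in> F ` D" using C1_diffeo_regular(3)[OF F_D] assms radii by auto
  then obtain x where x: "x \<in> D" "F x = y" by blast
  have "\<not> norm x < r1" using F_r1_inside[OF x(1)] x(2) assms by auto
  moreover have "\<not> norm x > r1"
  proof
    assume "norm x > r1"
    then have "x \<in> annulus" using x(1) by auto
    then have "F x \<in> shell" using C1_diffeo_regular(3)[OF F_annulus] by blast
    then show False using x(2) assms by auto
  qed
  ultimately show ?thesis using that x(2) by force
qed

text \<open>Hence the two reflected terms of \<open>fold_back\<close> cancel at radius \<open>r3\<close>; at radius \<open>r2\<close> the first two terms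
  cancel because \<open>F\<close> is the identity there. This is why \<open>fold_back\<close> preserves continuity.\<close>

lemma \<Psi>_r3: "norm y = r3 \<Longrightarrow> f.\<Psi> y = k.\<Psi> y"
proof -
  assume "norm y = r3"
  then obtain x where x: "norm x = r1" "F x = y" by (rule F_r3)
  have "f.\<Psi> y = x" using f.\<Psi>_\<Phi>[of x] x radii unfolding closure_annulus_eq by auto
  moreover have "k.\<Psi> y = x" using k.\<Psi>_\<Phi>[of x] x K_r1[OF x(1)] unfolding closure_core_eq by auto
  ultimately show ?thesis by simp
qed

lemma closed_shell_image: "cball 0 r3 - ball 0 r2 \<subseteq> F ` closure annulus"
proof
  fix y assume y: "y \<in> cball (0::real^'n) r3 - ball 0 r2"
  then consider "norm y = r2" | "norm y = r3" | "y \<in> shell" by (auto simp: order_le_less)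
  then show "y \<in> F ` closure annulus"
  proof cases
    case 1
    then show ?thesis using F_sphere[OF 1] radii unfolding closure_annulus_eq by (intro image_eqI[of _ _ y]) auto
  next
    case 2
    then obtain x where "norm x = r1" "F x = y" by (rule F_r3)
    then show ?thesis using radii unfolding closure_annulus_eq by (intro image_eqI[of _ _ x]) auto
  next
    case 3
    then show ?thesis using f.image_S closure_subset[of annulus] by blast
  qed
qed

lemma closed_ball_image: "cball 0 r3 \<subseteq> K ` closure core"
proof
  fix y assume y: "y \<in> cball (0::real^'n) r3"
  then consider "norm y = r3" | "y \<in> ball 0 r3" by (auto simp: order_le_less)
  then show "y \<in> K ` closure core"
  proof cases
    case 1
    then obtain x where "norm x = r1" "F x = y" by (rule F_r3)
    then show ?thesis using K_r1[of x] unfolding closure_core_eq by (intro image_eqI[of _ _ x]) auto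
  next
    case 2
    then show ?thesis using k.image_S closure_subset[of core] by blast
  qed
qed

lemma bounded_outside_cball:
  assumes "test_function \<Omega> u" "\<And>x. norm x \<ge> r3 \<Longrightarrow> h x = u x"
  shows "bounded {x. h x \<noteq> 0}" "closure {x. h x \<noteq> 0} \<subseteq> \<Omega>"
proof -
  have t: "compact (support_of u)" "support_of u \<subseteq> \<Omega>" using assms(1) by (auto simp: test_function_def)
  have sub: "{x. h x \<noteq> 0} \<subseteq> cball 0 r3 \<union> support_of u"
  proof
    fix x assume x: "x \<in> {x. h x \<noteq> 0}"
    show "x \<in> cball 0 r3 \<union> support_of u"
    proof (cases "norm x \<ge> r3")
      case True
      then have "u x \<noteq> 0" using x assms(2) by auto
      then show ?thesis using closure_subset[of "{x. u x \<noteq> 0}"] by (auto simp: support_of_def)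
    qed auto
  qed
  have "bounded (cball 0 r3 \<union> support_of u)" using compact_imp_bounded[OF t(1)] by simp
  then show "bounded {x. h x \<noteq> 0}" using sub by (rule bounded_subset)
  have "closed (cball 0 r3 \<union> support_of u)" by (intro closed_Un) (auto simp: support_of_def)
  with sub have "closure {x. h x \<noteq> 0} \<subseteq> cball 0 r3 \<union> support_of u" by (rule closure_minimal)
  then show "closure {x. h x \<noteq> 0} \<subseteq> \<Omega>" using t(2) cball_\<Omega> by blast
qed

lemma open_pieces: "open core" "open annulus" "open shell" "open (- cball (0::real^'n) r3)"
  by (auto intro: open_Diff)

lemma reflect_pieces:
  "x \<in> core \<Longrightarrow> reflect u x = u (K x)" "x \<in> annulus \<Longrightarrow> reflect u x = u (F x)"
  "r2 \<le> norm x \<Longrightarrow> reflect u x = u x"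
  using radii by (auto simp: reflect_def)

lemma fold_back_pieces:
  "y \<in> ball 0 r2 \<Longrightarrow> fold_back u y = u (k.\<Psi> y)"
  "y \<in> shell \<Longrightarrow> fold_back u y = u y - u (f.\<Psi> y) + u (k.\<Psi> y)"
  "r3 \<le> norm y \<Longrightarrow> fold_back u y = u y"
  using radii by (auto simp: fold_back_def)

lemma test_function_continuous: "test_function \<Omega> u \<Longrightarrow> continuous_on S u"
  using smooth_on_continuous[OF test_function_smooth] .

lemma reflect_piecewise_C1:
  assumes u: "test_function \<Omega> u"
  shows "piecewise_C1 Z (reflect u)"
proof (rule piecewise_C1_annuli)
  have cu: "continuous_on UNIV u" by (rule test_function_continuous[OF u])
  show "continuous_on UNIV (reflect u)"
  proof (rule continuous_on_annuli)
    have "continuous_on (cball 0 r1) (\<lambda>x. u (K x))"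
      by (rule continuous_on_compose2[OF cu k.cont[unfolded closure_core_eq]]) simp
    then show "continuous_on (cball 0 r1) (reflect u)"
      by (rule continuous_on_eq) (use radii K_r1 in \<open>auto simp: reflect_def\<close>)
    have "continuous_on (cball 0 r2 - ball 0 r1) (\<lambda>x. u (F x))"
      by (rule continuous_on_compose2[OF cu f.cont[unfolded closure_annulus_eq]]) simp
    then show "continuous_on (cball 0 r2 - ball 0 r1) (reflect u)"
      by (rule continuous_on_eq) (use F_sphere in \<open>auto simp: reflect_def\<close>)
    show "continuous_on (cball 0 r3 - ball 0 r2) (reflect u)"
      by (rule continuous_on_eq[OF continuous_on_subset[OF cu]]) (auto simp: reflect_def)
    show "continuous_on (- ball 0 r3) (reflect u)"
      by (rule continuous_on_eq[OF continuous_on_subset[OF cu]]) (use radii in \<open>auto simp: reflect_def\<close>)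
  qed
  show "bounded {x. reflect u x \<noteq> 0}"
    by (rule bounded_outside_cball(1)[OF u]) (use radii in \<open>simp add: reflect_def\<close>)
  note C = C1_bounded_test_function[OF u]
  show "C1_bounded core (reflect u)"
    by (rule C1_bounded_cong[OF open_pieces(1) _ k.C1_bounded_compose(1)[OF C]]) (rule reflect_pieces)
  show "C1_bounded annulus (reflect u)"
    by (rule C1_bounded_cong[OF open_pieces(2) _ f.C1_bounded_compose(1)[OF C]]) (rule reflect_pieces)
  show "C1_bounded shell (reflect u)"
    by (rule C1_bounded_cong[OF open_pieces(3) _ C]) (auto intro: reflect_pieces)
  show "C1_bounded (- cball 0 r3) (reflect u)"
    by (rule C1_bounded_cong[OF open_pieces(4) _ C]) (use radii in \<open>auto intro: reflect_pieces\<close>)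
qed

lemma C1_bounded_fold_back_parts:
  assumes u: "test_function \<Omega> u"
  shows "C1_bounded (ball 0 r3) (\<lambda>y. u (k.\<Psi> y))" "C1_bounded shell (\<lambda>y. u (f.\<Psi> y))"
  by (rule k.C1_bounded_compose_inverse(1)[OF C1_bounded_test_function[OF u]],
      rule f.C1_bounded_compose_inverse(1)[OF C1_bounded_test_function[OF u]])

lemma fold_back_piecewise_C1:
  assumes u: "test_function \<Omega> u"
  shows "piecewise_C1 Z (fold_back u)"
proof (rule piecewise_C1_annuli)
  have cu: "continuous_on UNIV u" by (rule test_function_continuous[OF u])
  have ck: "continuous_on (cball 0 r3) (\<lambda>y. u (k.\<Psi> y))"
    by (rule continuous_on_compose2[OF cu continuous_on_subset[OF k.cont_\<Psi> closed_ball_image]]) simp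
  have cf: "continuous_on (cball 0 r3 - ball 0 r2) (\<lambda>y. u (f.\<Psi> y))"
    by (rule continuous_on_compose2[OF cu continuous_on_subset[OF f.cont_\<Psi> closed_shell_image]]) simp
  have in2: "fold_back u y = u (k.\<Psi> y)" if "norm y \<le> r2" for y
    using that f\<Psi>_r2[of y] radii by (auto simp: fold_back_def)
  show "continuous_on UNIV (fold_back u)"
  proof (rule continuous_on_annuli)
    show "continuous_on (cball 0 r1) (fold_back u)"
      by (rule continuous_on_eq[OF continuous_on_subset[OF ck]]) (use radii in2 in auto)
    show "continuous_on (cball 0 r2 - ball 0 r1) (fold_back u)"
      by (rule continuous_on_eq[OF continuous_on_subset[OF ck]]) (use radii in2 in auto)
    have "continuous_on (cball 0 r3 - ball 0 r2) (\<lambda>y. u y - u (f.\<Psi> y) + u (k.\<Psi> y))"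
      by (rule continuous_on_add[OF continuous_on_diff[OF continuous_on_subset[OF cu] cf] continuous_on_subset[OF ck]]) auto
    then show "continuous_on (cball 0 r3 - ball 0 r2) (fold_back u)"
      by (rule continuous_on_eq) (use \<Psi>_r3 in \<open>auto simp: fold_back_def\<close>)
    show "continuous_on (- ball 0 r3) (fold_back u)"
      by (rule continuous_on_eq[OF continuous_on_subset[OF cu]]) (auto simp: fold_back_def)
  qed
  show "bounded {x. fold_back u x \<noteq> 0}"
    by (rule bounded_outside_cball(1)[OF u]) (simp add: fold_back_def)
  note C = C1_bounded_test_function[OF u] and P = C1_bounded_fold_back_parts[OF u]
  have core: "core \<subseteq> ball 0 r2" "core \<subseteq> ball 0 r3" "annulus \<subseteq> ball 0 r2" "annulus \<subseteq> ball 0 r3" "shell \<subseteq> ball 0 r3"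
    using radii by auto
  show "C1_bounded core (fold_back u)"
    by (rule C1_bounded_cong[OF open_pieces(1) _ C1_bounded_subset[OF P(1) core(2)]]) (use core in \<open>auto intro: fold_back_pieces(1)\<close>)
  show "C1_bounded annulus (fold_back u)"
    by (rule C1_bounded_cong[OF open_pieces(2) _ C1_bounded_subset[OF P(1) core(4)]]) (use core in \<open>auto intro: fold_back_pieces(1)\<close>)
  show "C1_bounded shell (fold_back u)"
    by (rule C1_bounded_cong[OF open_pieces(3) _ C1_bounded_add(1)[OF C1_bounded_add(2)[OF C P(2)] C1_bounded_subset[OF P(1) core(5)]]])
      (rule fold_back_pieces(2))
  show "C1_bounded (- cball 0 r3) (fold_back u)"
    by (rule C1_bounded_cong[OF open_pieces(4) _ C]) (auto intro: fold_back_pieces(3))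
qed

end

section \<open>The folded medium\<close>

lemma integrable_lebesgue_on_subset:
  fixes h :: "'a::euclidean_space \<Rightarrow> 'b::euclidean_space"
  assumes "U \<in> sets lebesgue" "V \<in> sets lebesgue" "V \<subseteq> U" "integrable (lebesgue_on U) h"
  shows "integrable (lebesgue_on V) h"
  using assms set_integrable_subset[of lebesgue U h V] by (simp add: integrable_lebesgue_on_iff)

lemma L2_subset:
  fixes p :: "'a::euclidean_space \<Rightarrow> 'b::euclidean_space"
  assumes "U \<in> sets lebesgue" "V \<in> sets lebesgue" "V \<subseteq> U" "p \<in> L2 U"
  shows "p \<in> L2 V" "L2_norm V p \<le> L2_norm U p"
proof -
  have m: "p \<in> borel_measurable (lebesgue_on V)"
    using measurable_restrict_mono[OF L2_measurable[OF assms(4)] assms(3)] .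
  have i: "integrable (lebesgue_on V) (\<lambda>x. (norm (p x))\<^sup>2)"
    by (rule integrable_lebesgue_on_subset[OF assms(1-3) L2_integrable[OF assms(4)]])
  show "p \<in> L2 V" using m i by (simp add: L2_def)
  have "(LINT x|lebesgue_on V. (norm (p x))\<^sup>2) = (LINT x|lebesgue. indicat_real V x *\<^sub>R (norm (p x))\<^sup>2)"
    by (rule integral_restrict_space) (simp add: assms(2))
  also have "\<dots> \<le> (LINT x|lebesgue. indicat_real U x *\<^sub>R (norm (p x))\<^sup>2)"
  proof (rule integral_mono)
    show "integrable lebesgue (\<lambda>x. indicat_real V x *\<^sub>R (norm (p x))\<^sup>2)"
      using i assms(2) by (simp add: integrable_restrict_space)
    show "integrable lebesgue (\<lambda>x. indicat_real U x *\<^sub>R (norm (p x))\<^sup>2)"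
      using L2_integrable[OF assms(4)] assms(1) by (simp add: integrable_restrict_space)
    show "indicat_real V x *\<^sub>R (norm (p x))\<^sup>2 \<le> indicat_real U x *\<^sub>R (norm (p x))\<^sup>2" for x
      using assms(3) by (auto simp: indicator_def)
  qed
  also have "\<dots> = (LINT x|lebesgue_on U. (norm (p x))\<^sup>2)"
    by (rule integral_restrict_space[symmetric]) (simp add: assms(1))
  finally show "L2_norm V p \<le> L2_norm U p" by (simp add: L2_norm_def)
qed

lemma AE_lebesgue_on_subset:
  assumes "U \<in> sets lebesgue" "V \<in> sets lebesgue" "V \<subseteq> U" "AE x in lebesgue_on U. P x"
  shows "AE x in lebesgue_on V. P x"
proof -
  have "negligible {x \<in> U. \<not> P x}" using assms(4) negligible_AE[OF assms(1), of P] by simp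
  then have "negligible {x \<in> V. \<not> P x}" by (rule negligible_subset) (use assms(3) in auto)
  then show ?thesis using negligible_AE[OF assms(2), of P] by simp
qed

lemma measurable_lebesgue_on_subset:
  "V \<subseteq> U \<Longrightarrow> h \<in> borel_measurable (lebesgue_on U) \<Longrightarrow> h \<in> borel_measurable (lebesgue_on V)"
  by (rule measurable_restrict_mono)

lemma L2_norm_square_split:
  fixes p :: "'a::euclidean_space \<Rightarrow> 'b::euclidean_space"
  assumes s: "U \<in> sets lebesgue" "V \<in> sets lebesgue" "W \<in> sets lebesgue"
    and d: "V \<inter> W = {}" "V \<union> W \<subseteq> U" "negligible (U - (V \<union> W))" and p: "p \<in> L2 U"
  shows "(L2_norm U p)\<^sup>2 = (L2_norm V p)\<^sup>2 + (L2_norm W p)\<^sup>2"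
proof -
  have "integrable (lebesgue_on U) (\<lambda>x. complex_of_real ((norm (p x))\<^sup>2))"
    using L2_integrable[OF p] by (rule integrable_of_real)
  from integral_lebesgue_on_split(3)[OF s d this]
  have "complex_of_real ((L2_norm U p)\<^sup>2) = complex_of_real ((L2_norm V p)\<^sup>2 + (L2_norm W p)\<^sup>2)"
    unfolding L2_norm_square integral_complex_of_real of_real_add .
  then show ?thesis by (simp only: of_real_eq_iff)
qed

context doubly_reflected
begin

text \<open>The folded medium: \<open>K\<close> inflates the core to \<open>B\<^bsub>r3\<^esub>\<close>. It is elliptic, and by double
  complementarity it agrees with \<open>A\<close> in the shell, both almost everywhere.\<close>

definition A_folded :: "real^'n \<Rightarrow> real^'n^'n" where
  "A_folded y = (if norm y < r3 then pushforward core K A y else A y)"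

lemma subset_\<Omega>: "core \<subseteq> \<Omega>" "annulus \<subseteq> \<Omega>" "shell \<subseteq> \<Omega>" "ball 0 r3 \<subseteq> \<Omega>" "ball 0 r2 \<subseteq> \<Omega>"
proof -
  have "ball 0 r3 \<subseteq> \<Omega>" using cball_\<Omega> by (meson ball_subset_cball order_trans)
  then show "core \<subseteq> \<Omega>" "annulus \<subseteq> \<Omega>" "shell \<subseteq> \<Omega>" "ball 0 r3 \<subseteq> \<Omega>" "ball 0 r2 \<subseteq> \<Omega>" using radii by auto
qed

lemma sets_pieces [simp]: "core \<in> sets lebesgue" "annulus \<in> sets lebesgue" "shell \<in> sets lebesgue"
  "ball 0 r3 \<in> sets lebesgue" "ball 0 r2 \<in> sets lebesgue" "\<Omega> - cball 0 r3 \<in> sets lebesgue"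
  using open_pieces open_\<Omega> by (auto intro!: open_lebesgue open_Diff)

lemma split_\<Omega>: "ball 0 r3 \<inter> (\<Omega> - cball 0 r3) = {}" "ball 0 r3 \<union> (\<Omega> - cball 0 r3) \<subseteq> \<Omega>"
  "negligible (\<Omega> - (ball 0 r3 \<union> (\<Omega> - cball 0 r3)))"
  using subset_\<Omega> by (auto intro: negligible_subset[OF negligible_sphere[of 0 r3]])

lemma split_r3: "ball 0 r2 \<inter> shell = {}" "ball 0 r2 \<union> shell \<subseteq> ball 0 r3"
  "negligible (ball 0 r3 - (ball 0 r2 \<union> shell))"
  using radii by (auto intro: negligible_subset[OF negligible_sphere[of 0 r2]])

lemma split_r2: "core \<inter> annulus = {}" "core \<union> annulus \<subseteq> ball 0 r2"
  "negligible (ball 0 r2 - (core \<union> annulus))"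
  using radii by (auto intro: negligible_subset[OF negligible_sphere[of 0 r1]])

lemma A_folded_eq_A: "AE y in lebesgue_on shell. A_folded y = A y"
proof -
  have sh: "shell \<subseteq> ball 0 r3 - ball 0 r2" by auto
  have m: "ball 0 r3 - ball 0 r2 \<in> sets lebesgue" by (intro sets.Diff) simp_all
  have n: "AE y in lebesgue_on shell. y \<noteq> x2"
    using negligible_AE[OF sets_pieces(3)] by (auto intro: negligible_subset[OF negligible_sing[of x2]])
  show ?thesis
    using AE_lebesgue_on_subset[OF m sets_pieces(3) sh double] n AE_space[of "lebesgue_on shell"]
  proof eventually_elim
    case (elim y)
    then show ?case by (simp add: A_folded_def pushforward_K)
  qed
qed

lemma A_folded_measurable: "A_folded \<in> borel_measurable (lebesgue_on \<Omega>)"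
proof -
  have 1: "pushforward core K A \<in> borel_measurable (lebesgue_on (ball 0 r3))"
    by (rule k.measurable_pushforward[OF measurable_lebesgue_on_subset[OF subset_\<Omega>(1) A_measurable]])
  have a: "(\<lambda>y. if y \<in> ball 0 r3 then pushforward core K A y else 0) \<in> borel_measurable lebesgue"
    by (subst borel_measurable_if) (use 1 in simp_all)
  have b: "(\<lambda>y. if y \<in> \<Omega> then A y else 0) \<in> borel_measurable lebesgue"
    by (subst borel_measurable_if) (use A_measurable in simp_all)
  have "(\<lambda>y. if y \<in> ball 0 r3 then (if y \<in> ball 0 r3 then pushforward core K A y else 0)
      else (if y \<in> \<Omega> then A y else 0)) \<in> borel_measurable lebesgue"
    by (rule measurable_If_set[OF a b]) simp
  then have "(\<lambda>y. if y \<in> ball 0 r3 then (if y \<in> ball 0 r3 then pushforward core K A y else 0)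
      else (if y \<in> \<Omega> then A y else 0)) \<in> borel_measurable (lebesgue_on \<Omega>)"
    by (rule measurable_restrict_space1)
  then show ?thesis
    by (rule measurable_cong[THEN iffD1, rotated]) (auto simp: A_folded_def)
qed

lemma A_folded_elliptic:
  obtains \<Lambda>' where "\<Lambda>' > 0" "AE y in lebesgue_on \<Omega>. elliptic \<Lambda>' (A_folded y)"
proof -
  obtain \<Lambda>1 where 1: "\<Lambda>1 > 0" "AE y in lebesgue_on (ball 0 r3). elliptic \<Lambda>1 (pushforward core K A y)"
    by (rule k.elliptic_pushforward_AE[OF AE_lebesgue_on_subset[OF lebesgue_\<Omega> sets_pieces(1) subset_\<Omega>(1) A_elliptic] \<Lambda>]) blast
  have mono: "elliptic (max \<Lambda> \<Lambda>1) M" if M: "elliptic \<Lambda>2 M" and \<Lambda>2: "0 < \<Lambda>2" "\<Lambda>2 \<le> max \<Lambda> \<Lambda>1" for \<Lambda>2 and M :: "real^'n^'n"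
    unfolding elliptic_def
  proof (intro conjI allI)
    show "transpose M = M" using M by (simp add: elliptic_def)
    fix \<xi> :: "real^'n"
    have "(norm \<xi>)\<^sup>2 / max \<Lambda> \<Lambda>1 \<le> (norm \<xi>)\<^sup>2 / \<Lambda>2"
      using \<Lambda>2 by (intro divide_left_mono) auto
    then show "(norm \<xi>)\<^sup>2 / max \<Lambda> \<Lambda>1 \<le> (M *v \<xi>) \<bullet> \<xi>" using M unfolding elliptic_def by (meson order_trans)
    have "\<Lambda>2 * (norm \<xi>)\<^sup>2 \<le> max \<Lambda> \<Lambda>1 * (norm \<xi>)\<^sup>2" using \<Lambda>2 by (intro mult_right_mono) auto
    then show "(M *v \<xi>) \<bullet> \<xi> \<le> max \<Lambda> \<Lambda>1 * (norm \<xi>)\<^sup>2" using M unfolding elliptic_def by (meson order_trans)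
  qed
  have "AE y in lebesgue. y \<in> ball 0 r3 \<longrightarrow> elliptic \<Lambda>1 (pushforward core K A y)"
    using 1(2) by (simp add: AE_restrict_space_iff)
  moreover have "AE y in lebesgue. y \<in> \<Omega> \<longrightarrow> elliptic \<Lambda> (A y)"
    using A_elliptic by (simp add: AE_restrict_space_iff)
  ultimately have "AE y in lebesgue. y \<in> \<Omega> \<longrightarrow> elliptic (max \<Lambda> \<Lambda>1) (A_folded y)"
  proof eventually_elim
    case (elim y)
    then show ?case
      using mono[of \<Lambda>1] mono[of \<Lambda>] 1(1) \<Lambda> by (auto simp: A_folded_def)
  qed
  then have "AE y in lebesgue_on \<Omega>. elliptic (max \<Lambda> \<Lambda>1) (A_folded y)"
    by (simp add: AE_restrict_space_iff)
  moreover have "max \<Lambda> \<Lambda>1 > 0" using \<Lambda> by simp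
  ultimately show ?thesis using that by blast
qed

lemma gradient_reflect:
  assumes u: "test_function \<Omega> u"
  shows "x \<in> core \<Longrightarrow> gradient (reflect u) x = gradient (\<lambda>x. u (K x)) x"
    "x \<in> annulus \<Longrightarrow> gradient (reflect u) x = gradient (\<lambda>x. u (F x)) x"
    "r2 < norm x \<Longrightarrow> gradient (reflect u) x = gradient u x"
proof -
  note C = C1_bounded_test_function[OF u]
  show "gradient (reflect u) x = gradient (\<lambda>x. u (K x)) x" if "x \<in> core"
    by (rule gradient_cong(1)[OF open_pieces(1) that reflect_pieces(1)])
      (use k.C1_bounded_compose(1)[OF C] that in \<open>auto simp: C1_bounded_def\<close>)
  show "gradient (reflect u) x = gradient (\<lambda>x. u (F x)) x" if "x \<in> annulus"
    by (rule gradient_cong(1)[OF open_pieces(2) that reflect_pieces(2)])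
      (use f.C1_bounded_compose(1)[OF C] that in \<open>auto simp: C1_bounded_def\<close>)
  show "gradient (reflect u) x = gradient u x" if "r2 < norm x"
    by (rule gradient_cong(1)[of "- cball 0 r2"])
      (use that C[of UNIV] reflect_pieces(3)[of _ u] in \<open>auto simp: C1_bounded_def\<close>)
qed

lemma gradient_fold_back:
  assumes u: "test_function \<Omega> u"
  shows "y \<in> ball 0 r2 \<Longrightarrow> gradient (fold_back u) y = gradient (\<lambda>y. u (k.\<Psi> y)) y"
    "y \<in> shell \<Longrightarrow> gradient (fold_back u) y = (gradient u y - gradient (\<lambda>y. u (f.\<Psi> y)) y) + gradient (\<lambda>y. u (k.\<Psi> y)) y"
    "r3 < norm y \<Longrightarrow> gradient (fold_back u) y = gradient u y"
proof -
  note C = C1_bounded_test_function[OF u] and P = C1_bounded_fold_back_parts[OF u]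
  have "ball 0 r2 \<subseteq> ball (0::real^'n) r3" using radii by auto
  show "gradient (fold_back u) y = gradient (\<lambda>y. u (k.\<Psi> y)) y" if "y \<in> ball 0 r2"
    by (rule gradient_cong(1)[OF open_ball that fold_back_pieces(1)])
      (use P(1) that \<open>ball 0 r2 \<subseteq> ball 0 r3\<close> in \<open>auto simp: C1_bounded_def\<close>)
  show "gradient (fold_back u) y = (gradient u y - gradient (\<lambda>y. u (f.\<Psi> y)) y) + gradient (\<lambda>y. u (k.\<Psi> y)) y" if y: "y \<in> shell"
  proof -
    have s: "shell \<subseteq> ball 0 r3" by auto
    note P1 = C1_bounded_subset[OF P(1) s]
    note D = C1_bounded_add(2)[OF C[of shell] P(2)]
    have "gradient (fold_back u) y = gradient (\<lambda>y. (u y - u (f.\<Psi> y)) + u (k.\<Psi> y)) y"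
      by (rule gradient_cong(1)[OF open_pieces(3) y fold_back_pieces(2)])
        (use C1_bounded_add(1)[OF D P1] y in \<open>auto simp: C1_bounded_def\<close>)
    then show ?thesis
      using C1_bounded_add(3)[OF D P1 y] C1_bounded_add(4)[OF C[of shell] P(2) y] by simp
  qed
  show "gradient (fold_back u) y = gradient u y" if "r3 < norm y"
    by (rule gradient_cong(1)[of "- cball 0 r3"])
      (use that C[of UNIV] fold_back_pieces(3)[of _ u] in \<open>auto simp: C1_bounded_def\<close>)
qed

lemma reflect_L2: "test_function \<Omega> u \<Longrightarrow> reflect u \<in> L2 \<Omega>" "test_function \<Omega> u \<Longrightarrow> gradient (reflect u) \<in> L2 \<Omega>"
  and fold_back_L2: "test_function \<Omega> u \<Longrightarrow> fold_back u \<in> L2 \<Omega>" "test_function \<Omega> u \<Longrightarrow> gradient (fold_back u) \<in> L2 \<Omega>"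
  using piecewise_C1_L2[OF thin_spheres reflect_piecewise_C1 lebesgue_\<Omega>]
    piecewise_C1_L2[OF thin_spheres fold_back_piecewise_C1 lebesgue_\<Omega>] by auto

lemma L2_norm_cong:
  assumes "\<And>x. x \<in> U \<Longrightarrow> p x = q x"
  shows "L2_norm U p = L2_norm U q"
  unfolding L2_norm_def using assms
  by (intro arg_cong[of _ _ sqrt] Bochner_Integration.integral_cong[OF refl]) auto

lemma L2_norm_pieces:
  fixes p :: "real^'n \<Rightarrow> complex^'n"
  assumes p: "p \<in> L2 \<Omega>"
  shows "L2_norm \<Omega> p \<le> L2_norm core p + L2_norm annulus p + L2_norm shell p + L2_norm (\<Omega> - cball 0 r3) p"
proof -
  note p3 = L2_subset(1)[OF lebesgue_\<Omega> sets_pieces(4) subset_\<Omega>(4) p]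
  note p2 = L2_subset(1)[OF lebesgue_\<Omega> sets_pieces(5) subset_\<Omega>(5) p]
  have "(L2_norm \<Omega> p)\<^sup>2 = (L2_norm core p)\<^sup>2 + (L2_norm annulus p)\<^sup>2 + (L2_norm shell p)\<^sup>2 + (L2_norm (\<Omega> - cball 0 r3) p)\<^sup>2"
    using L2_norm_square_split[OF lebesgue_\<Omega> sets_pieces(4,6) split_\<Omega> p]
      L2_norm_square_split[OF sets_pieces(4,5,3) split_r3 p3]
      L2_norm_square_split[OF sets_pieces(5,1,2) split_r2 p2] by simp
  also have "\<dots> \<le> (L2_norm core p + L2_norm annulus p + L2_norm shell p + L2_norm (\<Omega> - cball 0 r3) p)\<^sup>2"
    by (simp add: power2_sum algebra_simps add_nonneg_nonneg)
  finally show ?thesis by (rule power2_le_imp_le) (simp add: add_nonneg_nonneg)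
qed

lemma reflect_bounded:
  obtains C where "C \<ge> 0" "\<And>u. test_function \<Omega> u \<Longrightarrow> L2_norm \<Omega> (gradient (reflect u)) \<le> C * L2_norm \<Omega> (gradient u)"
proof -
  obtain Cf where Cf: "Cf \<ge> 0" "\<And>u. C1_bounded shell u \<Longrightarrow> L2_norm annulus (gradient (\<lambda>x. u (F x))) \<le> Cf * L2_norm shell (gradient u)"
    by (rule f.gradient_norm_bounds) blast
  obtain Ck where Ck: "Ck \<ge> 0" "\<And>u. C1_bounded (ball 0 r3) u \<Longrightarrow> L2_norm core (gradient (\<lambda>x. u (K x))) \<le> Ck * L2_norm (ball 0 r3) (gradient u)"
    by (rule k.gradient_norm_bounds) blast
  have "L2_norm \<Omega> (gradient (reflect u)) \<le> (Ck + Cf + 1 + 1) * L2_norm \<Omega> (gradient u)" if u: "test_function \<Omega> u" for u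
  proof -
    let ?N = "L2_norm \<Omega> (gradient u)"
    have g: "gradient u \<in> L2 \<Omega>" by (rule test_function_L2(2)[OF u lebesgue_\<Omega>])
    note C = C1_bounded_test_function[OF u]
    note sub = L2_subset(2)[OF lebesgue_\<Omega> _ _ g]
    have "L2_norm core (gradient (reflect u)) = L2_norm core (gradient (\<lambda>x. u (K x)))"
      by (rule L2_norm_cong) (rule gradient_reflect(1)[OF u])
    also have "\<dots> \<le> Ck * L2_norm (ball 0 r3) (gradient u)" by (rule Ck(2)[OF C])
    also have "\<dots> \<le> Ck * ?N" using sub[OF sets_pieces(4) subset_\<Omega>(4)] Ck(1) by (rule mult_left_mono)
    finally have 1: "L2_norm core (gradient (reflect u)) \<le> Ck * ?N" .
    have "L2_norm annulus (gradient (reflect u)) = L2_norm annulus (gradient (\<lambda>x. u (F x)))"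
      by (rule L2_norm_cong) (rule gradient_reflect(2)[OF u])
    also have "\<dots> \<le> Cf * L2_norm shell (gradient u)" by (rule Cf(2)[OF C])
    also have "\<dots> \<le> Cf * ?N" using sub[OF sets_pieces(3) subset_\<Omega>(3)] Cf(1) by (rule mult_left_mono)
    finally have 2: "L2_norm annulus (gradient (reflect u)) \<le> Cf * ?N" .
    have 3: "L2_norm shell (gradient (reflect u)) \<le> ?N"
    proof -
      have "L2_norm shell (gradient (reflect u)) = L2_norm shell (gradient u)"
        by (rule L2_norm_cong) (auto intro: gradient_reflect(3)[OF u])
      then show ?thesis using sub[OF sets_pieces(3) subset_\<Omega>(3)] by simp
    qed
    have 4: "L2_norm (\<Omega> - cball 0 r3) (gradient (reflect u)) \<le> ?N"
    proof -
      have "L2_norm (\<Omega> - cball 0 r3) (gradient (reflect u)) = L2_norm (\<Omega> - cball 0 r3) (gradient u)"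
        by (rule L2_norm_cong) (use radii in \<open>auto intro: gradient_reflect(3)[OF u]\<close>)
      then show ?thesis using sub[OF sets_pieces(6)] by simp
    qed
    show ?thesis
      using L2_norm_pieces[OF reflect_L2(2)[OF u]] 1 2 3 4 by (simp add: distrib_right)
  qed
  then show ?thesis using Cf(1) Ck(1) by (intro that[of "Ck + Cf + 1 + 1"]) auto
qed

lemma fold_back_bounded:
  obtains C where "C \<ge> 0" "\<And>u. test_function \<Omega> u \<Longrightarrow> L2_norm \<Omega> (gradient (fold_back u)) \<le> C * L2_norm \<Omega> (gradient u)"
proof -
  obtain Cf where Cf: "Cf \<ge> 0" "\<And>u. C1_bounded annulus u \<Longrightarrow> L2_norm shell (gradient (\<lambda>y. u (f.\<Psi> y))) \<le> Cf * L2_norm annulus (gradient u)"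
    by (rule f.gradient_norm_bounds) blast
  obtain Ck where Ck: "Ck \<ge> 0" "\<And>u. C1_bounded core u \<Longrightarrow> L2_norm (ball 0 r3) (gradient (\<lambda>y. u (k.\<Psi> y))) \<le> Ck * L2_norm core (gradient u)"
    by (rule k.gradient_norm_bounds) blast
  have "L2_norm \<Omega> (gradient (fold_back u)) \<le> (Ck + Ck + ((1 + Cf) + Ck) + 1) * L2_norm \<Omega> (gradient u)" if u: "test_function \<Omega> u" for u
  proof -
    let ?N = "L2_norm \<Omega> (gradient u)"
    have g: "gradient u \<in> L2 \<Omega>" by (rule test_function_L2(2)[OF u lebesgue_\<Omega>])
    note C = C1_bounded_test_function[OF u] and P = C1_bounded_fold_back_parts[OF u]
    note sub = L2_subset(2)[OF lebesgue_\<Omega> _ _ g]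
    have gk: "gradient (\<lambda>y. u (k.\<Psi> y)) \<in> L2 (ball 0 r3)" by (rule C1_bounded_L2[OF P(1)]) auto
    have gf: "gradient (\<lambda>y. u (f.\<Psi> y)) \<in> L2 shell" by (rule C1_bounded_L2[OF P(2) open_pieces(3)]) (rule f.bounded_T)
    have "L2_norm (ball 0 r3) (gradient (\<lambda>y. u (k.\<Psi> y))) \<le> Ck * L2_norm core (gradient u)" by (rule Ck(2)[OF C])
    also have "\<dots> \<le> Ck * ?N" using sub[OF sets_pieces(1) subset_\<Omega>(1)] Ck(1) by (rule mult_left_mono)
    finally have k: "L2_norm V (gradient (\<lambda>y. u (k.\<Psi> y))) \<le> Ck * ?N" if "V \<subseteq> ball 0 r3" "V \<in> sets lebesgue" for V
      using L2_subset(2)[OF sets_pieces(4) that(2,1) gk] by simp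
    have "L2_norm shell (gradient (\<lambda>y. u (f.\<Psi> y))) \<le> Cf * L2_norm annulus (gradient u)" by (rule Cf(2)[OF C])
    also have "\<dots> \<le> Cf * ?N" using sub[OF sets_pieces(2) subset_\<Omega>(2)] Cf(1) by (rule mult_left_mono)
    finally have f: "L2_norm shell (gradient (\<lambda>y. u (f.\<Psi> y))) \<le> Cf * ?N" .
    have sr: "core \<subseteq> ball 0 r2" "annulus \<subseteq> ball 0 r2" "core \<subseteq> ball 0 r3" "annulus \<subseteq> ball 0 r3" "shell \<subseteq> ball 0 r3"
      using radii by auto
    have 1: "L2_norm core (gradient (fold_back u)) \<le> Ck * ?N"
    proof -
      have "L2_norm core (gradient (fold_back u)) = L2_norm core (gradient (\<lambda>y. u (k.\<Psi> y)))"
        by (rule L2_norm_cong, rule gradient_fold_back(1)[OF u]) (use sr(1) in blast)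
      then show ?thesis using k[OF sr(3) sets_pieces(1)] by simp
    qed
    have 2: "L2_norm annulus (gradient (fold_back u)) \<le> Ck * ?N"
    proof -
      have "L2_norm annulus (gradient (fold_back u)) = L2_norm annulus (gradient (\<lambda>y. u (k.\<Psi> y)))"
        by (rule L2_norm_cong, rule gradient_fold_back(1)[OF u]) (use sr(2) in blast)
      then show ?thesis using k[OF sr(4) sets_pieces(2)] by simp
    qed
    have 3: "L2_norm shell (gradient (fold_back u)) \<le> ((1 + Cf) + Ck) * ?N"
    proof -
      have gs: "gradient u \<in> L2 shell" by (rule L2_subset(1)[OF lebesgue_\<Omega> sets_pieces(3) subset_\<Omega>(3) g])
      note gks = L2_subset(1)[OF sets_pieces(4) sets_pieces(3) sr(5) gk]
      have "L2_norm shell (gradient (fold_back u)) =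
          L2_norm shell (\<lambda>y. (gradient u y - gradient (\<lambda>y. u (f.\<Psi> y)) y) + gradient (\<lambda>y. u (k.\<Psi> y)) y)"
        by (rule L2_norm_cong) (rule gradient_fold_back(2)[OF u])
      also have "\<dots> \<le> L2_norm shell (\<lambda>y. gradient u y - gradient (\<lambda>y. u (f.\<Psi> y)) y) + L2_norm shell (gradient (\<lambda>y. u (k.\<Psi> y)))"
        by (rule L2_norm_triangle[OF L2_diff[OF gs gf] gks])
      also have "L2_norm shell (\<lambda>y. gradient u y - gradient (\<lambda>y. u (f.\<Psi> y)) y) \<le> L2_norm shell (gradient u) + L2_norm shell (gradient (\<lambda>y. u (f.\<Psi> y)))"
        using L2_norm_triangle[OF gs L2_scaleR[OF gf, of "-1"]] L2_norm_scaleR[OF gf, of "-1"] by simp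
      finally show ?thesis
        using f k[OF sr(5) sets_pieces(3)] sub[OF sets_pieces(3) subset_\<Omega>(3)] by (simp add: distrib_right)
    qed
    have 4: "L2_norm (\<Omega> - cball 0 r3) (gradient (fold_back u)) \<le> ?N"
    proof -
      have "L2_norm (\<Omega> - cball 0 r3) (gradient (fold_back u)) = L2_norm (\<Omega> - cball 0 r3) (gradient u)"
        by (rule L2_norm_cong) (auto intro: gradient_fold_back(3)[OF u])
      then show ?thesis using sub[OF sets_pieces(6)] by simp
    qed
    show ?thesis
      using L2_norm_pieces[OF fold_back_L2(2)[OF u]] 1 2 3 4 by (simp add: distrib_right)
  qed
  then show ?thesis using Cf(1) Ck(1) by (intro that[of "Ck + Ck + ((1 + Cf) + Ck) + 1"]) auto
qed

end

section \<open>Duality of reflecting and folding back\<close>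

lemma s_coeff_measurable: "s_coeff r1 r2 \<delta> \<in> borel_measurable (lebesgue_on (U :: 'a::euclidean_space set))"
proof -
  have "(\<lambda>x::'a. if x \<in> ball 0 r2 - ball 0 r1 then - 1 + \<i> * complex_of_real \<delta> else 1) \<in> borel_measurable lebesgue"
    by (rule measurable_If_set) (auto intro!: sets.Diff)
  then show ?thesis unfolding s_coeff_def by (rule measurable_restrict_space1)
qed

lemma s_coeff_bound: "\<bar>\<delta>\<bar> \<le> 1 \<Longrightarrow> norm (s_coeff r1 r2 \<delta> x) \<le> 2"
  using norm_triangle_ineq[of "-1" "\<i> * complex_of_real \<delta>"] by (auto simp: s_coeff_def norm_mult)

context doubly_reflected
begin

lemma A_on: "V \<subseteq> \<Omega> \<Longrightarrow> A \<in> borel_measurable (lebesgue_on V)"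
  "V \<in> sets lebesgue \<Longrightarrow> V \<subseteq> \<Omega> \<Longrightarrow> AE x in lebesgue_on V. elliptic \<Lambda> (A x)"
  using measurable_lebesgue_on_subset[OF _ A_measurable] AE_lebesgue_on_subset[OF lebesgue_\<Omega> _ _ A_elliptic] by auto

text \<open>Piece by piece: with its sign \<open>-1\<close> the annulus is carried by \<open>F\<close> onto the shell and accounts for the
  term \<open>- \<phi> \<circ> F\<^sup>-\<^sup>1\<close> of \<open>fold_back \<phi>\<close>, the core is carried by \<open>K\<close> onto all of \<open>B\<^bsub>r3\<^esub>\<close> and accounts for the term
  \<open>\<phi> \<circ> K\<^sup>-\<^sup>1\<close> there, and \<open>\<phi>\<close> itself remains outside \<open>B\<^bsub>r2\<^esub>\<close>.\<close>

lemma reflect_fold_back_duality: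
  assumes u: "test_function \<Omega> u" and \<phi>: "test_function \<Omega> \<phi>"
  shows "(LINT x|lebesgue_on \<Omega>. s_coeff r1 r2 0 x * pairing (A x) (gradient (reflect u) x) (gradient \<phi> x)) =
    (LINT y|lebesgue_on \<Omega>. pairing (A_folded y) (gradient u y) (gradient (fold_back \<phi>) y))"
proof -
  obtain \<Lambda>' where \<Lambda>': "\<Lambda>' > 0" "AE y in lebesgue_on \<Omega>. elliptic \<Lambda>' (A_folded y)"
    by (rule A_folded_elliptic)
  let ?out = "\<Omega> - cball 0 r3"
  let ?\<phi>k = "\<lambda>y. \<phi> (k.\<Psi> y)" and ?\<phi>f = "\<lambda>y. \<phi> (f.\<Psi> y)"
  note Cu = C1_bounded_test_function[OF u] and C\<phi> = C1_bounded_test_function[OF \<phi>] and P = C1_bounded_fold_back_parts[OF \<phi>]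
  note gu = test_function_L2(2)[OF u lebesgue_\<Omega>] and g\<phi> = test_function_L2(2)[OF \<phi> lebesgue_\<Omega>]
  have sh: "shell \<subseteq> ball 0 r3" and b2: "ball 0 r2 \<subseteq> ball (0::real^'n) r3" using radii by auto
  have gk: "gradient ?\<phi>k \<in> L2 (ball 0 r3)" by (rule C1_bounded_L2[OF P(1)]) auto
  have gf: "gradient ?\<phi>f \<in> L2 shell" by (rule C1_bounded_L2[OF P(2) open_pieces(3) f.bounded_T])
  note guV = L2_subset(1)[OF lebesgue_\<Omega> _ _ gu] and g\<phi>V = L2_subset(1)[OF lebesgue_\<Omega> _ _ g\<phi>]
  note mA = A_folded_measurable
  have AV: "A_folded \<in> borel_measurable (lebesgue_on V)" "AE y in lebesgue_on V. elliptic \<Lambda>' (A_folded y)"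
    if "V \<in> sets lebesgue" "V \<subseteq> \<Omega>" for V
    using measurable_lebesgue_on_subset[OF that(2) mA] AE_lebesgue_on_subset[OF lebesgue_\<Omega> that \<Lambda>'(2)] by auto
  define I where "I V p q = (LINT x|lebesgue_on V. pairing (A x) (p x) (q x))" for V and p q :: "real^'n \<Rightarrow> complex^'n"
  define J where "J V p q = (LINT x|lebesgue_on V. pairing (A_folded x) (p x) (q x))" for V and p q :: "real^'n \<Rightarrow> complex^'n"
  have JI: "J shell p q = I shell p q" if "p \<in> L2 shell" "q \<in> L2 shell" for p q
    unfolding J_def I_def
  proof (rule integral_cong_AE)
    show "AE x in lebesgue_on shell. pairing (A_folded x) (p x) (q x) = pairing (A x) (p x) (q x)"
      using A_folded_eq_A by eventually_elim simp
    show "(\<lambda>x. pairing (A_folded x) (p x) (q x)) \<in> borel_measurable (lebesgue_on shell)"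
      by (rule measurable_pairing[OF AV(1)[OF sets_pieces(3) subset_\<Omega>(3)] L2_measurable[OF that(1)] L2_measurable[OF that(2)]])
    show "(\<lambda>x. pairing (A x) (p x) (q x)) \<in> borel_measurable (lebesgue_on shell)"
      by (rule measurable_pairing[OF A_on(1)[OF subset_\<Omega>(3)] L2_measurable[OF that(1)] L2_measurable[OF that(2)]])
  qed

  let ?L = "\<lambda>x. s_coeff r1 r2 0 x * pairing (A x) (gradient (reflect u) x) (gradient \<phi> x)"
  have s: "s_coeff r1 r2 0 x = 1" if "x \<notin> ball 0 r2 - ball 0 r1" for x :: "real^'n" using that by (simp add: s_coeff_def)
  have s': "s_coeff r1 r2 0 x = -1" if "x \<in> annulus" for x :: "real^'n" using that by (simp add: s_coeff_def)
  have iL: "integrable (lebesgue_on \<Omega>) ?L"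
    by (rule pairing_L2(1)[OF A_measurable A_elliptic \<Lambda> reflect_L2(2)[OF u] g\<phi> s_coeff_measurable s_coeff_bound, of 0]) auto
  note L3 = integral_lebesgue_on_split[OF lebesgue_\<Omega> sets_pieces(4,6) split_\<Omega> iL]
  note L2 = integral_lebesgue_on_split[OF sets_pieces(4,5,3) split_r3 L3(1)]
  note L1 = integral_lebesgue_on_split[OF sets_pieces(5,1,2) split_r2 L2(1)]
  have "(LINT x|lebesgue_on core. ?L x) = I core (gradient (\<lambda>x. u (K x))) (gradient \<phi>)"
    unfolding I_def by (rule Bochner_Integration.integral_cong) (auto simp: gradient_reflect(1)[OF u] s)
  moreover have "(LINT x|lebesgue_on annulus. ?L x) = - I annulus (gradient (\<lambda>x. u (F x))) (gradient \<phi>)"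
  proof -
    have "(LINT x|lebesgue_on annulus. ?L x) =
        (LINT x|lebesgue_on annulus. - pairing (A x) (gradient (\<lambda>x. u (F x)) x) (gradient \<phi> x))"
      by (rule Bochner_Integration.integral_cong) (simp_all add: gradient_reflect(2)[OF u] s')
    then show ?thesis by (simp add: I_def)
  qed
  moreover have "(LINT x|lebesgue_on shell. ?L x) = I shell (gradient u) (gradient \<phi>)"
    unfolding I_def by (rule Bochner_Integration.integral_cong) (auto simp: gradient_reflect(3)[OF u] s)
  moreover have "(LINT x|lebesgue_on ?out. ?L x) = I ?out (gradient u) (gradient \<phi>)"
    unfolding I_def by (rule Bochner_Integration.integral_cong) (use radii in \<open>auto simp: gradient_reflect(3)[OF u] s\<close>)
  ultimately have LHS: "(LINT x|lebesgue_on \<Omega>. ?L x) = I core (gradient (\<lambda>x. u (K x))) (gradient \<phi>)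
      - I annulus (gradient (\<lambda>x. u (F x))) (gradient \<phi>) + I shell (gradient u) (gradient \<phi>) + I ?out (gradient u) (gradient \<phi>)"
    using L1(3) L2(3) L3(3) by simp

  let ?R = "\<lambda>y. pairing (A_folded y) (gradient u y) (gradient (fold_back \<phi>) y)"
  have iR: "integrable (lebesgue_on \<Omega>) ?R"
    by (rule pairing_L2_1(1)[OF mA \<Lambda>'(2,1) gu fold_back_L2(2)[OF \<phi>]])
  note R3 = integral_lebesgue_on_split[OF lebesgue_\<Omega> sets_pieces(4,6) split_\<Omega> iR]
  note R2 = integral_lebesgue_on_split[OF sets_pieces(4,5,3) split_r3 R3(1)]
  have ik: "integrable (lebesgue_on (ball 0 r3)) (\<lambda>y. pairing (A_folded y) (gradient u y) (gradient ?\<phi>k y))"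
    by (rule pairing_L2_1(1)[OF AV[OF sets_pieces(4) subset_\<Omega>(4)] \<Lambda>'(1) guV[OF sets_pieces(4) subset_\<Omega>(4)] gk])
  note k2 = integral_lebesgue_on_split[OF sets_pieces(4,5,3) split_r3 ik]
  have i1: "integrable (lebesgue_on shell) (\<lambda>y. pairing (A_folded y) (gradient u y) (gradient \<phi> y))"
    by (rule pairing_L2_1(1)[OF AV[OF sets_pieces(3) subset_\<Omega>(3)] \<Lambda>'(1) guV[OF sets_pieces(3) subset_\<Omega>(3)] g\<phi>V[OF sets_pieces(3) subset_\<Omega>(3)]])
  have i2: "integrable (lebesgue_on shell) (\<lambda>y. pairing (A_folded y) (gradient u y) (gradient ?\<phi>f y))"
    by (rule pairing_L2_1(1)[OF AV[OF sets_pieces(3) subset_\<Omega>(3)] \<Lambda>'(1) guV[OF sets_pieces(3) subset_\<Omega>(3)] gf])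
  have i2': "integrable (lebesgue_on shell) (\<lambda>y. pairing (A y) (gradient u y) (gradient ?\<phi>f y))"
    by (rule pairing_L2_1(1)[OF A_on(1)[OF subset_\<Omega>(3)] A_on(2)[OF sets_pieces(3) subset_\<Omega>(3)] \<Lambda> guV[OF sets_pieces(3) subset_\<Omega>(3)] gf])
  have "(LINT y|lebesgue_on (ball 0 r2). ?R y) = J (ball 0 r2) (gradient u) (gradient ?\<phi>k)"
    unfolding J_def by (rule Bochner_Integration.integral_cong) (auto simp: gradient_fold_back(1)[OF \<phi>])
  moreover have "(LINT y|lebesgue_on shell. ?R y) =
      J shell (gradient u) (gradient \<phi>) - J shell (gradient u) (gradient ?\<phi>f) + J shell (gradient u) (gradient ?\<phi>k)"
  proof -
    have "(LINT y|lebesgue_on shell. ?R y) = (LINT y|lebesgue_on shell. (pairing (A_folded y) (gradient u y) (gradient \<phi> y)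
        - pairing (A_folded y) (gradient u y) (gradient ?\<phi>f y)) + pairing (A_folded y) (gradient u y) (gradient ?\<phi>k y))"
    proof (rule Bochner_Integration.integral_cong[OF refl])
      fix y assume "y \<in> space (lebesgue_on shell)"
      then have "y \<in> shell" by simp
      then show "?R y = (pairing (A_folded y) (gradient u y) (gradient \<phi> y)
        - pairing (A_folded y) (gradient u y) (gradient ?\<phi>f y)) + pairing (A_folded y) (gradient u y) (gradient ?\<phi>k y)"
        by (simp only: gradient_fold_back(2)[OF \<phi>] pairing_add_right pairing_diff_right)
    qed
    then show ?thesis using i1 i2 k2(2) by (simp add: J_def)
  qed
  moreover have "(LINT y|lebesgue_on ?out. ?R y) = I ?out (gradient u) (gradient \<phi>)"
    unfolding I_def by (rule Bochner_Integration.integral_cong) (auto simp: gradient_fold_back(3)[OF \<phi>] A_folded_def)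
  moreover have "J (ball 0 r2) (gradient u) (gradient ?\<phi>k) + J shell (gradient u) (gradient ?\<phi>k) =
      I core (gradient (\<lambda>x. u (K x))) (gradient \<phi>)"
  proof -
    have "J (ball 0 r2) (gradient u) (gradient ?\<phi>k) + J shell (gradient u) (gradient ?\<phi>k) = J (ball 0 r3) (gradient u) (gradient ?\<phi>k)"
      unfolding J_def using k2(3) by simp
    also have "\<dots> = I core (gradient (\<lambda>x. u (K x))) (gradient (\<lambda>x. ?\<phi>k (K x)))"
      unfolding J_def I_def
    proof (rule k.transform_pairing[OF Cu P(1) _ ik, symmetric])
      show "AE y in lebesgue_on (ball 0 r3). pushforward core K A y = A_folded y"
        by (rule AE_I2) (simp add: A_folded_def)
    qed
    also have "\<dots> = I core (gradient (\<lambda>x. u (K x))) (gradient \<phi>)"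
      unfolding I_def
    proof (rule Bochner_Integration.integral_cong[OF refl])
      fix x assume "x \<in> space (lebesgue_on core)"
      then have x: "x \<in> core" by simp
      have e: "?\<phi>k (K z) = \<phi> z" if "z \<in> core" for z
        using k.\<Psi>_\<Phi>[of z] that closure_subset[of core] by auto
      have "gradient (\<lambda>x. ?\<phi>k (K x)) x = gradient \<phi> x"
        by (rule gradient_cong(1)[OF open_pieces(1) x e smooth_on_differentiable[OF test_function_smooth[OF \<phi>]]])
      then show "pairing (A x) (gradient (\<lambda>x. u (K x)) x) (gradient (\<lambda>x. ?\<phi>k (K x)) x) =
          pairing (A x) (gradient (\<lambda>x. u (K x)) x) (gradient \<phi> x)" by simp
    qed
    finally show ?thesis .
  qed
  moreover have "J shell (gradient u) (gradient ?\<phi>f) = I annulus (gradient (\<lambda>x. u (F x))) (gradient \<phi>)"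
  proof -
    have "J shell (gradient u) (gradient ?\<phi>f) = I shell (gradient u) (gradient ?\<phi>f)"
      by (rule JI[OF guV[OF sets_pieces(3) subset_\<Omega>(3)] gf])
    also have "\<dots> = I annulus (gradient (\<lambda>x. u (F x))) (gradient (\<lambda>x. ?\<phi>f (F x)))"
      unfolding I_def by (rule f.transform_pairing[OF Cu P(2) F_AE i2', symmetric])
    also have "\<dots> = I annulus (gradient (\<lambda>x. u (F x))) (gradient \<phi>)"
      unfolding I_def
    proof (rule Bochner_Integration.integral_cong[OF refl])
      fix x assume "x \<in> space (lebesgue_on annulus)"
      then have x: "x \<in> annulus" by simp
      have e: "?\<phi>f (F z) = \<phi> z" if "z \<in> annulus" for z
        using f.\<Psi>_\<Phi>[of z] that closure_subset[of annulus] by auto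
      have "gradient (\<lambda>x. ?\<phi>f (F x)) x = gradient \<phi> x"
        by (rule gradient_cong(1)[OF open_pieces(2) x e smooth_on_differentiable[OF test_function_smooth[OF \<phi>]]])
      then show "pairing (A x) (gradient (\<lambda>x. u (F x)) x) (gradient (\<lambda>x. ?\<phi>f (F x)) x) =
          pairing (A x) (gradient (\<lambda>x. u (F x)) x) (gradient \<phi> x)" by simp
    qed
    finally show ?thesis .
  qed
  moreover have "J shell (gradient u) (gradient \<phi>) = I shell (gradient u) (gradient \<phi>)"
    by (rule JI[OF guV[OF sets_pieces(3) subset_\<Omega>(3)] g\<phi>V[OF sets_pieces(3) subset_\<Omega>(3)]])
  ultimately show ?thesis using LHS R2(3) R3(3) by simp
qed

end

section \<open>Sesquilinear energies\<close>

lemma test_function_cmult_add: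
  assumes u: "test_function U u" and w: "test_function U w"
  shows "test_function U (\<lambda>x. u x + c * w x)"
    "gradient (\<lambda>x. u x + c * w x) x = gradient u x + (\<chi> i. c * gradient w x $ i)"
proof -
  note su = test_function_smooth[OF u] and sw = test_function_smooth[OF w]
  have sm: "smooth_on UNIV (\<lambda>x. u x + c * w x)"
    by (intro smooth_on_add smooth_on_mult smooth_on_const su sw)
  have "{x. u x + c * w x \<noteq> 0} \<subseteq> {x. u x \<noteq> 0} \<union> {x. w x \<noteq> 0}" by auto
  also have "\<dots> \<subseteq> support_of u \<union> support_of w"
    unfolding support_of_def by (rule Un_mono[OF closure_subset closure_subset])
  finally have "{x. u x + c * w x \<noteq> 0} \<subseteq> support_of u \<union> support_of w" .
  then have s: "support_of (\<lambda>x. u x + c * w x) \<subseteq> support_of u \<union> support_of w"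
    unfolding support_of_def[of "\<lambda>x. u x + c * w x"] by (rule closure_minimal) (auto simp: support_of_def)
  have "compact (support_of u \<union> support_of w)" using u w by (intro compact_Un) (auto simp: test_function_def)
  from compact_Int_closed[OF this, of "support_of (\<lambda>x. u x + c * w x)"]
  have "compact (support_of (\<lambda>x. u x + c * w x))" using s by (simp add: Int_absorb1 support_of_def)
  with sm s u w show "test_function U (\<lambda>x. u x + c * w x)" by (auto simp: test_function_def)
  have bl: "bounded_linear (\<lambda>z::complex. c * z)" by (rule bounded_linear_mult_right)
  note dw = smooth_on_differentiable[OF sw, of x]
  show "gradient (\<lambda>x. u x + c * w x) x = gradient u x + (\<chi> i. c * gradient w x $ i)"
    using gradient_add[OF smooth_on_differentiable[OF su] gradient_bounded_linear(2)[OF dw bl]]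
      gradient_bounded_linear(1)[OF dw bl] by (simp add: vec_eq_iff)
qed

lemma test_function_cnj:
  assumes u: "test_function U u"
  shows "test_function U (\<lambda>x. cnj (u x))" "gradient (\<lambda>x. cnj (u x)) x = cnj_vec (gradient u x)"
proof -
  note su = test_function_smooth[OF u]
  have "support_of (\<lambda>x. cnj (u x)) = support_of u" by (simp add: support_of_def)
  then show "test_function U (\<lambda>x. cnj (u x))"
    using u smooth_on_bounded_linear[OF bounded_linear_cnj su] by (simp add: test_function_def)
  show "gradient (\<lambda>x. cnj (u x)) x = cnj_vec (gradient u x)"
    using gradient_bounded_linear(1)[OF smooth_on_differentiable[OF su] bounded_linear_cnj]
    by (simp add: vec_eq_iff cnj_vec_def)
qed

lemma bounded_linear_cnj_vec: "bounded_linear (cnj_vec :: complex^'n::finite \<Rightarrow> complex^'n)"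
  by (rule linear_conv_bounded_linear[THEN iffD1]) (auto intro!: linearI simp: cnj_vec_def vec_eq_iff)

lemma bounded_linear_cmult_vec: "bounded_linear (\<lambda>p::complex^'n::finite. \<chi> i. c * p $ i)"
  by (rule linear_conv_bounded_linear[THEN iffD1]) (auto intro!: linearI simp: vec_eq_iff algebra_simps)

lemma L2_bounded_linear:
  fixes p :: "'a::euclidean_space \<Rightarrow> 'b::euclidean_space" and l :: "'b \<Rightarrow> 'c::euclidean_space"
  assumes "p \<in> L2 U" "bounded_linear l"
  shows "(\<lambda>x. l (p x)) \<in> L2 U"
proof -
  obtain C where C: "C > 0" "\<And>v. norm (l v) \<le> norm v * C" using bounded_linear.pos_bounded[OF assms(2)] by blast
  have "l \<in> borel_measurable borel"
    by (rule borel_measurable_continuous_onI[OF linear_continuous_on[OF assms(2)]])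
  from measurable_compose[OF L2_measurable[OF assms(1)] this]
  show ?thesis
    by (intro L2_dominated(1)[OF assms(1), of _ C]) (use C in \<open>auto simp: mult.commute\<close>)
qed

lemma L2_cnj_vec: "p \<in> L2 U \<Longrightarrow> (\<lambda>x. cnj_vec (p x)) \<in> L2 U" "L2_norm U (\<lambda>x. cnj_vec (p x)) = L2_norm U p"
  using L2_bounded_linear[OF _ bounded_linear_cnj_vec] by (auto simp: L2_norm_def)

lemma L2_norm_tendsto:
  fixes q :: "'a::euclidean_space \<Rightarrow> 'b::euclidean_space"
  assumes "\<And>k::nat. q' k \<in> L2 U" "q \<in> L2 U" "(\<lambda>k. L2_norm U (\<lambda>x. q' k x - q x)) \<longlonglongrightarrow> 0"
  shows "(\<lambda>k. L2_norm U (q' k)) \<longlonglongrightarrow> L2_norm U q"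
proof (rule LIM_zero_cancel, rule tendsto_rabs_zero_cancel, rule tendsto_sandwich[OF _ _ tendsto_const assms(3)])
  have "\<bar>L2_norm U (q' k) - L2_norm U q\<bar> \<le> L2_norm U (\<lambda>x. q' k x - q x)" for k
    using L2_norm_triangle_diff[OF assms(1)[of k] assms(2)]
      L2_norm_triangle_diff[OF assms(2) assms(1)[of k], unfolded L2_norm_minus_commute[of U q]] by linarith
  then show "\<forall>\<^sub>F k in sequentially. \<bar>L2_norm U (q' k) - L2_norm U q\<bar> \<le> L2_norm U (\<lambda>x. q' k x - q x)" by simp
qed simp

text \<open>The fields \<open>p\<close> and \<open>q\<close> need not be gradients: the estimates are applied to weak gradients and to their
  conjugates.\<close>

definition sform where
  "sform U s B p q = (LINT x|lebesgue_on U. s x * pairing (B x) (p x) (q x))"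

locale form_coeff =
  fixes U :: "(real^'n::finite) set" and B :: "real^'n \<Rightarrow> real^'n^'n" and \<Lambda> :: real
  assumes B_measurable: "B \<in> borel_measurable (lebesgue_on U)"
    and B_elliptic: "AE x in lebesgue_on U. elliptic \<Lambda> (B x)"
    and \<Lambda>_pos: "\<Lambda> > 0"
begin

context
  fixes s :: "real^'n \<Rightarrow> complex" and c :: real
  assumes s: "s \<in> borel_measurable (lebesgue_on U)" "\<And>x. norm (s x) \<le> c"
begin

lemma c_nonneg: "c \<ge> 0"
  using s(2)[of 0] norm_ge_zero order_trans by blast

lemma sform_integrable:
  "p \<in> L2 U \<Longrightarrow> q \<in> L2 U \<Longrightarrow> integrable (lebesgue_on U) (\<lambda>x. s x * pairing (B x) (p x) (q x))"
  by (rule pairing_L2(1)[OF B_measurable B_elliptic \<Lambda>_pos _ _ s c_nonneg])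

lemma sform_bound:
  "p \<in> L2 U \<Longrightarrow> q \<in> L2 U \<Longrightarrow> norm (sform U s B p q) \<le> (c * (\<Lambda> * (real CARD('n))\<^sup>2)) * (L2_norm U p * L2_norm U q)"
  unfolding sform_def by (rule pairing_L2(2)[OF B_measurable B_elliptic \<Lambda>_pos _ _ s c_nonneg])

lemma sform_diff_left: "p \<in> L2 U \<Longrightarrow> p' \<in> L2 U \<Longrightarrow> q \<in> L2 U \<Longrightarrow>
    sform U s B (\<lambda>x. p x - p' x) q = sform U s B p q - sform U s B p' q"
  and sform_diff_right: "p \<in> L2 U \<Longrightarrow> q \<in> L2 U \<Longrightarrow> q' \<in> L2 U \<Longrightarrow>
    sform U s B p (\<lambda>x. q x - q' x) = sform U s B p q - sform U s B p q'"
  and sform_add_left: "p \<in> L2 U \<Longrightarrow> p' \<in> L2 U \<Longrightarrow> q \<in> L2 U \<Longrightarrow>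
    sform U s B (\<lambda>x. p x + p' x) q = sform U s B p q + sform U s B p' q"
  and sform_add_right: "p \<in> L2 U \<Longrightarrow> q \<in> L2 U \<Longrightarrow> q' \<in> L2 U \<Longrightarrow>
    sform U s B p (\<lambda>x. q x + q' x) = sform U s B p q + sform U s B p q'"
  by (simp_all add: sform_def pairing_diff_left pairing_diff_right pairing_add_left pairing_add_right
      right_diff_distrib distrib_left sform_integrable)

lemma sform_tendsto:
  assumes "p \<in> L2 U" "\<And>k::nat. q' k \<in> L2 U" "q \<in> L2 U" "(\<lambda>k. L2_norm U (\<lambda>x. q' k x - q x)) \<longlonglongrightarrow> 0"
  shows "(\<lambda>k. sform U s B p (q' k)) \<longlonglongrightarrow> sform U s B p q"
proof -
  let ?b = "\<lambda>k. (c * (\<Lambda> * (real CARD('n))\<^sup>2)) * (L2_norm U p * L2_norm U (\<lambda>x. q' k x - q x))"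
  have b: "?b \<longlonglongrightarrow> 0" by (intro tendsto_mult_right_zero assms(4))
  have "norm (sform U s B p (q' k) - sform U s B p q) \<le> ?b k" for k
    using sform_bound[OF assms(1) L2_diff[OF assms(2,3)], of k] sform_diff_right[OF assms(1) assms(2)[of k] assms(3)] by simp
  then have "(\<lambda>k. norm (sform U s B p (q' k) - sform U s B p q)) \<longlonglongrightarrow> 0"
    by (intro tendsto_sandwich[OF _ _ tendsto_const b]) auto
  then have "(\<lambda>k. sform U s B p (q' k) - sform U s B p q) \<longlonglongrightarrow> 0" by (rule tendsto_norm_zero_cancel)
  then show ?thesis by (rule LIM_zero_cancel)
qed

end

lemma sform_smult:
  "sform U s B (\<lambda>x. \<chi> i. c * p x $ i) q = c * sform U s B p q"
  "sform U s B p (\<lambda>x. \<chi> i. c * q x $ i) = c * sform U s B p q"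
  by (simp_all add: sform_def pairing_smult mult.left_commute)

lemma sform_hermitian:
  assumes p: "p \<in> L2 U" and q: "q \<in> L2 U"
  shows "sform U (\<lambda>_. 1) B q (\<lambda>x. cnj_vec (p x)) = cnj (sform U (\<lambda>_. 1) B p (\<lambda>x. cnj_vec (q x)))"
proof -
  have "cnj (sform U (\<lambda>_. 1) B p (\<lambda>x. cnj_vec (q x))) = (LINT x|lebesgue_on U. cnj (pairing (B x) (p x) (cnj_vec (q x))))"
    by (simp add: sform_def)
  also have "\<dots> = (LINT x|lebesgue_on U. pairing (B x) (q x) (cnj_vec (p x)))"
  proof (rule integral_cong_AE)
    show "AE x in lebesgue_on U. cnj (pairing (B x) (p x) (cnj_vec (q x))) = pairing (B x) (q x) (cnj_vec (p x))"
      using B_elliptic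
    proof eventually_elim
      case (elim x)
      then have t: "transpose (B x) = B x" by (simp add: elliptic_def)
      have "cnj (pairing (B x) (p x) (cnj_vec (q x))) = pairing (B x) (cnj_vec (p x)) (q x)"
        by (simp add: pairing_def cnj_vec_def)
      then show ?case using pairing_commute[OF t] by simp
    qed
    have m: "(\<lambda>x. pairing (B x) (p' x) (cnj_vec (q' x))) \<in> borel_measurable (lebesgue_on U)" if "p' \<in> L2 U" "q' \<in> L2 U" for p' q'
      by (rule measurable_pairing[OF B_measurable L2_measurable[OF that(1)] L2_measurable[OF L2_cnj_vec(1)[OF that(2)]]])
    show "(\<lambda>x. pairing (B x) (q x) (cnj_vec (p x))) \<in> borel_measurable (lebesgue_on U)" by (rule m[OF q p])
    have "cnj \<in> borel_measurable borel"
      by (rule borel_measurable_continuous_onI[OF linear_continuous_on[OF bounded_linear_cnj]])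
    from measurable_compose[OF m[OF p q] this]
    show "(\<lambda>x. cnj (pairing (B x) (p x) (cnj_vec (q x)))) \<in> borel_measurable (lebesgue_on U)" .
  qed
  finally show ?thesis by (simp add: sform_def)
qed

lemma sform_indicator_real:
  assumes p: "p \<in> L2 U" and s: "s \<in> borel_measurable (lebesgue_on U)" "\<And>x. s x = 0 \<or> s x = 1"
  shows "sform U s B p (\<lambda>x. cnj_vec (p x)) = complex_of_real (Re (sform U s B p (\<lambda>x. cnj_vec (p x))))"
    "0 \<le> Re (sform U s B p (\<lambda>x. cnj_vec (p x)))"
proof -
  define h where "h x = s x * pairing (B x) (p x) (cnj_vec (p x))" for x
  have s1: "norm (s x) \<le> 1" for x using s(2)[of x] by auto
  have i: "integrable (lebesgue_on U) h"
    unfolding h_def by (rule sform_integrable[OF s(1) s1 p L2_cnj_vec(1)[OF p]])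
  have ae: "AE x in lebesgue_on U. h x = complex_of_real (Re (h x)) \<and> 0 \<le> Re (h x)"
    using B_elliptic
  proof eventually_elim
    case (elim x)
    have "0 \<le> (norm (p x))\<^sup>2 / \<Lambda>" using \<Lambda>_pos by simp
    then have "0 \<le> Re (pairing (B x) (p x) (cnj_vec (p x)))" using pairing_coercive(2)[OF elim, of "p x"] by linarith
    with pairing_coercive(1)[OF elim, of "p x"] s(2)[of x] show ?case by (auto simp: h_def)
  qed
  have ae1: "AE x in lebesgue_on U. h x = complex_of_real (Re (h x))" "AE x in lebesgue_on U. 0 \<le> Re (h x)"
    by (rule eventually_mono[OF ae], fast)+
  have iR: "integrable (lebesgue_on U) (\<lambda>x. Re (h x))" using i by (rule integrable_Re)
  have "(LINT x|lebesgue_on U. h x) = (LINT x|lebesgue_on U. complex_of_real (Re (h x)))"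
    by (rule integral_cong_AE[OF borel_measurable_integrable[OF i]
        borel_measurable_integrable[OF integrable_of_real[OF iR]] ae1(1)])
  also have "\<dots> = complex_of_real (LINT x|lebesgue_on U. Re (h x))" by (rule integral_complex_of_real)
  finally have e: "sform U s B p (\<lambda>x. cnj_vec (p x)) = complex_of_real (LINT x|lebesgue_on U. Re (h x))"
    by (simp add: sform_def h_def)
  then show "sform U s B p (\<lambda>x. cnj_vec (p x)) = complex_of_real (Re (sform U s B p (\<lambda>x. cnj_vec (p x))))" by simp
  show "0 \<le> Re (sform U s B p (\<lambda>x. cnj_vec (p x)))"
    unfolding e using integral_nonneg_AE[OF ae1(2)] by simp
qed

lemma sform_coercive:
  assumes p: "p \<in> L2 U"
  shows "(L2_norm U p)\<^sup>2 / \<Lambda> \<le> Re (sform U (\<lambda>_. 1) B p (\<lambda>x. cnj_vec (p x)))"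
    "Re (sform U (\<lambda>_. 1) B p (\<lambda>x. cnj_vec (p x))) \<le> \<Lambda> * (L2_norm U p)\<^sup>2"
proof -
  define h where "h x = pairing (B x) (p x) (cnj_vec (p x))" for x
  have i: "integrable (lebesgue_on U) h"
    using sform_integrable[OF _ _ p L2_cnj_vec(1)[OF p], of "\<lambda>_. 1" 1] by (simp add: h_def[abs_def])
  then have iR: "integrable (lebesgue_on U) (\<lambda>x. Re (h x))" by (rule integrable_Re)
  have ae: "AE x in lebesgue_on U. (norm (p x))\<^sup>2 / \<Lambda> \<le> Re (h x) \<and> Re (h x) \<le> \<Lambda> * (norm (p x))\<^sup>2"
    using B_elliptic by (rule eventually_mono) (unfold h_def, intro conjI pairing_coercive(2,3))
  have ae1: "AE x in lebesgue_on U. (norm (p x))\<^sup>2 / \<Lambda> \<le> Re (h x)" "AE x in lebesgue_on U. Re (h x) \<le> \<Lambda> * (norm (p x))\<^sup>2"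
    by (rule eventually_mono[OF ae], fast)+
  have e: "Re (sform U (\<lambda>_. 1) B p (\<lambda>x. cnj_vec (p x))) = (LINT x|lebesgue_on U. Re (h x))"
    unfolding integral_Re[OF i] by (simp add: sform_def flip: h_def)
  note ip = L2_integrable[OF p]
  have ip1: "integrable (lebesgue_on U) (\<lambda>x. (norm (p x))\<^sup>2 / \<Lambda>)" "integrable (lebesgue_on U) (\<lambda>x. \<Lambda> * (norm (p x))\<^sup>2)"
    unfolding divide_inverse by (rule integrable_mult_left, rule ip) (rule integrable_mult_right, rule ip)
  have c: "(L2_norm U p)\<^sup>2 / \<Lambda> = (LINT x|lebesgue_on U. (norm (p x))\<^sup>2 / \<Lambda>)"
    "\<Lambda> * (L2_norm U p)\<^sup>2 = (LINT x|lebesgue_on U. \<Lambda> * (norm (p x))\<^sup>2)"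
    unfolding L2_norm_square divide_inverse by (rule integral_mult_left_zero[symmetric], rule integral_mult_right_zero[symmetric])
  have "(L2_norm U p)\<^sup>2 / \<Lambda> \<le> (LINT x|lebesgue_on U. Re (h x))"
    unfolding c by (rule integral_mono_AE[OF ip1(1) iR ae1(1)])
  then show "(L2_norm U p)\<^sup>2 / \<Lambda> \<le> Re (sform U (\<lambda>_. 1) B p (\<lambda>x. cnj_vec (p x)))" by (simp only: e)
  have "(LINT x|lebesgue_on U. Re (h x)) \<le> \<Lambda> * (L2_norm U p)\<^sup>2"
    unfolding c by (rule integral_mono_AE[OF iR ip1(2) ae1(2)])
  then show "Re (sform U (\<lambda>_. 1) B p (\<lambda>x. cnj_vec (p x))) \<le> \<Lambda> * (L2_norm U p)\<^sup>2" by (simp only: e)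
qed

end

lemma test_function_0: "test_function U (\<lambda>_. 0)" "gradient (\<lambda>_. 0) x = 0"
  by (simp_all add: test_function_def support_of_def smooth_on_const gradient_def frechet_derivative_const vec_eq_iff)

lemma test_function_cmult:
  assumes w: "test_function U w"
  shows "test_function U (\<lambda>x. c * w x)" "gradient (\<lambda>x. c * w x) x = (\<chi> i. c * gradient w x $ i)"
  using test_function_cmult_add[OF test_function_0(1) w, of c] by (simp_all add: test_function_0(2))

lemma norm_cmult_vec: "norm (\<chi> i. c * p $ i :: complex^'n::finite) = norm c * norm p"
  by (simp add: norm_vec_def L2_set_def norm_mult power_mult_distrib sum_distrib_left[symmetric] real_sqrt_mult)

lemma L2_mult_tendsto:
  fixes f q :: "'a::euclidean_space \<Rightarrow> complex"
  assumes f: "f \<in> L2 U" and q: "\<And>k::nat. q' k \<in> L2 U" "q \<in> L2 U"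
    and l: "(\<lambda>k. L2_norm U (\<lambda>x. q' k x - q x)) \<longlonglongrightarrow> 0"
  shows "(\<lambda>k. LINT x|lebesgue_on U. f x * q' k x) \<longlonglongrightarrow> (LINT x|lebesgue_on U. f x * q x)"
proof (rule LIM_zero_cancel, rule tendsto_norm_zero_cancel, rule tendsto_sandwich[OF _ _ tendsto_const])
  show "(\<lambda>k. L2_norm U f * L2_norm U (\<lambda>x. q' k x - q x)) \<longlonglongrightarrow> 0"
    by (rule tendsto_mult_right_zero[OF l])
  have "norm ((LINT x|lebesgue_on U. f x * q' k x) - (LINT x|lebesgue_on U. f x * q x))
      \<le> L2_norm U f * L2_norm U (\<lambda>x. q' k x - q x)" for k
    using L2_mult_integrable(2)[OF f L2_diff[OF q(1)[of k] q(2)]]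
      L2_mult_integrable(1)[OF f q(1)[of k]] L2_mult_integrable(1)[OF f q(2)]
    by (simp add: right_diff_distrib)
  then show "\<forall>\<^sub>F k in sequentially. norm ((LINT x|lebesgue_on U. f x * q' k x) - (LINT x|lebesgue_on U. f x * q x))
      \<le> L2_norm U f * L2_norm U (\<lambda>x. q' k x - q x)" by simp
qed simp

section \<open>Approximate solutions of elliptic problems\<close>

text \<open>A quadratic functional with first variation \<open>r\<close> in a direction of size \<open>q\<close> can be lowered by \<open>r\<^sup>2 / q\<close>.
  Hence the first variation is small at an almost minimal point, and no minimiser has to exist. The
  excess is allowed to be \<open>\<epsilon>\<^sup>2\<close> so that the bound on \<open>r\<close> is linear in \<open>\<epsilon>\<close>.\<close>

lemma approximate_minimizer:
  fixes E :: "'v \<Rightarrow> real"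
  assumes u0: "u0 \<in> V" and low: "\<And>u. u \<in> V \<Longrightarrow> m \<le> E u" and \<epsilon>: "\<epsilon> > 0"
    and comb: "\<And>u w t. u \<in> V \<Longrightarrow> w \<in> V \<Longrightarrow> comb u t w \<in> V"
    and expand: "\<And>u w t. u \<in> V \<Longrightarrow> w \<in> V \<Longrightarrow> E (comb u t w) = E u + 2 * t * r u w + t\<^sup>2 * q w"
  obtains u where "u \<in> V" "E u \<le> E u0 + \<epsilon>\<^sup>2" "\<And>w. w \<in> V \<Longrightarrow> (r u w)\<^sup>2 \<le> \<epsilon>\<^sup>2 * q w"
proof -
  have bd: "bdd_below (E ` V)" using low by (auto simp: bdd_below_def)
  have ne: "E ` V \<noteq> {}" using u0 by auto
  have "Inf (E ` V) < Inf (E ` V) + \<epsilon>\<^sup>2" using \<epsilon> by simp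
  then obtain u where u: "u \<in> V" "E u < Inf (E ` V) + \<epsilon>\<^sup>2"
    using cInf_lessD[OF ne] by blast
  have inf: "Inf (E ` V) \<le> E w" if "w \<in> V" for w using bd that by (intro cInf_lower) auto
  have "(r u w)\<^sup>2 \<le> q w * \<epsilon>\<^sup>2" if w: "w \<in> V" for w
  proof (rule quadratic_nonneg_discriminant)
    fix t
    have "Inf (E ` V) \<le> E u + 2 * t * r u w + t\<^sup>2 * q w"
      using inf[OF comb[OF u(1) w]] expand[OF u(1) w] by metis
    then show "0 \<le> q w * t\<^sup>2 + 2 * r u w * t + \<epsilon>\<^sup>2" using u(2) by (simp add: algebra_simps)
  qed
  then show ?thesis using that[OF u(1)] u(2) inf[OF u0] by (simp add: mult.commute less_imp_le)
qed

text \<open>Almost minimisers of \<open>\<integral> B \<nabla>v \<cdot> \<nabla>v\<^sup>* + 2 Re \<integral> f v\<^sup>*\<close> among test functions, where \<open>*\<close> is complex conjugation. By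
  Poincare's inequality the functional is bounded below and its size controls the gradient.\<close>

lemma (in form_coeff) approximate_solution:
  assumes U: "open U" "bounded U" and f: "f \<in> L2 U"
  obtains C where "C \<ge> 0"
    "\<And>\<epsilon>. 0 < \<epsilon> \<Longrightarrow> \<epsilon> \<le> 1 \<Longrightarrow> \<exists>v. test_function U v \<and> L2_norm U (gradient v) \<le> C \<and>
      (\<forall>\<phi>. test_function U \<phi> \<longrightarrow>
        norm (sform U (\<lambda>_. 1) B (gradient v) (gradient \<phi>) + (LINT x|lebesgue_on U. f x * \<phi> x)) \<le> \<epsilon> * L2_norm U (gradient \<phi>))"
proof -
  obtain R where R: "R > 0" "U \<subseteq> cball 0 R" using U(2) by (auto simp: bounded_pos subset_iff)
  define M where "M = L2_norm U f * (2 * R)"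
  have M: "M \<ge> 0" using R by (simp add: M_def)
  define ell where "ell \<phi> = (LINT x|lebesgue_on U. f x * \<phi> x)" for \<phi> :: "real^'n \<Rightarrow> complex"
  define a where "a = sform U (\<lambda>_. 1) B"
  define q where "q w = Re (a (gradient w) (\<lambda>x. cnj_vec (gradient w x)))" for w
  define r where "r u w = Re (a (gradient u) (\<lambda>x. cnj_vec (gradient w x))) + Re (ell (\<lambda>x. cnj (w x)))" for u w
  define E where "E u = q u + 2 * Re (ell (\<lambda>x. cnj (u x)))" for u
  define comb where "comb u t w = (\<lambda>x. u x + complex_of_real t * w x)" for u :: "real^'n \<Rightarrow> complex" and t w
  have Us: "U \<in> sets lebesgue" using U by simp
  note tL = test_function_L2[OF _ Us]
  have gL: "(\<lambda>x. cnj_vec (gradient w x)) \<in> L2 U" if "test_function U w" for w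
    by (rule L2_cnj_vec(1)[OF tL(2)[OF that]])
  have one: "(\<lambda>_. 1) \<in> borel_measurable (lebesgue_on U)" "\<And>x::real^'n. norm ((\<lambda>_. 1::complex) x) \<le> 1" by simp_all
  note add = sform_add_left[OF one, folded a_def] sform_add_right[OF one, folded a_def]
  note smult = sform_smult[of "\<lambda>_. 1", folded a_def]
  have ell_bound: "norm (ell \<phi>) \<le> M * L2_norm U (gradient \<phi>)" if \<phi>: "test_function U \<phi>" for \<phi>
  proof -
    have "norm (ell \<phi>) \<le> L2_norm U f * L2_norm U \<phi>" unfolding ell_def by (rule L2_mult_integrable(2)[OF f tL(1)[OF \<phi>]])
    also have "\<dots> \<le> L2_norm U f * (2 * R * L2_norm U (gradient \<phi>))"
      by (rule mult_left_mono[OF test_function_poincare[OF U(1) R(2) less_imp_le[OF R(1)] \<phi>]]) simp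
    finally show ?thesis by (simp add: M_def)
  qed
  have norm_cnj: "L2_norm U (gradient (\<lambda>x. cnj (u x))) = L2_norm U (gradient u)" if u: "test_function U u" for u
    unfolding ext[where g = "\<lambda>x. cnj_vec (gradient u x)", OF test_function_cnj(2)[OF u]] by (rule L2_cnj_vec(2))
  have ell_lin: "ell (\<lambda>x. u x + c * w x) = ell u + c * ell w" if "test_function U u" "test_function U w" for u w c
    using L2_mult_integrable(1)[OF f tL(1)[OF that(1)]] L2_mult_integrable(1)[OF f tL(1)[OF that(2)]]
    by (simp add: ell_def distrib_left mult.left_commute[of _ c])

  have q_lower: "(L2_norm U (gradient u))\<^sup>2 / \<Lambda> \<le> q u" if "test_function U u" for u
    unfolding q_def a_def by (rule sform_coercive(1)[OF tL(2)[OF that]])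
  have q_upper: "q u \<le> \<Lambda> * (L2_norm U (gradient u))\<^sup>2" if "test_function U u" for u
    unfolding q_def a_def by (rule sform_coercive(2)[OF tL(2)[OF that]])
  have E_lower: "(L2_norm U (gradient u) - \<Lambda> * M)\<^sup>2 / \<Lambda> - \<Lambda> * M\<^sup>2 \<le> E u" if u: "test_function U u" for u
  proof -
    have "\<bar>Re (ell (\<lambda>x. cnj (u x)))\<bar> \<le> M * L2_norm U (gradient u)"
      using ell_bound[OF test_function_cnj(1)[OF u]] norm_cnj[OF u] abs_Re_le_cmod order_trans by metis
    then have "(L2_norm U (gradient u))\<^sup>2 / \<Lambda> - 2 * (M * L2_norm U (gradient u)) \<le> E u"
      using q_lower[OF u] unfolding E_def by linarith
    moreover have "(L2_norm U (gradient u) - \<Lambda> * M)\<^sup>2 / \<Lambda> - \<Lambda> * M\<^sup>2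
        = (L2_norm U (gradient u))\<^sup>2 / \<Lambda> - 2 * (M * L2_norm U (gradient u))"
      using \<Lambda>_pos by (simp add: field_simps power2_eq_square)
    ultimately show ?thesis by simp
  qed
  have comb_test: "test_function U (comb u t w)" if "test_function U u" "test_function U w" for u t w
    unfolding comb_def by (rule test_function_cmult_add(1)[OF that])
  have expand: "E (comb u t w) = E u + 2 * t * r u w + t\<^sup>2 * q w" if u: "test_function U u" and w: "test_function U w" for u t w
  proof -
    let ?t = "complex_of_real t"
    let ?cu = "\<lambda>x. cnj_vec (gradient u x)" and ?cw = "\<lambda>x. cnj_vec (gradient w x)"
    have tw: "(\<lambda>x. \<chi> i. ?t * gradient w x $ i) \<in> L2 U" "(\<lambda>x. \<chi> i. ?t * ?cw x $ i) \<in> L2 U"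
      by (rule L2_bounded_linear[OF _ bounded_linear_cmult_vec], rule tL(2)[OF w],
          rule L2_bounded_linear[OF _ bounded_linear_cmult_vec], rule gL[OF w])
    have g: "gradient (comb u t w) = (\<lambda>x. gradient u x + (\<chi> i. ?t * gradient w x $ i))"
      unfolding comb_def by (rule ext, rule test_function_cmult_add(2)[OF u w])
    have cg: "(\<lambda>x. cnj_vec (gradient (comb u t w) x)) = (\<lambda>x. ?cu x + (\<chi> i. ?t * ?cw x $ i))"
      unfolding g by (simp add: cnj_vec_def vec_eq_iff fun_eq_iff)
    have h: "a (gradient w) ?cu = cnj (a (gradient u) ?cw)"
      unfolding a_def by (rule sform_hermitian[OF tL(2)[OF u] tL(2)[OF w]])
    have "a (gradient (comb u t w)) (\<lambda>x. cnj_vec (gradient (comb u t w) x))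
        = a (gradient u) ?cu + ?t * a (gradient u) ?cw + (?t * a (gradient w) ?cu + ?t * (?t * a (gradient w) ?cw))"
      unfolding cg unfolding g
      using tL(2)[OF u] tL(2)[OF w] gL[OF u] gL[OF w] tw
      by (simp add: add L2_add smult distrib_left)
    then have "q (comb u t w) = q u + 2 * t * Re (a (gradient u) ?cw) + t\<^sup>2 * q w"
      by (simp add: q_def h power2_eq_square)
    moreover have "ell (\<lambda>x. cnj (comb u t w x)) = ell (\<lambda>x. cnj (u x)) + ?t * ell (\<lambda>x. cnj (w x))"
      using ell_lin[OF test_function_cnj(1)[OF u] test_function_cnj(1)[OF w], of ?t] by (simp add: comb_def)
    ultimately show ?thesis by (simp add: E_def r_def algebra_simps)
  qed

  define C where "C = 2 * (\<Lambda> * M) + 1"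
  have \<Lambda>M: "\<Lambda> * M \<ge> 0" using M \<Lambda>_pos by simp
  show thesis
  proof (rule that[of C])
    show "C \<ge> 0" using \<Lambda>M by (simp add: C_def)
    fix \<epsilon> :: real assume \<epsilon>: "0 < \<epsilon>" "\<epsilon> \<le> 1"
    define e where "e = \<epsilon> / sqrt \<Lambda>"
    have e: "e > 0" "e\<^sup>2 = \<epsilon>\<^sup>2 / \<Lambda>" using \<epsilon> \<Lambda>_pos by (simp_all add: e_def power_divide)
    have low: "- (\<Lambda> * M\<^sup>2) \<le> E u" if "u \<in> Collect (test_function U)" for u
    proof -
      have "0 \<le> (L2_norm U (gradient u) - \<Lambda> * M)\<^sup>2 / \<Lambda>" using \<Lambda>_pos by simp
      then show ?thesis using E_lower[of u] that by simp
    qed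
    obtain v where v: "test_function U v" "E v \<le> E (\<lambda>_. 0) + e\<^sup>2" "\<And>w. test_function U w \<Longrightarrow> (r v w)\<^sup>2 \<le> e\<^sup>2 * q w"
      by (rule approximate_minimizer[of "\<lambda>_. 0" "Collect (test_function U)" "- (\<Lambda> * M\<^sup>2)" E e comb r q])
        (use test_function_0(1) low e(1) comb_test expand in auto)
    let ?n = "L2_norm U (gradient v)"
    have E0: "E (\<lambda>_. 0) = 0"
      by (simp add: E_def q_def a_def sform_def ell_def test_function_0(2) pairing_def)
    have "(?n - \<Lambda> * M)\<^sup>2 / \<Lambda> \<le> \<Lambda> * M\<^sup>2 + \<epsilon>\<^sup>2 / \<Lambda>" using E_lower[OF v(1)] v(2) E0 e(2) by linarith
    also have "\<dots> = ((\<Lambda> * M)\<^sup>2 + \<epsilon>\<^sup>2) / \<Lambda>" using \<Lambda>_pos by (simp add: field_simps power2_eq_square)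
    finally have "(?n - \<Lambda> * M)\<^sup>2 \<le> (\<Lambda> * M)\<^sup>2 + \<epsilon>\<^sup>2"
      using \<Lambda>_pos by (simp add: divide_le_cancel)
    also have "\<dots> \<le> (\<Lambda> * M)\<^sup>2 + 1" using \<epsilon> by (simp add: power_le_one)
    also have "\<dots> \<le> (\<Lambda> * M + 1)\<^sup>2" using \<Lambda>M by (simp add: power2_sum)
    finally have "\<bar>?n - \<Lambda> * M\<bar> \<le> \<bar>\<Lambda> * M + 1\<bar>" by (rule abs_le_square_iff[THEN iffD2])
    then have "\<bar>?n - \<Lambda> * M\<bar> \<le> \<Lambda> * M + 1" using \<Lambda>M by simp
    then have n: "?n \<le> C" by (simp add: C_def)
    have "norm (a (gradient v) (gradient \<phi>) + ell \<phi>) \<le> \<epsilon> * L2_norm U (gradient \<phi>)" if \<phi>: "test_function U \<phi>" for \<phi>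
    proof -
      define z where "z = a (gradient v) (gradient \<phi>) + ell \<phi>"
      obtain c where c: "norm c = 1" "c * z = complex_of_real (norm z)"
      proof (cases "z = 0")
        case True then show ?thesis using that[of 1] by simp
      next
        case False
        have "cnj z / complex_of_real (norm z) * z = complex_of_real (norm z)"
          using False complex_norm_square[of z] by (simp add: field_simps power2_eq_square)
        then show ?thesis using that[of "cnj z / complex_of_real (norm z)"] False by (simp add: norm_divide)
      qed
      \<comment> \<open>the conjugations cancel in \<open>r v w\<close>, and \<open>c\<close> rotates the residual \<open>z\<close> to its modulus\<close>
      define w where "w x = cnj (c * \<phi> x)" for x
      note t = test_function_cmult[OF \<phi>, of c]
      have w: "test_function U w" unfolding w_def by (rule test_function_cnj(1)[OF t(1)])
      have gw: "gradient w x = cnj_vec (\<chi> i. c * gradient \<phi> x $ i)" for x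
        unfolding w_def test_function_cnj(2)[OF t(1)] t(2) ..
      have cw: "(\<lambda>x. cnj_vec (gradient w x)) = (\<lambda>x. \<chi> i. c * gradient \<phi> x $ i)" "(\<lambda>x. cnj (w x)) = (\<lambda>x. c * \<phi> x)"
        by (simp_all add: gw cnj_vec_def w_def vec_eq_iff fun_eq_iff)
      have "r v w = Re (c * z)"
        unfolding r_def cw smult z_def by (simp add: ell_def distrib_left mult.left_commute[of _ c])
      then have r: "r v w = norm z" using c(2) by simp
      have "norm (gradient w x) = norm (gradient \<phi> x)" for x
        unfolding gw by (simp add: norm_cmult_vec c(1))
      then have "L2_norm U (gradient w) = L2_norm U (gradient \<phi>)" by (simp add: L2_norm_def)
      then have "q w \<le> \<Lambda> * (L2_norm U (gradient \<phi>))\<^sup>2" using q_upper[OF w] by simp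
      then have "e\<^sup>2 * q w \<le> e\<^sup>2 * (\<Lambda> * (L2_norm U (gradient \<phi>))\<^sup>2)" by (rule mult_left_mono) simp
      also have "\<dots> = (\<epsilon> * L2_norm U (gradient \<phi>))\<^sup>2" using \<Lambda>_pos by (simp add: e(2) power_mult_distrib)
      finally have "(norm z)\<^sup>2 \<le> (\<epsilon> * L2_norm U (gradient \<phi>))\<^sup>2" using v(3)[OF w] r by simp
      then show ?thesis unfolding z_def[symmetric] by (rule power2_le_imp_le) (use \<epsilon> in simp)
    qed
    then show "\<exists>v. test_function U v \<and> L2_norm U (gradient v) \<le> C \<and>
      (\<forall>\<phi>. test_function U \<phi> \<longrightarrow>
        norm (sform U (\<lambda>_. 1) B (gradient v) (gradient \<phi>) + (LINT x|lebesgue_on U. f x * \<phi> x)) \<le> \<epsilon> * L2_norm U (gradient \<phi>))"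
      using v(1) n unfolding a_def ell_def by blast
  qed
qed

section \<open>The energy estimate\<close>

text \<open>\<open>X\<close> and \<open>Y\<close> are the energies of the error in the annulus and outside, \<open>W\<close> is the forcing. The imaginary
  part carries the common factor \<open>\<delta>\<close> and bounds \<open>X\<close>; the real part then bounds \<open>Y\<close> by \<open>X\<close>, in spite of the
  negative sign of the coefficient in the annulus.\<close>

lemma energy_algebra:
  fixes X Y K \<delta> :: real and W :: complex
  assumes XY: "0 \<le> X" and \<delta>: "0 < \<delta>" "\<delta> \<le> 1"
    and b: "norm (of_real Y - of_real X + \<i> * of_real \<delta> * of_real X + \<i> * of_real \<delta> * W) \<le> \<delta> * K"
  shows "X + Y \<le> 3 * (norm W + K)"
proof -
  let ?z = "of_real Y - of_real X + \<i> * of_real \<delta> * of_real X + \<i> * of_real \<delta> * W"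
  have "\<delta> * (X + Re W) \<le> \<delta> * K"
    using b abs_Im_le_cmod[of ?z] by (simp add: algebra_simps)
  then have "X + Re W \<le> K" using \<delta> by simp
  then have X: "X \<le> norm W + K" using abs_Re_le_cmod[of W] by linarith
  have k: "0 \<le> norm W + K" using X XY by linarith
  have "Y - X - \<delta> * Im W \<le> \<delta> * K"
    using b abs_Re_le_cmod[of ?z] by (simp add: algebra_simps)
  moreover have "\<delta> * Im W \<le> \<delta> * norm W" using abs_Im_le_cmod[of W] \<delta> by (intro mult_left_mono) auto
  moreover have "\<delta> * (norm W + K) \<le> norm W + K" using k \<delta> by (intro mult_left_le_one_le) auto
  ultimately have "Y \<le> X + (norm W + K)" by (simp add: distrib_left)
  then have "X + Y \<le> (norm W + K) + (norm W + K) + (norm W + K)" using X by linarith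
  then show ?thesis by simp
qed

lemma (in form_coeff) sform_coeff_add:
  fixes s t :: "real^'n \<Rightarrow> complex"
  assumes s: "s \<in> borel_measurable (lebesgue_on U)" "\<And>x. norm (s x) \<le> b"
    and t: "t \<in> borel_measurable (lebesgue_on U)" "\<And>x. norm (t x) \<le> b'"
    and p: "p \<in> L2 U" and q: "q \<in> L2 U"
  shows "sform U (\<lambda>x. s x + c * t x) B p q = sform U s B p q + c * sform U t B p q"
proof -
  have "(\<lambda>x. (s x + c * t x) * pairing (B x) (p x) (q x)) =
      (\<lambda>x. s x * pairing (B x) (p x) (q x) + c * (t x * pairing (B x) (p x) (q x)))"
    by (simp add: distrib_right mult.assoc)
  then show ?thesis
    using sform_integrable[OF s p q] sform_integrable[OF t p q] by (simp add: sform_def)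
qed

context doubly_reflected
begin

text \<open>\<open>fold_back \<phi>\<close> differs from \<open>\<phi>\<close> only in \<open>B\<^bsub>r3\<^esub>\<close>, where \<open>f\<close> vanishes.\<close>

lemma fold_back_load:
  assumes f0: "AE x in lebesgue_on (ball 0 r3). f x = 0"
    and f: "f \<in> L2 \<Omega>" and \<phi>: "test_function \<Omega> \<phi>"
  shows "(LINT x|lebesgue_on \<Omega>. f x * fold_back \<phi> x) = (LINT x|lebesgue_on \<Omega>. f x * \<phi> x)"
proof (rule integral_cong_AE)
  have "negligible {x \<in> ball 0 r3. \<not> f x = 0}" by (rule negligible_AE[OF sets_pieces(4), THEN iffD1, OF f0])
  then have "negligible {x \<in> \<Omega>. \<not> f x * fold_back \<phi> x = f x * \<phi> x}"
    by (rule negligible_subset) (use fold_back_pieces(3)[of _ \<phi>] in force)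
  then show "AE x in lebesgue_on \<Omega>. f x * fold_back \<phi> x = f x * \<phi> x"
    by (rule negligible_AE[OF lebesgue_\<Omega>, THEN iffD2])
qed (rule borel_measurable_integrable, rule L2_mult_integrable(1)[OF f fold_back_L2(1)[OF \<phi>]],
  rule borel_measurable_integrable, rule L2_mult_integrable(1)[OF f test_function_L2(1)[OF \<phi> lebesgue_\<Omega>]])

text \<open>By duality, reflecting an approximate solution in the folded medium gives an approximate solution of
  the equation with \<open>\<delta> = 0\<close>. Duality leads to the test field \<open>fold_back \<phi>\<close>, which is only glued from \<open>C\<^sup>1\<close>
  pieces, so it is replaced by approximating test functions first.\<close>

lemma approximate_field:
  assumes f0: "AE x in lebesgue_on (ball 0 r3). f x = 0" and f: "f \<in> L2 \<Omega>"
  obtains C1 C2 where "C1 \<ge> 0" "C2 \<ge> 0"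
    "\<And>\<epsilon>. 0 < \<epsilon> \<Longrightarrow> \<epsilon> \<le> 1 \<Longrightarrow> \<exists>v. test_function \<Omega> v \<and> L2_norm \<Omega> (gradient (reflect v)) \<le> C1 \<and>
      (\<forall>\<phi>. test_function \<Omega> \<phi> \<longrightarrow>
        norm (sform \<Omega> (s_coeff r1 r2 0) A (gradient (reflect v)) (gradient \<phi>) + (LINT x|lebesgue_on \<Omega>. f x * \<phi> x))
          \<le> \<epsilon> * (C2 * L2_norm \<Omega> (gradient \<phi>)))"
proof -
  obtain \<Lambda>' where \<Lambda>': "\<Lambda>' > 0" "AE y in lebesgue_on \<Omega>. elliptic \<Lambda>' (A_folded y)"
    by (rule A_folded_elliptic)
  interpret form_coeff \<Omega> A_folded \<Lambda>'
    by (rule form_coeff.intro[OF A_folded_measurable \<Lambda>'(2,1)])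
  obtain C where C: "C \<ge> 0" and sol:
    "\<And>\<epsilon>. 0 < \<epsilon> \<Longrightarrow> \<epsilon> \<le> 1 \<Longrightarrow> \<exists>v. test_function \<Omega> v \<and> L2_norm \<Omega> (gradient v) \<le> C \<and>
      (\<forall>\<phi>. test_function \<Omega> \<phi> \<longrightarrow>
        norm (sform \<Omega> (\<lambda>_. 1) A_folded (gradient v) (gradient \<phi>) + (LINT x|lebesgue_on \<Omega>. f x * \<phi> x)) \<le> \<epsilon> * L2_norm \<Omega> (gradient \<phi>))"
    proof (rule approximate_solution[OF open_\<Omega> bounded_\<Omega> f], goal_cases)
      case (1 C)
      show ?case by (rule 1(1)) (fact 1)+
    qed
  obtain CP where CP: "CP \<ge> 0" "\<And>u. test_function \<Omega> u \<Longrightarrow> L2_norm \<Omega> (gradient (reflect u)) \<le> CP * L2_norm \<Omega> (gradient u)"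
    proof (rule reflect_bounded, goal_cases)
      case (1 C)
      show ?case by (rule 1(1)) (fact 1)+
    qed
  obtain CQ where CQ: "CQ \<ge> 0" "\<And>u. test_function \<Omega> u \<Longrightarrow> L2_norm \<Omega> (gradient (fold_back u)) \<le> CQ * L2_norm \<Omega> (gradient u)"
    proof (rule fold_back_bounded, goal_cases)
      case (1 C)
      show ?case by (rule 1(1)) (fact 1)+
    qed
  note tL = test_function_L2[OF _ lebesgue_\<Omega>]
  have one: "(\<lambda>_. 1) \<in> borel_measurable (lebesgue_on \<Omega>)" "\<And>x::real^'n. norm ((\<lambda>_. 1::complex) x) \<le> 1" by simp_all
  show thesis
  proof (rule that[of "CP * C" CQ])
    fix \<epsilon> :: real assume \<epsilon>: "0 < \<epsilon>" "\<epsilon> \<le> 1"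
    obtain v where v: "test_function \<Omega> v" "L2_norm \<Omega> (gradient v) \<le> C"
      and res: "\<And>\<phi>. test_function \<Omega> \<phi> \<Longrightarrow>
        norm (sform \<Omega> (\<lambda>_. 1) A_folded (gradient v) (gradient \<phi>) + (LINT x|lebesgue_on \<Omega>. f x * \<phi> x)) \<le> \<epsilon> * L2_norm \<Omega> (gradient \<phi>)"
      using sol[OF \<epsilon>] by blast
    have "L2_norm \<Omega> (gradient (reflect v)) \<le> CP * C"
      using CP(2)[OF v(1)] mult_left_mono[OF v(2) CP(1)] by linarith
    moreover have "norm (sform \<Omega> (s_coeff r1 r2 0) A (gradient (reflect v)) (gradient \<phi>) + (LINT x|lebesgue_on \<Omega>. f x * \<phi> x))
          \<le> \<epsilon> * (CQ * L2_norm \<Omega> (gradient \<phi>))" if \<phi>: "test_function \<Omega> \<phi>" for \<phi>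
    proof -
      have supp: "closure {x. fold_back \<phi> x \<noteq> 0} \<subseteq> \<Omega>"
        by (rule bounded_outside_cball(2)[OF \<phi>]) (rule fold_back_pieces(3))
      obtain \<psi> where \<psi>: "\<And>k::nat. test_function \<Omega> (\<psi> k)"
        "(\<lambda>k. L2_norm \<Omega> (\<lambda>x. \<psi> k x - fold_back \<phi> x)) \<longlonglongrightarrow> 0"
        "(\<lambda>k. L2_norm \<Omega> (\<lambda>x. gradient (\<psi> k) x - gradient (fold_back \<phi>) x)) \<longlonglongrightarrow> 0"
        by (rule piecewise_C1_approximation[OF thin_spheres fold_back_piecewise_C1[OF \<phi>] open_\<Omega> supp]) blast
      have "(\<lambda>k. norm (sform \<Omega> (\<lambda>_. 1) A_folded (gradient v) (gradient (\<psi> k)) + (LINT x|lebesgue_on \<Omega>. f x * \<psi> k x)))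
          \<longlonglongrightarrow> norm (sform \<Omega> (\<lambda>_. 1) A_folded (gradient v) (gradient (fold_back \<phi>)) + (LINT x|lebesgue_on \<Omega>. f x * fold_back \<phi> x))"
        by (rule tendsto_norm, rule tendsto_add)
          (rule sform_tendsto[OF one tL(2)[OF v(1)] tL(2)[OF \<psi>(1)] fold_back_L2(2)[OF \<phi>] \<psi>(3)],
           rule L2_mult_tendsto[OF f tL(1)[OF \<psi>(1)] fold_back_L2(1)[OF \<phi>] \<psi>(2)])
      moreover have "(\<lambda>k. \<epsilon> * L2_norm \<Omega> (gradient (\<psi> k))) \<longlonglongrightarrow> \<epsilon> * L2_norm \<Omega> (gradient (fold_back \<phi>))"
        by (rule tendsto_mult_left, rule L2_norm_tendsto[OF tL(2)[OF \<psi>(1)] fold_back_L2(2)[OF \<phi>] \<psi>(3)])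
      ultimately have "norm (sform \<Omega> (\<lambda>_. 1) A_folded (gradient v) (gradient (fold_back \<phi>)) + (LINT x|lebesgue_on \<Omega>. f x * fold_back \<phi> x))
          \<le> \<epsilon> * L2_norm \<Omega> (gradient (fold_back \<phi>))"
        by (rule LIMSEQ_le) (use res[OF \<psi>(1)] in blast)
      also have "\<dots> \<le> \<epsilon> * (CQ * L2_norm \<Omega> (gradient \<phi>))"
        by (rule mult_left_mono[OF CQ(2)[OF \<phi>]]) (use \<epsilon> in simp)
      finally show ?thesis
        using reflect_fold_back_duality[OF v(1) \<phi>] fold_back_load[OF f0 f \<phi>] by (simp add: sform_def)
    qed
    ultimately show "\<exists>v. test_function \<Omega> v \<and> L2_norm \<Omega> (gradient (reflect v)) \<le> CP * C \<and>
      (\<forall>\<phi>. test_function \<Omega> \<phi> \<longrightarrow>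
        norm (sform \<Omega> (s_coeff r1 r2 0) A (gradient (reflect v)) (gradient \<phi>) + (LINT x|lebesgue_on \<Omega>. f x * \<phi> x))
          \<le> \<epsilon> * (CQ * L2_norm \<Omega> (gradient \<phi>)))"
      using v(1) by blast
  qed (use CP CQ C in simp_all)
qed

text \<open>The reflected field is taken with accuracy \<open>\<epsilon> = \<delta>\<close>. The error \<open>H\<close> between the gradient of the solution
  and the reflected field is then forced by terms of order \<open>\<delta>\<close> only, the size of the absorption in the
  annulus. By density the conjugate of \<open>H\<close> is an admissible test field.\<close>

lemma uniform_bound:
  assumes f0: "AE x in lebesgue_on (ball 0 r3). f x = 0" and f: "f \<in> L2 \<Omega>"
  obtains C where "\<And>\<delta> u. 0 < \<delta> \<Longrightarrow> \<delta> \<le> 1 \<Longrightarrow> u \<in> H10 \<Omega> \<Longrightarrow>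
    weak_div_eq \<Omega> (complex_coeff (s_coeff r1 r2 \<delta>) A) u f \<Longrightarrow> H1_norm \<Omega> u \<le> C"
proof -
  obtain C1 C2 where C: "C1 \<ge> 0" "C2 \<ge> 0" and field:
    "\<And>\<epsilon>. 0 < \<epsilon> \<Longrightarrow> \<epsilon> \<le> 1 \<Longrightarrow> \<exists>v. test_function \<Omega> v \<and> L2_norm \<Omega> (gradient (reflect v)) \<le> C1 \<and>
      (\<forall>\<phi>. test_function \<Omega> \<phi> \<longrightarrow>
        norm (sform \<Omega> (s_coeff r1 r2 0) A (gradient (reflect v)) (gradient \<phi>) + (LINT x|lebesgue_on \<Omega>. f x * \<phi> x))
          \<le> \<epsilon> * (C2 * L2_norm \<Omega> (gradient \<phi>)))"
    proof (rule approximate_field[OF f0 f], goal_cases)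
      case (1 C1 C2)
      show ?case by (rule 1(1)) (fact 1)+
    qed
  interpret form_coeff \<Omega> A \<Lambda> by (rule form_coeff.intro[OF A_measurable A_elliptic \<Lambda>])
  obtain R where R: "R > 0" "\<Omega> \<subseteq> cball 0 R" using bounded_\<Omega> by (auto simp: bounded_pos subset_iff)
  define N where "N = \<Lambda> * (real CARD('n))\<^sup>2"
  define D where "D = 3 * \<Lambda> * (N * C1 + C2)"
  define ind where "ind = (\<lambda>x::real^'n. if x \<in> ball 0 r2 - ball 0 r1 then 1 else 0 :: complex)"
  define out where "out = (\<lambda>x::real^'n. 1 - ind x)"
  have "ind \<in> borel_measurable lebesgue"
    unfolding ind_def by (rule measurable_If_set) (auto intro!: sets.Diff)
  then have mind: "ind \<in> borel_measurable (lebesgue_on \<Omega>)" by (rule measurable_restrict_space1)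
  then have mout: "out \<in> borel_measurable (lebesgue_on \<Omega>)" by (simp add: out_def)
  have i01: "ind x = 0 \<or> ind x = 1" "out x = 0 \<or> out x = 1" for x by (auto simp: ind_def out_def)
  have bind: "norm (ind x) \<le> 1" and bout: "norm (out x) \<le> 1" for x using i01[of x] by auto
  note coeff_add = sform_coeff_add[OF _ _ mind bind]
  note tL = test_function_L2[OF _ lebesgue_\<Omega>]
  show thesis
  proof (rule that[of "2 * R * (C1 + D) + (C1 + D)"])
    fix \<delta> :: real and u :: "real^'n \<Rightarrow> complex"
    assume \<delta>: "0 < \<delta>" "\<delta> \<le> 1" and u: "u \<in> H10 \<Omega>"
      and eq: "weak_div_eq \<Omega> (complex_coeff (s_coeff r1 r2 \<delta>) A) u f"
    obtain v where v: "test_function \<Omega> v" "L2_norm \<Omega> (gradient (reflect v)) \<le> C1"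
      and res: "\<And>\<phi>. test_function \<Omega> \<phi> \<Longrightarrow>
        norm (sform \<Omega> (s_coeff r1 r2 0) A (gradient (reflect v)) (gradient \<phi>) + (LINT x|lebesgue_on \<Omega>. f x * \<phi> x))
          \<le> \<delta> * (C2 * L2_norm \<Omega> (gradient \<phi>))"
      using field[OF \<delta>] by blast
    define g where "g = weak_gradient \<Omega> u"
    define p where "p = gradient (reflect v)"
    define H where "H x = g x - p x" for x
    define Hc where "Hc x = cnj_vec (H x)" for x
    define W where "W q = sform \<Omega> (s_coeff r1 r2 \<delta>) A H q + \<i> * \<delta> * sform \<Omega> ind A p q" for q
    have uH1: "u \<in> H1 \<Omega>" using u by (simp add: H10_def)
    have gL: "g \<in> L2 \<Omega>" unfolding g_def by (rule has_weak_gradient_L2[OF weak_gradient_works[OF uH1]])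
    have pL: "p \<in> L2 \<Omega>" unfolding p_def by (rule reflect_L2(2)[OF v(1)])
    have HL: "H \<in> L2 \<Omega>" unfolding H_def by (rule L2_diff[OF gL pL])
    have HcL: "Hc \<in> L2 \<Omega>" "L2_norm \<Omega> Hc = L2_norm \<Omega> H" unfolding Hc_def by (rule L2_cnj_vec(1)[OF HL], rule L2_cnj_vec(2))
    have ms: "s_coeff r1 r2 \<delta> \<in> borel_measurable (lebesgue_on \<Omega>)" "\<And>x::real^'n. norm (s_coeff r1 r2 \<delta> x) \<le> 2"
      using \<delta> by (simp_all add: s_coeff_measurable s_coeff_bound)
    have ms0: "s_coeff r1 r2 0 \<in> borel_measurable (lebesgue_on \<Omega>)" "\<And>x::real^'n. norm (s_coeff r1 r2 0 x) \<le> 2"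
      by (simp_all add: s_coeff_measurable s_coeff_bound)
    have s0: "s_coeff r1 r2 \<delta> = (\<lambda>x. s_coeff r1 r2 0 x + \<i> * \<delta> * ind x)"
      and so: "s_coeff r1 r2 \<delta> = (\<lambda>x. out x + (- 1 + \<i> * \<delta>) * ind x)"
      by (auto simp: s_coeff_def ind_def out_def fun_eq_iff)

    have test: "norm (W (gradient \<phi>)) \<le> \<delta> * (C2 * L2_norm \<Omega> (gradient \<phi>))" if \<phi>: "test_function \<Omega> \<phi>" for \<phi>
    proof -
      note g\<phi> = tL(2)[OF \<phi>]
      have "sform \<Omega> (s_coeff r1 r2 \<delta>) A g (gradient \<phi>) = - (LINT x|lebesgue_on \<Omega>. f x * \<phi> x)"
        using eq \<phi> by (simp add: weak_div_eq_def energy_form_def complex_coeff_pairing sform_def g_def)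
      moreover have "sform \<Omega> (s_coeff r1 r2 \<delta>) A H (gradient \<phi>) =
          sform \<Omega> (s_coeff r1 r2 \<delta>) A g (gradient \<phi>) - sform \<Omega> (s_coeff r1 r2 \<delta>) A p (gradient \<phi>)"
        unfolding H_def by (rule sform_diff_left[OF ms gL pL g\<phi>])
      moreover have "sform \<Omega> (s_coeff r1 r2 \<delta>) A p (gradient \<phi>) =
          sform \<Omega> (s_coeff r1 r2 0) A p (gradient \<phi>) + \<i> * \<delta> * sform \<Omega> ind A p (gradient \<phi>)"
        unfolding s0 by (rule coeff_add[OF ms0 pL g\<phi>])
      ultimately have "W (gradient \<phi>) =
          - (sform \<Omega> (s_coeff r1 r2 0) A p (gradient \<phi>) + (LINT x|lebesgue_on \<Omega>. f x * \<phi> x))"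
        by (simp add: W_def)
      then show ?thesis using res[OF \<phi>] by (simp only: norm_minus_cancel p_def)
    qed

    have supp: "closure {x. reflect v x \<noteq> 0} \<subseteq> \<Omega>"
      by (rule bounded_outside_cball(2)[OF v(1)]) (rule reflect_pieces(3), use radii in simp)
    obtain \<eta> where \<eta>: "\<And>k::nat. test_function \<Omega> (\<eta> k)"
      "(\<lambda>k. L2_norm \<Omega> (\<lambda>x. gradient (\<eta> k) x - p x)) \<longlonglongrightarrow> 0"
      unfolding p_def by (rule piecewise_C1_approximation[OF thin_spheres reflect_piecewise_C1[OF v(1)] open_\<Omega> supp]) blast
    obtain \<phi> where \<phi>: "\<And>k::nat. test_function \<Omega> (\<phi> k)"
      "(\<lambda>k. L2_norm \<Omega> (\<lambda>x. g x - gradient (\<phi> k) x)) \<longlonglongrightarrow> 0"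
      unfolding g_def by (rule H10_approximation[OF open_\<Omega> u]) blast
    \<comment> \<open>the gradients of \<open>\<psi> k\<close> tend to the conjugate of \<open>H\<close>, since \<open>H\<close> is the difference of two limits\<close>
    define \<psi> where "\<psi> k x = cnj (\<phi> k x + (- 1) * \<eta> k x)" for k x
    note t = test_function_cmult_add[OF \<phi>(1) \<eta>(1), where c = "- 1"]
    have \<psi>: "test_function \<Omega> (\<psi> k)" for k
      unfolding \<psi>_def by (rule test_function_cnj(1)[OF t(1)])
    have g\<psi>: "gradient (\<psi> k) x = cnj_vec (gradient (\<phi> k) x - gradient (\<eta> k) x)" for k x
      unfolding \<psi>_def test_function_cnj(2)[OF t(1)] t(2) by (simp add: cnj_vec_def vec_eq_iff)
    have lim: "(\<lambda>k. L2_norm \<Omega> (\<lambda>x. gradient (\<psi> k) x - Hc x)) \<longlonglongrightarrow> 0"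
    proof (rule tendsto_sandwich[OF _ _ tendsto_const])
      show "(\<lambda>k. L2_norm \<Omega> (\<lambda>x. gradient (\<eta> k) x - p x) + L2_norm \<Omega> (\<lambda>x. g x - gradient (\<phi> k) x)) \<longlonglongrightarrow> 0"
        using tendsto_add[OF \<eta>(2) \<phi>(2)] by simp
      have "L2_norm \<Omega> (\<lambda>x. gradient (\<psi> k) x - Hc x)
          \<le> L2_norm \<Omega> (\<lambda>x. gradient (\<eta> k) x - p x) + L2_norm \<Omega> (\<lambda>x. g x - gradient (\<phi> k) x)" for k
      proof -
        have "norm (gradient (\<psi> k) x - Hc x) = norm ((gradient (\<eta> k) x - p x) + (g x - gradient (\<phi> k) x))" for x
        proof -
          have "gradient (\<psi> k) x - Hc x = - cnj_vec ((gradient (\<eta> k) x - p x) + (g x - gradient (\<phi> k) x))"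
            by (simp add: g\<psi> Hc_def H_def cnj_vec_def vec_eq_iff)
          then show ?thesis by (simp add: norm_cnj_vec)
        qed
        then have "L2_norm \<Omega> (\<lambda>x. gradient (\<psi> k) x - Hc x) =
            L2_norm \<Omega> (\<lambda>x. (gradient (\<eta> k) x - p x) + (g x - gradient (\<phi> k) x))" by (simp add: L2_norm_def)
        also have "\<dots> \<le> L2_norm \<Omega> (\<lambda>x. gradient (\<eta> k) x - p x) + L2_norm \<Omega> (\<lambda>x. g x - gradient (\<phi> k) x)"
          by (rule L2_norm_triangle[OF L2_diff[OF tL(2)[OF \<eta>(1)] pL] L2_diff[OF gL tL(2)[OF \<phi>(1)]]])
        finally show ?thesis .
      qed
      then show "\<forall>\<^sub>F k in sequentially. L2_norm \<Omega> (\<lambda>x. gradient (\<psi> k) x - Hc x)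
          \<le> L2_norm \<Omega> (\<lambda>x. gradient (\<eta> k) x - p x) + L2_norm \<Omega> (\<lambda>x. g x - gradient (\<phi> k) x)" by simp
    qed simp
    have "(\<lambda>k. norm (W (gradient (\<psi> k)))) \<longlonglongrightarrow> norm (W Hc)"
      unfolding W_def
      by (rule tendsto_norm, rule tendsto_add, rule sform_tendsto[OF ms HL tL(2)[OF \<psi>] HcL(1) lim],
          rule tendsto_mult_left, rule sform_tendsto[OF mind bind pL tL(2)[OF \<psi>] HcL(1) lim])
    moreover have "(\<lambda>k. \<delta> * (C2 * L2_norm \<Omega> (gradient (\<psi> k)))) \<longlonglongrightarrow> \<delta> * (C2 * L2_norm \<Omega> Hc)"
      by (rule tendsto_mult_left, rule tendsto_mult_left, rule L2_norm_tendsto[OF tL(2)[OF \<psi>] HcL(1) lim])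
    ultimately have WH: "norm (W Hc) \<le> \<delta> * (C2 * L2_norm \<Omega> H)"
      unfolding HcL(2)[symmetric] by (rule LIMSEQ_le) (use test[OF \<psi>] in blast)

    define X where "X = Re (sform \<Omega> ind A H Hc)"
    define Y where "Y = Re (sform \<Omega> out A H Hc)"
    have X: "sform \<Omega> ind A H Hc = of_real X" "0 \<le> X"
      unfolding X_def Hc_def by (rule sform_indicator_real[OF HL mind i01(1)])+
    have Y: "sform \<Omega> out A H Hc = of_real Y"
      unfolding Y_def Hc_def by (rule sform_indicator_real(1)[OF HL mout i01(2)])
    have "sform \<Omega> (s_coeff r1 r2 \<delta>) A H Hc = of_real Y + (- 1 + \<i> * \<delta>) * of_real X"
      unfolding so using coeff_add[OF mout bout HL HcL(1)] X(1) Y by simp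
    then have "W Hc = of_real Y - of_real X + \<i> * \<delta> * of_real X + \<i> * \<delta> * sform \<Omega> ind A p Hc"
      by (simp add: W_def algebra_simps)
    with WH have "norm (of_real Y - of_real X + \<i> * \<delta> * of_real X + \<i> * \<delta> * sform \<Omega> ind A p Hc) \<le> \<delta> * (C2 * L2_norm \<Omega> H)"
      by simp
    then have XY: "X + Y \<le> 3 * (norm (sform \<Omega> ind A p Hc) + C2 * L2_norm \<Omega> H)"
      by (rule energy_algebra[OF X(2) \<delta>])
    have "sform \<Omega> (\<lambda>x. out x + 1 * ind x) A H Hc = of_real Y + of_real X"
      using coeff_add[OF mout bout HL HcL(1), of 1] X(1) Y by simp
    then have "Re (sform \<Omega> (\<lambda>_. 1) A H Hc) = X + Y" by (simp add: out_def)
    then have coer: "(L2_norm \<Omega> H)\<^sup>2 / \<Lambda> \<le> X + Y"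
      using sform_coercive(1)[OF HL] by (simp add: Hc_def[abs_def])
    have "norm (sform \<Omega> ind A p Hc) \<le> N * (L2_norm \<Omega> p * L2_norm \<Omega> H)"
      using sform_bound[OF mind bind pL HcL(1)] by (simp add: N_def HcL(2))
    also have "\<dots> \<le> N * (C1 * L2_norm \<Omega> H)"
      using v(2) \<Lambda> by (intro mult_left_mono mult_right_mono) (simp_all add: p_def N_def)
    finally have "(L2_norm \<Omega> H)\<^sup>2 / \<Lambda> \<le> 3 * (N * (C1 * L2_norm \<Omega> H) + C2 * L2_norm \<Omega> H)"
      using coer XY unfolding distrib_left by linarith
    then have "L2_norm \<Omega> H * L2_norm \<Omega> H \<le> D * L2_norm \<Omega> H"
      using \<Lambda> by (simp add: D_def field_simps power2_eq_square)
    moreover have "D \<ge> 0" using C \<Lambda> by (simp add: D_def N_def)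
    ultimately have H: "L2_norm \<Omega> H \<le> D"
      using L2_norm_nonneg[of \<Omega> H] by (cases "L2_norm \<Omega> H = 0") auto
    have "L2_norm \<Omega> g \<le> L2_norm \<Omega> p + L2_norm \<Omega> H"
      unfolding H_def by (rule L2_norm_triangle_diff[OF gL pL])
    then have g: "L2_norm \<Omega> g \<le> C1 + D" using v(2) H by (simp add: p_def)
    have "L2_norm \<Omega> u \<le> 2 * R * L2_norm \<Omega> g"
      unfolding g_def by (rule H10_poincare[OF open_\<Omega> R(2) less_imp_le[OF R(1)] u])
    also have "\<dots> \<le> 2 * R * (C1 + D)" by (rule mult_left_mono[OF g]) (use R in simp)
    finally have "L2_norm \<Omega> u \<le> 2 * R * (C1 + D)" .
    moreover have "H1_norm \<Omega> u \<le> L2_norm \<Omega> u + L2_norm \<Omega> g"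
      unfolding H1_norm_eq g_def[symmetric] by (rule sqrt_sum_squares_le_sum) simp_all
    ultimately show "H1_norm \<Omega> u \<le> 2 * R * (C1 + D) + (C1 + D)" using g by linarith
  qed
qed

end

section \<open>Boundedness as the absorption tends to zero\<close>

text \<open>By Lindeloef's theorem countably many of the neighbourhoods in the definition of the support cover
  \<open>V\<close>.\<close>

lemma AE_eq_0_off_ess_support:
  fixes f :: "'a::euclidean_space \<Rightarrow> 'b::zero"
  assumes U: "U \<in> sets lebesgue" and V: "open V" "V \<subseteq> U" "ess_support U f \<inter> V = {}"
  shows "AE x in lebesgue_on V. f x = 0"
proof -
  have "\<exists>N. open N \<and> x \<in> N \<and> (AE y in lebesgue_on (N \<inter> U). f y = 0)" if "x \<in> V" for x
  proof -
    have "x \<in> closure U" "x \<notin> ess_support U f" using that V closure_subset[of U] by auto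
    then show ?thesis by (auto simp: ess_support_def)
  qed
  then obtain N where N: "\<And>x. x \<in> V \<Longrightarrow> open (N x)" "\<And>x. x \<in> V \<Longrightarrow> x \<in> N x"
    "\<And>x. x \<in> V \<Longrightarrow> AE y in lebesgue_on (N x \<inter> U). f y = 0" by metis
  obtain \<F> where \<F>: "\<F> \<subseteq> N ` V" "countable \<F>" "\<Union>\<F> = \<Union>(N ` V)"
    by (rule Lindelof[of "N ` V"]) (use N(1) in auto)
  have "negligible {y \<in> M \<inter> U. f y \<noteq> 0}" if M: "M \<in> \<F>" for M
  proof -
    obtain x where x: "x \<in> V" "M = N x" using subsetD[OF \<F>(1) M] by (auto simp: image_iff)
    have "M \<inter> U \<in> sets lebesgue" using N(1)[OF x(1)] U x(2) by auto
    then show ?thesis by (rule negligible_AE[THEN iffD1]) (unfold x(2), rule N(3)[OF x(1)])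
  qed
  then have "negligible (\<Union>((\<lambda>M. {y \<in> M \<inter> U. f y \<noteq> 0}) ` \<F>))"
    using \<F>(2) by (intro negligible_countable_Union) auto
  then have "negligible {y \<in> V. \<not> f y = 0}"
  proof (rule negligible_subset)
    show "{y \<in> V. \<not> f y = 0} \<subseteq> (\<Union>((\<lambda>M. {y \<in> M \<inter> U. f y \<noteq> 0}) ` \<F>))"
    proof
      fix y assume y: "y \<in> {y \<in> V. \<not> f y = 0}"
      then have "y \<in> \<Union>\<F>" unfolding \<F>(3) using N(2)[of y] by blast
      then show "y \<in> (\<Union>((\<lambda>M. {y \<in> M \<inter> U. f y \<noteq> 0}) ` \<F>))" using y V(2) by auto
    qed
  qed
  then show ?thesis by (rule negligible_AE[OF open_lebesgue[OF V(1)], THEN iffD2])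
qed

lemma Limsup_at_right_0_less_top:
  fixes h :: "real \<Rightarrow> real"
  assumes "\<And>\<delta>. 0 < \<delta> \<Longrightarrow> \<delta> \<le> 1 \<Longrightarrow> h \<delta> \<le> C"
  shows "Limsup (at_right 0) (\<lambda>\<delta>. ereal (h \<delta>)) < \<infinity>"
proof -
  have "\<forall>\<^sub>F \<delta> in at_right (0::real). ereal (h \<delta>) \<le> ereal C"
    unfolding eventually_at_right_field using assms by (intro exI[of _ 1]) auto
  from Limsup_bounded[OF this] show ?thesis by (rule le_less_trans) simp
qed

theorem theorem1p3:
  fixes \<Omega> :: "(real^'n::finite) set"
    and A :: "real^'n \<Rightarrow> real^'n^'n"
    and f :: "real^'n \<Rightarrow> complex"
    and u :: "real \<Rightarrow> real^'n \<Rightarrow> complex"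
    and r1 r2 r3 :: real
  assumes dim: "CARD('n) = 2 \<or> CARD('n) = 3"
    and domain: "smooth_open_set \<Omega>" "bounded \<Omega>"
    and radii: "0 < r1" "r1 < r2" "cball 0 r2 \<subseteq> \<Omega>"
    and A_sym: "symmetric_ae \<Omega> A"
    and A_ell: "uniformly_elliptic \<Omega> A"
    and A_C3: "\<exists>A'. Ck_closure 3 (ball 0 r3 - cball 0 r2) A' \<and>
                 (AE x in lebesgue_on (ball 0 r3 - ball 0 r2). A x = A' x)"
    and dc: "doubly_complementary \<Omega> A r1 r2 r3"
    and f_L2: "f \<in> L2 \<Omega>"
    and f_supp: "ess_support \<Omega> f \<inter> ball 0 r3 = {}"
    and u_H10: "\<And>\<delta>. \<delta> > 0 \<Longrightarrow> u \<delta> \<in> H10 \<Omega>"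
    and u_sol: "\<And>\<delta>. \<delta> > 0 \<Longrightarrow>
                  weak_div_eq \<Omega> (complex_coeff (s_coeff r1 r2 \<delta>) A) (u \<delta>) f"
  shows "Limsup (at_right 0) (\<lambda>\<delta>. ereal (H1_norm \<Omega> (u \<delta>))) < \<infinity> \<and>
         ((AE x in lebesgue_on (ball 0 r3 - ball 0 r2). A x = mat 1) \<longrightarrow>
          (\<exists>r0 w. r0 > sqrt (r2 * r3) \<and> ball 0 r0 \<subseteq> \<Omega> \<and>
             w \<in> H1 (ball 0 r0 - cball 0 r2) \<and>
             weak_div_eq (ball 0 r0 - cball 0 r2) (complex_coeff (\<lambda>_. 1) A) w f \<and>
             has_trace_on_sphere (ball 0 r0 - cball 0 r2) r2 w (\<lambda>_. 0) \<and>
             zero_conormal_on (sphere 0 r2) (ball 0 r0 - cball 0 r2)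
               (complex_coeff (\<lambda>_. 1) A) w f) \<longrightarrow>
          Limsup (at_right 0) (\<lambda>\<delta>. ereal (sqrt \<delta> * H1_norm \<Omega> (u \<delta>))) < \<infinity>)"
proof -
  have \<Omega>: "open \<Omega>" using domain(1) by (simp add: smooth_open_set_def)
  obtain F G x1 x2 where maps: "reflecting_maps A r1 r2 r3 F G x1 x2"
    and double: "AE y in lebesgue_on (ball 0 r3 - ball 0 r2).
        pushforward (ball 0 r2 - {x1}) F A y = A y \<and>
        pushforward (- cball 0 r3) G (pushforward (ball 0 r2 - {x1}) F A) y = A y"
    using dc by (auto simp: doubly_complementary_def)
  have r3: "r2 < r3" "cball 0 r3 \<subseteq> \<Omega>"
    using dc by (auto simp: doubly_complementary_def reflecting_complementary_def)
  obtain \<Lambda> where \<Lambda>: "\<Lambda> \<ge> 1" "AE x in lebesgue_on \<Omega>. \<forall>\<xi>.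
        (norm \<xi>)\<^sup>2 / \<Lambda> \<le> (A x *v \<xi>) \<bullet> \<xi> \<and> (A x *v \<xi>) \<bullet> \<xi> \<le> \<Lambda> * (norm \<xi>)\<^sup>2"
    using A_ell by (auto simp: uniformly_elliptic_def)
  have ell: "AE x in lebesgue_on \<Omega>. elliptic \<Lambda> (A x)"
    using \<Lambda>(2) A_sym[unfolded symmetric_ae_def] by eventually_elim (simp add: elliptic_def)
  have double': "AE y in lebesgue_on (ball 0 r3 - ball 0 r2).
      pushforward (- cball 0 r3) G (pushforward (ball 0 r2 - {x1}) F A) y = A y"
    using double by eventually_elim simp
  interpret doubly_reflected A r1 r2 r3 F G x1 x2 \<Omega> \<Lambda>
  proof unfold_locales
    show "A \<in> borel_measurable (lebesgue_on \<Omega>)" using A_ell by (simp add: uniformly_elliptic_def)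
    show "\<Lambda> > 0" using \<Lambda>(1) by simp
  qed (fact dim radii(1) radii(2) r3 maps \<Omega> domain(2) ell double')+
  have f0: "AE x in lebesgue_on (ball 0 r3). f x = 0"
    by (rule AE_eq_0_off_ess_support[OF lebesgue_\<Omega> open_ball subset_\<Omega>(4) f_supp])
  obtain C where C: "\<And>\<delta> u. 0 < \<delta> \<Longrightarrow> \<delta> \<le> 1 \<Longrightarrow> u \<in> H10 \<Omega> \<Longrightarrow>
    weak_div_eq \<Omega> (complex_coeff (s_coeff r1 r2 \<delta>) A) u f \<Longrightarrow> H1_norm \<Omega> u \<le> C"
    proof (rule uniform_bound[OF f0 f_L2], goal_cases)
      case (1 C)
      show ?case by (rule 1(1)) (fact 1)+
    qed
  have b: "H1_norm \<Omega> (u \<delta>) \<le> C" if "0 < \<delta>" "\<delta> \<le> 1" for \<delta>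
    by (rule C[OF that u_H10[OF that(1)] u_sol[OF that(1)]])
  have "sqrt \<delta> * H1_norm \<Omega> (u \<delta>) \<le> C" if "0 < \<delta>" "\<delta> \<le> 1" for \<delta>
  proof -
    have "sqrt \<delta> * H1_norm \<Omega> (u \<delta>) \<le> H1_norm \<Omega> (u \<delta>)"
      using that by (intro mult_left_le_one_le) (simp_all add: H1_norm_eq)
    with b[OF that] show ?thesis by linarith
  qed
  from Limsup_at_right_0_less_top[of "\<lambda>\<delta>. sqrt \<delta> * H1_norm \<Omega> (u \<delta>)", OF this]
    Limsup_at_right_0_less_top[of "\<lambda>\<delta>. H1_norm \<Omega> (u \<delta>)", OF b]
  show ?thesis by blast
qed

end
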